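(* Let $\pi$ be an irreducible cuspidal automorphic representation of $\mathrm{GL}_n(\mathbb{A}_{\mathbb{Q}})$ such that $L(s,\pi)$ is entire, and let $m = \operatorname{ord}_{s=1/2} L(s,\pi)$. Assume the Ramanujan--Petersson Conjecture for $\pi$ and the Riemann Hypothesis for $L(s,\pi)$. Then there exists a subset $S \subseteq \mathbb{R}_{\geq 2}$ of finite logarithmic measure such that for all $x \notin S$ (i.e. as $x \to \infty$ through the complement of $S$), $$(\log x)^m \cdot \prod_{p \leq x} \prod_{j=1}^n \left(1-\alpha_{j,p}\,p^{-\frac12}\right)^{-1} \sim \frac{\sqrt{2}^{\,\nu(\pi)}}{e^{m\gamma}\, m!}\cdot L^{(m)}\!\left(\tfrac12,\pi\right).$$
   Context: For $\pi=\bigotimes'\pi_v$ an irreducible cuspidal automorphic representation of $\mathrm{GL}_n(\mathbb{A}_{\mathbb{Q}})$, the $L$-function is written $L(s,\pi)=\prod_p\prod_{j=1}^n(1-\alpha_{j,p}p^{-s})^{-1}$ for $\mathrm{Re}(s)>1$ (continued meromorphically to $\mathbb{C}$). If $\pi_p$ is unramified, $\alpha_{1,p},\dots,\alpha_{n,p}$ are the Satake parameters of $\pi_p$; at a ramified prime the local factor is $P_p(p^{-s})^{-1}$ with $P_p$ a polynomial of degree at most $n$ and $P_p(0)=1$, written in the same form with some $\alpha_{j,p}$ allowed to be zero. The normalization is such that the completed $L$-function $\Lambda(s,\pi)=Q(\pi)^{s/2}\prod_{j=1}^n\Gamma_{\mathbb{R}}(s+\mu_\pi(j))\,L(s,\pi)$,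 where $Q(\pi)$ is the conductor, the $\mu_\pi(j)$ are the archimedean constants and $\Gamma_{\mathbb{R}}(s)=\pi^{-s/2}\Gamma(s/2)$ (here $\pi=3.14\ldots$), satisfies $\Lambda(s,\pi)=\epsilon(\pi)\Lambda(1-s,\pi^\vee)$ with $|\epsilon(\pi)|=1$ and $\pi^\vee$ the contragredient. Ramanujan--Petersson Conjecture: for every $p$ such that $\pi_p$ is unramified, $|\alpha_{j,p}|=1$ for all $j\in\{1,\dots,n\}$. Riemann Hypothesis for $L(s,\pi)$: all non-trivial zeros of $L(s,\pi)$ lie on $\mathrm{Re}(s)=\frac12$; the trivial zeros are those at $-2k-\mu_\pi(j)$, $k\ge 0$, $1\le j\le n$. The second-moment $L$-function is $L_2(s,\pi)=\prod_p\prod_{j=1}^n(1-\alpha_{j,p}^2p^{-s})^{-1}$; it continues meromorphically to an open set containing $\{\mathrm{Re}(s)\ge 1\}$. Put $R(\pi)=\operatorname{ord}_{s=1}L_2(s,\pi)$ (the order of vanishing, negative for a pole). The integer $\nu(\pi)=m(\mathrm{sym}^2\pi)-m(\wedge^2\pi)$, where $m(\rho)$ is the multiplicity of the trivial representation in $\rho$, satisfies $\nu(\pi)=-R(\pi)$. $\gamma$ is Euler's constant. The logarithmic measure of a measurable $S\subseteq\mathbb{R}_{\ge2}$ is $\int_S\frac{dt}{t}$. *)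

theory Defs
  imports "HOL-Complex_Analysis.Complex_Analysis" "HOL-Library.Landau_Symbols"
begin

section \<open>The ring of finite adeles of the rationals\<close>

text \<open>
  The ring of finite adeles is realised as the completion of the rationals for the ring
  topology in which the subgroups \<open>N\<int>\<close> (for \<open>N > 0\<close>) form a neighbourhood base of zero.
\<close>

definition multiples :: "nat \<Rightarrow> rat set" where
  "multiples N = range (\<lambda>c::int. of_int (int N * c))"

definition adelic_null :: "(nat \<Rightarrow> rat) \<Rightarrow> bool" where
  "adelic_null x \<longleftrightarrow> (\<forall>N>0. \<forall>\<^sub>F i in sequentially. x i \<in> multiples N)"

definition adelic_Cauchy :: "(nat \<Rightarrow> rat) \<Rightarrow> bool" where
  "adelic_Cauchy x \<longleftrightarrow> (\<forall>N>0. \<exists>M. \<forall>i\<ge>M. \<forall>j\<ge>M. x i - x j \<in> multiples N)"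

definition adelic_rel :: "(nat \<Rightarrow> rat) \<Rightarrow> (nat \<Rightarrow> rat) \<Rightarrow> bool" where
  "adelic_rel x y \<longleftrightarrow> adelic_Cauchy x \<and> adelic_Cauchy y \<and> adelic_null (\<lambda>i. x i - y i)"

lemma multiples_0 [simp]: "0 \<in> multiples N"
  by (auto simp: multiples_def intro!: image_eqI[of _ _ 0])

lemma multiples_add: "a \<in> multiples N \<Longrightarrow> b \<in> multiples N \<Longrightarrow> a + b \<in> multiples N"
proof -
  assume "a \<in> multiples N" "b \<in> multiples N"
  then obtain c d where "a = of_int (int N * c)" "b = of_int (int N * d)"
    by (auto simp: multiples_def)
  then have "a + b = of_int (int N * (c + d))" by (simp add: algebra_simps)
  then show ?thesis unfolding multiples_def by blast
qed

lemma multiples_minus: "a \<in> multiples N \<Longrightarrow> - a \<in> multiples N"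
proof -
  assume "a \<in> multiples N"
  then obtain c where "a = of_int (int N * c)" by (auto simp: multiples_def)
  then have "- a = of_int (int N * (- c))" by simp
  then show ?thesis unfolding multiples_def by blast
qed

lemma multiples_mult:
  assumes "a * of_int D \<in> \<int>" "b \<in> multiples (nat \<bar>D\<bar> * N)"
  shows "a * b \<in> multiples N"
proof -
  from assms(1) obtain e :: int where e: "a * of_int D = of_int e" by (auto elim: Ints_cases)
  from assms(2) obtain c where c: "b = of_int (int (nat \<bar>D\<bar> * N) * c)" by (auto simp: multiples_def)
  have "int (nat \<bar>D\<bar>) = D * sgn D" by (metis abs_ge_zero abs_sgn int_nat_eq)
  then have "b = of_int (D * sgn D * int N * c)" by (simp only: c of_nat_mult)
  then have "a * b = (a * of_int D) * of_int (int N * (sgn D * c))"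
    by simp
  also have "\<dots> = of_int (int N * (e * sgn D * c))"
    by (simp add: e)
  finally have "a * b = of_int (int N * (e * sgn D * c))" .
  then show ?thesis unfolding multiples_def by blast
qed

lemma adelic_null_add: "adelic_null x \<Longrightarrow> adelic_null y \<Longrightarrow> adelic_null (\<lambda>i. x i + y i)"
  unfolding adelic_null_def by (blast intro: eventually_elim2 multiples_add)

lemma adelic_null_minus: "adelic_null x \<Longrightarrow> adelic_null (\<lambda>i. - x i)"
  unfolding adelic_null_def by (blast intro: eventually_mono multiples_minus)

lemma adelic_null_0 [simp]: "adelic_null (\<lambda>i. 0)"
  by (simp add: adelic_null_def)

lemma adelic_Cauchy_const [simp]: "adelic_Cauchy (\<lambda>i. c)"
  by (simp add: adelic_Cauchy_def)

lemma adelic_Cauchy_add: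
  assumes "adelic_Cauchy x" "adelic_Cauchy y"
  shows "adelic_Cauchy (\<lambda>i. x i + y i)"
  unfolding adelic_Cauchy_def
proof (intro allI impI)
  fix N :: nat assume "N > 0"
  with assms obtain M1 M2 where
    "\<And>i j. i \<ge> M1 \<Longrightarrow> j \<ge> M1 \<Longrightarrow> x i - x j \<in> multiples N"
    "\<And>i j. i \<ge> M2 \<Longrightarrow> j \<ge> M2 \<Longrightarrow> y i - y j \<in> multiples N"
    unfolding adelic_Cauchy_def by metis
  then have "(x i + y i) - (x j + y j) \<in> multiples N"
    if "i \<ge> max M1 M2" "j \<ge> max M1 M2" for i j
    using multiples_add[of "x i - x j" N "y i - y j"] that by (simp add: algebra_simps)
  then show "\<exists>M. \<forall>i\<ge>M. \<forall>j\<ge>M. x i + y i - (x j + y j) \<in> multiples N" by blast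
qed

lemma adelic_Cauchy_minus:
  assumes "adelic_Cauchy x"
  shows "adelic_Cauchy (\<lambda>i. - x i)"
proof -
  have "- x i - - x j = x j - x i" for i j by simp
  then show ?thesis using assms unfolding adelic_Cauchy_def by metis
qed

lemma adelic_Cauchy_denominator:
  assumes "adelic_Cauchy x"
  obtains D M where "D \<noteq> 0" "\<And>i. i \<ge> M \<Longrightarrow> x i * of_int D \<in> \<int>"
proof -
  from assms obtain M where M: "\<And>i j. i \<ge> M \<Longrightarrow> j \<ge> M \<Longrightarrow> x i - x j \<in> multiples 1"
    unfolding adelic_Cauchy_def by (metis zero_less_one)
  obtain a D where D: "D > 0" "x M = of_int a / of_int D"
    by (metis Fract_of_int_quotient Rat_cases)
  have "x i * of_int D \<in> \<int>" if i: "i \<ge> M" for i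
  proof -
    from M[OF i order_refl] obtain c where "x i - x M = of_int c"
      by (auto simp: multiples_def)
    then have "x i = of_int c + x M" by (simp add: algebra_simps)
    then have "x i * of_int D = of_int (c * D + a)"
      using D by (simp add: field_simps)
    then show ?thesis by (metis Ints_of_int)
  qed
  with D show ?thesis by (intro that[of D M]) auto
qed

lemma adelic_null_mult:
  assumes "adelic_Cauchy x" "adelic_null y"
  shows "adelic_null (\<lambda>i. x i * y i)"
  unfolding adelic_null_def
proof (intro allI impI)
  fix N :: nat assume N: "N > 0"
  obtain D M where D: "D \<noteq> 0" "\<And>i. i \<ge> M \<Longrightarrow> x i * of_int D \<in> \<int>"
    using adelic_Cauchy_denominator[OF assms(1)] by blast
  have "\<forall>\<^sub>F i in sequentially. y i \<in> multiples (nat \<bar>D\<bar> * N)"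
    using assms(2) D(1) N unfolding adelic_null_def by simp
  then show "\<forall>\<^sub>F i in sequentially. x i * y i \<in> multiples N"
    using eventually_ge_at_top[of M]
    by eventually_elim (use D multiples_mult in blast)
qed

lemma adelic_Cauchy_mult:
  assumes "adelic_Cauchy x" "adelic_Cauchy y"
  shows "adelic_Cauchy (\<lambda>i. x i * y i)"
  unfolding adelic_Cauchy_def
proof (intro allI impI)
  fix N :: nat assume N: "N > 0"
  obtain D M where D: "D \<noteq> 0" "\<And>i. i \<ge> M \<Longrightarrow> x i * of_int D \<in> \<int>"
    using adelic_Cauchy_denominator[OF assms(1)] by blast
  obtain D' M' where D': "D' \<noteq> 0" "\<And>i. i \<ge> M' \<Longrightarrow> y i * of_int D' \<in> \<int>"
    using adelic_Cauchy_denominator[OF assms(2)] by blast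
  from assms D(1) D'(1) N obtain M1 M2 where
    M1: "\<And>i j. i \<ge> M1 \<Longrightarrow> j \<ge> M1 \<Longrightarrow> x i - x j \<in> multiples (nat \<bar>D'\<bar> * N)" and
    M2: "\<And>i j. i \<ge> M2 \<Longrightarrow> j \<ge> M2 \<Longrightarrow> y i - y j \<in> multiples (nat \<bar>D\<bar> * N)"
    unfolding adelic_Cauchy_def by (metis nat_0_less_mult_iff zero_less_abs_iff zero_less_nat_eq)
  have "x i * y i - x j * y j \<in> multiples N"
    if "i \<ge> max (max M1 M2) (max M M')" "j \<ge> max (max M1 M2) (max M M')" for i j
  proof -
    have 1: "x i * (y i - y j) \<in> multiples N"
      using that by (intro multiples_mult[of _ D] D M2) auto
    have 2: "y j * (x i - x j) \<in> multiples N"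
      using that by (intro multiples_mult[of _ D'] D' M1) auto
    from multiples_add[OF 1 2] show ?thesis by (simp add: algebra_simps)
  qed
  then show "\<exists>M. \<forall>i\<ge>M. \<forall>j\<ge>M. x i * y i - x j * y j \<in> multiples N" by blast
qed

lemma adelic_rel_part_equivp: "part_equivp adelic_rel"
proof (rule part_equivpI)
  show "\<exists>x. adelic_rel x x" by (rule exI[of _ "\<lambda>_. 0"]) (simp add: adelic_rel_def)
  show "symp adelic_rel"
    proof (rule sympI)
    fix x y assume "adelic_rel x y"
    then show "adelic_rel y x"
      using adelic_null_minus[of "\<lambda>i. x i - y i"] by (simp add: adelic_rel_def)
  qed
  show "transp adelic_rel"
    proof (rule transpI)
    fix x y z assume "adelic_rel x y" "adelic_rel y z"
    then show "adelic_rel x z"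
      using adelic_null_add[of "\<lambda>i. x i - y i" "\<lambda>i. y i - z i"] by (simp add: adelic_rel_def)
  qed
qed

quotient_type fin_adele = "nat \<Rightarrow> rat" / partial: adelic_rel
  by (rule adelic_rel_part_equivp)

instantiation fin_adele :: comm_ring_1
begin

lift_definition zero_fin_adele :: fin_adele is "\<lambda>_. 0"
  by (simp add: adelic_rel_def)

lift_definition one_fin_adele :: fin_adele is "\<lambda>_. 1"
  by (simp add: adelic_rel_def)

lift_definition plus_fin_adele :: "fin_adele \<Rightarrow> fin_adele \<Rightarrow> fin_adele" is "\<lambda>x y i. x i + y i"
proof -
  fix x x' y y' assume "adelic_rel x x'" "adelic_rel y y'"
  then show "adelic_rel (\<lambda>i. x i + y i) (\<lambda>i. x' i + y' i)"
    using adelic_null_add[of "\<lambda>i. x i - x' i" "\<lambda>i. y i - y' i"]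
    by (simp add: adelic_rel_def adelic_Cauchy_add add_diff_add)
qed

lift_definition uminus_fin_adele :: "fin_adele \<Rightarrow> fin_adele" is "\<lambda>x i. - x i"
proof -
  fix x x' assume "adelic_rel x x'"
  then show "adelic_rel (\<lambda>i. - x i) (\<lambda>i. - x' i)"
    using adelic_null_minus[of "\<lambda>i. x i - x' i"]
    by (auto simp: adelic_rel_def adelic_Cauchy_minus)
qed

definition minus_fin_adele :: "fin_adele \<Rightarrow> fin_adele \<Rightarrow> fin_adele" where
  "minus_fin_adele x y = x + (- y)"

lift_definition times_fin_adele :: "fin_adele \<Rightarrow> fin_adele \<Rightarrow> fin_adele" is "\<lambda>x y i. x i * y i"
proof -
  fix x x' y y' assume *: "adelic_rel x x'" "adelic_rel y y'"
  then have "adelic_null (\<lambda>i. x i * (y i - y' i) + y' i * (x i - x' i))"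
    by (intro adelic_null_add adelic_null_mult) (auto simp: adelic_rel_def)
  then have "adelic_null (\<lambda>i. x i * y i - x' i * y' i)"
    by (simp add: algebra_simps)
  with * show "adelic_rel (\<lambda>i. x i * y i) (\<lambda>i. x' i * y' i)"
    by (auto simp: adelic_rel_def adelic_Cauchy_mult)
qed

instance
proof
  fix a b c :: fin_adele
  show "a * b * c = a * (b * c)"
    by transfer (auto simp: adelic_rel_def mult.assoc adelic_Cauchy_mult)
  show "a * b = b * a"
    by transfer (simp add: adelic_rel_def mult.commute adelic_Cauchy_mult)
  show "1 * a = a"
    by transfer (auto simp: adelic_rel_def)
  show "a + b + c = a + (b + c)"
    by transfer (auto simp: adelic_rel_def add.assoc adelic_Cauchy_add)
  show "a + b = b + a"
    by transfer (simp add: adelic_rel_def add.commute adelic_Cauchy_add)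
  show "0 + a = a"
    by transfer (auto simp: adelic_rel_def)
  show "- a + a = 0"
    by transfer (auto simp: adelic_rel_def)
  show "a - b = a + - b"
    by (simp add: minus_fin_adele_def)
  show "(a + b) * c = a * c + b * c"
    by transfer (auto simp: adelic_rel_def distrib_right adelic_Cauchy_add adelic_Cauchy_mult)
  show "(0::fin_adele) \<noteq> 1"
  proof transfer
    have "(- 1 :: rat) \<notin> multiples 2"
    proof
      assume "(- 1 :: rat) \<in> multiples 2"
      then obtain c :: int where "(- 1 :: rat) = of_int (2 * c)" by (auto simp: multiples_def)
      then have "- 1 = 2 * c" by (metis of_int_1 of_int_eq_iff of_int_minus)
      then show False by presburger
    qed
    then have "\<not> adelic_null (\<lambda>i. - 1)"
      unfolding adelic_null_def by (auto intro!: exI[of _ 2])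
    then show "\<not> adelic_rel (\<lambda>_. 0) (\<lambda>_. 1)" by (simp add: adelic_rel_def)
  qed
qed

end

lift_definition rat_adele :: "rat \<Rightarrow> fin_adele" is "\<lambda>c _. c"
  by (simp add: adelic_rel_def)

text \<open>
  \<open>val_ge q k x\<close> says that the component of \<open>x\<close> at the prime \<open>q\<close> lies in \<open>q^k \<int>\<^sub>q\<close>; on
  rationals this is membership in \<open>q^k\<close> times the localisation of the integers at \<open>q\<close>.
\<close>

definition rat_val_ge :: "nat \<Rightarrow> nat \<Rightarrow> rat \<Rightarrow> bool" where
  "rat_val_ge q k r \<longleftrightarrow>
     (\<exists>a b::int. b \<noteq> 0 \<and> coprime b (int q) \<and> r * of_int b = of_int (int q ^ k * a))"

lemma rat_val_ge_add:
  assumes "rat_val_ge q k r" "rat_val_ge q k s"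
  shows "rat_val_ge q k (r + s)"
proof -
  from assms obtain a b c d :: int where
    1: "b \<noteq> 0" "coprime b (int q)" "r * of_int b = of_int (int q ^ k * a)" and
    2: "d \<noteq> 0" "coprime d (int q)" "s * of_int d = of_int (int q ^ k * c)"
    unfolding rat_val_ge_def by blast
  have "(r + s) * of_int (b * d) = (r * of_int b) * of_int d + (s * of_int d) * of_int b"
    by (simp add: algebra_simps)
  also have "\<dots> = of_int (int q ^ k * (a * d + c * b))"
    unfolding 1(3) 2(3) by (simp add: algebra_simps)
  finally show ?thesis
    using 1 2 unfolding rat_val_ge_def
    by (intro exI[of _ "a * d + c * b"] exI[of _ "b * d"]) auto
qed

lemma rat_val_ge_multiples: "r \<in> multiples (q ^ k) \<Longrightarrow> rat_val_ge q k r"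
  unfolding rat_val_ge_def multiples_def
proof -
  assume "r \<in> range (\<lambda>c::int. of_int (int (q ^ k) * c))"
  then obtain c :: int where "r = of_int (int (q ^ k) * c)" by blast
  then show "\<exists>a b::int. b \<noteq> 0 \<and> coprime b (int q) \<and> r * of_int b = of_int (int q ^ k * a)"
    by (intro exI[of _ c] exI[of _ 1]) simp
qed

lift_definition val_ge :: "nat \<Rightarrow> nat \<Rightarrow> fin_adele \<Rightarrow> bool" is
  "\<lambda>q k x. q > 0 \<and> (\<forall>\<^sub>F i in sequentially. rat_val_ge q k (x i))"
proof -
  fix q k :: nat and x y assume *: "adelic_rel x y"
  have "(\<forall>\<^sub>F i in sequentially. rat_val_ge q k (v i))"
    if "q > 0" "adelic_null (\<lambda>i. u i - v i)" "\<forall>\<^sub>F i in sequentially. rat_val_ge q k (u i)" for u v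
  proof -
    have "\<forall>\<^sub>F i in sequentially. u i - v i \<in> multiples (q ^ k)"
      using that unfolding adelic_null_def by simp
    with that(3) show ?thesis
    proof eventually_elim
      case (elim i)
      from rat_val_ge_add[OF elim(1) rat_val_ge_multiples[OF multiples_minus[OF elim(2)]]]
      show ?case by simp
    qed
  qed
  moreover have "adelic_null (\<lambda>i. x i - y i)" "adelic_null (\<lambda>i. y i - x i)"
    using * adelic_null_minus[of "\<lambda>i. x i - y i"] by (auto simp: adelic_rel_def)
  ultimately show "(q > 0 \<and> (\<forall>\<^sub>F i in sequentially. rat_val_ge q k (x i))) \<longleftrightarrow>
      (q > 0 \<and> (\<forall>\<^sub>F i in sequentially. rat_val_ge q k (y i)))"
    by blast
qed

text \<open>Equality of the components at \<open>q\<close>.\<close>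

definition eq_at :: "nat \<Rightarrow> fin_adele \<Rightarrow> fin_adele \<Rightarrow> bool" where
  "eq_at q x y \<longleftrightarrow> (\<forall>k. val_ge q k (x - y))"

text \<open>The profinite completion of the integers.\<close>

definition Zhat :: "fin_adele set" where
  "Zhat = {x. \<forall>q. prime q \<longrightarrow> val_ge q 0 x}"


section \<open>The adelic general linear group\<close>

text \<open>
  A matrix over the adeles is a pair of a real matrix and a matrix over the finite adeles.
  The size of the matrices is the cardinality of the index type \<open>'n\<close>.
\<close>

type_synonym 'n adele_mat = "(real^'n^'n) \<times> (fin_adele^'n^'n)"
type_synonym 'n adele_fun = "'n adele_mat \<Rightarrow> complex"

definition amult :: "'n::finite adele_mat \<Rightarrow> 'n adele_mat \<Rightarrow> 'n adele_mat" where
  "amult g h = (fst g ** fst h, snd g ** snd h)"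

definition GL_A :: "'n::finite adele_mat set" where
  "GL_A = {g. invertible (fst g) \<and> invertible (snd g)}"

definition diag_embed :: "rat^'n^'n \<Rightarrow> 'n adele_mat" where
  "diag_embed \<gamma> = ((\<chi> i j. of_rat (\<gamma> $ i $ j)), (\<chi> i j. rat_adele (\<gamma> $ i $ j)))"

definition GL_Zhat :: "(fin_adele^'n::finite^'n) set" where
  "GL_Zhat = {k. \<exists>k'. k ** k' = mat 1 \<and> k' ** k = mat 1 \<and>
                      (\<forall>i j. k $ i $ j \<in> Zhat \<and> k' $ i $ j \<in> Zhat)}"

text \<open>
  The principal congruence subgroups; they form a neighbourhood base of the identity in the
  group of finite adelic points.
\<close>

definition K_cong :: "nat \<Rightarrow> (fin_adele^'n::finite^'n) set" where
  "K_cong N = {k \<in> GL_Zhat. \<forall>i j. \<exists>y\<in>Zhat. (k - mat 1) $ i $ j = of_nat N * y}"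

text \<open>
  The group \<open>GL\<^sub>n(\<int>\<^sub>p)\<close>, embedded by taking the identity at all other primes.
\<close>

definition K_loc :: "nat \<Rightarrow> (fin_adele^'n::finite^'n) set" where
  "K_loc p = {k \<in> GL_Zhat. \<forall>q. prime q \<and> q \<noteq> p \<longrightarrow> (\<forall>i j. eq_at q (k $ i $ j) (mat 1 $ i $ j))}"

definition rtrans :: "'n::finite adele_mat \<Rightarrow> 'n adele_fun \<Rightarrow> 'n adele_fun" where
  "rtrans h \<phi> = (\<lambda>g. \<phi> (amult g h))"


section \<open>Cusp forms\<close>

definition fun_span :: "('a \<Rightarrow> complex) set \<Rightarrow> ('a \<Rightarrow> complex) set" where
  "fun_span B = {(\<lambda>x. \<Sum>b\<in>F. c b * b x) | F c. finite F \<and> F \<subseteq> B}"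

definition fin_dim :: "('a \<Rightarrow> complex) set \<Rightarrow> bool" where
  "fin_dim V \<longleftrightarrow> (\<exists>B. finite B \<and> V \<subseteq> fun_span B)"

primrec Ck_on :: "nat \<Rightarrow> 'a::euclidean_space set \<Rightarrow> ('a \<Rightarrow> complex) \<Rightarrow> bool" where
  "Ck_on 0 S f \<longleftrightarrow> continuous_on S f"
| "Ck_on (Suc k) S f \<longleftrightarrow>
     f differentiable_on S \<and> (\<forall>v. Ck_on k S (\<lambda>x. frechet_derivative f (at x) v))"

definition smooth_inf :: "'n::finite adele_fun \<Rightarrow> bool" where
  "smooth_inf \<phi> \<longleftrightarrow>
     (\<forall>h. invertible h \<longrightarrow> (\<forall>k. Ck_on k {g. invertible g} (\<lambda>g. \<phi> (g, h))))"

text \<open>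
  The action of a real matrix \<open>X\<close> by the left invariant vector field, i.e. the derivative of
  \<open>\<phi> (g exp(tX))\<close> at \<open>t = 0\<close>.
\<close>

definition lie :: "real^'n^'n \<Rightarrow> 'n::finite adele_fun \<Rightarrow> 'n adele_fun" where
  "lie X \<phi> = (\<lambda>(g, h). if (g, h) \<in> GL_A
     then frechet_derivative (\<lambda>x. \<phi> (x, h)) (at g) (g ** X) else 0)"

text \<open>
  The universal enveloping algebra of the complexified Lie algebra, as an algebra of left
  invariant differential operators, and its centre.
\<close>

inductive_set U_gl :: "('n::finite adele_fun \<Rightarrow> 'n adele_fun) set" where
  U_id: "id \<in> U_gl"
| U_add: "D \<in> U_gl \<Longrightarrow> E \<in> U_gl \<Longrightarrow> (\<lambda>\<phi> g. D \<phi> g + E \<phi> g) \<in> U_gl"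
| U_scale: "D \<in> U_gl \<Longrightarrow> (\<lambda>\<phi> g. c * D \<phi> g) \<in> U_gl"
| U_lie: "D \<in> U_gl \<Longrightarrow> (\<lambda>\<phi>. lie X (D \<phi>)) \<in> U_gl"

definition Z_gl :: "('n::finite adele_fun \<Rightarrow> 'n adele_fun) set" where
  "Z_gl = {D \<in> U_gl. \<forall>X \<phi>. smooth_inf \<phi> \<longrightarrow> D (lie X \<phi>) = lie X (D \<phi>)}"

text \<open>
  Automorphic forms in the sense of Borel and Jacquet. Functions on the group are extended by
  zero to all matrices, so that they form a vector space of HOL functions.
\<close>

definition automorphic_form :: "'n::finite adele_fun \<Rightarrow> bool" where
  "automorphic_form \<phi> \<longleftrightarrow>
     (\<forall>g. g \<notin> GL_A \<longrightarrow> \<phi> g = 0) \<and>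
     (\<forall>\<gamma> g. invertible \<gamma> \<and> g \<in> GL_A \<longrightarrow> \<phi> (amult (diag_embed \<gamma>) g) = \<phi> g) \<and>
     smooth_inf \<phi> \<and>
     (\<exists>N>0. \<forall>k\<in>K_cong N. rtrans (mat 1, k) \<phi> = \<phi>) \<and>
     fin_dim {rtrans (k, mat 1) \<phi> | k. orthogonal_matrix k} \<and>
     fin_dim {D \<phi> | D. D \<in> Z_gl} \<and>
     (\<forall>h. invertible h \<longrightarrow> (\<exists>C r. \<forall>g. invertible g \<longrightarrow>
        norm (\<phi> (g, h)) \<le> C * (norm g + norm (matrix_inv g)) ^ r))"

text \<open>
  For a set \<open>I\<close> of indices, the matrices \<open>unip I X\<close> make up the unipotent radical of the
  maximal parabolic subgroup stabilising the span of the basis vectors indexed by \<open>I\<close>. Up to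
  conjugation over the rationals every maximal parabolic subgroup is of this kind.
\<close>

definition unip :: "'n set \<Rightarrow> 'a::comm_ring_1^'n^'n \<Rightarrow> 'a^'n^'n" where
  "unip I X = (\<chi> i j. if i = j then 1 else if i \<in> I \<and> j \<notin> I then X $ i $ j else 0)"

text \<open>
  The integral of \<open>\<phi> (u g)\<close> over \<open>u\<close> in the quotient of the adelic points of \<open>N\<close> by its
  rational points, where \<open>N\<close> is the radical
  attached to \<open>I\<close>. A fundamental domain for the adeles modulo the rationals is the product of
  the unit interval and \<open>Zhat\<close>; the integral of a locally constant function over \<open>Zhat\<close> is its
  average over the residues modulo \<open>k!\<close> for all large \<open>k\<close>. Matrix entries outside the block
  given by \<open>I\<close> are ignored by \<open>unip\<close>, and integrating over them contributes a factor of one.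
\<close>

definition constant_term :: "'n::finite set \<Rightarrow> 'n adele_fun \<Rightarrow> 'n adele_fun" where
  "constant_term I \<phi> g = lim (\<lambda>k. integral (cbox 0 (\<chi> i j. 1)) (\<lambda>X.
     (\<Sum>A\<in>{A :: int^'n^'n. \<forall>i j. A $ i $ j \<in> {0..<fact k}}.
        \<phi> (amult (unip I X, unip I (\<chi> i j. of_int (A $ i $ j))) g))
     / fact k ^ (CARD('n) ^ 2)))"

definition cusp_form :: "'n::finite adele_fun \<Rightarrow> bool" where
  "cusp_form \<phi> \<longleftrightarrow> automorphic_form \<phi> \<and>
     (\<forall>I. I \<noteq> {} \<and> I \<noteq> UNIV \<longrightarrow> (\<forall>g\<in>GL_A. constant_term I \<phi> g = 0))"


section \<open>Cuspidal automorphic representations\<close>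

text \<open>
  Stability under the Lie algebra, the maximal compact subgroup at infinity, and the group of
  finite adelic points.
\<close>

definition invariant_subspace :: "'n::finite adele_fun set \<Rightarrow> bool" where
  "invariant_subspace V \<longleftrightarrow>
     (\<lambda>_. 0) \<in> V \<and>
     (\<forall>\<phi>\<in>V. \<forall>\<psi>\<in>V. (\<lambda>g. \<phi> g + \<psi> g) \<in> V) \<and>
     (\<forall>\<phi>\<in>V. \<forall>c. (\<lambda>g. c * \<phi> g) \<in> V) \<and>
     (\<forall>\<phi>\<in>V. \<forall>X. lie X \<phi> \<in> V) \<and>
     (\<forall>\<phi>\<in>V. \<forall>k. orthogonal_matrix k \<longrightarrow> rtrans (k, mat 1) \<phi> \<in> V) \<and>
     (\<forall>\<phi>\<in>V. \<forall>h. invertible h \<longrightarrow> rtrans (mat 1, h) \<phi> \<in> V)"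

definition cuspidal_automorphic_rep :: "'n::finite adele_fun set \<Rightarrow> bool" where
  "cuspidal_automorphic_rep \<pi> \<longleftrightarrow>
     invariant_subspace \<pi> \<and> (\<forall>\<phi>\<in>\<pi>. cusp_form \<phi>) \<and> \<pi> \<noteq> {\<lambda>_. 0} \<and>
     (\<forall>V. invariant_subspace V \<and> V \<subseteq> \<pi> \<longrightarrow> V = {\<lambda>_. 0} \<or> V = \<pi>)"

definition spherical :: "'n::finite adele_fun set \<Rightarrow> nat \<Rightarrow> 'n adele_fun \<Rightarrow> bool" where
  "spherical \<pi> p \<phi> \<longleftrightarrow> \<phi> \<in> \<pi> \<and> \<phi> \<noteq> (\<lambda>_. 0) \<and> (\<forall>k\<in>K_loc p. rtrans (mat 1, k) \<phi> = \<phi>)"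

definition unramified :: "'n::finite adele_fun set \<Rightarrow> nat \<Rightarrow> bool" where
  "unramified \<pi> p \<longleftrightarrow> (\<exists>\<phi>. spherical \<pi> p \<phi>)"

text \<open>
  The double coset of \<open>diag(p, \<dots>, p, 1, \<dots>, 1)\<close>, with \<open>r\<close> entries \<open>p\<close>, for the group \<open>K_loc p\<close>
  in \<open>GL\<^sub>n(\<rat>\<^sub>p)\<close>. Permutation matrices lie in \<open>K_loc p\<close>, so the position of the entries is
  irrelevant.
\<close>

definition hecke_coset :: "nat \<Rightarrow> nat \<Rightarrow> (fin_adele^'n::finite^'n) set" where
  "hecke_coset p r = {h. invertible h \<and>
     (\<forall>q. prime q \<and> q \<noteq> p \<longrightarrow> (\<forall>i j. eq_at q (h $ i $ j) (mat 1 $ i $ j))) \<and>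
     (\<exists>J k1 k2. card J = r \<and> k1 \<in> K_loc p \<and> k2 \<in> K_loc p \<and>
        (\<forall>i j. eq_at p (h $ i $ j)
           ((k1 ** (\<chi> a b. if a = b then (if a \<in> J then of_nat p else 1) else 0) ** k2) $ i $ j)))}"

definition hecke :: "nat \<Rightarrow> nat \<Rightarrow> 'n::finite adele_fun \<Rightarrow> 'n adele_fun" where
  "hecke p r \<phi> = (\<lambda>g. \<Sum>C\<in>(\<lambda>h. (\<lambda>k. h ** k) ` K_loc p) ` hecke_coset p r.
     \<phi> (amult g (mat 1, SOME h. h \<in> C)))"

definition elem_sym :: "nat \<Rightarrow> ('n::finite \<Rightarrow> complex) \<Rightarrow> complex" where
  "elem_sym r a = (\<Sum>J\<in>{J. card J = r}. \<Prod>j\<in>J. a j)"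

text \<open>
  The Satake parameters: the Hecke operator \<open>hecke p r\<close> acts on spherical vectors by \<open>p\<close> to the
  power \<open>r (n - r) / 2\<close> times the elementary symmetric function of degree \<open>r\<close>. This
  determines \<open>a\<close> up to order.
\<close>

definition satake_parameters :: "'n::finite adele_fun set \<Rightarrow> nat \<Rightarrow> ('n \<Rightarrow> complex) \<Rightarrow> bool" where
  "satake_parameters \<pi> p a \<longleftrightarrow>
     (\<forall>\<phi> r. spherical \<pi> p \<phi> \<and> r \<le> CARD('n) \<longrightarrow>
        hecke p r \<phi> =
          (\<lambda>g. of_real (real p powr (real r * (real CARD('n) - real r) / 2)) * elem_sym r a * \<phi> g))"


section \<open>L-functions\<close>

definition euler_factor :: "('n::finite \<Rightarrow> complex) \<Rightarrow> nat \<Rightarrow> complex \<Rightarrow> complex" where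
  "euler_factor a p s = (\<Prod>j\<in>UNIV. inverse (1 - a j * of_nat p powr (- s)))"

definition Gamma_R :: "complex \<Rightarrow> complex" where
  "Gamma_R s = of_real pi powr (- s / 2) * Gamma (s / 2)"

definition completed_L ::
  "nat \<Rightarrow> ('n::finite \<Rightarrow> complex) \<Rightarrow> (complex \<Rightarrow> complex) \<Rightarrow> complex \<Rightarrow> complex" where
  "completed_L Q \<mu> L s = of_nat Q powr (s / 2) * (\<Prod>j\<in>UNIV. Gamma_R (s + \<mu> j)) * L s"

text \<open>
  \<open>L_function \<pi> \<alpha> Q \<mu> \<epsilon> L\<close> says that \<open>L\<close> is the L-function of \<open>\<pi>\<close>, with local parameters
  \<open>\<alpha> p\<close>, conductor \<open>Q\<close>, archimedean constants \<open>\<mu>\<close> and root number \<open>\<epsilon>\<close>. At the unramified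
  primes the parameters are the Satake parameters. The ramified factors and the factor at
  infinity are specified by the functional equation: together with the bounds of Jacquet and
  Shalika required here, it determines them uniquely, because a ratio of two candidates would
  have all its zeros and poles in \<open>Re s < 1/2\<close> and, by the functional equation, also in
  \<open>Re s > 1/2\<close>.

  The contragredient of a unitary representation is its complex conjugate, so its local
  parameters and archimedean constants are the conjugates of those of \<open>\<pi>\<close>, and its L-function
  is \<open>s \<mapsto> cnj (L (cnj s))\<close>. The functional equation is required where neither side has a
  Gamma factor or an L-function at a pole. The last condition is that \<open>L\<close> has finite order.
\<close>

definition L_function ::
  "'n::finite adele_fun set \<Rightarrow> (nat \<Rightarrow> 'n \<Rightarrow> complex) \<Rightarrow> nat \<Rightarrow> ('n \<Rightarrow> complex) \<Rightarrow> complex \<Rightarrow>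
     (complex \<Rightarrow> complex) \<Rightarrow> bool" where
  "L_function \<pi> \<alpha> Q \<mu> \<epsilon> L \<longleftrightarrow>
     (\<forall>p. prime p \<and> unramified \<pi> p \<longrightarrow> satake_parameters \<pi> p (\<alpha> p)) \<and>
     (\<forall>p j. prime p \<longrightarrow> norm (\<alpha> p j) < sqrt (real p)) \<and>
     (\<forall>j. Re (\<mu> j) > - 1 / 2) \<and>
     Q > 0 \<and> norm \<epsilon> = 1 \<and>
     L meromorphic_on UNIV \<and>
     (\<forall>s. Re s > 1 \<longrightarrow> (\<lambda>p. if prime p then euler_factor (\<alpha> p) p s else 1) has_prod L s) \<and>
     (\<forall>s. (\<forall>j. (s + \<mu> j) / 2 \<notin> \<int>\<^sub>\<le>\<^sub>0 \<and> (1 - s + cnj (\<mu> j)) / 2 \<notin> \<int>\<^sub>\<le>\<^sub>0) \<and>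
          L analytic_on {s, 1 - cnj s} \<longrightarrow>
        completed_L Q \<mu> L s =
          \<epsilon> * completed_L Q (\<lambda>j. cnj (\<mu> j)) (\<lambda>z. cnj (L (cnj z))) (1 - s)) \<and>
     (\<exists>A. \<forall>\<^sub>F s in at_infinity. norm (L s) \<le> exp (norm s ^ A))"

definition Ramanujan_Petersson ::
  "'n::finite adele_fun set \<Rightarrow> (nat \<Rightarrow> 'n \<Rightarrow> complex) \<Rightarrow> bool" where
  "Ramanujan_Petersson \<pi> \<alpha> \<longleftrightarrow>
     (\<forall>p. prime p \<and> unramified \<pi> p \<longrightarrow> (\<forall>j. norm (\<alpha> p j) = 1))"

definition Riemann_Hypothesis_L ::
  "('n::finite \<Rightarrow> complex) \<Rightarrow> (complex \<Rightarrow> complex) \<Rightarrow> bool" where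
  "Riemann_Hypothesis_L \<mu> L \<longleftrightarrow>
     (\<forall>s. L s = 0 \<and> \<not> (\<exists>(k::nat) j. s = - 2 * of_nat k - \<mu> j) \<longrightarrow> Re s = 1 / 2)"

text \<open>\<open>L2\<close> continues the second-moment L-function to a neighbourhood of \<open>Re s \<ge> 1\<close>.\<close>

definition second_moment_L ::
  "(nat \<Rightarrow> 'n::finite \<Rightarrow> complex) \<Rightarrow> (complex \<Rightarrow> complex) \<Rightarrow> bool" where
  "second_moment_L \<alpha> L2 \<longleftrightarrow>
     (\<exists>U. open U \<and> {s. Re s \<ge> 1} \<subseteq> U \<and> L2 meromorphic_on U) \<and>
     (\<forall>s. Re s > 1 \<longrightarrow>
        (\<lambda>p. if prime p then euler_factor (\<lambda>j. (\<alpha> p j)\<^sup>2) p s else 1) has_prod L2 s)"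

text \<open>
  The difference of the multiplicities of the trivial representation in the symmetric and the
  exterior square of \<open>\<pi>\<close>, expressed as minus the order of vanishing at \<open>1\<close> of the second-moment
  L-function.
\<close>

definition nu_index :: "(complex \<Rightarrow> complex) \<Rightarrow> int" where
  "nu_index L2 = - zorder L2 1"

definition finite_log_measure :: "real set \<Rightarrow> bool" where
  "finite_log_measure S \<longleftrightarrow>
     S \<in> sets lebesgue \<and> (\<integral>\<^sup>+ t\<in>S. ennreal (1 / t) \<partial>lebesgue) < \<infinity>"

end

theory Submission
  imports Defs "HOL-Probability.Probability" "HOL-Real_Asymp.Real_Asymp"
begin

text \<open>
  Let \<open>u = ln x\<close>. The logarithm of the central Euler product is the sum over \<open>p\<^sup>k \<le> x\<close> of
  the coefficients of \<open>ln L\<close> at \<open>1/2\<close>, plus the squares of the primes in \<open>(sqrt x, x]\<close>, plus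
  \<open>o(1)\<close>. The prime squares contribute \<open>(\<nu>/2) ln 2\<close>, by Karamata's Tauberian method applied to
  the pole of \<open>L\<^sub>2\<close> at \<open>1\<close>.

  Adding \<open>m\<close> times the harmonic sum up to \<open>u\<close> and subtracting a constant \<open>c\<close>, the sum over \<open>p\<^sup>k\<close>
  turns into a step function \<open>D u\<close> with Laplace transform \<open>H z / z\<close>, where
  \<open>H z = ln L (1/2 + z) - m ln (1 - exp (- z)) - c\<close>. By the Riemann hypothesis \<open>H\<close> is holomorphic in the
  right half plane, and \<open>c\<close> can be chosen so that \<open>H z / z\<close> stays bounded at \<open>0\<close>, which forces
  \<open>exp c = (deriv ^^ m) L (1/2) / m!\<close>. Dividing out the zeros of \<open>L\<close> in a disc around \<open>1 + iT\<close> gives a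
  bound on the mean square of \<open>H\<close> over a unit interval at height \<open>T\<close>, uniformly up to
  the boundary and of order \<open>(log T)\<^sup>2\<close>. Hence \<open>H z / z\<close> has bounded mean square on vertical
  lines, and Plancherel shows that \<open>D\<close> is square integrable in \<open>u\<close>. So \<open>D u\<close> tends to \<open>0\<close> outside a
  set of finite measure in \<open>u\<close>, that is, of finite logarithmic measure in \<open>x\<close>.
\<close>

section \<open>Logarithms of holomorphic functions\<close>

text \<open>The zeros of \<open>L\<close> on the central line are logarithmic singularities of
  \<open>ln L\<close> and give no pointwise control of the remainder in this argument. A logarithm
  is however locally square integrable, and only the number of zeros near height T enters its mean
  square; this is why the bound is an L2 bound and an exceptional set appears. The term -m ln (1 -
  exp (- z)) is preferred to -m ln z because, divided by z, it is itself the transform of a step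
  function: the harmonic sum, which is ln u + \<gamma> + o(1) and so supplies both (log x)^m and exp
  (- m \<gamma>). Its further singularities at 2 pi i k are of the same logarithmic kind. Squares of
  primes between sqrt x and x must be split off because the factor at p carries all powers of p,
  while \<open>D\<close> sees only p^k <= x; cubes and beyond converge absolutely. The Laplace
  integral converges a priori only to the right of Re z = 1/2 and its inverse need not converge, so
  \<open>D\<close> is smoothed by a Gaussian, the line of integration is moved to Re z = 1 / U,
  where exp (u / U) stays bounded for u <= U, and the smoothing is removed at the end.\<close>

lemma exp_eq_imp_diff_constant:
  fixes f g :: "complex \<Rightarrow> complex"
  assumes "connected S" "continuous_on S f" "continuous_on S g"
    and "\<And>z. z \<in> S \<Longrightarrow> exp (f z) = exp (g z)"
  shows "\<exists>c. \<forall>z\<in>S. f z = g z + c"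
proof -
  have int: "\<exists>n::int. f z - g z = of_int (2 * n) * (of_real pi * \<i>)" if "z \<in> S" for z
  proof -
    from assms(4)[OF that] obtain n :: int where "f z = g z + (of_int (2 * n) * pi) * \<i>"
      unfolding exp_eq by blast
    then show ?thesis by (intro exI[of _ n]) simp
  qed
  have "(\<lambda>z. f z - g z) constant_on S"
  proof (rule continuous_discrete_range_constant[OF assms(1)])
    show "continuous_on S (\<lambda>z. f z - g z)"
      by (intro continuous_intros assms)
    \<comment> \<open>Distinct multiples of 2 pi i are at least 2 pi apart, so the continuous
      difference f - g has discrete range.\<close>
    show "\<exists>e>0. \<forall>y. y \<in> S \<and> f y - g y \<noteq> f x - g x \<longrightarrow> e \<le> norm (f y - g y - (f x - g x))"
      if xS: "x \<in> S" for x
    proof (intro exI[of _ "2 * pi"] conjI allI impI)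
      fix y assume y: "y \<in> S \<and> f y - g y \<noteq> f x - g x"
      obtain n :: int where n: "f y - g y = of_int (2 * n) * (of_real pi * \<i>)"
        using int[of y] y by blast
      obtain k :: int where k: "f x - g x = of_int (2 * k) * (of_real pi * \<i>)"
        using int[OF xS] by blast
      have "n \<noteq> k" using y unfolding n k by auto
      then have "1 \<le> \<bar>real_of_int (n - k)\<bar>" by linarith
      moreover have "norm (f y - g y - (f x - g x)) = 2 * pi * \<bar>real_of_int (n - k)\<bar>"
      proof -
        have "f y - g y - (f x - g x) = of_int (2 * (n - k)) * (of_real pi * \<i>)"
          unfolding n k by (simp add: algebra_simps)
        also have "norm \<dots> = \<bar>real_of_int (2 * (n - k))\<bar> * pi"
          by (simp only: norm_mult norm_of_int norm_of_real norm_ii) simp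
        finally show ?thesis by (simp add: abs_if algebra_simps)
      qed
      ultimately show "2 * pi \<le> norm (f y - g y - (f x - g x))"
        by (simp add: mult_le_cancel_left1)
    qed simp
  qed
  then obtain c where "\<And>z. z \<in> S \<Longrightarrow> f z - g z = c" unfolding constant_on_def by blast
  then have "f z = g z + c" if "z \<in> S" for z using that by (metis add.commute diff_add_cancel)
  then show ?thesis by blast
qed

section \<open>Bounding a logarithm by dividing out zeros\<close>

text \<open>With k the recentred h on the unit disc, k / (2 A - k) fixes 0 and maps the disc into
  itself, since a point with real part below A is closer to 0 than to 2 A. Schwarz's lemma bounds it
  by |w|, and solving for k gives the claim.\<close>

lemma Borel_Caratheodory:
  assumes hol: "h holomorphic_on ball 0 R" and r: "0 < r" "r < R"
    and A: "\<And>z. norm z < R \<Longrightarrow> Re (h z - h 0) < A" and z: "norm z \<le> r"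
  shows "norm (h z - h 0) \<le> 2 * A * r / (R - r)"
proof -
  have A0: "A > 0" using A[of 0] r by simp
  define k where "k = (\<lambda>w. h (of_real R * w) - h 0)"
  define f where "f = (\<lambda>w. k w / (2 * of_real A - k w))"
  have Rek: "Re (k w) < A" if "norm w < 1" for w
    unfolding k_def by (rule A) (use that r in \<open>simp add: norm_mult\<close>)
  have nz: "2 * of_real A - k w \<noteq> 0" if "norm w < 1" for w
    using Rek[OF that] A0 by (auto simp: complex_eq_iff)
  have kle: "norm (k w) < norm (2 * of_real A - k w)" if "norm w < 1" for w
  proof -
    have "(norm (k w))\<^sup>2 < (norm (2 * of_real A - k w))\<^sup>2"
      using Rek[OF that] A0 unfolding cmod_power2
      by (simp add: power2_eq_square algebra_simps)
    then show ?thesis by (meson norm_ge_zero power2_less_imp_less)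
  qed
  have holk: "k holomorphic_on ball 0 1"
    unfolding k_def
    by (intro holomorphic_intros holomorphic_on_compose_gen[OF _ hol, unfolded o_def])
       (use r in \<open>auto simp: norm_mult\<close>)
  have schwarz: "norm (f w) \<le> norm w" if "norm w < 1" for w
  proof (rule Schwarz_Lemma(1))
    show "f holomorphic_on ball 0 1"
      unfolding f_def using nz by (intro holomorphic_intros holk) auto
    show "f 0 = 0" by (simp add: f_def k_def)
    show "norm (f w) < 1" if "norm w < 1" for w
      using kle[OF that] unfolding f_def norm_divide
      by (metis divide_less_eq_1 norm_ge_zero order_le_less_trans)
  qed fact
  define w where "w = z / of_real R"
  have w: "norm w \<le> r / R" "norm w < 1" "of_real R * w = z"
    using r z by (auto simp: w_def norm_divide divide_right_mono)
  have "k w = f w * (2 * of_real A - k w)"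
    using nz[OF w(2)] by (simp add: f_def)
  then have "norm (k w) \<le> norm w * (2 * A + norm (k w))"
    using schwarz[OF w(2)] A0 norm_triangle_ineq4[of "2 * of_real A" "k w"]
    by (metis (no_types, lifting) abs_of_pos mult_mono norm_ge_zero norm_mult norm_numeral norm_of_real)
  also have "\<dots> \<le> r / R * (2 * A + norm (k w))"
    using A0 by (intro mult_right_mono w) auto
  finally have "norm (k w) * (R - r) \<le> 2 * A * r"
    using r by (simp add: field_simps)
  then have "norm (k w) \<le> 2 * A * r / (R - r)"
    using r by (simp add: field_simps)
  then show ?thesis using w(3) by (simp add: k_def)
qed

text \<open>The factor 2 (z - \<rho>) / (4 - cnj \<rho> z) has modulus 1 on the circle of radius 2,
  so dividing f by it keeps the bound M there. The identity has products on both sides to avoid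
  division. Extraction stops after n zeros, or earlier if none is left in the disc of radius 3/2;
  \<open>zero_free_factorization\<close> picks n so large that the second case must occur.\<close>

lemma Blaschke_factor_zeros:
  assumes hol: "f holomorphic_on UNIV" and f0: "f 0 \<noteq> 0"
    and M: "\<And>z. norm z = 2 \<Longrightarrow> norm (f z) \<le> M"
  shows "\<exists>\<rho>s g. g holomorphic_on UNIV \<and> length \<rho>s \<le> n \<and>
     (\<forall>\<rho>\<in>set \<rho>s. norm \<rho> \<le> 3/2 \<and> f \<rho> = 0) \<and>
     (\<forall>z. f z * (\<Prod>\<rho>\<leftarrow>\<rho>s. (4 - cnj \<rho> * z) / 2) = g z * (\<Prod>\<rho>\<leftarrow>\<rho>s. z - \<rho>)) \<and>
     (\<forall>z. norm z = 2 \<longrightarrow> norm (g z) \<le> M) \<and>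
     (length \<rho>s = n \<or> (\<forall>z. norm z \<le> 3/2 \<longrightarrow> g z \<noteq> 0))"
proof (induction n)
  case 0
  show ?case by (rule exI[of _ "[]"], rule exI[of _ f]) (use assms in auto)
next
  case (Suc n)
  then obtain \<rho>s g where g: "g holomorphic_on UNIV" and len: "length \<rho>s \<le> n"
    and zeros: "\<And>\<rho>. \<rho> \<in> set \<rho>s \<Longrightarrow> norm \<rho> \<le> 3/2 \<and> f \<rho> = 0"
    and eq: "\<And>z. f z * (\<Prod>\<rho>\<leftarrow>\<rho>s. (4 - cnj \<rho> * z) / 2) = g z * (\<Prod>\<rho>\<leftarrow>\<rho>s. z - \<rho>)"
    and Mg: "\<And>z. norm z = 2 \<Longrightarrow> norm (g z) \<le> M"
    and alt: "length \<rho>s = n \<or> (\<forall>z. norm z \<le> 3/2 \<longrightarrow> g z \<noteq> 0)"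
    by blast
  show ?case
  proof (cases "\<forall>z. norm z \<le> 3/2 \<longrightarrow> g z \<noteq> 0")
    case True
    show ?thesis
      by (rule exI[of _ \<rho>s], rule exI[of _ g]) (use g len zeros eq Mg True in auto)
  next
    case False
    then obtain \<rho> where \<rho>: "norm \<rho> \<le> 3/2" "g \<rho> = 0" by blast
    have len': "length \<rho>s = n" using alt False by blast
    define g0 where "g0 = (\<lambda>z. if z = \<rho> then deriv g \<rho> else (g z - g \<rho>) / (z - \<rho>))"
    have g0: "g0 holomorphic_on UNIV" unfolding g0_def by (rule pole_lemma_open[OF g open_UNIV])
    have gg0: "g z = (z - \<rho>) * g0 z" for z using \<rho> by (simp add: g0_def)
    define g1 where "g1 = (\<lambda>z. g0 z * ((4 - cnj \<rho> * z) / 2))"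
    have f\<rho>: "f \<rho> = 0"
    proof -
      \<comment> \<open>A zero of the quotient is a zero of f: the factors on the left would vanish
        only for |\<rho>'| |\<rho>| = 4, while both moduli are at most 3/2.\<close>
      have "(\<Prod>\<rho>'\<leftarrow>\<rho>s. (4 - cnj \<rho>' * \<rho>) / 2) \<noteq> 0"
      proof
        assume "(\<Prod>\<rho>'\<leftarrow>\<rho>s. (4 - cnj \<rho>' * \<rho>) / 2) = 0"
        then obtain \<rho>' where "\<rho>' \<in> set \<rho>s" "cnj \<rho>' * \<rho> = 4"
          by (auto simp: prod_list_zero_iff)
        then have "norm \<rho>' * norm \<rho> = 4"
          by (metis complex_mod_cnj norm_mult norm_numeral)
        moreover have "norm \<rho>' * norm \<rho> \<le> 3/2 * (3/2)"
          using zeros \<open>\<rho>' \<in> set \<rho>s\<close> \<rho> by (intro mult_mono) auto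
        ultimately show False by simp
      qed
      then show ?thesis using eq[of \<rho>] \<rho> by auto
    qed
    have Mg1: "norm (g1 z) \<le> M" if z: "norm z = 2" for z
    proof -
      \<comment> \<open>On the circle 4 = z cnj z, which turns the numerator into z cnj (z -
        \<rho>).\<close>
      have "norm (4 - cnj \<rho> * z) = norm (z * cnj z - cnj \<rho> * z)"
        using z by (simp add: complex_norm_square[symmetric])
      also have "\<dots> = norm (z * cnj (z - \<rho>))" by (simp add: algebra_simps)
      also have "\<dots> = 2 * norm (z - \<rho>)" using z by (simp only: norm_mult complex_mod_cnj)
      finally have "norm (g1 z) = norm (g z)"
        by (simp add: g1_def gg0 norm_mult norm_divide)
      with Mg[OF z] show ?thesis by simp
    qed
    show ?thesis
    proof (rule exI[of _ "\<rho> # \<rho>s"], rule exI[of _ g1], intro conjI)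
      show "g1 holomorphic_on UNIV" unfolding g1_def by (intro holomorphic_intros g0) auto
      show "\<forall>z. f z * (\<Prod>\<rho>\<leftarrow>\<rho> # \<rho>s. (4 - cnj \<rho> * z) / 2) = g1 z * (\<Prod>\<rho>\<leftarrow>\<rho> # \<rho>s. z - \<rho>)"
      proof
        fix z
        have "f z * (\<Prod>\<rho>\<leftarrow>\<rho> # \<rho>s. (4 - cnj \<rho> * z) / 2) =
            (4 - cnj \<rho> * z) / 2 * (f z * (\<Prod>\<rho>\<leftarrow>\<rho>s. (4 - cnj \<rho> * z) / 2))"
          by simp
        also have "\<dots> = g1 z * (\<Prod>\<rho>\<leftarrow>\<rho> # \<rho>s. z - \<rho>)"
          unfolding eq gg0 g1_def by simp
        finally show "f z * (\<Prod>\<rho>\<leftarrow>\<rho> # \<rho>s. (4 - cnj \<rho> * z) / 2) = g1 z * (\<Prod>\<rho>\<leftarrow>\<rho> # \<rho>s. z - \<rho>)" .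
      qed
    qed (use zeros \<rho> f\<rho> Mg1 len' in auto)
  qed
qed

lemma prod_list_norm_le:
  fixes xs :: "complex list"
  assumes "\<And>x. x \<in> set xs \<Longrightarrow> norm x \<le> b"
  shows "norm (prod_list xs) \<le> b ^ length xs"
  using assms
proof (induction xs)
  case (Cons x xs)
  have "norm x \<le> b" "norm (prod_list xs) \<le> b ^ length xs" using Cons by auto
  then show ?case
    by (auto simp: norm_mult intro!: mult_mono order_trans[OF norm_ge_zero])
qed simp

lemma sum_list_norm_le:
  fixes f :: "'a \<Rightarrow> complex"
  shows "norm (\<Sum>x\<leftarrow>xs. f x) \<le> (\<Sum>x\<leftarrow>xs. norm (f x))"
  by (induction xs) (auto intro: order_trans[OF norm_triangle_ineq])

text \<open>A Jensen count: at 0 each extracted factor has modulus |\<rho>| / 2 <= 3/4, so N of them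
  force |f 0| (4/3)^N <= |g 0| <= M.\<close>

lemma zero_free_factorization:
  assumes hol: "f holomorphic_on UNIV" and f0: "f 0 \<noteq> 0"
    and M: "\<And>z. norm z = 2 \<Longrightarrow> norm (f z) \<le> M"
  obtains \<rho>s g where "g holomorphic_on UNIV"
    "\<And>\<rho>. \<rho> \<in> set \<rho>s \<Longrightarrow> norm \<rho> \<le> 3/2 \<and> f \<rho> = 0"
    "\<And>z. f z * (\<Prod>\<rho>\<leftarrow>\<rho>s. (4 - cnj \<rho> * z) / 2) = g z * (\<Prod>\<rho>\<leftarrow>\<rho>s. z - \<rho>)"
    "\<And>z. norm z \<le> 2 \<Longrightarrow> norm (g z) \<le> M"
    "\<And>z. norm z \<le> 3/2 \<Longrightarrow> g z \<noteq> 0"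
    "real (length \<rho>s) \<le> 4 * ln (M / norm (f 0))" "norm (f 0) \<le> norm (g 0)"
proof -
  have main: "(\<forall>z. norm z \<le> 2 \<longrightarrow> norm (g z) \<le> M) \<and> norm (f 0) \<le> norm (g 0) \<and>
      real (length \<rho>s) \<le> 4 * ln (M / norm (f 0))"
    if g: "g holomorphic_on UNIV"
    and zeros: "\<And>\<rho>. \<rho> \<in> set \<rho>s \<Longrightarrow> norm \<rho> \<le> 3/2 \<and> f \<rho> = 0"
    and eq: "\<And>z. f z * (\<Prod>\<rho>\<leftarrow>\<rho>s. (4 - cnj \<rho> * z) / 2) = g z * (\<Prod>\<rho>\<leftarrow>\<rho>s. z - \<rho>)"
    and Mg: "\<And>z. norm z = 2 \<Longrightarrow> norm (g z) \<le> M" for g \<rho>s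
  proof -
    have mm: "norm (g z) \<le> M" if "norm z \<le> 2" for z
    proof (rule maximum_modulus_frontier[where f = g and S = "cball 0 2"])
      show "g holomorphic_on interior (cball 0 2)" using g holomorphic_on_subset by blast
      show "continuous_on (closure (cball 0 2)) g"
        using g holomorphic_on_imp_continuous_on holomorphic_on_subset by blast
    qed (use that Mg in auto)
    have e0: "f 0 * (\<Prod>\<rho>\<leftarrow>\<rho>s. 2) = g 0 * (\<Prod>\<rho>\<leftarrow>\<rho>s. - \<rho>)"
      using eq[of 0] by simp
    have p2: "norm (\<Prod>\<rho>\<leftarrow>\<rho>s. (2::complex)) = 2 ^ length \<rho>s"
      by (simp add: prod_list_replicate map_replicate_const norm_power)
    have pl: "norm (\<Prod>\<rho>\<leftarrow>\<rho>s. - \<rho>) \<le> (3/2) ^ length \<rho>s"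
      using prod_list_norm_le[of "map uminus \<rho>s" "3/2"] zeros by fastforce
    have "norm (f 0) * 2 ^ length \<rho>s \<le> norm (g 0) * (3/2) ^ length \<rho>s"
      using arg_cong[OF e0, of norm] pl unfolding norm_mult p2
      by (simp add: mult_left_mono)
    then have le: "norm (f 0) * (4/3) ^ length \<rho>s \<le> norm (g 0)"
      by (simp add: power_divide field_simps flip: power_mult_distrib)
    have "norm (f 0) * 1 \<le> norm (f 0) * (4/3) ^ length \<rho>s"
      by (intro mult_left_mono one_le_power) auto
    with le have le1: "norm (f 0) \<le> norm (g 0)" by simp
    have "(4/3) ^ length \<rho>s \<le> M / norm (f 0)"
      using order_trans[OF le mm[of 0]] f0 by (simp add: field_simps)
    then have "ln ((4/3) ^ length \<rho>s) \<le> ln (M / norm (f 0))"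
      by (smt (verit) ln_le_cancel_iff zero_less_power zero_less_divide_iff)
    then have "real (length \<rho>s) * ln (4/3) \<le> ln (M / norm (f 0))"
      by (simp add: ln_realpow)
    moreover have "(1/4::real) \<le> ln (4/3)"
      using ln_add_one_self_le_self2[of "-1/4"] ln_div[of 1 "4/3::real"] 
      by (simp add: ln_div)
    then have "real (length \<rho>s) * (1/4) \<le> real (length \<rho>s) * ln (4/3)" by (intro mult_left_mono) auto
    ultimately have "real (length \<rho>s) \<le> 4 * ln (M / norm (f 0))" by linarith
    with mm le1 show ?thesis by blast
  qed
  \<comment> \<open>More than the Jensen bound allows, so the extraction cannot have used all n
    steps and g is zero-free.\<close>
  define n where "n = Suc (nat \<lceil>4 * ln (M / norm (f 0))\<rceil>)"
  obtain \<rho>s g where g: "g holomorphic_on UNIV"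
    and zeros: "\<And>\<rho>. \<rho> \<in> set \<rho>s \<Longrightarrow> norm \<rho> \<le> 3/2 \<and> f \<rho> = 0"
    and eq: "\<And>z. f z * (\<Prod>\<rho>\<leftarrow>\<rho>s. (4 - cnj \<rho> * z) / 2) = g z * (\<Prod>\<rho>\<leftarrow>\<rho>s. z - \<rho>)"
    and Mg: "\<And>z. norm z = 2 \<Longrightarrow> norm (g z) \<le> M"
    and alt: "length \<rho>s = n \<or> (\<forall>z. norm z \<le> 3/2 \<longrightarrow> g z \<noteq> 0)"
    using Blaschke_factor_zeros[OF assms, of n] by blast
  note m = main[OF g zeros eq Mg]
  have "length \<rho>s \<noteq> n"
  proof
    assume "length \<rho>s = n"
    then have "real n \<le> 4 * ln (M / norm (f 0))" using m by simp
    then show False unfolding n_def by linarith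
  qed
  with alt m show ?thesis by (intro that[OF g zeros eq]) auto
qed

lemma norm_Ln_le: "z \<noteq> 0 \<Longrightarrow> norm (Ln z) \<le> \<bar>ln (norm z)\<bar> + pi"
proof -
  assume z: "z \<noteq> 0"
  have "norm (Ln z) \<le> \<bar>Re (Ln z)\<bar> + \<bar>Im (Ln z)\<bar>" by (rule cmod_le)
  also have "\<bar>Im (Ln z)\<bar> \<le> pi"
    using mpi_less_Im_Ln[OF z] Im_Ln_le_pi[OF z] by linarith
  finally show ?thesis using Re_Ln[OF z] by simp
qed

text \<open>The interval contains |4 - w| / 2 for all |w| <= 9/4, the range of the denominators of
  the extracted factors.\<close>

lemma abs_ln_le:
  assumes "7/8 \<le> x" "x \<le> (25/8::real)"
  shows "\<bar>ln x\<bar> \<le> 17/8"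
proof -
  have "ln x \<le> x - 1" by (rule ln_le_minus_one) (use assms in auto)
  moreover have "ln (1 / x) \<le> 1 / x - 1" by (rule ln_le_minus_one) (use assms in auto)
  moreover have "1 / x \<le> 8/7" using assms by (simp add: field_simps)
  ultimately show ?thesis using assms by (simp add: ln_div)
qed

lemma exp_sum_list:
  fixes f :: "'a \<Rightarrow> complex"
  shows "exp (\<Sum>x\<leftarrow>xs. f x) = (\<Prod>x\<leftarrow>xs. exp (f x))"
  by (induction xs) (auto simp: exp_add)

lemma holomorphic_on_sum_list:
  assumes "\<And>x. x \<in> set xs \<Longrightarrow> (\<lambda>z. f x z) holomorphic_on S"
  shows "(\<lambda>z. \<Sum>x\<leftarrow>xs. f x z) holomorphic_on S"
  using assms by (induction xs) (auto intro!: holomorphic_intros)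

lemma sum_list_le_length:
  assumes "\<And>x. x \<in> set xs \<Longrightarrow> f x \<le> (c::real)"
  shows "(\<Sum>x\<leftarrow>xs. f x) \<le> real (length xs) * c"
  using assms by (induction xs) (auto simp: algebra_simps add_mono)

lemma prod_list_mult_distrib:
  fixes f g :: "'a \<Rightarrow> complex"
  shows "(\<Prod>x\<leftarrow>xs. f x * g x) = (\<Prod>x\<leftarrow>xs. f x) * (\<Prod>x\<leftarrow>xs. g x)"
  by (induction xs) (auto simp: mult_ac)

text \<open>Since exp never vanishes, every zero of f has real part at most -1, and z - \<rho> stays
  in the right half plane, where \<open>Ln\<close> is holomorphic. Dividing out the zeros leaves a
  function whose logarithm is controlled by its modulus through Borel-Caratheodory; the terms
  \<open>Ln (z - \<rho>)\<close> are kept because they may become singular as z approaches the edge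
  Re z = -1.\<close>

lemma log_bound_near_center:
  assumes hol: "f holomorphic_on UNIV" and l: "l holomorphic_on {z. Re z > -1}"
    and ef: "\<And>z. Re z > -1 \<Longrightarrow> exp (l z) = f z"
    and B: "\<And>z. norm z \<le> 2 \<Longrightarrow> norm (f z) \<le> exp B" and l0: "norm (l 0) \<le> B" and B1: "B \<ge> 1"
  obtains \<rho>s where "real (length \<rho>s) \<le> 8 * B" 
    "\<And>\<rho>. \<rho> \<in> set \<rho>s \<Longrightarrow> Re \<rho> \<le> -1 \<and> norm \<rho> \<le> 3/2"
    "\<And>z. Re z > -1 \<Longrightarrow> norm z \<le> 5/4 \<Longrightarrow> norm (l z) \<le> 200 * B + (\<Sum>\<rho>\<leftarrow>\<rho>s. norm (Ln (z - \<rho>)))"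
proof -
  have f0: "f 0 = exp (l 0)" using ef[of 0] by simp
  have nf0: "norm (f 0) = exp (Re (l 0))" by (simp add: f0)
  have Rel0: "Re (l 0) \<ge> -B" using abs_Re_le_cmod[of "l 0"] l0 by linarith
  have "f 0 \<noteq> 0" by (simp add: f0)
  then obtain \<rho>s g where g: "g holomorphic_on UNIV"
    and zeros: "\<And>\<rho>. \<rho> \<in> set \<rho>s \<Longrightarrow> norm \<rho> \<le> 3/2 \<and> f \<rho> = 0"
    and eq: "\<And>z. f z * (\<Prod>\<rho>\<leftarrow>\<rho>s. (4 - cnj \<rho> * z) / 2) = g z * (\<Prod>\<rho>\<leftarrow>\<rho>s. z - \<rho>)"
    and gM: "\<And>z. norm z \<le> 2 \<Longrightarrow> norm (g z) \<le> exp B"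
    and gnz: "\<And>z. norm z \<le> 3/2 \<Longrightarrow> g z \<noteq> 0"
    and len: "real (length \<rho>s) \<le> 4 * ln (exp B / norm (f 0))" and g0: "norm (f 0) \<le> norm (g 0)"
    by (rule zero_free_factorization[OF hol, of "exp B"]) (use B in auto)
  \<comment> \<open>Indeed ln (exp B / |f 0|) = B - Re (l 0) <= 2 B.\<close>
  have len': "real (length \<rho>s) \<le> 8 * B"
    using len Rel0 unfolding nf0 exp_diff[symmetric] by simp
  have Re\<rho>: "Re \<rho> \<le> -1" if "\<rho> \<in> set \<rho>s" for \<rho>
    using zeros[OF that] ef[of \<rho>] by (metis exp_not_eq_zero not_le)
  have lng0: "\<bar>ln (norm (g 0))\<bar> \<le> B"
  proof -
    have "ln (norm (g 0)) \<le> ln (exp B)" using gM[of 0] gnz[of 0] by (subst ln_le_cancel_iff) auto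
    moreover have "ln (norm (f 0)) \<le> ln (norm (g 0))" using g0 gnz[of 0] \<open>f 0 \<noteq> 0\<close> by simp
    ultimately show ?thesis using Rel0 unfolding nf0 by simp
  qed
  obtain h0 where h0: "h0 holomorphic_on ball 0 (3/2)" "\<And>z. z \<in> ball 0 (3/2) \<Longrightarrow> g z = exp (h0 z)"
  proof (rule contractible_imp_holomorphic_log[of g "ball 0 (3/2)"])
    show "g holomorphic_on ball 0 (3/2)" by (rule holomorphic_on_subset[OF g]) simp
    show "contractible (ball (0::complex) (3/2))" by (intro convex_imp_contractible convex_ball)
    show "g z \<noteq> 0" if "z \<in> ball 0 (3/2)" for z using that by (intro gnz) simp
  qed blast
  define h where "h = (\<lambda>z. h0 z - h0 0 + Ln (g 0))"
  have h: "h holomorphic_on ball 0 (3/2)" unfolding h_def by (intro holomorphic_intros h0)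
  have eh: "exp (h z) = g z" if "norm z < 3/2" for z
    using h0(2)[of z] h0(2)[of 0] gnz[of 0] that by (simp add: h_def exp_add exp_diff)
  have h00: "h 0 = Ln (g 0)" by (simp add: h_def)
  have nh0: "norm (h 0) \<le> B + pi"
    using norm_Ln_le[of "g 0"] gnz[of 0] lng0 by (simp add: h00)
  have Reh: "Re (h z - h 0) < 3 * B" if "norm z < 3/2" for z
  proof -
    have "exp (Re (h z)) \<le> exp B" using eh[OF that] gM[of z] that norm_exp_eq_Re[of "h z"] by simp
    moreover have "Re (h 0) \<ge> -B" using gnz[of 0] lng0 by (simp add: h00 Re_Ln)
    ultimately show ?thesis using B1 by simp
  qed
  have hbd: "norm (h z) \<le> 35 * B" if "norm z \<le> 5/4" for z
  proof -
    \<comment> \<open>The right-hand side is 30 B; adding |h 0| <= B + pi <= 5 B gives 35 B.\<close>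
    have "norm (h z - h 0) \<le> 2 * (3 * B) * (5/4) / (3/2 - 5/4)"
      by (rule Borel_Caratheodory[OF h _ _ Reh that]) auto
    moreover have "norm (h z) \<le> norm (h z - h 0) + norm (h 0)" by (metis diff_add_cancel norm_triangle_ineq)
    moreover have "pi < 4" using pi_less_4 .
    ultimately show ?thesis using nh0 B1 by simp
  qed
  define S where "S = ball 0 (3/2) \<inter> {z. Re z > -1}"
  \<comment> \<open>An explicit branch of ln f on \<open>S\<close>; there it differs from l by a
    constant, which is estimated at the centre 0.\<close>
  define l' where "l' = (\<lambda>z. h z + (\<Sum>\<rho>\<leftarrow>\<rho>s. Ln (z - \<rho>) - Ln ((4 - cnj \<rho> * z) / 2)))"
  have w: "Re ((4 - cnj \<rho> * z) / 2) > 0" "norm (Ln ((4 - cnj \<rho> * z) / 2)) \<le> 6" 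
    if "\<rho> \<in> set \<rho>s" "norm z < 3/2" for \<rho> z
  proof -
    have "norm (cnj \<rho> * z) \<le> 3/2 * (3/2)"
      unfolding norm_mult using zeros that by (intro mult_mono) auto
    then have n: "norm (cnj \<rho> * z) \<le> 9/4" by simp
    moreover have "Re (cnj \<rho> * z) \<le> norm (cnj \<rho> * z)" by (rule complex_Re_le_cmod)
    ultimately have re: "Re ((4 - cnj \<rho> * z) / 2) \<ge> 7/8" by simp
    then show "Re ((4 - cnj \<rho> * z) / 2) > 0" by linarith
    have n1: "norm ((4 - cnj \<rho> * z) / 2) \<ge> 7/8" using re complex_Re_le_cmod order_trans by blast
    have n2: "norm ((4 - cnj \<rho> * z) / 2) \<le> 25/8"
      using norm_triangle_ineq4[of 4 "cnj \<rho> * z"] n by (simp add: norm_divide)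
    have "\<bar>ln (norm ((4 - cnj \<rho> * z) / 2))\<bar> \<le> 17/8"
      by (rule abs_ln_le) (use n1 n2 in linarith)+
    moreover have "norm (Ln ((4 - cnj \<rho> * z) / 2)) \<le> \<bar>ln (norm ((4 - cnj \<rho> * z) / 2))\<bar> + pi"
      by (rule norm_Ln_le) (use n1 in auto)
    moreover have "pi < 3.5" using pi_approx by simp
    ultimately show "norm (Ln ((4 - cnj \<rho> * z) / 2)) \<le> 6" by linarith
  qed
  have wnz: "(4 - cnj \<rho> * z) / 2 \<noteq> 0" if "\<rho> \<in> set \<rho>s" "norm z < 3/2" for \<rho> z
  proof
    assume eq: "(4 - cnj \<rho> * z) / 2 = 0"
    show False using w(1)[OF that] unfolding eq by simp
  qed
  have zr: "Re (z - \<rho>) > 0" if "\<rho> \<in> set \<rho>s" "Re z > -1" for \<rho> z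
    using Re\<rho>[OF that(1)] that(2) by simp
  have l': "l' holomorphic_on S"
    unfolding l'_def S_def
  proof (intro holomorphic_intros holomorphic_on_sum_list holomorphic_on_subset[OF h])
    show "z - \<rho> \<notin> \<real>\<^sub>\<le>\<^sub>0" if "\<rho> \<in> set \<rho>s" "z \<in> ball 0 (3/2) \<inter> {z. Re z > -1}" for z \<rho>
      using zr[OF that(1), of z] that(2) by (simp add: complex_nonpos_Reals_iff)
    show "(4 - cnj \<rho> * z) / 2 \<notin> \<real>\<^sub>\<le>\<^sub>0" if "\<rho> \<in> set \<rho>s" "z \<in> ball 0 (3/2) \<inter> {z. Re z > -1}" for z \<rho>
      using w(1)[OF that(1), of z] that(2) unfolding complex_nonpos_Reals_iff by (metis Int_iff mem_ball_0 not_le)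
  qed auto
  have el': "exp (l' z) = exp (l z)" if "z \<in> S" for z
  proof -
    have z: "norm z < 3/2" "Re z > -1" using that by (auto simp: S_def)
    have nz: "(\<Prod>\<rho>\<leftarrow>\<rho>s. (4 - cnj \<rho> * z) / 2) \<noteq> 0"
      unfolding prod_list_zero_iff using wnz[OF _ z(1)] by fastforce
    have "exp (\<Sum>\<rho>\<leftarrow>\<rho>s. Ln (z - \<rho>) - Ln ((4 - cnj \<rho> * z) / 2)) * (\<Prod>\<rho>\<leftarrow>\<rho>s. (4 - cnj \<rho> * z) / 2)
       = (\<Prod>\<rho>\<leftarrow>\<rho>s. exp (Ln (z - \<rho>) - Ln ((4 - cnj \<rho> * z) / 2)) * ((4 - cnj \<rho> * z) / 2))"
      unfolding exp_sum_list prod_list_mult_distrib ..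
    also have "\<dots> = (\<Prod>\<rho>\<leftarrow>\<rho>s. z - \<rho>)"
    proof (intro arg_cong[where f = prod_list] map_cong refl)
      fix \<rho> assume \<rho>: "\<rho> \<in> set \<rho>s"
      have a: "z - \<rho> \<noteq> 0" using zr[OF \<rho> z(2)] by auto
      have b: "(4 - cnj \<rho> * z) / 2 \<noteq> 0" by (rule wnz[OF \<rho> z(1)])
      show "exp (Ln (z - \<rho>) - Ln ((4 - cnj \<rho> * z) / 2)) * ((4 - cnj \<rho> * z) / 2) = z - \<rho>"
        unfolding exp_diff exp_Ln[OF a] exp_Ln[OF b] using b by simp
    qed
    finally have "exp (l' z) * (\<Prod>\<rho>\<leftarrow>\<rho>s. (4 - cnj \<rho> * z) / 2) = g z * (\<Prod>\<rho>\<leftarrow>\<rho>s. z - \<rho>)"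
      by (simp add: l'_def exp_add eh[OF z(1)])
    also have "\<dots> = exp (l z) * (\<Prod>\<rho>\<leftarrow>\<rho>s. (4 - cnj \<rho> * z) / 2)"
      unfolding eq[symmetric] using ef z by simp
    finally show ?thesis using nz by simp
  qed
  have "convex S" unfolding S_def by (intro convex_Int convex_ball convex_halfspace_Re_gt)
  then have "connected S" by (rule convex_connected)
  moreover have "continuous_on S l"
    by (rule holomorphic_on_imp_continuous_on, rule holomorphic_on_subset[OF l]) (simp add: S_def)
  moreover note holomorphic_on_imp_continuous_on[OF l'] el'[symmetric]
  ultimately have "\<exists>c. \<forall>z\<in>S. l z = l' z + c" by (rule exp_eq_imp_diff_constant)
  then obtain c where c: "\<And>z. z \<in> S \<Longrightarrow> l z = l' z + c" by blast
  have l'bd: "norm (l' z) \<le> 35 * B + 48 * B + (\<Sum>\<rho>\<leftarrow>\<rho>s. norm (Ln (z - \<rho>)))" if z: "norm z \<le> 5/4" for z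
  proof -
    have "norm (l' z) \<le> norm (h z) + (\<Sum>\<rho>\<leftarrow>\<rho>s. norm (Ln (z - \<rho>) - Ln ((4 - cnj \<rho> * z) / 2)))"
      unfolding l'_def by (intro norm_triangle_le add_left_mono sum_list_norm_le)
    also have "(\<Sum>\<rho>\<leftarrow>\<rho>s. norm (Ln (z - \<rho>) - Ln ((4 - cnj \<rho> * z) / 2))) \<le>
        (\<Sum>\<rho>\<leftarrow>\<rho>s. norm (Ln (z - \<rho>)) + norm (Ln ((4 - cnj \<rho> * z) / 2)))"
      by (intro sum_list_mono norm_triangle_ineq4)
    also have "\<dots> = (\<Sum>\<rho>\<leftarrow>\<rho>s. norm (Ln (z - \<rho>))) + (\<Sum>\<rho>\<leftarrow>\<rho>s. norm (Ln ((4 - cnj \<rho> * z) / 2)))"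
      by (rule sum_list_addf)
    also have "(\<Sum>\<rho>\<leftarrow>\<rho>s. norm (Ln ((4 - cnj \<rho> * z) / 2))) \<le> real (length \<rho>s) * 6"
      using z by (intro sum_list_le_length w) auto
    finally show ?thesis using hbd[OF z] len' by linarith
  qed
  \<comment> \<open>Seen from the centre every zero lies at distance between 1 and 3/2, so no
    logarithm is large. Hence |l' 0| <= 115 B, the constant c is at most 116 B, and 83 + 116 <=
    200.\<close>
  have "(\<Sum>\<rho>\<leftarrow>\<rho>s. norm (Ln (0 - \<rho>))) \<le> real (length \<rho>s) * 4"
  proof (rule sum_list_le_length)
    fix \<rho> assume \<rho>: "\<rho> \<in> set \<rho>s"
    have "norm (0 - \<rho>) \<ge> 1" using Re\<rho>[OF \<rho>] abs_Re_le_cmod[of \<rho>] by simp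
    moreover have "norm (0 - \<rho>) \<le> 3/2" using zeros[OF \<rho>] by simp
    ultimately have "\<bar>ln (norm (0 - \<rho>))\<bar> \<le> 1/2" 
      using ln_le_minus_one[of "norm (0 - \<rho>)"] ln_ge_zero[of "norm (0 - \<rho>)"] by linarith
    moreover have "norm (Ln (0 - \<rho>)) \<le> \<bar>ln (norm (0 - \<rho>))\<bar> + pi"
      by (rule norm_Ln_le) (use Re\<rho>[OF \<rho>] in auto)
    moreover have "pi < 3.5" using pi_approx by simp
    ultimately show "norm (Ln (0 - \<rho>)) \<le> 4" by simp
  qed
  then have "norm (l' 0) \<le> 35 * B + 48 * B + 32 * B" using l'bd[of 0] len' by simp
  then have nc: "norm c \<le> 116 * B"
    using c[of 0] l0 norm_triangle_ineq4[of "l 0" "l' 0"] by (simp add: S_def)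
  have "norm (l z) \<le> 200 * B + (\<Sum>\<rho>\<leftarrow>\<rho>s. norm (Ln (z - \<rho>)))" if "Re z > -1" "norm z \<le> 5/4" for z
    using c[of z] l'bd[OF that(2)] nc that norm_triangle_ineq[of "l' z" c] B1 by (simp add: S_def)
  then show ?thesis using Re\<rho> zeros len' by (intro that[of \<rho>s]) blast+
qed

section \<open>Mean squares of a logarithm up to the boundary line\<close>

text \<open>Uniform in the position of c: within distance 1 of c each side contributes 2, and
  elsewhere the integrand is at most 1 on an interval of length 1.\<close>

lemma nn_integral_inverse_sqrt_le:
  "(\<integral>\<^sup>+t. ennreal (\<bar>t - c\<bar> powr (-1/2)) * indicator {a..a+1} t \<partial>lborel) \<le> 5"
proof -
  define h where "h = (\<lambda>x::real. ennreal (x powr (-1/2)) * indicator {0..1} x)"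
  have [measurable]: "h \<in> borel_measurable borel" unfolding h_def by measurable
  have h: "integral\<^sup>N lborel h = 2"
  proof -
    have "((\<lambda>x. x powr (-1/2)) has_integral (1 powr (-1/2+1) / (-1/2+1))) {0..1::real}"
      by (rule has_integral_powr_from_0) auto
    then have "((\<lambda>x. x powr (-1/2)) has_integral 2) {0..1::real}" by simp
    from nn_integral_has_integral_lebesgue[OF _ this] 
    have "integral\<^sup>N lborel (\<lambda>x. ennreal (indicator {0..1} x * x powr (-1/2))) = ennreal 2" by simp
    also have "(\<lambda>x::real. ennreal (indicator {0..1} x * x powr (-1/2))) = h"
      by (auto simp: h_def fun_eq_iff indicator_def)
    finally show ?thesis by simp
  qed
  have h1: "(\<integral>\<^sup>+t. h (-c + t) \<partial>lborel) = 2"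
    using nn_integral_real_affine[of h 1 "-c"] h by simp
  have h2: "(\<integral>\<^sup>+t. h (c - t) \<partial>lborel) = 2"
    using nn_integral_real_affine[of h "-1" "c"] h by simp
  have "(\<integral>\<^sup>+t. ennreal (\<bar>t - c\<bar> powr (-1/2)) * indicator {a..a+1} t \<partial>lborel)
     \<le> (\<integral>\<^sup>+t. indicator {a..a+1} t + (h (-c + t) + h (c - t)) \<partial>lborel)"
  proof (rule nn_integral_mono)
    fix t :: real
    show "ennreal (\<bar>t - c\<bar> powr (-1/2)) * indicator {a..a+1} t \<le> indicator {a..a+1} t + (h (-c + t) + h (c - t))"
    proof (cases "\<bar>t - c\<bar> \<le> 1")
      case True
      have le: "ennreal (\<bar>t - c\<bar> powr (-1/2)) \<le> h (-c + t) + h (c - t)"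
      proof (cases "c \<le> t")
        case True
        then have "h (-c + t) = ennreal (\<bar>t - c\<bar> powr (-1/2))"
          using \<open>\<bar>t - c\<bar> \<le> 1\<close> by (simp add: h_def)
        then show ?thesis by simp
      next
        case False
        then have "h (c - t) = ennreal (\<bar>t - c\<bar> powr (-1/2))"
          using \<open>\<bar>t - c\<bar> \<le> 1\<close> by (simp add: h_def)
        then show ?thesis by simp
      qed
      have "ennreal (\<bar>t - c\<bar> powr (-1/2)) * indicator {a..a+1} t \<le> ennreal (\<bar>t - c\<bar> powr (-1/2)) * 1"
        by (intro mult_left_mono) (auto simp: indicator_def)
      also have "\<dots> \<le> 0 + (h (-c + t) + h (c - t))" using le by simp
      also have "\<dots> \<le> indicator {a..a+1} t + (h (-c + t) + h (c - t))"
        by (intro add_right_mono) simp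
      finally show ?thesis .
    next
      case False
      then have "\<bar>t - c\<bar> powr (-1/2) \<le> \<bar>t - c\<bar> powr 0"
        by (intro powr_mono) auto
      then have "ennreal (\<bar>t - c\<bar> powr (-1/2)) \<le> ennreal 1" using False by (intro ennreal_leI) (auto split: if_splits)
      then have "ennreal (\<bar>t - c\<bar> powr (-1/2)) * indicator {a..a+1} t \<le> 1 * indicator {a..a+1} t"
        by (intro mult_right_mono) auto
      also have "\<dots> \<le> indicator {a..a+1} t + (h (-c + t) + h (c - t))" by simp
      finally show ?thesis .
    qed
  qed
  also have "\<dots> = (\<integral>\<^sup>+t. indicator {a..a+1} t \<partial>lborel) + ((\<integral>\<^sup>+t. h (-c + t) \<partial>lborel) + (\<integral>\<^sup>+t. h (c - t) \<partial>lborel))"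
    by (subst nn_integral_add, measurable, subst nn_integral_add) measurable
  also have "\<dots> = ennreal 1 + (ennreal 2 + ennreal 2)"
    unfolding h1 h2 by simp
  also have "\<dots> = 5"
    by (simp only: ennreal_plus[symmetric] ennreal_numeral[symmetric]) simp
  finally show ?thesis .
qed

text \<open>The exponent -1/4 is chosen so that the square of the bound, of order -1/2, is
  integrable across the singularity. The restriction |z| <= 3 keeps the power above 16^(-1/4) = 1/2,
  so that it also absorbs the argument of z.\<close>

lemma Ln_le_powr:
  assumes "Re z > 0" "norm z \<le> 3"
  shows "norm (Ln z) \<le> 8 * norm z powr (-1/4)"
proof -
  define x where "x = norm z"
  have x: "0 < x" "x \<le> 3" using assms by (auto simp: x_def)
  have 1: "norm (Ln z) \<le> \<bar>ln x\<bar> + pi / 2"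
  proof -
    have z: "z \<noteq> 0" using assms by auto
    have "norm (Ln z) \<le> \<bar>Re (Ln z)\<bar> + \<bar>Im (Ln z)\<bar>" by (rule cmod_le)
    moreover have "\<bar>Im (Ln z)\<bar> < pi / 2" using Re_Ln_pos_lt_imp[OF assms(1)] by simp
    ultimately show ?thesis using Re_Ln[OF z] by (simp add: x_def)
  qed
  have "3 powr (-1/4) \<le> x powr (-1/4)" using x by (simp add: powr_mono2')
  moreover have "(1/2::real) \<le> 3 powr (-1/4)"
  proof -
    have "(16::real) powr (-1/4) \<le> 3 powr (-1/4)" by (rule powr_mono2') auto
    moreover have "(16::real) powr (-1/4) = (2 powr 4) powr (-1/4)" by simp
    then have "(16::real) powr (-1/4) = 1/2" unfolding powr_powr by (simp add: powr_minus)
    ultimately show ?thesis by simp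
  qed
  ultimately have px: "x powr (-1/4) \<ge> 1/2" by linarith
  have pi: "pi / 2 \<le> 1.6" using pi_approx by simp
  have "\<bar>ln x\<bar> \<le> 4 * x powr (-1/4) - 4 + 4"
  proof (cases "x \<le> 1")
    case True
    have "ln (x powr (-1/4)) \<le> x powr (-1/4) - 1" using x by (intro ln_le_minus_one) simp
    then have "- ln x \<le> 4 * x powr (-1/4) - 4" using x by (simp add: ln_powr)
    then show ?thesis using True x by (simp add: abs_if)
  next
    case False
    have "ln x \<le> x - 1" using x by (intro ln_le_minus_one)
    then show ?thesis using False x px by (simp add: abs_if)
  qed
  with 1 pi px show ?thesis unfolding x_def[symmetric] by linarith
qed

text \<open>\<open>log_bound_near_center\<close> is recentred at 1 + iT. Pointwise, a zero on the
  boundary line costs up to |ln \<sigma>|. In mean square the distance to a zero is bounded below by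
  the vertical distance |t - \<gamma>| alone, so the second bound does not depend on
  \<sigma>.\<close>

lemma log_bounds_at_height:
  fixes l f :: "complex \<Rightarrow> complex" and T B :: real
  assumes hol: "f holomorphic_on UNIV" and l: "l holomorphic_on {z. Re z > 0}"
    and ef: "\<And>z. Re z > 0 \<Longrightarrow> exp (l z) = f z"
    and B: "\<And>z. norm (z - Complex 1 T) \<le> 2 \<Longrightarrow> norm (f z) \<le> exp B" 
    and l0: "norm (l (Complex 1 T)) \<le> B" and B1: "B \<ge> 1"
    and \<sigma>: "0 < \<sigma>" "\<sigma> \<le> 1"
  shows log_bound_at_height: "\<bar>t - T\<bar> \<le> 1/2 \<Longrightarrow> norm (l (Complex \<sigma> t)) \<le> (250 + 8 * \<bar>ln \<sigma>\<bar>) * B"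
    and log_mean_square_at_height:
      "(\<integral>\<^sup>+t. ennreal ((norm (l (Complex \<sigma> t)))\<^sup>2) * indicator {T-1/2..T+1/2} t \<partial>lborel) \<le> ennreal (200000 * B\<^sup>2)"
proof -
  define z0 where "z0 = Complex 1 T"
  have "\<exists>\<rho>s. real (length \<rho>s) \<le> 8 * B \<and> 
    (\<forall>\<rho>\<in>set \<rho>s. Re \<rho> \<le> -1 \<and> norm \<rho> \<le> 3/2) \<and>
    (\<forall>z. Re z > -1 \<longrightarrow> norm z \<le> 5/4 \<longrightarrow> norm (l (z + z0)) \<le> 200 * B + (\<Sum>\<rho>\<leftarrow>\<rho>s. norm (Ln (z - \<rho>))))"
  proof (rule log_bound_near_center[of "\<lambda>z. f (z + z0)" "\<lambda>z. l (z + z0)" B])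
    show "(\<lambda>z. f (z + z0)) holomorphic_on UNIV"
      by (intro holomorphic_on_compose_gen[OF _ hol, unfolded o_def] holomorphic_intros) auto
    show "(\<lambda>z. l (z + z0)) holomorphic_on {z. Re z > -1}"
      by (intro holomorphic_on_compose_gen[OF _ l, unfolded o_def] holomorphic_intros) (auto simp: z0_def)
  qed (use ef B l0 B1 in \<open>auto simp: z0_def\<close>)
  then obtain \<rho>s where len: "real (length \<rho>s) \<le> 8 * B"
    and \<rho>s: "\<And>\<rho>. \<rho> \<in> set \<rho>s \<Longrightarrow> Re \<rho> \<le> -1 \<and> norm \<rho> \<le> 3/2"
    and bd: "\<And>z. Re z > -1 \<Longrightarrow> norm z \<le> 5/4 \<Longrightarrow> norm (l (z + z0)) \<le> 200 * B + (\<Sum>\<rho>\<leftarrow>\<rho>s. norm (Ln (z - \<rho>)))"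
    by blast
  define \<zeta> where "\<zeta> = (\<lambda>t. Complex \<sigma> t - z0)"
  have \<zeta>: "Re (\<zeta> t) = \<sigma> - 1" "Im (\<zeta> t) = t - T" for t by (auto simp: \<zeta>_def z0_def)
  have n\<zeta>: "norm (\<zeta> t) \<le> 5/4" if "\<bar>t - T\<bar> \<le> 1/2" for t
  proof -
    have "(norm (\<zeta> t))\<^sup>2 \<le> 1\<^sup>2 + (1/2)\<^sup>2"
      unfolding cmod_power2 \<zeta> using \<sigma> that by (intro add_mono iffD1[OF abs_le_square_iff]) auto
    also have "\<dots> \<le> (5/4)\<^sup>2" by (simp add: power2_eq_square)
    finally show ?thesis by (rule power2_le_imp_le) simp
  qed
  have bdt: "norm (l (Complex \<sigma> t)) \<le> 200 * B + (\<Sum>\<rho>\<leftarrow>\<rho>s. norm (Ln (\<zeta> t - \<rho>)))" if "\<bar>t - T\<bar> \<le> 1/2" for t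
    using bd[of "\<zeta> t"] n\<zeta>[OF that] \<sigma> by (simp add: \<zeta>) (simp add: \<zeta>_def)
  have r3: "norm (\<zeta> t - \<rho>) \<le> 3" "\<sigma> \<le> Re (\<zeta> t - \<rho>)" if "\<bar>t - T\<bar> \<le> 1/2" "\<rho> \<in> set \<rho>s" for t \<rho>
    using norm_triangle_ineq4[of "\<zeta> t" \<rho>] n\<zeta>[OF that(1)] \<rho>s[OF that(2)] by (auto simp: \<zeta>)
  show "norm (l (Complex \<sigma> t)) \<le> (250 + 8 * \<bar>ln \<sigma>\<bar>) * B" if t: "\<bar>t - T\<bar> \<le> 1/2" 
  proof -
    have "(\<Sum>\<rho>\<leftarrow>\<rho>s. norm (Ln (\<zeta> t - \<rho>))) \<le> real (length \<rho>s) * (\<bar>ln \<sigma>\<bar> + 6)"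
    proof (rule sum_list_le_length)
      fix \<rho> assume \<rho>: "\<rho> \<in> set \<rho>s"
      define x where "x = norm (\<zeta> t - \<rho>)"
      have x: "\<sigma> \<le> x" "x \<le> 3" using r3[OF t \<rho>] complex_Re_le_cmod[of "\<zeta> t - \<rho>"] by (auto simp: x_def)
      then have "ln \<sigma> \<le> ln x" "ln x \<le> x - 1" using \<sigma> by (auto intro!: ln_le_minus_one)
      then have "\<bar>ln x\<bar> \<le> \<bar>ln \<sigma>\<bar> + 2" using x by linarith
      moreover have "norm (Ln (\<zeta> t - \<rho>)) \<le> \<bar>ln x\<bar> + pi"
        unfolding x_def by (rule norm_Ln_le) (use x \<sigma> in \<open>auto simp: x_def\<close>)
      moreover have "pi < 3.5" using pi_approx by simp
      ultimately show "norm (Ln (\<zeta> t - \<rho>)) \<le> \<bar>ln \<sigma>\<bar> + 6" by simp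
    qed
    also have "\<dots> \<le> 8 * B * (\<bar>ln \<sigma>\<bar> + 6)" using len by (intro mult_right_mono) auto
    finally show ?thesis using bdt[OF t] B1 by (simp add: algebra_simps)
  qed
  define N where "N = length \<rho>s"
  define \<gamma> where "\<gamma> = (\<lambda>i. Im (\<rho>s ! i) + T)"
  let ?I = "indicator {T-1/2..T+1/2} :: real \<Rightarrow> ennreal"
  \<comment> \<open>From (x + y)^2 <= 2 x^2 + 2 y^2 and Cauchy-Schwarz over the N zeros: 80000 = 2 *
    200^2 and 128 = 2 * 8^2. The points t = \<gamma> i are excluded because \<open>powr\<close>
    takes the value 0 there instead of a large one.\<close>
  have sq: "(norm (l (Complex \<sigma> t)))\<^sup>2 \<le> 80000 * B\<^sup>2 + (\<Sum>i<N. 128 * N * \<bar>t - \<gamma> i\<bar> powr (-1/2))"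
    if t: "\<bar>t - T\<bar> \<le> 1/2" and ne: "\<And>i. i < N \<Longrightarrow> t \<noteq> \<gamma> i" for t
  proof -
    define a where "a = (\<lambda>i. norm (Ln (\<zeta> t - \<rho>s ! i)))"
    have s64: "(\<Sum>i<N. (a i)\<^sup>2) \<le> (\<Sum>i<N. 64 * \<bar>t - \<gamma> i\<bar> powr (-1/2))"
    proof (rule sum_mono)
      fix i assume "i \<in> {..<N}"
      then have i: "\<rho>s ! i \<in> set \<rho>s" "i < N" by (auto simp: N_def)
      define z where "z = \<zeta> t - \<rho>s ! i"
      have "norm (Ln z) \<le> 8 * norm z powr (-1/4)"
        unfolding z_def by (rule Ln_le_powr) (use r3[OF t i(1)] \<sigma> in auto)
      also have "norm z powr (-1/4) \<le> \<bar>t - \<gamma> i\<bar> powr (-1/4)"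
      proof (rule powr_mono2')
        show "\<bar>t - \<gamma> i\<bar> \<le> cmod z"
          using abs_Im_le_cmod[of z] by (simp add: z_def \<gamma>_def \<zeta> algebra_simps)
      qed (use ne[OF i(2)] in auto)
      finally have "a i \<le> 8 * \<bar>t - \<gamma> i\<bar> powr (-1/4)" by (simp add: a_def z_def)
      then have "(a i)\<^sup>2 \<le> (8 * \<bar>t - \<gamma> i\<bar> powr (-1/4))\<^sup>2" by (intro power_mono) (auto simp: a_def)
      also have "\<dots> = 64 * \<bar>t - \<gamma> i\<bar> powr (-1/2)"
        by (simp add: power_mult_distrib power2_eq_square flip: powr_add)
      finally show "(a i)\<^sup>2 \<le> 64 * \<bar>t - \<gamma> i\<bar> powr (-1/2)" .
    qed
    have "norm (l (Complex \<sigma> t)) \<le> 200 * B + (\<Sum>i<N. a i)"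
      using bdt[OF t] by (simp add: sum_list_sum_nth N_def a_def atLeast0LessThan)
    then have "(norm (l (Complex \<sigma> t)))\<^sup>2 \<le> (200 * B + (\<Sum>i<N. a i))\<^sup>2"
      by (intro power_mono) auto
    also have "\<dots> \<le> 2 * (200 * B)\<^sup>2 + 2 * (\<Sum>i<N. a i)\<^sup>2"
      using zero_le_power2[of "200 * B - (\<Sum>i<N. a i)"] by (simp add: power2_eq_square algebra_simps)
    also have "(\<Sum>i<N. a i)\<^sup>2 \<le> (\<Sum>i<N. 64 * \<bar>t - \<gamma> i\<bar> powr (-1/2)) * N"
      using sum_squared_le_sum_of_squares[of a "{..<N}"] mult_right_mono[OF s64, of "real N"] by simp
    finally show ?thesis by (simp add: sum_distrib_left sum_distrib_right power_mult_distrib mult_ac)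
  qed
  have "(\<integral>\<^sup>+t. ennreal ((norm (l (Complex \<sigma> t)))\<^sup>2) * ?I t \<partial>lborel) \<le>
    (\<integral>\<^sup>+t. ennreal (80000 * B\<^sup>2) * ?I t + (\<Sum>i<N. ennreal (128 * N) * (ennreal (\<bar>t - \<gamma> i\<bar> powr (-1/2)) * ?I t)) \<partial>lborel)"
  proof (rule nn_integral_mono_AE)
    have "AE t in lborel. t \<notin> \<gamma> ` {..<N}" by (intro AE_not_in finite_imp_null_set_lborel) auto
    then show "AE t in lborel. ennreal ((norm (l (Complex \<sigma> t)))\<^sup>2) * ?I t \<le>
       ennreal (80000 * B\<^sup>2) * ?I t + (\<Sum>i<N. ennreal (128 * N) * (ennreal (\<bar>t - \<gamma> i\<bar> powr (-1/2)) * ?I t))"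
    proof eventually_elim
      case (elim t)
      show ?case
      proof (cases "\<bar>t - T\<bar> \<le> 1/2")
        case True
        then have I: "?I t = 1" by (auto simp: abs_if split: if_splits)
        have "ennreal ((norm (l (Complex \<sigma> t)))\<^sup>2) \<le> ennreal (80000 * B\<^sup>2 + (\<Sum>i<N. 128 * N * \<bar>t - \<gamma> i\<bar> powr (-1/2)))"
          by (intro ennreal_leI sq True) (use elim in auto)
        also have "\<dots> = ennreal (80000 * B\<^sup>2) + (\<Sum>i<N. ennreal (128 * N) * ennreal (\<bar>t - \<gamma> i\<bar> powr (-1/2)))"
          by (subst ennreal_plus) (auto intro!: sum_nonneg simp: sum_ennreal[symmetric] ennreal_mult)
        finally show ?thesis by (simp add: I)
      next
        case False
        then have "?I t = 0" by (auto simp: abs_if split: if_splits)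
        then show ?thesis by simp
      qed
    qed
  qed
  also have "\<dots> = (\<integral>\<^sup>+t. ennreal (80000 * B\<^sup>2) * ?I t \<partial>lborel) + 
      (\<Sum>i<N. ennreal (128 * N) * (\<integral>\<^sup>+t. ennreal (\<bar>t - \<gamma> i\<bar> powr (-1/2)) * ?I t \<partial>lborel))"
    by (subst nn_integral_add, measurable) (subst nn_integral_sum, measurable, subst nn_integral_cmult, measurable)
  also have "\<dots> \<le> ennreal (80000 * B\<^sup>2) + (\<Sum>i<N. ennreal (128 * N) * 5)"
  proof (intro add_mono sum_mono mult_left_mono)
    show "(\<integral>\<^sup>+t. ennreal (80000 * B\<^sup>2) * ?I t \<partial>lborel) \<le> ennreal (80000 * B\<^sup>2)"
      by (subst nn_integral_cmult) auto
    show "(\<integral>\<^sup>+t. ennreal (\<bar>t - \<gamma> i\<bar> powr (-1/2)) * ?I t \<partial>lborel) \<le> 5" for i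
      using nn_integral_inverse_sqrt_le[of "\<gamma> i" "T - 1/2"] by (simp add: add.commute)
  qed auto
  also have "\<dots> = ennreal (80000 * B\<^sup>2 + 640 * (real N)\<^sup>2)"
  proof -
    have "ennreal (128 * real N) * 5 = ennreal (128 * real N) * ennreal 5" by simp
    also have "\<dots> = ennreal (128 * real N * 5)" by (rule ennreal_mult[symmetric]) simp_all
    finally have "ennreal (128 * real N) * 5 = ennreal (640 * real N)" by simp
    then have "(\<Sum>i<N. ennreal (128 * real N) * 5) = ennreal (\<Sum>i<N. 640 * real N)"
      by (simp only: sum_ennreal)
    also have "(\<Sum>i<N. 640 * real N) = 640 * (real N)\<^sup>2" by (simp add: power2_eq_square)
    finally show ?thesis by simp
  qed
  also have "\<dots> \<le> ennreal (200000 * B\<^sup>2)"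
  proof (rule ennreal_leI)
    \<comment> \<open>N <= 8 B gives 640 N^2 <= 40960 B^2, well within the remaining 120000
      B^2.\<close>
    have "(real N)\<^sup>2 \<le> (8 * B)\<^sup>2" using len by (intro power_mono) (auto simp: N_def)
    also have "(8 * B)\<^sup>2 = 64 * B\<^sup>2" by (simp add: power_mult_distrib)
    finally show "80000 * B\<^sup>2 + 640 * (real N)\<^sup>2 \<le> 200000 * B\<^sup>2"
      using zero_le_power2[of B] by linarith
  qed
  finally show "(\<integral>\<^sup>+t. ennreal ((norm (l (Complex \<sigma> t)))\<^sup>2) * ?I t \<partial>lborel) \<le> ennreal (200000 * B\<^sup>2)" .
qed

section \<open>Plancherel's inequality and mean squares of Laplace transforms\<close>

lemma nn_integral_gaussian_scaled:
  assumes "0 < U"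
  shows "(\<integral>\<^sup>+x. ennreal (exp (- (U * (x - c))\<^sup>2 / 2)) \<partial>lborel) = ennreal (sqrt (2 * pi) / U)"
proof -
  have eq: "exp (- (U * (x - c))\<^sup>2 / 2) = sqrt (2 * pi) / U * normal_density c (1 / U) x" for x
  proof -
    have e: "(x - c)\<^sup>2 / (2 * (1 / U)\<^sup>2) = (U * (x - c))\<^sup>2 / 2"
      using assms by (simp add: power_mult_distrib power_divide)
    have q: "sqrt (2 * pi * (1 / U)\<^sup>2) = sqrt (2 * pi) / U"
      using assms by (simp add: real_sqrt_mult)
    show ?thesis
      unfolding normal_density_def minus_divide_left[symmetric] e q using assms by simp
  qed
  have "(\<integral>\<^sup>+x. ennreal (normal_density c (1 / U) x) \<partial>lborel) = 1"
    using prob_space.emeasure_space_1[OF prob_space_normal_density[of "1 / U" c]] assms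
    by (simp add: emeasure_density)
  then show ?thesis
    unfolding eq using assms by (subst ennreal_mult) (auto simp: nn_integral_cmult)
qed

lemma std_normal_char:
  "(LINT y|std_normal_distribution. exp (\<i> * of_real (x * y))) = of_real (exp (- x\<^sup>2 / 2))"
  using fun_cong[OF char_std_normal_distribution, of x] unfolding char_def by simp

lemma borel_measurable_cnj [measurable (raw)]:
  "f \<in> borel_measurable M \<Longrightarrow> (\<lambda>x. cnj (f x)) \<in> borel_measurable M"
  by (rule borel_measurable_continuous_on[OF continuous_on_cnj[OF continuous_on_id]])

text \<open>Instead of inverting the transform, |E u|^2 is weighted with a Gaussian of width U. When
  the square is expanded, Fubini turns the weight into the kernel k (t - s), again a Gaussian, and
  with |\<Psi> t \<Psi> s| <= (|\<Psi> t|^2 + |\<Psi> s|^2) / 2 only the integral of k enters. The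
  factor exp (1/2) is the loss from bounding the weight below on [-U, U] by exp (-1/2) times its
  maximum.\<close>

lemma Plancherel_le:
  fixes \<Psi> :: "real \<Rightarrow> complex"
  assumes int: "integrable lborel \<Psi>" and U: "0 < U"
  shows "(\<integral>\<^sup>+u. ennreal ((norm (LINT t|lborel. \<Psi> t * exp (\<i> * of_real (u * t))))\<^sup>2) * indicator {-U..U} u \<partial>lborel)
    \<le> ennreal (2 * pi * exp (1/2)) * (\<integral>\<^sup>+t. ennreal ((norm (\<Psi> t))\<^sup>2) \<partial>lborel)"
proof -
  define N where "N = std_normal_distribution"
  interpret N: prob_space N unfolding N_def by (rule prob_space_normal_density) simp
  interpret P: pair_sigma_finite N lborel ..
  have [simp, measurable_cong]: "sets N = sets borel" by (simp add: N_def)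
  have [simp]: "space N = UNIV" by (simp add: N_def)
  have [measurable]: "\<Psi> \<in> borel_measurable borel" using int by auto
  define E where "E = (\<lambda>u. LINT t|lborel. \<Psi> t * exp (\<i> * of_real (u * t)))"
  have [measurable]: "E \<in> borel_measurable borel" unfolding E_def by measurable
  define C where "C = (LBINT t. norm (\<Psi> t))"
  have ne: "norm (exp (\<i> * of_real x)) = 1" for x by simp
  have intE: "integrable lborel (\<lambda>t. \<Psi> t * exp (\<i> * of_real (u * t)))" for u
    by (rule Bochner_Integration.integrable_bound[OF int]) (measurable, simp add: norm_mult del: of_real_mult)
  have EC: "norm (E u) \<le> C" for u
    unfolding E_def C_def by (rule order_trans[OF integral_norm_bound]) (simp add: norm_mult del: of_real_mult)
  have C0: "C \<ge> 0" unfolding C_def by simp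
  define k where "k = (\<lambda>x::real. exp (- (U * x)\<^sup>2 / 2))"
  have [measurable]: "k \<in> borel_measurable borel" unfolding k_def by measurable
  have "N.expectation (\<lambda>y. complex_of_real ((norm (E (U * y)))\<^sup>2)) =
     (LINT y|N. LINT t|lborel. (\<Psi> t * exp (\<i> * of_real (U * y * t))) * cnj (E (U * y)))"
  proof (rule Bochner_Integration.integral_cong[OF refl])
    fix y
    have "complex_of_real ((norm (E (U * y)))\<^sup>2) = E (U * y) * cnj (E (U * y))"
      by (rule complex_norm_square)
    then show "complex_of_real ((norm (E (U * y)))\<^sup>2) =
       (LINT t|lborel. (\<Psi> t * exp (\<i> * of_real (U * y * t))) * cnj (E (U * y)))"
      unfolding E_def by simp
  qed
  \<comment> \<open>Fubini rests on |E| <= C, the integrability of \<Psi> and the total mass 1 of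
    the weight.\<close>
  also have "\<dots> = (LINT t|lborel. LINT y|N. (\<Psi> t * exp (\<i> * of_real (U * y * t))) * cnj (E (U * y)))"
  proof (rule P.Fubini_integral[symmetric])
    show "integrable (N \<Otimes>\<^sub>M lborel) (\<lambda>(y, t). \<Psi> t * exp (\<i> * of_real (U * y * t)) * cnj (E (U * y)))"
    proof (rule P.Fubini_integrable)
      have "(LINT t|lborel. norm (\<Psi> t * exp (\<i> * of_real (U * y * t)) * cnj (E (U * y)))) = C * norm (E (U * y))" for y
        by (simp only: norm_mult ne complex_mod_cnj mult_1_right C_def integral_mult_left_zero)
      then show "integrable N (\<lambda>x. LBINT y. norm (case (x, y) of (y, t) \<Rightarrow> \<Psi> t * exp (\<i> * of_real (U * y * t)) * cnj (E (U * y))))"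
        by (simp only: prod.case) (rule N.integrable_const_bound[of _ "C * C"],
           auto simp: abs_mult C0 intro!: mult_left_mono EC)
      have "integrable lborel (\<lambda>t. \<Psi> t * exp (\<i> * of_real (U * y * t)) * cnj (E (U * y)))" for y
        by (rule integrable_mult_left) (rule intE)
      then show "AE y in N. integrable lborel (\<lambda>t. case (y, t) of (y, t) \<Rightarrow> \<Psi> t * exp (\<i> * of_real (U * y * t)) * cnj (E (U * y)))"
        by (simp only: prod.case) simp
      show "(\<lambda>(y, t). \<Psi> t * exp (\<i> * of_real (U * y * t)) * cnj (E (U * y))) \<in> borel_measurable (N \<Otimes>\<^sub>M lborel)"
        by measurable
    qed
  qed
  also have "\<dots> = (LINT t|lborel. \<Psi> t * (LINT s|lborel. cnj (\<Psi> s) * of_real (k (t - s))))"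
  proof (rule Bochner_Integration.integral_cong[OF refl])
    fix t
    have "(LINT y|N. (\<Psi> t * exp (\<i> * of_real (U * y * t))) * cnj (E (U * y))) =
      \<Psi> t * (LINT y|N. exp (\<i> * of_real (U * y * t)) * cnj (E (U * y)))"
      by (simp add: mult.assoc)
    also have "(LINT y|N. exp (\<i> * of_real (U * y * t)) * cnj (E (U * y))) =
       (LINT y|N. LINT s|lborel. cnj (\<Psi> s) * exp (\<i> * of_real (U * (t - s) * y)))"
    proof (rule Bochner_Integration.integral_cong[OF refl])
      fix y
      have "(LINT s|lborel. cnj (\<Psi> s) * exp (- \<i> * of_real (U * y * s))) =
          (LINT s|lborel. cnj (\<Psi> s * exp (\<i> * of_real (U * y * s))))"
        by (simp add: exp_cnj del: Bochner_Integration.integral_cnj)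
      also have "\<dots> = cnj (E (U * y))" unfolding E_def by (rule Bochner_Integration.integral_cnj)
      finally have "cnj (E (U * y)) = (LINT s|lborel. cnj (\<Psi> s) * exp (- \<i> * of_real (U * y * s)))" ..
      then have "exp (\<i> * of_real (U * y * t)) * cnj (E (U * y)) =
         (LINT s|lborel. exp (\<i> * of_real (U * y * t)) * (cnj (\<Psi> s) * exp (- \<i> * of_real (U * y * s))))"
        by simp
      also have "\<dots> = (LINT s|lborel. cnj (\<Psi> s) * exp (\<i> * of_real (U * (t - s) * y)))"
        by (rule Bochner_Integration.integral_cong[OF refl]) (simp add: algebra_simps flip: exp_add)
      finally show "exp (\<i> * of_real (U * y * t)) * cnj (E (U * y)) =
         (LINT s|lborel. cnj (\<Psi> s) * exp (\<i> * of_real (U * (t - s) * y)))" .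
    qed
    also have "\<dots> = (LINT s|lborel. LINT y|N. cnj (\<Psi> s) * exp (\<i> * of_real (U * (t - s) * y)))"
    proof (rule P.Fubini_integral[symmetric])
      show "integrable (N \<Otimes>\<^sub>M lborel) (\<lambda>(y, s). cnj (\<Psi> s) * exp (\<i> * of_real (U * (t - s) * y)))"
      proof (rule P.Fubini_integrable)
        show "integrable N (\<lambda>x. LBINT y. norm (case (x, y) of (y, s) \<Rightarrow> cnj (\<Psi> s) * exp (\<i> * of_real (U * (t - s) * y))))"
          by (simp only: prod.case norm_mult ne complex_mod_cnj) simp
        have "integrable lborel (\<lambda>s. cnj (\<Psi> s) * exp (\<i> * of_real (U * (t - s) * y)))" for y
          by (rule Bochner_Integration.integrable_bound[OF int]) (measurable, simp add: norm_mult del: of_real_mult of_real_diff)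
        then show "AE x in N. integrable lborel (\<lambda>y. case (x, y) of (y, s) \<Rightarrow> cnj (\<Psi> s) * exp (\<i> * of_real (U * (t - s) * y)))"
          by (simp only: prod.case) simp
        show "(\<lambda>(y, s). cnj (\<Psi> s) * exp (\<i> * of_real (U * (t - s) * y))) \<in> borel_measurable (N \<Otimes>\<^sub>M lborel)"
          by measurable
      qed
    qed
    also have "\<dots> = (LINT s|lborel. cnj (\<Psi> s) * of_real (k (t - s)))"
      by (intro Bochner_Integration.integral_cong refl)
         (simp add: N_def std_normal_char k_def del: of_real_mult)
    finally show "(LINT y|N. (\<Psi> t * exp (\<i> * of_real (U * y * t))) * cnj (E (U * y))) =
      \<Psi> t * (LINT s|lborel. cnj (\<Psi> s) * of_real (k (t - s)))" .
  qed
  finally have J: "complex_of_real (N.expectation (\<lambda>y. (norm (E (U * y)))\<^sup>2)) =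
     (LINT t|lborel. \<Psi> t * (LINT s|lborel. cnj (\<Psi> s) * of_real (k (t - s))))"
    unfolding integral_complex_of_real .
  let ?M = "(\<integral>\<^sup>+t. ennreal ((norm (\<Psi> t))\<^sup>2) \<partial>lborel)"
  let ?\<kappa> = "ennreal (sqrt (2 * pi) / U)"
  have kint: "(\<integral>\<^sup>+t. ennreal (c * k (t - s)) \<partial>lborel) = ennreal c * ?\<kappa>" if "c \<ge> 0" for c s
  proof -
    have "(\<integral>\<^sup>+t. ennreal (c * k (t - s)) \<partial>lborel) = (\<integral>\<^sup>+t. ennreal c * ennreal (k (t - s)) \<partial>lborel)"
      using that by (simp add: ennreal_mult')
    also have "\<dots> = ennreal c * (\<integral>\<^sup>+t. ennreal (k (t - s)) \<partial>lborel)"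
      by (rule nn_integral_cmult) measurable
    finally show ?thesis unfolding k_def nn_integral_gaussian_scaled[OF U] .
  qed
  have "ennreal (N.expectation (\<lambda>y. (norm (E (U * y)))\<^sup>2)) =
     ennreal (norm (LINT t|lborel. \<Psi> t * (LINT s|lborel. cnj (\<Psi> s) * of_real (k (t - s)))))"
    unfolding J[symmetric] by simp
  also have "\<dots> \<le> (\<integral>\<^sup>+t. ennreal (norm (\<Psi> t)) * ennreal (norm (LINT s|lborel. cnj (\<Psi> s) * of_real (k (t - s)))) \<partial>lborel)"
  \<comment> \<open>The Bochner integral of a non-integrable function is 0 by convention, so in that
    case the inequality is trivial.\<close>
  proof (cases "integrable lborel (\<lambda>t. \<Psi> t * (LINT s|lborel. cnj (\<Psi> s) * of_real (k (t - s))))")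
    case True
    from integral_norm_bound_ennreal[OF this] show ?thesis by (simp add: norm_mult ennreal_mult')
  qed (simp add: not_integrable_integral_eq)
  also have "\<dots> \<le> (\<integral>\<^sup>+t. ennreal (norm (\<Psi> t)) * (\<integral>\<^sup>+s. ennreal (norm (\<Psi> s) * k (t - s)) \<partial>lborel) \<partial>lborel)"
  proof (intro nn_integral_mono mult_left_mono)
    fix t
    have "integrable lborel (\<lambda>s. cnj (\<Psi> s) * of_real (k (t - s)))"
      by (rule Bochner_Integration.integrable_bound[OF int])
         (auto simp: norm_mult k_def intro!: mult_left_le)
    from integral_norm_bound_ennreal[OF this]
    show "ennreal (norm (LINT s|lborel. cnj (\<Psi> s) * of_real (k (t - s)))) \<le> (\<integral>\<^sup>+s. ennreal (norm (\<Psi> s) * k (t - s)) \<partial>lborel)"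
      by (simp add: norm_mult k_def)
  qed auto
  also have "\<dots> = (\<integral>\<^sup>+t. \<integral>\<^sup>+s. ennreal (norm (\<Psi> t) * norm (\<Psi> s) * k (t - s)) \<partial>lborel \<partial>lborel)"
    by (subst nn_integral_cmult[symmetric]) (auto simp: ennreal_mult'[symmetric] mult.assoc)
  also have "\<dots> \<le> (\<integral>\<^sup>+t. \<integral>\<^sup>+s. ennreal (1/2 * (norm (\<Psi> t))\<^sup>2 * k (t - s)) + ennreal (1/2 * (norm (\<Psi> s))\<^sup>2 * k (t - s)) \<partial>lborel \<partial>lborel)"
  proof (intro nn_integral_mono)
    fix t s
    have k0: "k (t - s) \<ge> 0" by (simp add: k_def)
    have "norm (\<Psi> t) * norm (\<Psi> s) \<le> 1/2 * (norm (\<Psi> t))\<^sup>2 + 1/2 * (norm (\<Psi> s))\<^sup>2"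
      using zero_le_power2[of "norm (\<Psi> t) - norm (\<Psi> s)"] by (simp add: power2_eq_square algebra_simps)
    then have "norm (\<Psi> t) * norm (\<Psi> s) * k (t - s) \<le> (1/2 * (norm (\<Psi> t))\<^sup>2 + 1/2 * (norm (\<Psi> s))\<^sup>2) * k (t - s)"
      by (rule mult_right_mono[OF _ k0])
    then show "ennreal (norm (\<Psi> t) * norm (\<Psi> s) * k (t - s)) \<le>
       ennreal (1/2 * (norm (\<Psi> t))\<^sup>2 * k (t - s)) + ennreal (1/2 * (norm (\<Psi> s))\<^sup>2 * k (t - s))"
      by (subst ennreal_plus[symmetric]) (use k0 in \<open>auto simp: algebra_simps simp del: ennreal_plus intro!: ennreal_leI\<close>)
  qed
  also have "\<dots> = (\<integral>\<^sup>+t. \<integral>\<^sup>+s. ennreal (1/2 * (norm (\<Psi> t))\<^sup>2 * k (t - s)) \<partial>lborel \<partial>lborel) +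
      (\<integral>\<^sup>+t. \<integral>\<^sup>+s. ennreal (1/2 * (norm (\<Psi> s))\<^sup>2 * k (t - s)) \<partial>lborel \<partial>lborel)"
    by (subst nn_integral_add, measurable, subst nn_integral_add, measurable)
  also have "(\<integral>\<^sup>+t. \<integral>\<^sup>+s. ennreal (1/2 * (norm (\<Psi> s))\<^sup>2 * k (t - s)) \<partial>lborel \<partial>lborel) =
     (\<integral>\<^sup>+s. \<integral>\<^sup>+t. ennreal (1/2 * (norm (\<Psi> s))\<^sup>2 * k (t - s)) \<partial>lborel \<partial>lborel)"
    by (rule lborel_pair.Fubini') measurable
  also have "\<dots> = (\<integral>\<^sup>+s. ennreal (1/2 * (norm (\<Psi> s))\<^sup>2) * ?\<kappa> \<partial>lborel)"
    by (intro nn_integral_cong kint) auto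
  also have "(\<integral>\<^sup>+t. \<integral>\<^sup>+s. ennreal (1/2 * (norm (\<Psi> t))\<^sup>2 * k (t - s)) \<partial>lborel \<partial>lborel) =
     (\<integral>\<^sup>+s. ennreal (1/2 * (norm (\<Psi> s))\<^sup>2) * ?\<kappa> \<partial>lborel)"
  proof (intro nn_integral_cong)
    fix t
    have "k (t - s) = k (s - t)" for s unfolding k_def by (simp add: power2_commute power_mult_distrib)
    then show "(\<integral>\<^sup>+s. ennreal (1/2 * (norm (\<Psi> t))\<^sup>2 * k (t - s)) \<partial>lborel) = ennreal (1/2 * (norm (\<Psi> t))\<^sup>2) * ?\<kappa>"
      by (simp only:) (rule kint, simp)
  qed
  also have "(\<integral>\<^sup>+s. ennreal (1/2 * (norm (\<Psi> s))\<^sup>2) * ?\<kappa> \<partial>lborel) + (\<integral>\<^sup>+s. ennreal (1/2 * (norm (\<Psi> s))\<^sup>2) * ?\<kappa> \<partial>lborel) = ?M * ?\<kappa>"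
    by (subst nn_integral_add[symmetric], measurable)
       (simp add: distrib_right[symmetric] ennreal_plus[symmetric] nn_integral_multc del: ennreal_plus)
  finally have J2: "ennreal (N.expectation (\<lambda>y. (norm (E (U * y)))\<^sup>2)) \<le> ?M * ?\<kappa>" .
  have "integrable N (\<lambda>y. (norm (E (U * y)))\<^sup>2)"
    by (rule N.integrable_const_bound[of _ "C\<^sup>2"]) (auto intro!: power_mono EC)
  then have "(\<integral>\<^sup>+y. ennreal ((norm (E (U * y)))\<^sup>2) \<partial>N) \<le> ?M * ?\<kappa>"
    using J2 by (subst nn_integral_eq_integral) auto
  then have J3: "(\<integral>\<^sup>+y. ennreal (std_normal_density y) * ennreal ((norm (E (U * y)))\<^sup>2) \<partial>lborel) \<le> ?M * ?\<kappa>"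
    unfolding N_def by (subst (asm) nn_integral_density) auto
  have "(\<integral>\<^sup>+u. ennreal ((norm (E u))\<^sup>2) * indicator {-U..U} u \<partial>lborel) =
     ennreal U * (\<integral>\<^sup>+y. ennreal ((norm (E (U * y)))\<^sup>2) * indicator {-U..U} (U * y) \<partial>lborel)"
    using nn_integral_real_affine[of "\<lambda>u. ennreal ((norm (E u))\<^sup>2) * indicator {-U..U} u" U 0] U by simp
  also have "\<dots> \<le> ennreal U * (\<integral>\<^sup>+y. ennreal (sqrt (2 * pi) * exp (1/2)) * (ennreal (std_normal_density y) * ennreal ((norm (E (U * y)))\<^sup>2)) \<partial>lborel)"
  proof (intro mult_left_mono nn_integral_mono)
    fix y
    show "ennreal ((norm (E (U * y)))\<^sup>2) * indicator {-U..U} (U * y) \<le>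
      ennreal (sqrt (2 * pi) * exp (1/2)) * (ennreal (std_normal_density y) * ennreal ((norm (E (U * y)))\<^sup>2))"
    proof (cases "U * y \<in> {-U..U}")
      case True
      then have "U * y \<le> U * 1" "U * (- y) \<le> U * 1" by auto
      then have "y \<le> 1" "- y \<le> 1" using U by (simp_all only: mult_le_cancel_left_pos)
      then have "\<bar>y\<bar> \<le> 1" by simp
      then have "y\<^sup>2 \<le> 1" by (simp add: abs_square_le_1)
      then have "1 \<le> exp (1/2) * exp (- y\<^sup>2 / 2)" by (simp flip: exp_add)
      then have "1 \<le> sqrt (2 * pi) * exp (1/2) * std_normal_density y"
        by (simp add: normal_density_def)
      then have "(norm (E (U * y)))\<^sup>2 \<le> sqrt (2 * pi) * exp (1/2) * std_normal_density y * (norm (E (U * y)))\<^sup>2"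
        by (simp add: mult_le_cancel_right1)
      then show ?thesis using True by (simp add: ennreal_mult'[symmetric] mult.assoc ennreal_leI)
    qed simp
  qed simp
  also have "\<dots> = ennreal (U * sqrt (2 * pi) * exp (1/2)) * (\<integral>\<^sup>+y. ennreal (std_normal_density y) * ennreal ((norm (E (U * y)))\<^sup>2) \<partial>lborel)"
    using U by (subst nn_integral_cmult) (auto simp: mult.assoc[symmetric] ennreal_mult'[symmetric])
  also have "\<dots> \<le> ennreal (U * sqrt (2 * pi) * exp (1/2)) * (?M * ?\<kappa>)"
    by (intro mult_left_mono J3) auto
  also have "\<dots> = ennreal (2 * pi * exp (1/2)) * ?M"
  proof -
    have "U * sqrt (2 * pi) * exp (1/2) * (sqrt (2 * pi) / U) = 2 * pi * exp (1/2)"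
      using U by simp
    then have "ennreal (U * sqrt (2 * pi) * exp (1/2)) * ?\<kappa> = ennreal (2 * pi * exp (1/2))"
      using U by (subst ennreal_mult[symmetric]) auto
    moreover have "ennreal (U * sqrt (2 * pi) * exp (1/2)) * (?M * ?\<kappa>) = ennreal (U * sqrt (2 * pi) * exp (1/2)) * ?\<kappa> * ?M"
      by (simp only: mult_ac)
    ultimately show ?thesis by simp
  qed
  finally show ?thesis unfolding E_def .
qed

section \<open>Gaussian smoothing and shifting the inversion line\<close>

text \<open>exp (s^2 z^2 / 2) is the bilateral Laplace transform of the centred normal density of
  deviation s, and this is its inversion on Re z = 1. Separating the real and imaginary parts of the
  exponent reduces it to the characteristic function of the standard normal law.\<close>

lemma gaussian_integral_line:
  assumes s: "0 < s"
  shows "(LINT t|lborel. exp (of_real (s\<^sup>2 / 2) * (Complex 1 t)\<^sup>2 + Complex 1 t * of_real w)) =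
     of_real (2 * pi * normal_density 0 s w)"
proof -
  let ?x = "s\<^sup>2 + w"
  have "exp (of_real (s\<^sup>2 / 2) * (Complex 1 t)\<^sup>2 + Complex 1 t * of_real w) =
     of_real (exp (s\<^sup>2 / 2 + w)) * (of_real (exp (- (s * t)\<^sup>2 / 2)) * exp (\<i> * of_real (?x * t)))" for t
  proof -
    have "of_real (s\<^sup>2 / 2) * (Complex 1 t)\<^sup>2 + Complex 1 t * of_real w =
       of_real (s\<^sup>2 / 2 + w) + (of_real (- (s * t)\<^sup>2 / 2) + \<i> * of_real (?x * t))"
      by (simp add: complex_eq_iff power2_eq_square field_simps)
    then show ?thesis by (simp only: exp_add exp_of_real)
  qed
  then have "(LINT t|lborel. exp (of_real (s\<^sup>2 / 2) * (Complex 1 t)\<^sup>2 + Complex 1 t * of_real w)) =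
    of_real (exp (s\<^sup>2 / 2 + w)) * (LINT t|lborel. of_real (exp (- (s * t)\<^sup>2 / 2)) * exp (\<i> * of_real (?x * t)))"
    by simp
  also have "(LINT t|lborel. of_real (exp (- (s * t)\<^sup>2 / 2)) * exp (\<i> * of_real (?x * t))) =
     (1 / s) *\<^sub>R (LINT y|lborel. of_real (exp (- y\<^sup>2 / 2)) * exp (\<i> * of_real (?x / s * y)))"
    using lborel_integral_real_affine[of "1/s" "\<lambda>t. of_real (exp (- (s * t)\<^sup>2 / 2)) * exp (\<i> * of_real (?x * t))" 0] s
    by simp
  also have "(LINT y|lborel. of_real (exp (- y\<^sup>2 / 2)) * exp (\<i> * of_real (?x / s * y))) =
     (LINT y|lborel. of_real (sqrt (2 * pi)) * (std_normal_density y *\<^sub>R exp (\<i> * of_real (?x / s * y))))"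
    by (intro Bochner_Integration.integral_cong refl) (simp add: normal_density_def scaleR_conv_of_real)
  also have "\<dots> = of_real (sqrt (2 * pi)) * (LINT y|std_normal_distribution. exp (\<i> * of_real (?x / s * y)))"
    by (subst Bochner_Integration.integral_mult_right_zero, subst integral_density) auto
  also have "\<dots> = of_real (sqrt (2 * pi) * exp (- (?x / s)\<^sup>2 / 2))"
    unfolding std_normal_char by simp
  finally have "(LINT t|lborel. exp (of_real (s\<^sup>2 / 2) * (Complex 1 t)\<^sup>2 + Complex 1 t * of_real w)) =
     of_real (exp (s\<^sup>2 / 2 + w) * ((1 / s) * (sqrt (2 * pi) * exp (- (?x / s)\<^sup>2 / 2))))"
    by (simp only: scaleR_conv_of_real of_real_mult)
  also have "exp (s\<^sup>2 / 2 + w) * ((1 / s) * (sqrt (2 * pi) * exp (- (?x / s)\<^sup>2 / 2))) = 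
     (sqrt (2 * pi) / s) * exp ((s\<^sup>2 / 2 + w) + (- (?x / s)\<^sup>2 / 2))"
    by (subst exp_add[of "s\<^sup>2 / 2 + w" "- (?x / s)\<^sup>2 / 2"]) (simp only: mult_ac times_divide_eq_left times_divide_eq_right mult_1_left)
  also have "(s\<^sup>2 / 2 + w) + (- (?x / s)\<^sup>2 / 2) = - w\<^sup>2 / (2 * s\<^sup>2)"
    using s by (simp add: field_simps power2_eq_square)
  also have "sqrt (2 * pi) / s * exp (- w\<^sup>2 / (2 * s\<^sup>2)) = 2 * pi * normal_density 0 s w"
    using s by (simp add: normal_density_def real_sqrt_mult field_simps)
  finally show ?thesis .
qed

text \<open>The weight 1 + |t| accommodates transforms of linear growth on vertical lines.\<close>

lemma integrable_gaussian_moment: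
  assumes "0 < (s::real)"
  shows "integrable lborel (\<lambda>t. (1 + \<bar>t\<bar>) * exp (- (s * t)\<^sup>2 / 2))"
proof -
  have eq: "exp (- (s * t)\<^sup>2 / 2) = (sqrt (2 * pi) / s) * normal_density 0 (1 / s) t" for t
  proof -
    have q: "sqrt (2 * pi * (1 / s)\<^sup>2) = sqrt (2 * pi) / s"
      using assms by (simp add: real_sqrt_mult)
    have e: "(t - 0)\<^sup>2 / (2 * (1 / s)\<^sup>2) = (s * t)\<^sup>2 / 2"
      using assms by (simp add: power_mult_distrib power_divide)
    show ?thesis
      unfolding normal_density_def minus_divide_left[symmetric] e q using assms by simp
  qed
  have "integrable lborel (\<lambda>t. normal_density 0 (1 / s) t * \<bar>t - 0\<bar> ^ 1)"
    by (rule integrable_normal_moment_abs) (use assms in simp)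
  moreover have "integrable lborel (\<lambda>t. normal_density 0 (1 / s) t)"
    by (rule integrable_normal_density) (use assms in simp)
  ultimately have "integrable lborel (\<lambda>t. (sqrt (2 * pi) / s) * (normal_density 0 (1 / s) t + normal_density 0 (1 / s) t * \<bar>t\<bar>))"
    by (intro integrable_mult_right Bochner_Integration.integrable_add) simp_all
  also have "(\<lambda>t. (sqrt (2 * pi) / s) * (normal_density 0 (1 / s) t + normal_density 0 (1 / s) t * \<bar>t\<bar>)) =
      (\<lambda>t. (1 + \<bar>t\<bar>) * ((sqrt (2 * pi) / s) * normal_density 0 (1 / s) t))"
    by (intro ext) (simp only: distrib_left distrib_right mult_1_left mult_ac)
  finally show ?thesis unfolding eq .
qed

lemma integrable_exp_neg:
  assumes "0 < b"
  shows "integrable lborel (\<lambda>v. indicator {0..} v * exp (- b * v) :: real)"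
proof (rule integrableI_bounded)
  have "((\<lambda>x. exp (- b * x)) has_integral exp (- b * 0) / b) {0..}"
    by (rule has_integral_exp_minus_to_infinity) fact
  from nn_integral_has_integral_lebesgue[OF _ this]
  have "(\<integral>\<^sup>+v. ennreal (indicator {0..} v * exp (- b * v)) \<partial>lborel) = ennreal (1 / b)" by simp
  then show "(\<integral>\<^sup>+v. ennreal (norm (indicator {0..} v * exp (- b * v) :: real)) \<partial>lborel) < \<infinity>"
    by (simp add: abs_mult)
qed simp

lemma norm_exp_gaussian:
  "norm (exp (of_real (s\<^sup>2 / 2) * (Complex \<sigma> t)\<^sup>2 + Complex \<sigma> t * of_real u)) =
     exp (s\<^sup>2 * \<sigma>\<^sup>2 / 2 + \<sigma> * u) * exp (- (s * t)\<^sup>2 / 2)"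
  unfolding norm_exp_eq_Re exp_add[symmetric]
  by (simp add: power2_eq_square field_simps)

text \<open>The Gaussian factor makes the double integral absolutely convergent whatever the decay
  of \<Phi>, so inversion is an application of Fubini. The result is the convolution of D with a
  normal density of width s.\<close>

lemma Gaussian_smoothing_inversion:
  fixes D :: "real \<Rightarrow> complex" and \<Phi> :: "complex \<Rightarrow> complex"
  assumes int: "integrable lborel (\<lambda>v. D v * exp (- of_real v))" and s: "0 < s"
    and [measurable]: "D \<in> borel_measurable borel"
    and \<Phi>: "\<And>t. \<Phi> (Complex 1 t) = (LINT v|lborel. D v * exp (- Complex 1 t * of_real v))"
  shows "(LINT t|lborel. \<Phi> (Complex 1 t) * exp (of_real (s\<^sup>2 / 2) * (Complex 1 t)\<^sup>2 + Complex 1 t * of_real u)) =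
    of_real (2 * pi) * (LINT v|lborel. D v * of_real (normal_density 0 s (u - v)))"
proof -
  define f where "f = (\<lambda>v t. D v * exp (- Complex 1 t * of_real v) * exp (of_real (s\<^sup>2 / 2) * (Complex 1 t)\<^sup>2 + Complex 1 t * of_real u))"
  have cplx [measurable]: "(\<lambda>t. Complex 1 t) \<in> borel_measurable borel"
    by (intro borel_measurable_continuous_onI continuous_intros)
  have nf: "norm (f v t) = norm (D v * exp (- of_real v)) * (exp (s\<^sup>2 / 2 + u) * exp (- (s * t)\<^sup>2 / 2))" for v t
    unfolding f_def norm_mult norm_exp_gaussian by (simp add: norm_exp_eq_Re)
  have ig: "integrable lborel (\<lambda>t. exp (- (s * t)\<^sup>2 / 2))"
    by (rule Bochner_Integration.integrable_bound[OF integrable_gaussian_moment[OF s]]) (auto simp: mult_le_cancel_right1)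
  have meas: "(\<lambda>(v, t). f v t) \<in> borel_measurable (lborel \<Otimes>\<^sub>M lborel)"
    unfolding f_def by measurable
  have "(LINT t|lborel. \<Phi> (Complex 1 t) * exp (of_real (s\<^sup>2 / 2) * (Complex 1 t)\<^sup>2 + Complex 1 t * of_real u)) =
      (LINT t|lborel. LINT v|lborel. f v t)"
    unfolding \<Phi> f_def by simp
  also have "\<dots> = (LINT v|lborel. LINT t|lborel. f v t)"
  proof (rule lborel_pair.Fubini_integral)
    show "integrable (lborel \<Otimes>\<^sub>M lborel) (\<lambda>(v, t). f v t)"
    proof (rule lborel_pair.Fubini_integrable[OF meas])
      show "integrable lborel (\<lambda>v. LINT t|lborel. norm (case (v, t) of (v, t) \<Rightarrow> f v t))"
        using integrable_norm[OF int] by (simp add: nf)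
      have "integrable lborel (\<lambda>t. f v t)" for v
      proof (rule Bochner_Integration.integrable_bound)
        show "integrable lborel (\<lambda>t. norm (D v * exp (- of_real v)) * (exp (s\<^sup>2 / 2 + u) * exp (- (s * t)\<^sup>2 / 2)))"
          by (intro integrable_mult_right ig)
        show "f v \<in> borel_measurable lborel" unfolding f_def by measurable
      qed (simp add: nf)
      then show "AE v in lborel. integrable lborel (\<lambda>t. case (v, t) of (v, t) \<Rightarrow> f v t)" by simp
    qed
  qed
  also have "\<dots> = (LINT v|lborel. of_real (2 * pi) * (D v * of_real (normal_density 0 s (u - v))))"
  proof (intro Bochner_Integration.integral_cong refl)
    fix v
    have "f v t = D v * exp (of_real (s\<^sup>2 / 2) * (Complex 1 t)\<^sup>2 + Complex 1 t * of_real (u - v))" for t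
      unfolding f_def mult.assoc exp_add[symmetric] by (simp add: algebra_simps)
    then have "(LINT t|lborel. f v t) = D v * (LINT t|lborel. exp (of_real (s\<^sup>2 / 2) * (Complex 1 t)\<^sup>2 + Complex 1 t * of_real (u - v)))"
      by simp
    then show "(LINT t|lborel. f v t) = of_real (2 * pi) * (D v * of_real (normal_density 0 s (u - v)))"
      unfolding gaussian_integral_line[OF s] by simp
  qed
  finally show ?thesis by simp
qed

text \<open>Cauchy's theorem on a strip: the Gaussian factor beats the growth K (1 + |Im z|), so the
  horizontal sides vanish at infinity. K is allowed to depend on \<sigma>.\<close>

lemma vertical_line_shift:
  fixes \<Phi> :: "complex \<Rightarrow> complex" and s \<sigma> u K :: real
  assumes hol: "\<Phi> holomorphic_on {z. Re z > 0}" and s: "0 < s" and \<sigma>: "0 < \<sigma>" "\<sigma> \<le> 1"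
    and growth: "\<And>z. \<sigma> \<le> Re z \<Longrightarrow> Re z \<le> 1 \<Longrightarrow> norm (\<Phi> z) \<le> K * (1 + \<bar>Im z\<bar>)"
  defines "G \<equiv> \<lambda>z. \<Phi> z * exp (of_real (s\<^sup>2 / 2) * z\<^sup>2 + z * of_real u)"
  shows integrable_vertical_line: "integrable lborel (\<lambda>t. G (Complex \<sigma> t))"
    and integral_vertical_line_eq: "(LINT t|lborel. G (Complex \<sigma> t)) = (LINT t|lborel. G (Complex 1 t))"
proof -
  let ?H = "{z. Re z > 0}"
  have holG: "G holomorphic_on ?H" unfolding G_def by (intro holomorphic_intros hol)
  define K' where "K' = K * exp (s\<^sup>2 / 2 + \<bar>u\<bar>)"
  have K0: "K \<ge> 0" using order_trans[OF norm_ge_zero growth[of 1]] \<sigma> by simp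
  have Gb: "norm (G (Complex x t)) \<le> K' * ((1 + \<bar>t\<bar>) * exp (- (s * t)\<^sup>2 / 2))" if "\<sigma> \<le> x" "x \<le> 1" for x t
  proof -
    have x: "0 < x" using that \<sigma> by simp
    have "s\<^sup>2 * x\<^sup>2 \<le> s\<^sup>2 * 1" using x that by (intro mult_left_mono) (auto simp: power_le_one)
    moreover have "x * u \<le> 1 * \<bar>u\<bar>"
      using x that by (intro order_trans[OF mult_left_mono mult_right_mono[of x 1]]) auto
    ultimately have "exp (s\<^sup>2 * x\<^sup>2 / 2 + x * u) \<le> exp (s\<^sup>2 / 2 + \<bar>u\<bar>)" by simp
    then have "norm (\<Phi> (Complex x t)) * (exp (s\<^sup>2 * x\<^sup>2 / 2 + x * u) * exp (- (s * t)\<^sup>2 / 2)) \<le>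
        (K * (1 + \<bar>t\<bar>)) * (exp (s\<^sup>2 / 2 + \<bar>u\<bar>) * exp (- (s * t)\<^sup>2 / 2))"
      using growth[of "Complex x t"] that K0 by (intro mult_mono) auto
    then show ?thesis unfolding G_def norm_mult norm_exp_gaussian K'_def by (simp add: mult_ac)
  qed
  have contG: "continuous_on UNIV (\<lambda>t. G (Complex x t))" if "0 < x" for x
    by (rule continuous_on_compose2[OF holomorphic_on_imp_continuous_on[OF holG]])
       (use that in \<open>auto intro!: continuous_intros\<close>)
  have meas: "(\<lambda>t. G (Complex x t)) \<in> borel_measurable borel" if "0 < x" for x
    by (rule borel_measurable_continuous_onI[OF contG[OF that]])
  have intG: "integrable lborel (\<lambda>t. G (Complex x t))" if "\<sigma> \<le> x" "x \<le> 1" for x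
  proof (rule Bochner_Integration.integrable_bound)
    show "integrable lborel (\<lambda>t. K' * ((1 + \<bar>t\<bar>) * exp (- (s * t)\<^sup>2 / 2)))"
      by (intro integrable_mult_right integrable_gaussian_moment s)
    show "(\<lambda>t. G (Complex x t)) \<in> borel_measurable lborel" using meas[of x] that \<sigma> by simp
    show "AE t in lborel. norm (G (Complex x t)) \<le> norm (K' * ((1 + \<bar>t\<bar>) * exp (- (s * t)\<^sup>2 / 2)))"
      by (intro AE_I2 order_trans[OF Gb[OF that]]) simp
  qed
  then show "integrable lborel (\<lambda>t. G (Complex \<sigma> t))" using \<sigma> by simp
  \<comment> \<open>A primitive on the half plane replaces the rectangular contour: truncated
    vertical integrals are differences of P at the corners.\<close>
  obtain P where P: "\<And>z. z \<in> ?H \<Longrightarrow> (P has_field_derivative G z) (at z within ?H)"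
    using holomorphic_convex_primitive'[OF convex_halfspace_Re_gt open_halfspace_Re_gt holG] by blast
  then have P: "(P has_field_derivative G z) (at z)" if "z \<in> ?H" for z
    using P[OF that] at_within_open[OF that open_halfspace_Re_gt] by simp
  define I where "I = (\<lambda>x (k::nat). LINT t|lborel. indicator {-real k..real k} t *\<^sub>R G (Complex x t))"
  have lim: "I x \<longlonglongrightarrow> (LINT t|lborel. G (Complex x t))" if "\<sigma> \<le> x" "x \<le> 1" for x
    unfolding I_def
  proof (rule integral_dominated_convergence)
    show "integrable lborel (\<lambda>t. norm (G (Complex x t)))" by (intro integrable_norm intG that)
    show "AE t in lborel. (\<lambda>k. indicator {-real k..real k} t *\<^sub>R G (Complex x t)) \<longlonglongrightarrow> G (Complex x t)"
    proof (intro AE_I2 tendsto_eventually)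
      fix t
      obtain n :: nat where "\<bar>t\<bar> \<le> real n" using real_arch_simple by blast
      then show "\<forall>\<^sub>F k in sequentially. indicator {-real k..real k} t *\<^sub>R G (Complex x t) = G (Complex x t)"
        by (intro eventually_sequentiallyI[of n]) (auto simp: indicator_def)
    qed
    show "(\<lambda>t. G (Complex x t)) \<in> borel_measurable lborel" using meas[of x] that \<sigma> by simp
    then show "(\<lambda>t. indicator {-real k..real k} t *\<^sub>R G (Complex x t)) \<in> borel_measurable lborel" for k
      by measurable
  qed (auto simp: indicator_def)
  have Ieq: "\<i> * I x k = P (Complex x (real k)) - P (Complex x (- real k))" if "\<sigma> \<le> x" "x \<le> 1" for x k
  proof -
    have "((\<lambda>t. \<i> * G (Complex x t)) has_integral (P (Complex x (real k)) - P (Complex x (- real k)))) {-real k..real k}"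
    proof (rule fundamental_theorem_of_calculus)
      fix t assume "t \<in> {-real k..real k}"
      have 1: "((\<lambda>t. Complex x t) has_vector_derivative \<i>) (at t within {-real k..real k})"
        unfolding Complex_eq by (auto intro!: derivative_eq_intros simp: has_vector_derivative_def scaleR_conv_of_real)
      have "((P \<circ> (\<lambda>t. Complex x t)) has_vector_derivative \<i> * G (Complex x t)) (at t within {-real k..real k})"
        by (rule field_vector_diff_chain_within[OF 1])
           (use P[of "Complex x t"] that \<sigma> in \<open>auto intro: has_field_derivative_at_within\<close>)
      then show "((\<lambda>t. P (Complex x t)) has_vector_derivative \<i> * G (Complex x t)) (at t within {-real k..real k})"
        by (simp add: o_def)
    qed simp
    then have "integral {-real k..real k} (\<lambda>t. \<i> * G (Complex x t)) = P (Complex x (real k)) - P (Complex x (- real k))"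
      by (rule integral_unique)
    moreover have "(LINT t:{-real k..real k}|lborel. \<i> * G (Complex x t)) = integral {-real k..real k} (\<lambda>t. \<i> * G (Complex x t))"
      by (intro set_borel_integral_eq_integral borel_integrable_atLeastAtMost')
         (use that \<sigma> in \<open>auto intro!: continuous_intros continuous_on_subset[OF contG]\<close>)
    ultimately show ?thesis
      unfolding I_def set_lebesgue_integral_def by (simp flip: mult_scaleR_right)
  qed
  \<comment> \<open>The horizontal side has length 1 - \<sigma> <= 1, and the mean value inequality
    for P bounds its contribution.\<close>
  have hb: "norm (P (Complex \<sigma> y) - P (Complex 1 y)) \<le> K' * ((1 + \<bar>y\<bar>) * exp (- (s * y)\<^sup>2 / 2))" for y
  proof -
    let ?S = "closed_segment (Complex \<sigma> y) (Complex 1 y)"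
    have seg: "Im z = y \<and> \<sigma> \<le> Re z \<and> Re z \<le> 1" if "z \<in> ?S" for z
    proof -
      from that obtain v where v: "0 \<le> v" "v \<le> 1" "z = (1 - v) *\<^sub>R Complex \<sigma> y + v *\<^sub>R Complex 1 y"
        unfolding in_segment by blast
      have "Re z = \<sigma> + v * (1 - \<sigma>)" "Im z = y" unfolding v(3) by (simp_all add: algebra_simps)
      moreover have "0 \<le> v * (1 - \<sigma>)" "v * (1 - \<sigma>) \<le> 1 * (1 - \<sigma>)"
        using v \<sigma> by (intro mult_nonneg_nonneg mult_right_mono; simp)+
      ultimately show ?thesis by simp
    qed
    have "norm (P (Complex \<sigma> y) - P (Complex 1 y)) \<le> K' * ((1 + \<bar>y\<bar>) * exp (- (s * y)\<^sup>2 / 2)) * norm (Complex \<sigma> y - Complex 1 y)"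
    proof (rule field_differentiable_bound[where S = ?S and f' = G])
      fix z assume z: "z \<in> ?S"
      show "(P has_field_derivative G z) (at z within ?S)"
        using P[of z] seg[OF z] \<sigma> by (auto intro: has_field_derivative_at_within)
      show "norm (G z) \<le> K' * ((1 + \<bar>y\<bar>) * exp (- (s * y)\<^sup>2 / 2))"
      proof -
        have "Complex (Re z) y = z" using seg[OF z] by (simp add: complex_eq_iff)
        then show ?thesis using Gb[of "Re z" y] seg[OF z] by simp
      qed
    qed auto
    also have "norm (Complex \<sigma> y - Complex 1 y) = 1 - \<sigma>"
      using \<sigma> by (simp add: cmod_def)
    also have "K' * ((1 + \<bar>y\<bar>) * exp (- (s * y)\<^sup>2 / 2)) * (1 - \<sigma>) \<le> K' * ((1 + \<bar>y\<bar>) * exp (- (s * y)\<^sup>2 / 2))"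
      using \<sigma> K0 by (intro mult_left_le) (auto simp: K'_def)
    finally show ?thesis .
  qed
  have "(\<lambda>k. I \<sigma> k - I 1 k) \<longlonglongrightarrow> 0"
  proof (rule Lim_null_comparison)
    show "\<forall>\<^sub>F k in sequentially. norm (I \<sigma> k - I 1 k) \<le> 2 * (K' * ((1 + real k) * exp (- (s * real k)\<^sup>2 / 2)))"
    proof (intro always_eventually allI)
      fix k
      have "norm (I \<sigma> k - I 1 k) = norm (\<i> * I \<sigma> k - \<i> * I 1 k)"
        by (simp flip: right_diff_distrib add: norm_mult)
      also have "\<dots> = norm ((P (Complex \<sigma> (real k)) - P (Complex 1 (real k))) - (P (Complex \<sigma> (- real k)) - P (Complex 1 (- real k))))"
        using \<sigma> by (simp add: Ieq algebra_simps)
      also have "\<dots> \<le> norm (P (Complex \<sigma> (real k)) - P (Complex 1 (real k))) + norm (P (Complex \<sigma> (- real k)) - P (Complex 1 (- real k)))"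
        by (rule norm_triangle_ineq4)
      finally show "norm (I \<sigma> k - I 1 k) \<le> 2 * (K' * ((1 + real k) * exp (- (s * real k)\<^sup>2 / 2)))"
        using hb[of "real k"] hb[of "- real k"] by simp
    qed
    have "((\<lambda>k. (1 + real k) * exp (- (s * real k)\<^sup>2 / 2)) \<longlonglongrightarrow> 0)"
      using s by real_asymp
    then show "(\<lambda>k. 2 * (K' * ((1 + real k) * exp (- (s * real k)\<^sup>2 / 2)))) \<longlonglongrightarrow> 0"
      by (intro tendsto_mult_right_zero)
  qed
  moreover have "(\<lambda>k. I \<sigma> k - I 1 k) \<longlonglongrightarrow> (LINT t|lborel. G (Complex \<sigma> t)) - (LINT t|lborel. G (Complex 1 t))"
    using \<sigma> by (intro tendsto_diff lim) auto
  ultimately show "(LINT t|lborel. G (Complex \<sigma> t)) = (LINT t|lborel. G (Complex 1 t))"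
    using LIMSEQ_unique by fastforce
qed

text \<open>Normal densities of width tending to 0 form an approximate identity at points of
  continuity. The growth exp |v| of D is absorbed because exp y and exp (- y) times the standard
  density are multiples of normal densities centred at 1 and -1, which yields an integrable
  majorant.\<close>

lemma Gaussian_smoothing_tendsto:
  fixes D :: "real \<Rightarrow> complex"
  assumes [measurable]: "D \<in> borel_measurable borel" and bd: "\<And>v. norm (D v) \<le> C * exp \<bar>v\<bar>"
    and cont: "isCont D u"
  shows "(\<lambda>k. LINT v|lborel. D v * of_real (normal_density 0 (1 / real (Suc k)) (u - v))) \<longlonglongrightarrow> D u"
proof -
  have C0: "C \<ge> 0" using order_trans[OF norm_ge_zero bd[of 0]] by simp
  have eq: "(LINT v|lborel. D v * of_real (normal_density 0 s (u - v))) =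
      (LINT y|lborel. D (u - s * y) * of_real (std_normal_density y))" if s: "0 < s" for s
  proof -
    have "s * normal_density 0 s (s * y) = std_normal_density y" for y
      using s by (simp add: normal_density_def real_sqrt_mult power_mult_distrib)
    then have d: "of_real s * (x * complex_of_real (normal_density 0 s (s * y))) = x * of_real (std_normal_density y)" for x y
      by (metis mult.left_commute of_real_mult)
    have "(LINT v|lborel. D v * of_real (normal_density 0 s (u - v))) =
      s *\<^sub>R (LINT y|lborel. D (u - s * y) * of_real (normal_density 0 s (s * y)))"
      using lborel_integral_real_affine[of "- s" "\<lambda>v. D v * of_real (normal_density 0 s (u - v))" u] s by simp
    then show ?thesis
      by (simp add: scaleR_conv_of_real d flip: integral_mult_right_zero)
  qed
  have ednormal: "exp y * std_normal_density y = exp (1/2) * normal_density 1 1 y" for y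
  proof -
    have "exp y * exp (- y\<^sup>2 / 2) = exp (1/2) * exp (- (y - 1)\<^sup>2 / 2)"
      unfolding exp_add[symmetric] by (simp add: power2_eq_square field_simps)
    then show ?thesis by (simp add: normal_density_def)
  qed
  have ednormal': "exp (- y) * std_normal_density y = exp (1/2) * normal_density (-1) 1 y" for y
  proof -
    have "exp (- y) * exp (- y\<^sup>2 / 2) = exp (1/2) * exp (- (y + 1)\<^sup>2 / 2)"
      unfolding exp_add[symmetric] by (simp add: power2_eq_square field_simps)
    then show ?thesis by (simp add: normal_density_def)
  qed
  have "(\<lambda>k. LINT y|lborel. D (u - 1 / real (Suc k) * y) * of_real (std_normal_density y)) \<longlonglongrightarrow>
     (LINT y|lborel. D u * of_real (std_normal_density y))"
  proof (rule integral_dominated_convergence)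
    let ?w = "\<lambda>y. C * exp \<bar>u\<bar> * (exp (1/2) * normal_density 1 1 y + exp (1/2) * normal_density (-1) 1 y)"
    show "integrable lborel ?w"
      by (intro integrable_mult_right Bochner_Integration.integrable_add integrable_normal_density) auto
    show "AE y in lborel. (\<lambda>k. D (u - 1 / real (Suc k) * y) * of_real (std_normal_density y)) \<longlonglongrightarrow> D u * of_real (std_normal_density y)"
    proof (intro AE_I2 tendsto_mult tendsto_const)
      fix y
      have "(\<lambda>k. u - 1 / real (Suc k) * y) \<longlonglongrightarrow> u - 0 * y"
        by (intro tendsto_intros LIMSEQ_Suc lim_1_over_n)
      then show "(\<lambda>k. D (u - 1 / real (Suc k) * y)) \<longlonglongrightarrow> D u"
        using isCont_tendsto_compose[OF cont] by simp
    qed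
    show "AE y in lborel. norm (D (u - 1 / real (Suc k) * y) * of_real (std_normal_density y)) \<le> ?w y" for k
    proof (rule AE_I2)
      fix y
      have "\<bar>1 / real (Suc k) * y\<bar> \<le> 1 * \<bar>y\<bar>"
        unfolding abs_mult by (intro mult_right_mono) auto
      then have "\<bar>u - 1 / real (Suc k) * y\<bar> \<le> \<bar>u\<bar> + \<bar>y\<bar>" by linarith
      then have "exp \<bar>u - 1 / real (Suc k) * y\<bar> \<le> exp \<bar>u\<bar> * exp \<bar>y\<bar>" by (simp flip: exp_add)
      also have "exp \<bar>y\<bar> \<le> exp y + exp (- y)" by (auto simp: abs_if add_increasing add_increasing2)
      finally have "exp \<bar>u - 1 / real (Suc k) * y\<bar> \<le> exp \<bar>u\<bar> * (exp y + exp (- y))" by simp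
      then have "norm (D (u - 1 / real (Suc k) * y)) \<le> C * (exp \<bar>u\<bar> * (exp y + exp (- y)))"
        using C0 by (intro order_trans[OF bd] mult_left_mono)
      then have "norm (D (u - 1 / real (Suc k) * y)) * std_normal_density y \<le> C * (exp \<bar>u\<bar> * (exp y + exp (- y))) * std_normal_density y"
        by (intro mult_right_mono) auto
      also have "\<dots> = ?w y"
        unfolding ednormal[symmetric] ednormal'[symmetric] by (simp only: distrib_left distrib_right mult_ac)
      finally show "norm (D (u - 1 / real (Suc k) * y) * of_real (std_normal_density y)) \<le> ?w y"
        by (simp add: norm_mult)
    qed
  qed auto
  also have "(LINT y|lborel. D u * of_real (std_normal_density y)) = D u * of_real (LINT y|lborel. std_normal_density y)"
    by simp
  also have "(LINT y|lborel. std_normal_density y) = 1" by (rule integral_normal_density) simp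
  finally show ?thesis by (simp add: eq del: of_nat_Suc)
qed

text \<open>Plancherel controls exp (- \<sigma> u) D u, so on [0, U] the choice \<sigma> = 1 / U
  loses only a constant factor. The bound M has to be uniform in \<sigma>, whereas the growth bound
  may degenerate as \<sigma> tends to 0, since it only justifies moving the line. Fatou's lemma
  removes the smoothing, and monotone convergence lets U tend to infinity.\<close>

theorem Laplace_transform_mean_square:
  fixes D :: "real \<Rightarrow> complex" and \<Phi> :: "complex \<Rightarrow> complex"
  assumes D[measurable]: "D \<in> borel_measurable borel" and D0: "\<And>v. v < 0 \<Longrightarrow> D v = 0"
    and bd: "\<And>v. 0 \<le> v \<Longrightarrow> norm (D v) \<le> C * exp (a * v)" and a: "0 \<le> a" "a < 1"
    and cont: "AE u in lborel. isCont D u"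
    and \<Phi>: "\<And>t. \<Phi> (Complex 1 t) = (LINT v|lborel. D v * exp (- Complex 1 t * of_real v))"
    and hol: "\<Phi> holomorphic_on {z. Re z > 0}"
    and growth: "\<And>\<sigma>. 0 < \<sigma> \<Longrightarrow> \<exists>K. \<forall>z. \<sigma> \<le> Re z \<longrightarrow> Re z \<le> 1 \<longrightarrow> norm (\<Phi> z) \<le> K * (1 + \<bar>Im z\<bar>)"
    and M: "\<And>\<sigma>. 0 < \<sigma> \<Longrightarrow> \<sigma> \<le> 1 \<Longrightarrow> (\<integral>\<^sup>+t. ennreal ((norm (\<Phi> (Complex \<sigma> t)))\<^sup>2) \<partial>lborel) \<le> M"
  shows "(\<integral>\<^sup>+u. ennreal ((norm (D u))\<^sup>2) * indicator {0..} u \<partial>lborel) \<le> ennreal (exp 4) * M"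
proof -
  have C0: "C \<ge> 0" using order_trans[OF norm_ge_zero bd[of 0]] by simp
  have int: "integrable lborel (\<lambda>v. D v * exp (- of_real v))"
  proof (rule Bochner_Integration.integrable_bound)
    show "integrable lborel (\<lambda>v. C * (indicator {0..} v * exp (- (1 - a) * v)))"
      using a by (intro integrable_mult_right integrable_exp_neg) simp
    show "AE v in lborel. norm (D v * exp (- of_real v)) \<le> norm (C * (indicator {0..} v * exp (- (1 - a) * v)))"
    proof (rule AE_I2)
      fix v
      show "norm (D v * exp (- of_real v)) \<le> norm (C * (indicator {0..} v * exp (- (1 - a) * v)))"
      proof (cases "v \<ge> 0")
        case True
        then have "norm (D v) * exp (- v) \<le> C * exp (a * v) * exp (- v)" by (intro mult_right_mono bd) auto
        also have "\<dots> = C * exp (- (1 - a) * v)" by (simp add: algebra_simps flip: exp_add)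
        finally show ?thesis using True C0 by (simp add: norm_mult norm_exp_eq_Re)
      qed (simp add: D0)
    qed
  qed simp
  have bd': "norm (D v) \<le> C * exp \<bar>v\<bar>" for v
  proof (cases "v \<ge> 0")
    case True
    then have "a * v \<le> 1 * v" using a by (intro mult_right_mono) auto
    then have "C * exp (a * v) \<le> C * exp \<bar>v\<bar>" using True C0 by (intro mult_left_mono) auto
    then show ?thesis using bd[OF True] by linarith
  qed (use D0 C0 in auto)
  define Ds where "Ds = (\<lambda>s u. LINT v|lborel. D v * of_real (normal_density 0 s (u - v)))"
  have smooth: "(\<integral>\<^sup>+u. ennreal ((norm (Ds s u))\<^sup>2) * indicator {0..U} u \<partial>lborel) \<le> ennreal (exp 4) * M"
    if s: "0 < s" "s \<le> 1" and U: "1 \<le> U" for s U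
  proof -
    define \<sigma> where "\<sigma> = 1 / U"
    have \<sigma>: "0 < \<sigma>" "\<sigma> \<le> 1" "\<sigma> * U = 1" using U by (auto simp: \<sigma>_def)
    define \<Psi> where "\<Psi> = (\<lambda>t. \<Phi> (Complex \<sigma> t) * exp (of_real (s\<^sup>2 / 2) * (Complex \<sigma> t)\<^sup>2))"
    obtain K where K: "\<And>z. \<sigma> \<le> Re z \<Longrightarrow> Re z \<le> 1 \<Longrightarrow> norm (\<Phi> z) \<le> K * (1 + \<bar>Im z\<bar>)"
      using growth[OF \<sigma>(1)] by blast
    have int\<Psi>: "integrable lborel \<Psi>"
      using integrable_vertical_line[OF hol s(1) \<sigma>(1,2) K, of 0] by (simp add: \<Psi>_def)
    define E where "E = (\<lambda>u. LINT t|lborel. \<Psi> t * exp (\<i> * of_real (u * t)))"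
    have DsE: "of_real (2 * pi) * Ds s u = of_real (exp (\<sigma> * u)) * E u" for u
    proof -
      have "of_real (2 * pi) * Ds s u = 
         (LINT t|lborel. \<Phi> (Complex \<sigma> t) * exp (of_real (s\<^sup>2 / 2) * (Complex \<sigma> t)\<^sup>2 + Complex \<sigma> t * of_real u))"
        unfolding Ds_def Gaussian_smoothing_inversion[OF int s(1) D \<Phi>, symmetric]
        by (rule integral_vertical_line_eq[OF hol s(1) \<sigma>(1,2) K, symmetric])
      also have "\<dots> = (LINT t|lborel. of_real (exp (\<sigma> * u)) * (\<Psi> t * exp (\<i> * of_real (u * t))))"
      proof (intro Bochner_Integration.integral_cong refl)
        fix t
        have "Complex \<sigma> t * of_real u = of_real (\<sigma> * u) + \<i> * of_real (u * t)"
          by (simp add: complex_eq_iff)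
        then show "\<Phi> (Complex \<sigma> t) * exp (of_real (s\<^sup>2 / 2) * (Complex \<sigma> t)\<^sup>2 + Complex \<sigma> t * of_real u) =
           of_real (exp (\<sigma> * u)) * (\<Psi> t * exp (\<i> * of_real (u * t)))"
          by (simp only: \<Psi>_def exp_add exp_of_real mult_ac)
      qed
      finally show ?thesis unfolding E_def by simp
    qed
    \<comment> \<open>For u <= U one has exp (\<sigma> u) <= e; squared, this is the factor exp
      2.\<close>
    have nDs: "(norm (Ds s u))\<^sup>2 \<le> exp 2 / (4 * pi\<^sup>2) * (norm (E u))\<^sup>2" if "u \<le> U" for u
    proof -
      have "\<sigma> * u \<le> 1" using that \<sigma> by (metis mult_left_mono less_imp_le)
      then have "exp (\<sigma> * u) \<le> exp 1" by simp
      moreover have "2 * pi * norm (Ds s u) = exp (\<sigma> * u) * norm (E u)"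
        using arg_cong[OF DsE[of u], of norm] by (simp add: norm_mult)
      ultimately have "2 * pi * norm (Ds s u) \<le> exp 1 * norm (E u)" by (simp add: mult_right_mono)
      then have "(2 * pi * norm (Ds s u))\<^sup>2 \<le> (exp 1 * norm (E u))\<^sup>2" by (intro power_mono) auto
      then show ?thesis by (simp add: power_mult_distrib field_simps flip: exp_double)
    qed
    have "(\<integral>\<^sup>+u. ennreal ((norm (Ds s u))\<^sup>2) * indicator {0..U} u \<partial>lborel) \<le>
       (\<integral>\<^sup>+u. ennreal (exp 2 / (4 * pi\<^sup>2)) * (ennreal ((norm (E u))\<^sup>2) * indicator {-U..U} u) \<partial>lborel)"
    proof (rule nn_integral_mono)
      fix u
      show "ennreal ((norm (Ds s u))\<^sup>2) * indicator {0..U} u \<le> ennreal (exp 2 / (4 * pi\<^sup>2)) * (ennreal ((norm (E u))\<^sup>2) * indicator {-U..U} u)"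
      proof (cases "u \<in> {0..U}")
        case True
        then show ?thesis using nDs[of u] U by (auto simp: ennreal_mult'[symmetric] intro!: ennreal_leI)
      qed simp
    qed
    also have "\<dots> = ennreal (exp 2 / (4 * pi\<^sup>2)) * (\<integral>\<^sup>+u. ennreal ((norm (E u))\<^sup>2) * indicator {-U..U} u \<partial>lborel)"
    proof (rule nn_integral_cmult)
      have [measurable]: "\<Psi> \<in> borel_measurable borel" using int\<Psi> by auto
      show "(\<lambda>u. ennreal ((norm (E u))\<^sup>2) * indicator {-U..U} u) \<in> borel_measurable lborel"
        unfolding E_def by measurable
    qed
    also have "\<dots> \<le> ennreal (exp 2 / (4 * pi\<^sup>2)) * (ennreal (2 * pi * exp (1/2)) * (\<integral>\<^sup>+t. ennreal ((norm (\<Psi> t))\<^sup>2) \<partial>lborel))"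
      unfolding E_def using U by (intro mult_left_mono Plancherel_le int\<Psi>) auto
    also have "(\<integral>\<^sup>+t. ennreal ((norm (\<Psi> t))\<^sup>2) \<partial>lborel) \<le> (\<integral>\<^sup>+t. ennreal (exp 1) * ennreal ((norm (\<Phi> (Complex \<sigma> t)))\<^sup>2) \<partial>lborel)"
    proof (rule nn_integral_mono)
      fix t
      have "norm (exp (of_real (s\<^sup>2 / 2) * (Complex \<sigma> t)\<^sup>2)) = exp (s\<^sup>2 * \<sigma>\<^sup>2 / 2) * exp (- (s * t)\<^sup>2 / 2)"
        using norm_exp_gaussian[of s \<sigma> t 0] by simp
      also have "\<dots> \<le> exp (1/2) * 1"
      proof (intro mult_mono)
        have "s\<^sup>2 * \<sigma>\<^sup>2 \<le> 1 * 1" using s \<sigma> by (intro mult_mono) (auto simp: power_le_one)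
        then show "exp (s\<^sup>2 * \<sigma>\<^sup>2 / 2) \<le> exp (1 / 2)" by simp
      qed auto
      finally have "norm (\<Psi> t) \<le> norm (\<Phi> (Complex \<sigma> t)) * exp (1/2)"
        unfolding \<Psi>_def norm_mult by (intro mult_left_mono) auto
      then have "(norm (\<Psi> t))\<^sup>2 \<le> (norm (\<Phi> (Complex \<sigma> t)) * exp (1/2))\<^sup>2" by (intro power_mono) auto
      also have "\<dots> = exp 1 * (norm (\<Phi> (Complex \<sigma> t)))\<^sup>2" by (simp add: power_mult_distrib flip: exp_double)
      finally show "ennreal ((norm (\<Psi> t))\<^sup>2) \<le> ennreal (exp 1) * ennreal ((norm (\<Phi> (Complex \<sigma> t)))\<^sup>2)"
        by (simp add: ennreal_mult'[symmetric] ennreal_leI)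
    qed
    also have "\<dots> = ennreal (exp 1) * (\<integral>\<^sup>+t. ennreal ((norm (\<Phi> (Complex \<sigma> t)))\<^sup>2) \<partial>lborel)"
    proof (rule nn_integral_cmult)
      have "continuous_on UNIV (\<lambda>t. \<Phi> (Complex \<sigma> t))"
        by (rule continuous_on_compose2[OF holomorphic_on_imp_continuous_on[OF hol]])
           (use \<sigma> in \<open>auto intro!: continuous_intros\<close>)
      then have [measurable]: "(\<lambda>t. \<Phi> (Complex \<sigma> t)) \<in> borel_measurable borel" by (rule borel_measurable_continuous_onI)
      show "(\<lambda>t. ennreal ((norm (\<Phi> (Complex \<sigma> t)))\<^sup>2)) \<in> borel_measurable lborel" by measurable
    qed
    also have "\<dots> \<le> ennreal (exp 1) * M" by (intro mult_left_mono M \<sigma>) auto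
    also have "ennreal (exp 2 / (4 * pi\<^sup>2)) * (ennreal (2 * pi * exp (1/2)) * (ennreal (exp 1) * M)) = 
       ennreal (exp 2 / (4 * pi\<^sup>2) * (2 * pi * exp (1/2)) * exp 1) * M"
    proof -
      have "ennreal x * (ennreal y * (ennreal z * M)) = ennreal (x * y * z) * M" if "0 \<le> x" "0 \<le> y" "0 \<le> z" for x y z
        using that by (simp add: ennreal_mult mult.assoc)
      then show ?thesis by simp
    qed
    also have "\<dots> \<le> ennreal (exp 4) * M"
    proof (intro mult_right_mono ennreal_leI)
      \<comment> \<open>The factors come from exp (\<sigma> u), from the Plancherel constant and
        from the Gaussian in \<Psi>; together they are exp (7/2) / (2 pi).\<close>
      have "exp 2 / (4 * pi\<^sup>2) * (2 * pi * exp (1/2)) * exp 1 = exp 2 * exp (1/2) * exp 1 / (2 * pi)"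
        by (simp add: power2_eq_square field_simps)
      also have "exp 2 * exp (1/2) * exp (1::real) = exp (7/2)" by (simp flip: exp_add)
      also have "exp (7/2) / (2 * pi) \<le> exp 4 / 1" using pi_gt3 by (intro frac_le) auto
      finally show "exp 2 / (4 * pi\<^sup>2) * (2 * pi * exp (1/2)) * exp 1 \<le> exp 4" by simp
    qed simp
    finally show ?thesis by (simp add: mult_left_mono)
  qed
  have fin: "(\<integral>\<^sup>+u. ennreal ((norm (D u))\<^sup>2) * indicator {0..U} u \<partial>lborel) \<le> ennreal (exp 4) * M" if U: "1 \<le> U" for U
  proof -
    have [measurable]: "(\<lambda>u. Ds s u) \<in> borel_measurable borel" for s unfolding Ds_def by measurable
    have "(\<integral>\<^sup>+u. ennreal ((norm (D u))\<^sup>2) * indicator {0..U} u \<partial>lborel) =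
       (\<integral>\<^sup>+u. liminf (\<lambda>k. ennreal ((norm (Ds (1 / real (Suc k)) u))\<^sup>2) * indicator {0..U} u) \<partial>lborel)"
    proof (rule nn_integral_cong_AE)
      show "AE u in lborel. ennreal ((norm (D u))\<^sup>2) * indicator {0..U} u = liminf (\<lambda>k. ennreal ((norm (Ds (1 / real (Suc k)) u))\<^sup>2) * indicator {0..U} u)"
        using cont
      proof eventually_elim
        case (elim u)
        have "(\<lambda>k. Ds (1 / real (Suc k)) u) \<longlonglongrightarrow> D u"
          unfolding Ds_def by (rule Gaussian_smoothing_tendsto[OF D bd' elim])
        then have "(\<lambda>k. ennreal ((norm (Ds (1 / real (Suc k)) u))\<^sup>2)) \<longlonglongrightarrow> ennreal ((norm (D u))\<^sup>2)"
          by (intro tendsto_ennrealI tendsto_power tendsto_norm)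
        then have "(\<lambda>k. ennreal ((norm (Ds (1 / real (Suc k)) u))\<^sup>2) * indicator {0..U} u) \<longlonglongrightarrow> ennreal ((norm (D u))\<^sup>2) * indicator {0..U} u"
          by (cases "u \<in> {0..U}") auto
        then show ?case by (simp add: lim_imp_Liminf)
      qed
    qed
    \<comment> \<open>Fatou: almost every u is a point of continuity of D, where the smoothed
      functions converge to D u.\<close>
    also have "\<dots> \<le> liminf (\<lambda>k. \<integral>\<^sup>+u. ennreal ((norm (Ds (1 / real (Suc k)) u))\<^sup>2) * indicator {0..U} u \<partial>lborel)"
      by (rule nn_integral_liminf) measurable
    also have "\<dots> \<le> liminf (\<lambda>k. ennreal (exp 4) * M)"
      by (intro Liminf_mono always_eventually allI smooth U) auto
    finally show ?thesis by (simp add: Liminf_const)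
  qed
  have "(\<integral>\<^sup>+u. ennreal ((norm (D u))\<^sup>2) * indicator {0..} u \<partial>lborel) =
     (\<integral>\<^sup>+u. (SUP k. ennreal ((norm (D u))\<^sup>2) * indicator {0..real (Suc k)} u) \<partial>lborel)"
  proof (rule nn_integral_cong)
    fix u :: real
    show "ennreal ((norm (D u))\<^sup>2) * indicator {0..} u = (SUP k. ennreal ((norm (D u))\<^sup>2) * indicator {0..real (Suc k)} u)"
    proof (cases "0 \<le> u")
      case True
      obtain n :: nat where n: "u \<le> real n" using real_arch_simple by blast
      show ?thesis
      proof (rule antisym)
        have "ennreal ((norm (D u))\<^sup>2) * indicator {0..} u = ennreal ((norm (D u))\<^sup>2) * indicator {0..real (Suc n)} u"
          using True n by simp
        also have "\<dots> \<le> (SUP k. ennreal ((norm (D u))\<^sup>2) * indicator {0..real (Suc k)} u)"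
          by (rule SUP_upper) simp
        finally show "ennreal ((norm (D u))\<^sup>2) * indicator {0..} u \<le> (SUP k. ennreal ((norm (D u))\<^sup>2) * indicator {0..real (Suc k)} u)" .
        show "(SUP k. ennreal ((norm (D u))\<^sup>2) * indicator {0..real (Suc k)} u) \<le> ennreal ((norm (D u))\<^sup>2) * indicator {0..} u"
          by (intro SUP_least mult_left_mono) (auto simp: indicator_def)
      qed
    qed simp
  qed
  also have "\<dots> = (SUP k. \<integral>\<^sup>+u. ennreal ((norm (D u))\<^sup>2) * indicator {0..real (Suc k)} u \<partial>lborel)"
    by (intro nn_integral_monotone_convergence_SUP)
       (auto simp: incseq_def le_fun_def intro!: mult_left_mono split: split_indicator)
  also have "\<dots> \<le> ennreal (exp 4) * M"
    by (intro SUP_least fin) simp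
  finally show ?thesis .
qed

section \<open>Step sums and Euler products\<close>

text \<open>The transform of a unit jump at c, from which that of a step function follows by
  summation.\<close>

lemma exp_halfline_integral:
  fixes z :: complex and c :: real
  assumes z: "Re z > 0"
  shows integrable_exp_halfline: "integrable lborel (\<lambda>v. indicator {c..} v *\<^sub>R exp (- z * of_real v))"
    and integral_exp_halfline: "(LINT v|lborel. indicator {c..} v *\<^sub>R exp (- z * of_real v)) = exp (- z * of_real c) / z"
    and integral_norm_exp_halfline: "(LINT v|lborel. norm (indicator {c..} v *\<^sub>R exp (- z * of_real v))) = exp (- Re z * c) / Re z"
proof -
  have nrm: "norm (indicator {c..} v *\<^sub>R exp (- z * of_real v)) = indicator {c..} v * exp (- Re z * v)" for v :: real
    by (simp add: norm_exp_eq_Re)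
  have "((\<lambda>x. exp (- Re z * x)) has_integral exp (- Re z * c) / Re z) {c..}"
    by (rule has_integral_exp_minus_to_infinity) fact
  from nn_integral_has_integral_lebesgue[OF _ this]
  have nn: "(\<integral>\<^sup>+v. ennreal (indicator {c..} v * exp (- Re z * v)) \<partial>lborel) = ennreal (exp (- Re z * c) / Re z)" by simp
  show int: "integrable lborel (\<lambda>v. indicator {c..} v *\<^sub>R exp (- z * of_real v))"
    by (rule integrableI_bounded) (measurable, simp only: nrm nn, simp)
  show "(LINT v|lborel. norm (indicator {c..} v *\<^sub>R exp (- z * of_real v))) = exp (- Re z * c) / Re z"
    unfolding nrm using nn z by (subst integral_eq_nn_integral) (auto simp: nn)
  have z0: "z \<noteq> 0" using z by auto
  have fin: "(LINT v|lborel. indicator {c..c + real n} v *\<^sub>R exp (- z * of_real v)) =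
      (exp (- z * of_real c) - exp (- z * of_real (c + real n))) / z" for n
  proof -
    have "((\<lambda>v. exp (- z * of_real v)) has_integral
       (- exp (- z * of_real (c + real n)) / z - (- exp (- z * of_real c) / z))) {c..c + real n}"
    proof (rule fundamental_theorem_of_calculus)
      fix v assume "v \<in> {c..c + real n}"
      have "((\<lambda>w. - exp (- z * w) / z) has_field_derivative exp (- z * of_real v)) (at (of_real v))"
        using z0 by (auto intro!: derivative_eq_intros)
      then show "((\<lambda>v. - exp (- z * of_real v) / z) has_vector_derivative exp (- z * of_real v)) (at v within {c..c + real n})"
        by (rule has_vector_derivative_real_field)
    qed simp
    then have "integral {c..c + real n} (\<lambda>v. exp (- z * of_real v)) = - exp (- z * of_real (c + real n)) / z - (- exp (- z * of_real c) / z)"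
      by (rule integral_unique)
    moreover have "(LINT v:{c..c + real n}|lborel. exp (- z * of_real v)) = integral {c..c + real n} (\<lambda>v. exp (- z * of_real v))"
      by (intro set_borel_integral_eq_integral borel_integrable_atLeastAtMost' continuous_intros)
    ultimately show ?thesis
      unfolding set_lebesgue_integral_def by (simp add: diff_divide_distrib)
  qed
  have "(\<lambda>n. LINT v|lborel. indicator {c..c + real n} v *\<^sub>R exp (- z * of_real v)) \<longlonglongrightarrow>
     (LINT v|lborel. indicator {c..} v *\<^sub>R exp (- z * of_real v))"
  proof (rule integral_dominated_convergence)
    show "integrable lborel (\<lambda>v. norm (indicator {c..} v *\<^sub>R exp (- z * of_real v)))" by (rule integrable_norm[OF int])
    show "AE v in lborel. (\<lambda>n. indicator {c..c + real n} v *\<^sub>R exp (- z * of_real v)) \<longlonglongrightarrow> indicator {c..} v *\<^sub>R exp (- z * of_real v)"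
    proof (intro AE_I2 tendsto_eventually)
      fix v
      obtain k :: nat where k: "v - c \<le> real k" using real_arch_simple by blast
      have "indicator {c..c + real n} v = (indicator {c..} v :: real)" if "k \<le> n" for n
      proof -
        have "v \<le> c + real n" using k that by linarith
        then show ?thesis by (simp add: indicator_def)
      qed
      then show "\<forall>\<^sub>F n in sequentially. indicator {c..c + real n} v *\<^sub>R exp (- z * of_real v) = indicator {c..} v *\<^sub>R exp (- z * of_real v)"
        by (intro eventually_sequentiallyI[of k]) simp
    qed
    show "AE v in lborel. norm (indicator {c..c + real n} v *\<^sub>R exp (- z * of_real v)) \<le> norm (indicator {c..} v *\<^sub>R exp (- z * of_real v))" for n
      by (intro AE_I2) (auto simp: indicator_def)
  qed measurable
  moreover have "(\<lambda>n. LINT v|lborel. indicator {c..c + real n} v *\<^sub>R exp (- z * of_real v)) \<longlonglongrightarrow> (exp (- z * of_real c) - 0) / z"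
    unfolding fin
  proof (intro tendsto_divide tendsto_diff tendsto_const z0)
    have "(\<lambda>n. exp (- Re z * (c + real n))) \<longlonglongrightarrow> 0" using z by real_asymp
    moreover have "norm (exp (- z * of_real (c + real n))) = exp (- Re z * (c + real n))" for n
      by (simp only: norm_exp_eq_Re) simp
    ultimately have "(\<lambda>n. norm (exp (- z * of_real (c + real n)))) \<longlonglongrightarrow> 0" by (simp only:)
    then show "(\<lambda>n. exp (- z * of_real (c + real n))) \<longlonglongrightarrow> 0" by (rule tendsto_norm_zero_cancel)
  qed
  ultimately have "(LINT v|lborel. indicator {c..} v *\<^sub>R exp (- z * of_real v)) = (exp (- z * of_real c) - 0) / z"
    by (rule LIMSEQ_unique)
  then show "(LINT v|lborel. indicator {c..} v *\<^sub>R exp (- z * of_real v)) = exp (- z * of_real c) / z"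
    by (simp only: diff_zero)
qed

text \<open>The frequencies need not be increasing or distinct: every index is tested for l n <= u,
  so prime powers may be listed in any order.\<close>

definition step_sum :: "(nat \<Rightarrow> complex) \<Rightarrow> (nat \<Rightarrow> real) \<Rightarrow> real \<Rightarrow> complex" where
  "step_sum a l u = (\<Sum>n. if l n \<le> u then a n else 0)"

context
  fixes a :: "nat \<Rightarrow> complex" and l :: "nat \<Rightarrow> real" and b :: real
  assumes l: "\<And>n. 0 \<le> l n" and b: "0 \<le> b" and sum: "summable (\<lambda>n. norm (a n) * exp (- b * l n))"
begin

text \<open>Rankin's trick: for b >= 0 the indicator of l n <= u is at most exp (b (u - l n)), which
  turns convergence at b into growth exp (b u).\<close>

lemma step_sum_term_le: "norm (if l n \<le> u then a n else 0) \<le> norm (a n) * exp (- b * l n) * exp (b * u)"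
proof (cases "l n \<le> u")
  case True
  then have "b * l n \<le> b * u" using b by (rule mult_left_mono)
  then have "norm (a n) * 1 \<le> norm (a n) * exp (- b * l n + b * u)" by (intro mult_left_mono) auto
  then show ?thesis using True by (simp only: if_True exp_add mult.assoc mult_1_right)
qed simp

lemma step_sum_summable: "summable (\<lambda>n. norm (if l n \<le> u then a n else 0))"
  by (rule summable_comparison_test'[OF summable_mult2[OF sum, of "exp (b * u)"]])
     (simp only: real_norm_def abs_norm_cancel step_sum_term_le)

lemma norm_step_sum_le: "norm (step_sum a l u) \<le> (\<Sum>n. norm (a n) * exp (- b * l n)) * exp (b * u)"
proof -
  have "norm (step_sum a l u) \<le> (\<Sum>n. norm (if l n \<le> u then a n else 0))"
    unfolding step_sum_def by (rule summable_norm[OF step_sum_summable])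
  also have "\<dots> \<le> (\<Sum>n. norm (a n) * exp (- b * l n) * exp (b * u))"
    by (intro suminf_le step_sum_summable summable_mult2 sum step_sum_term_le)
  also have "\<dots> = (\<Sum>n. norm (a n) * exp (- b * l n)) * exp (b * u)"
    by (rule suminf_mult2[symmetric, OF sum])
  finally show ?thesis .
qed

lemma step_sum_neg: "u < 0 \<Longrightarrow> step_sum a l u = 0"
proof -
  assume "u < 0"
  then have "\<not> l n \<le> u" for n using l[of n] by linarith
  then show ?thesis by (simp add: step_sum_def)
qed

lemma step_sum_measurable [measurable]: "step_sum a l \<in> borel_measurable borel"
  unfolding step_sum_def by measurable

text \<open>Off the jumps each term is locally constant, and Tannery's theorem passes to the sum,
  with the majorant at u + 1 valid for all v near u. Points of continuity matter because smoothing
  recovers a function only there.\<close>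

lemma isCont_step_sum:
  assumes u: "u \<notin> range l"
  shows "isCont (step_sum a l) u"
proof -
  have "((\<lambda>v. suminf (\<lambda>n. if l n \<le> v then a n else 0)) \<longlongrightarrow> suminf (\<lambda>n. if l n \<le> u then a n else 0)) (at u)"
  proof (rule conjunct2[OF conjunct2[OF tannerys_theorem]])
    show "((\<lambda>v. if l n \<le> v then a n else 0) \<longlongrightarrow> (if l n \<le> u then a n else 0)) (at u)" for n
    proof (rule tendsto_eventually)
      have ne: "l n \<noteq> u" using u by auto
      show "\<forall>\<^sub>F v in at u. (if l n \<le> v then a n else 0) = (if l n \<le> u then a n else 0)"
      proof (cases "l n < u")
        case True
        have "\<forall>\<^sub>F v in at u. l n < v" by (rule order_tendstoD[OF tendsto_ident_at True])
        then show ?thesis by eventually_elim (use True in auto)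
      next
        case False
        then have "u < l n" using ne by simp
        from order_tendstoD(2)[OF tendsto_ident_at this] have "\<forall>\<^sub>F v in at u. v < l n" .
        then show ?thesis by eventually_elim (use \<open>u < l n\<close> in auto)
      qed
    qed
    show "summable (\<lambda>n. norm (a n) * exp (- b * l n) * exp (b * (u + 1)))"
      by (rule summable_mult2[OF sum])
    have "\<forall>\<^sub>F v in at u. v < u + 1" by (rule order_tendstoD[OF tendsto_ident_at]) simp
    from eventually_prodI[OF always_eventually[OF allI[OF TrueI]] this]
    show "\<forall>\<^sub>F (n, v) in sequentially \<times>\<^sub>F at u. norm (if l n \<le> v then a n else 0) \<le> norm (a n) * exp (- b * l n) * exp (b * (u + 1))"
    proof eventually_elim
      case (elim x)
      obtain n v where x: "x = (n, v)" by force
      have "b * v \<le> b * (u + 1)" using elim b by (intro mult_left_mono) (auto simp: x)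
      then have "norm (a n) * exp (- b * l n) * exp (b * v) \<le> norm (a n) * exp (- b * l n) * exp (b * (u + 1))"
        by (intro mult_left_mono) auto
      then show ?case using step_sum_term_le[of n v] by (simp add: x)
    qed
  qed simp
  then show ?thesis unfolding isCont_def step_sum_def .
qed

lemma step_sum_transform:
  assumes z: "b < Re z"
  shows "integrable lborel (\<lambda>v. step_sum a l v * exp (- z * of_real v))"
    and "(LINT v|lborel. step_sum a l v * exp (- z * of_real v)) = (\<Sum>n. a n * exp (- z * of_real (l n))) / z"
proof -
  have z0: "Re z > 0" using z b by simp
  define f where "f = (\<lambda>n v. a n * (indicator {l n..} v *\<^sub>R exp (- z * of_real v)))"
  have feq: "f n v = (if l n \<le> v then a n else 0) * exp (- z * of_real v)" for n v
    by (simp add: f_def indicator_def)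
  have int: "integrable lborel (f n)" for n
    unfolding f_def by (intro integrable_mult_right integrable_exp_halfline z0)
  have "summable (\<lambda>n. norm (a n) * exp (- Re z * l n))"
  proof (rule summable_comparison_test'[OF sum])
    fix n
    have "b * l n \<le> Re z * l n" using z l by (intro mult_right_mono) auto
    then show "norm (norm (a n) * exp (- Re z * l n)) \<le> norm (a n) * exp (- b * l n)"
      by (simp add: mult_left_mono)
  qed
  from summable_divide[OF this, of "Re z"]
  have sumint: "summable (\<lambda>n. LINT v|lborel. norm (f n v))"
    unfolding f_def norm_mult integral_mult_right_zero integral_norm_exp_halfline[OF z0] by simp
  have AE: "AE v in lborel. summable (\<lambda>n. norm (f n v))"
    unfolding feq norm_mult by (intro AE_I2 summable_mult2 step_sum_summable)
  have eq: "(\<lambda>v. \<Sum>n. f n v) = (\<lambda>v. step_sum a l v * exp (- z * of_real v))"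
    unfolding feq step_sum_def
    by (intro ext suminf_mult2[symmetric] summable_norm_cancel[OF step_sum_summable])
  show "integrable lborel (\<lambda>v. step_sum a l v * exp (- z * of_real v))"
    using integrable_suminf[OF int AE sumint] unfolding eq .
  have "(LINT v|lborel. step_sum a l v * exp (- z * of_real v)) = (\<Sum>n. LINT v|lborel. f n v)"
    using integral_suminf[OF int AE sumint] unfolding eq .
  also have "\<dots> = (\<Sum>n. a n * exp (- z * of_real (l n)) / z)"
    unfolding f_def integral_mult_right_zero integral_exp_halfline[OF z0] by simp
  also have "\<dots> = (\<Sum>n. a n * exp (- z * of_real (l n))) / z"
  proof (rule suminf_divide)
    show "summable (\<lambda>n. a n * exp (- z * of_real (l n)))"
      by (rule summable_norm_cancel, rule summable_comparison_test'[OF \<open>summable (\<lambda>n. norm (a n) * exp (- Re z * l n))\<close>])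
         (simp add: norm_mult norm_exp_eq_Re)
  qed
  finally show "(LINT v|lborel. step_sum a l v * exp (- z * of_real v)) = (\<Sum>n. a n * exp (- z * of_real (l n))) / z" .
qed

lemma exp_series_derivative:
  "\<exists>g g'. \<forall>z. b < Re z \<longrightarrow> (\<lambda>n. a n * exp (- z * of_real (l n))) sums g z \<and>
     (\<lambda>n. - of_real (l n) * a n * exp (- z * of_real (l n))) sums g' z \<and>
     (g has_field_derivative g' z) (at z)"
proof -
  have "\<exists>g g'. \<forall>z\<in>{z. b < Re z}. (\<lambda>n. a n * exp (- z * of_real (l n))) sums g z \<and>
     (\<lambda>n. - of_real (l n) * a n * exp (- z * of_real (l n))) sums g' z \<and>
     (g has_field_derivative g' z) (at z)"
  proof (rule series_and_derivative_comparison_complex)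
    show "open {z. b < Re z}" by (rule open_halfspace_Re_gt)
    show "((\<lambda>z. a n * exp (- z * of_real (l n))) has_field_derivative - of_real (l n) * a n * exp (- z * of_real (l n))) (at z)" for n z
      by (auto intro!: derivative_eq_intros)
    fix x assume x: "x \<in> {z. b < Re z}"
    show "\<exists>d h. 0 < d \<and> summable h \<and> range h \<subseteq> \<real>\<^sub>\<ge>\<^sub>0 \<and>
       (\<forall>\<^sub>F n in sequentially. \<forall>y\<in>ball x d \<inter> {z. b < Re z}. norm (a n * exp (- y * of_real (l n))) \<le> cmod (h n))"
    proof (rule exI[of _ 1], rule exI[of _ "\<lambda>n. complex_of_real (norm (a n) * exp (- b * l n))"], intro conjI)
      show "(0::real) < 1" by simp
      show "summable (\<lambda>n. complex_of_real (norm (a n) * exp (- b * l n)))" using sum by (rule summable_of_real)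
      show "range (\<lambda>n. complex_of_real (norm (a n) * exp (- b * l n))) \<subseteq> \<real>\<^sub>\<ge>\<^sub>0" by (auto simp del: of_real_mult)
      show "\<forall>\<^sub>F n in sequentially. \<forall>y\<in>ball x 1 \<inter> {z. b < Re z}. norm (a n * exp (- y * of_real (l n))) \<le> norm (complex_of_real (norm (a n) * exp (- b * l n)))"
      proof (intro always_eventually allI ballI)
        fix n y assume "y \<in> ball x 1 \<inter> {z. b < Re z}"
        then have "b * l n \<le> Re y * l n" using l by (intro mult_right_mono) auto
        then have "norm (a n) * exp (- Re y * l n) \<le> norm (a n) * exp (- b * l n)" by (intro mult_left_mono) auto
        then show "norm (a n * exp (- y * of_real (l n))) \<le> norm (complex_of_real (norm (a n) * exp (- b * l n)))"
          unfolding norm_mult norm_of_real by (simp add: norm_exp_eq_Re abs_mult)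
      qed
    qed
  qed
  then show ?thesis by simp
qed

end

section \<open>Logarithms of Euler products\<close>

text \<open>Apart from finitely many p, the powers of exponent at least K + 1 sum to O(p^(- \<sigma>
  (K + 1))), which is summable over p because \<sigma> (K + 1) > 1. At the finitely many exceptional
  p only x < 1 is used.\<close>

lemma geometric_family_summable_aux:
  fixes x :: "nat \<Rightarrow> 'n::finite \<Rightarrow> real"
  assumes P: "P \<subseteq> {2..}" and x0: "\<And>p j. p \<in> P \<Longrightarrow> 0 \<le> x p j" and x1: "\<And>p j. p \<in> P \<Longrightarrow> x p j < 1"
    and fin: "finite {p\<in>P. \<exists>j. x p j > real p powr - \<sigma>}" and \<sigma>: "0 < \<sigma>" "1 < \<sigma> * real (Suc K)"
  shows "(\<lambda>(p, k). \<Sum>j\<in>UNIV. x p j ^ (Suc K + k)) summable_on (P \<times> UNIV)"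
proof -
  define f where "f = (\<lambda>(p, k). \<Sum>j\<in>UNIV. x p j ^ (Suc K + k))"
  have f0: "0 \<le> f (p, k)" if "p \<in> P" for p k
    unfolding f_def using x0[OF that] by (auto intro!: sum_nonneg)
  define s where "s = (\<lambda>p. \<Sum>j\<in>UNIV. x p j ^ Suc K / (1 - x p j))"
  have inner: "((\<lambda>k. f (p, k)) has_sum s p) UNIV" if p: "p \<in> P" for p
  proof (rule norm_summable_imp_has_sum)
    have "(\<lambda>k. \<Sum>j\<in>UNIV. x p j ^ Suc K * x p j ^ k) sums (\<Sum>j\<in>UNIV. x p j ^ Suc K * (1 / (1 - x p j)))"
      by (intro sums_sum sums_mult geometric_sums) (use x0[OF p] x1[OF p] in auto)
    then show sums: "(\<lambda>k. f (p, k)) sums s p" by (simp add: f_def s_def power_add mult.assoc)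
    have "(\<lambda>k. norm (f (p, k))) = (\<lambda>k. f (p, k))" using f0[OF p] by simp
    then show "summable (\<lambda>k. norm (f (p, k)))" using sums by (simp only: sums_summable)
  qed
  have norm_inner: "infsum (\<lambda>k. norm (f (p, k))) UNIV = s p" if p: "p \<in> P" for p
    using infsumI[OF inner[OF p]] f0[OF p] by simp
  define B where "B = {p\<in>P. \<exists>j. x p j > real p powr - \<sigma>}"
  have s0: "0 \<le> s p" if "p \<in> P" for p
    unfolding s_def using x0[OF that] x1[OF that] by (intro sum_nonneg) (auto simp: less_imp_le)
  have "s summable_on (B \<union> (P - B))"
  proof (rule summable_on_Un_disjoint)
    show "s summable_on B" using fin unfolding B_def by simp
    define C where "C = real CARD('n) / (1 - 2 powr - \<sigma>)"
    have c1: "(2::real) powr - \<sigma> < 1" using \<sigma> by (simp add: powr_less_one)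
    show "s summable_on (P - B)"
    proof (rule summable_on_comparison_test)
      have "summable (\<lambda>p. real p powr - (\<sigma> * real (Suc K)))"
        using \<sigma> by (subst summable_real_powr_iff) linarith
      then have "summable (\<lambda>p. C * real p powr - (\<sigma> * real (Suc K)))" by (rule summable_mult)
      moreover have "C \<ge> 0" using c1 by (simp add: C_def)
      ultimately have "(\<lambda>p. C * real p powr - (\<sigma> * real (Suc K))) summable_on UNIV"
        by (subst summable_on_UNIV_nonneg_real_iff) auto
      then show "(\<lambda>p. C * real p powr - (\<sigma> * real (Suc K))) summable_on (P - B)"
        by (rule summable_on_subset_banach) simp
      fix p assume p: "p \<in> P - B"
      then have p2: "p \<ge> 2" using P by auto
      have "s p \<le> (\<Sum>j\<in>(UNIV::'n set). real p powr - (\<sigma> * real (Suc K)) / (1 - 2 powr - \<sigma>))"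
        unfolding s_def
      proof (intro sum_mono frac_le)
        fix j
        have xj: "0 \<le> x p j" "x p j \<le> real p powr - \<sigma>" using p x0 unfolding B_def by (auto simp: not_less)
        then have "x p j ^ Suc K \<le> (real p powr - \<sigma>) ^ Suc K" by (intro power_mono)
        also have "\<dots> = real p powr - (\<sigma> * real (Suc K))"
          using p2 by (subst powr_realpow[symmetric]) (auto simp: powr_powr simp del: power_Suc)
        finally show "x p j ^ Suc K \<le> real p powr - (\<sigma> * real (Suc K))" .
        have "real p powr - \<sigma> \<le> 2 powr - \<sigma>" using p2 \<sigma> by (intro powr_mono2') auto
        then show "1 - 2 powr - \<sigma> \<le> 1 - x p j" using xj by simp
      qed (use c1 in auto)
      also have "\<dots> = C * real p powr - (\<sigma> * real (Suc K))" by (simp add: C_def)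
      finally show "s p \<le> C * real p powr - (\<sigma> * real (Suc K))" .
      show "0 \<le> s p" using s0 p by simp
    qed
  qed (auto simp: B_def)
  also have "B \<union> (P - B) = P" by (auto simp: B_def)
  finally have "s summable_on P" .
  then have "(\<lambda>p. norm (infsum (\<lambda>k. norm (f (p, k))) UNIV)) summable_on P"
    using norm_inner s0 by (simp cong: summable_on_cong)
  moreover have "(\<lambda>k. norm (f (p, k))) summable_on UNIV" if "p \<in> P" for p
    using inner[OF that] f0[OF that] by (auto simp: summable_on_def)
  ultimately have "(\<lambda>x. norm (f x)) summable_on (P \<times> UNIV)"
    unfolding Infinite_Sum.abs_summable_on_Sigma_iff by blast
  then have "f summable_on (P \<times> UNIV)" by (rule Infinite_Sum.abs_summable_summable)
  then show ?thesis by (simp add: f_def)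
qed

lemma geometric_family_summable:
  fixes x :: "nat \<Rightarrow> 'n::finite \<Rightarrow> real"
  assumes "P \<subseteq> {2..}" "\<And>p j. p \<in> P \<Longrightarrow> 0 \<le> x p j" "\<And>p j. p \<in> P \<Longrightarrow> x p j < 1"
    and "finite {p\<in>P. \<exists>j. x p j > real p powr - \<sigma>}" and "0 < \<sigma>" "1 < \<sigma> * real (Suc K)"
  shows "(\<lambda>(p, k). \<Sum>j\<in>UNIV. x p j ^ Suc k) summable_on (P \<times> {K..})"
proof -
  let ?h = "\<lambda>(p::nat, k::nat). (p, K + k)"
  have "inj_on ?h (P \<times> UNIV)" by (auto simp: inj_on_def)
  moreover have "?h ` (P \<times> UNIV) = P \<times> {K..}" 
    by (auto simp: image_iff le_iff_add intro!: bexI)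
  moreover have "(\<lambda>(p, k). \<Sum>j\<in>UNIV. x p j ^ Suc k) \<circ> ?h = (\<lambda>(p, k). \<Sum>j\<in>UNIV. x p j ^ (Suc K + k))"
    by (auto simp: fun_eq_iff)
  ultimately show ?thesis
    using geometric_family_summable_aux[OF assms] summable_on_reindex[of ?h "P \<times> UNIV" "\<lambda>(p, k). \<Sum>j\<in>UNIV. x p j ^ Suc k"]
    by simp
qed

text \<open>Coefficients of the logarithm of the Euler product: the power sum of the parameters
  divided by the exponent. The index k stands for the exponent k + 1, here and in
  \<open>euler_freq\<close>, whose value is ln (p^(k+1)).\<close>

definition euler_coeff :: "(nat \<Rightarrow> 'n::finite \<Rightarrow> complex) \<Rightarrow> nat \<times> nat \<Rightarrow> complex" where
  "euler_coeff \<beta> = (\<lambda>(p, k). if prime p then (\<Sum>j\<in>UNIV. \<beta> p j ^ Suc k) / of_nat (Suc k) else 0)"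

definition euler_freq :: "nat \<times> nat \<Rightarrow> real" where
  "euler_freq = (\<lambda>(p, k). real (Suc k) * ln (real p))"

lemma euler_freq_nonneg: "0 \<le> euler_freq i"
proof -
  have "0 \<le> ln (real p)" for p by (cases "p = 0") auto
  then show ?thesis by (auto simp: euler_freq_def split: prod.splits intro!: mult_nonneg_nonneg)
qed

lemma exp_euler_freq:
  assumes "(p::nat) > 0"
  shows "exp (- \<sigma> * euler_freq (p, k)) = (real p powr - \<sigma>) ^ Suc k"
    and "exp (- s * of_real (euler_freq (p, k))) = (of_nat p powr (- s) :: complex) ^ Suc k"
proof -
  have "exp (- \<sigma> * euler_freq (p, k)) = exp (real (Suc k) * (- \<sigma> * ln (real p)))"
    by (simp add: euler_freq_def algebra_simps)
  also have "\<dots> = (real p powr - \<sigma>) ^ Suc k"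
    unfolding exp_of_nat_mult using assms by (simp add: powr_def)
  finally show "exp (- \<sigma> * euler_freq (p, k)) = (real p powr - \<sigma>) ^ Suc k" .
  have "exp (- s * of_real (euler_freq (p, k))) = exp (of_nat (Suc k) * (- s * of_real (ln (real p))))"
    by (simp add: euler_freq_def algebra_simps)
  also have "\<dots> = (of_nat p powr (- s)) ^ Suc k"
    unfolding exp_of_nat_mult using assms by (simp add: powr_def Ln_of_nat)
  finally show "exp (- s * of_real (euler_freq (p, k))) = (of_nat p powr (- s) :: complex) ^ Suc k" .
qed

lemma norm_euler_term_le:
  "norm (euler_coeff \<beta> (p, k)) * exp (- \<sigma> * euler_freq (p, k)) \<le>
     (if prime p then \<Sum>j\<in>UNIV. (norm (\<beta> p j) * real p powr - \<sigma>) ^ Suc k else 0)"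
proof (cases "prime p")
  case True
  then have p: "p > 0" by (rule prime_gt_0_nat)
  have "norm (euler_coeff \<beta> (p, k)) = norm (\<Sum>j\<in>UNIV. \<beta> p j ^ Suc k) / real (Suc k)"
    using True by (simp add: euler_coeff_def norm_divide del: power_Suc of_nat_Suc)
  also have "\<dots> \<le> norm (\<Sum>j\<in>UNIV. \<beta> p j ^ Suc k) / 1"
    by (rule divide_left_mono) auto
  also have "\<dots> \<le> (\<Sum>j\<in>UNIV. norm (\<beta> p j) ^ Suc k)"
    by (simp add: sum_norm_le norm_power del: power_Suc)
  finally have "norm (euler_coeff \<beta> (p, k)) * exp (- \<sigma> * euler_freq (p, k)) \<le> (\<Sum>j\<in>UNIV. norm (\<beta> p j) ^ Suc k) * (real p powr - \<sigma>) ^ Suc k"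
    unfolding exp_euler_freq(1)[OF p] by (intro mult_right_mono) auto
  then show ?thesis using True by (simp add: sum_distrib_right power_mult_distrib del: power_Suc)
qed (simp add: euler_coeff_def)

text \<open>The cut-off K records from which power on absolute convergence holds: all powers for
  \<sigma> > 1, squares onward at \<sigma> = 1, cubes onward at \<sigma> = 1/2. Finitely many primes
  may have parameters of modulus above 1.\<close>

lemma euler_terms_summable:
  fixes \<beta> :: "nat \<Rightarrow> 'n::finite \<Rightarrow> complex"
  assumes P: "P \<subseteq> {p. prime p}" and lt: "\<And>p j. p \<in> P \<Longrightarrow> norm (\<beta> p j) < real p powr \<sigma>"
    and fin: "finite {p\<in>P. \<exists>j. norm (\<beta> p j) > 1}" and \<sigma>: "0 < \<sigma>" "1 < \<sigma> * real (Suc K)"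
  shows "(\<lambda>i. norm (euler_coeff \<beta> i) * exp (- \<sigma> * euler_freq i)) summable_on (P \<times> {K..})"
proof (rule summable_on_comparison_test)
  show "(\<lambda>(p, k). \<Sum>j\<in>UNIV. (norm (\<beta> p j) * real p powr - \<sigma>) ^ Suc k) summable_on (P \<times> {K..})"
  proof (rule geometric_family_summable)
    show "P \<subseteq> {2..}" using P prime_ge_2_nat by auto
    show "norm (\<beta> p j) * real p powr - \<sigma> < 1" if "p \<in> P" for p j
    proof -
      have "real p > 0" using P that prime_gt_0_nat by auto
      then show ?thesis using lt[OF that, of j] by (simp add: powr_minus field_simps)
    qed
    have "{p\<in>P. \<exists>j. norm (\<beta> p j) * real p powr - \<sigma> > real p powr - \<sigma>} \<subseteq> {p\<in>P. \<exists>j. norm (\<beta> p j) > 1}"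
      by (auto simp: mult_less_cancel_right1)
    then show "finite {p\<in>P. \<exists>j. norm (\<beta> p j) * real p powr - \<sigma> > real p powr - \<sigma>}"
      using fin finite_subset by blast
  qed (use \<sigma> in auto)
next
  fix i assume "i \<in> P \<times> {K..}"
  then obtain p k where i: "i = (p, k)" "p \<in> P" by auto
  then show "norm (euler_coeff \<beta> i) * exp (- \<sigma> * euler_freq i) \<le> (case i of (p, k) \<Rightarrow> \<Sum>j\<in>UNIV. (norm (\<beta> p j) * real p powr - \<sigma>) ^ Suc k)"
    using norm_euler_term_le[of \<beta> p k \<sigma>] P by auto
qed auto

lemma euler_factor_eq_exp:
  fixes \<beta> :: "nat \<Rightarrow> 'n::finite \<Rightarrow> complex"
  assumes p: "prime p" and lt: "\<And>j. norm (\<beta> p j * of_nat p powr (- s)) < 1"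
  shows "\<exists>lg. ((\<lambda>k. euler_coeff \<beta> (p, k) * exp (- s * of_real (euler_freq (p, k)))) has_sum lg) UNIV \<and>
     exp lg = euler_factor (\<beta> p) p s"
proof -
  define w where "w = (\<lambda>j. \<beta> p j * of_nat p powr (- s))"
  have w: "norm (w j) < 1" for j using lt by (simp add: w_def)
  have p0: "p > 0" using p by (rule prime_gt_0_nat)
  have eqn: "euler_coeff \<beta> (p, k) * exp (- s * of_real (euler_freq (p, k))) = (\<Sum>j\<in>UNIV. w j ^ Suc k / of_nat (Suc k))" for k
    unfolding exp_euler_freq(2)[OF p0] using p
    by (simp add: euler_coeff_def w_def power_mult_distrib sum_divide_distrib sum_distrib_left mult_ac del: power_Suc of_nat_Suc)
  have 1: "(\<lambda>k. w j ^ Suc k / of_nat (Suc k)) sums (- Ln (1 - w j))" for j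
  proof -
    have "(\<lambda>n. - ((- (- w j)) ^ n) / of_nat n) sums ln (1 + (- w j))"
      by (rule Ln_series') (use w in simp)
    then have "(\<lambda>n. - (w j ^ n / of_nat n)) sums Ln (1 - w j)" by simp
    from sums_minus[OF this] have "(\<lambda>n. w j ^ n / of_nat n) sums (- Ln (1 - w j))" by simp
    then show ?thesis by (subst sums_Suc_iff) simp
  qed
  have sums: "(\<lambda>k. \<Sum>j\<in>UNIV. w j ^ Suc k / of_nat (Suc k)) sums (\<Sum>j\<in>UNIV. - Ln (1 - w j))"
    by (intro sums_sum 1)
  have "summable (\<lambda>k. norm (\<Sum>j\<in>UNIV. w j ^ Suc k / of_nat (Suc k)))"
  proof (rule summable_comparison_test')
    show "summable (\<lambda>k. \<Sum>j\<in>UNIV. norm (w j) * norm (w j) ^ k)"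
      by (intro summable_sum summable_mult summable_geometric) (use w in simp)
    fix k :: nat
    have "norm (norm (\<Sum>j\<in>UNIV. w j ^ Suc k / of_nat (Suc k))) \<le> (\<Sum>j\<in>UNIV. norm (w j ^ Suc k / of_nat (Suc k)))"
      by (simp only: real_norm_def abs_norm_cancel norm_sum)
    also have "\<dots> \<le> (\<Sum>j\<in>UNIV. norm (w j) * norm (w j) ^ k)"
    proof (rule sum_mono)
      fix j
      have "norm (w j ^ Suc k / of_nat (Suc k)) = norm (w j) ^ Suc k / real (Suc k)"
        by (simp only: norm_divide norm_power norm_of_nat)
      also have "\<dots> \<le> norm (w j) ^ Suc k / 1" by (rule divide_left_mono) auto
      finally show "norm (w j ^ Suc k / of_nat (Suc k)) \<le> norm (w j) * norm (w j) ^ k" by simp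
    qed
    finally show "norm (norm (\<Sum>j\<in>UNIV. w j ^ Suc k / of_nat (Suc k))) \<le> (\<Sum>j\<in>UNIV. norm (w j) * norm (w j) ^ k)" .
  qed
  from norm_summable_imp_has_sum[OF this sums]
  have "((\<lambda>k. euler_coeff \<beta> (p, k) * exp (- s * of_real (euler_freq (p, k)))) has_sum (\<Sum>j\<in>UNIV. - Ln (1 - w j))) UNIV"
    unfolding eqn .
  moreover have "exp (\<Sum>j\<in>UNIV. - Ln (1 - w j)) = euler_factor (\<beta> p) p s"
  proof -
    have "1 - w j \<noteq> 0" for j using w[of j] by (metis norm_one less_irrefl right_minus_eq)
    then show ?thesis unfolding euler_factor_def
      by (simp add: exp_sum exp_minus w_def)
  qed
  ultimately show ?thesis by blast
qed

definition euler_coeff_seq :: "(nat \<Rightarrow> 'n::finite \<Rightarrow> complex) \<Rightarrow> nat \<Rightarrow> complex" where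
  "euler_coeff_seq \<beta> n = euler_coeff \<beta> (prod_decode n)"

definition euler_freq_seq :: "nat \<Rightarrow> real" where
  "euler_freq_seq n = euler_freq (prod_decode n)"

lemma summable_on_prod_decode:
  "(\<lambda>n. f (prod_decode n)) summable_on UNIV \<longleftrightarrow> f summable_on UNIV"
  using summable_on_reindex_bij_betw[of prod_decode UNIV UNIV f] bij_prod_decode by simp

lemma euler_summable:
  fixes \<beta> :: "nat \<Rightarrow> 'n::finite \<Rightarrow> complex"
  assumes lt: "\<And>p j. prime p \<Longrightarrow> norm (\<beta> p j) < real p"
    and fin: "finite {p. prime p \<and> (\<exists>j. norm (\<beta> p j) > 1)}" and \<sigma>: "1 < \<sigma>"
  shows "(\<lambda>i. norm (euler_coeff \<beta> i) * exp (- \<sigma> * euler_freq i)) summable_on UNIV"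
    and "summable (\<lambda>n. norm (euler_coeff_seq \<beta> n) * exp (- \<sigma> * euler_freq_seq n))"
proof -
  have "(\<lambda>i. norm (euler_coeff \<beta> i) * exp (- \<sigma> * euler_freq i)) summable_on ({p. prime p} \<times> {0..})"
  proof (rule euler_terms_summable)
    fix p :: nat and j :: 'n assume "p \<in> {p. prime p}"
    then have p: "prime p" by simp
    then have "real p \<ge> 1" using prime_ge_1_nat by simp
    then have "real p powr 1 \<le> real p powr \<sigma>" using \<sigma> by (intro powr_mono) auto
    then show "norm (\<beta> p j) < real p powr \<sigma>" using lt[OF p, of j] p prime_gt_0_nat by fastforce
  qed (use \<sigma> fin in auto)
  then show *: "(\<lambda>i. norm (euler_coeff \<beta> i) * exp (- \<sigma> * euler_freq i)) summable_on UNIV"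
    by (rule iffD1[OF summable_on_cong_neutral, rotated -1]) (auto simp: euler_coeff_def split: if_splits)
  then have "(\<lambda>n. norm (euler_coeff \<beta> (prod_decode n)) * exp (- \<sigma> * euler_freq (prod_decode n))) summable_on UNIV"
    by (subst summable_on_prod_decode)
  then show "summable (\<lambda>n. norm (euler_coeff_seq \<beta> n) * exp (- \<sigma> * euler_freq_seq n))"
    unfolding euler_coeff_seq_def euler_freq_seq_def by (rule summable_on_imp_summable)
qed

text \<open>Absolute convergence allows the double series over (p, k) to be summed prime by prime,
  and the exponentials of its partial sums over p are the partial products. It also makes the
  enumeration by \<open>prod_decode\<close> immaterial to the value.\<close>

lemma euler_product_eq_exp:
  fixes \<beta> :: "nat \<Rightarrow> 'n::finite \<Rightarrow> complex"
  assumes lt: "\<And>p j. prime p \<Longrightarrow> norm (\<beta> p j) < real p"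
    and fin: "finite {p. prime p \<and> (\<exists>j. norm (\<beta> p j) > 1)}" and s: "1 < Re s"
    and prod: "(\<lambda>p. if prime p then euler_factor (\<beta> p) p s else 1) has_prod P"
  shows "exp (\<Sum>n. euler_coeff_seq \<beta> n * exp (- s * of_real (euler_freq_seq n))) = P"
proof -
  define F where "F = (\<lambda>i. euler_coeff \<beta> i * exp (- s * of_real (euler_freq i)))"
  have nF: "norm (F i) = norm (euler_coeff \<beta> i) * exp (- Re s * euler_freq i)" for i
    by (simp add: F_def norm_mult norm_exp_eq_Re)
  have "(\<lambda>i. norm (F i)) summable_on UNIV" unfolding nF by (rule euler_summable(1)[OF lt fin s])
  then have Fsum: "F summable_on UNIV" by (rule Infinite_Sum.abs_summable_summable)
  have "\<exists>lg. ((\<lambda>k. F (p, k)) has_sum lg) UNIV \<and> exp lg = (if prime p then euler_factor (\<beta> p) p s else 1)" for p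
  proof (cases "prime p")
    case True
    have "norm (\<beta> p j * of_nat p powr (- s)) < 1" for j
    proof -
      have p1: "real p > 1" using True prime_gt_1_nat by simp
      have "norm (of_nat p powr (- s) :: complex) = real p powr (- Re s)"
        using norm_powr_real_powr[of "of_nat p" "- s"] p1 by simp
      also have "\<dots> \<le> real p powr (- 1)" using p1 s by (intro powr_mono) auto
      finally have "norm (of_nat p powr (- s) :: complex) \<le> 1 / real p" using p1 by (simp add: powr_minus divide_inverse)
      then have "norm (\<beta> p j * of_nat p powr (- s)) \<le> norm (\<beta> p j) * (1 / real p)"
        unfolding norm_mult by (intro mult_left_mono) auto
      also have "\<dots> < 1" using lt[OF True, of j] p1 by simp
      finally show ?thesis .
    qed
    from euler_factor_eq_exp[where \<beta> = \<beta>, OF True this] show ?thesis using True by (simp add: F_def)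
  qed (auto intro!: exI[of _ 0] simp: F_def euler_coeff_def)
  then obtain lg where lg: "\<And>p. ((\<lambda>k. F (p, k)) has_sum lg p) UNIV"
     "\<And>p. exp (lg p) = (if prime p then euler_factor (\<beta> p) p s else 1)" by metis
  have "(F has_sum infsum F UNIV) (Sigma UNIV (\<lambda>_. UNIV))" using Fsum by simp
  from has_sum_Sigma'[OF this lg(1)] have "(lg has_sum infsum F UNIV) UNIV" .
  then have "lg sums infsum F UNIV" by (rule has_sum_imp_sums)
  then have "(\<lambda>n. exp (\<Sum>p<n. lg p)) \<longlonglongrightarrow> exp (infsum F UNIV)"
    unfolding sums_def by (rule tendsto_exp)
  also have "(\<lambda>n. exp (\<Sum>p<n. lg p)) = (\<lambda>n. \<Prod>p<n. if prime p then euler_factor (\<beta> p) p s else 1)"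
    by (simp add: exp_sum lg(2))
  finally have "exp (infsum F UNIV) = P"
    using has_prod_imp_tendsto'[OF prod] LIMSEQ_unique by blast
  moreover have "(\<Sum>n. F (prod_decode n)) = infsum F UNIV"
  proof -
    have "(\<lambda>n. F (prod_decode n)) summable_on UNIV" using Fsum by (subst summable_on_prod_decode)
    from has_sum_imp_sums[OF has_sum_infsum[OF this]] have "(\<Sum>n. F (prod_decode n)) = infsum (\<lambda>n. F (prod_decode n)) UNIV"
      by (rule sums_unique[symmetric])
    also have "\<dots> = infsum F UNIV" by (rule infsum_reindex_bij_betw) (rule bij_prod_decode)
    finally show ?thesis .
  qed
  ultimately show ?thesis by (simp add: F_def euler_coeff_seq_def euler_freq_seq_def)
qed

text \<open>A single finite F serves all X at once, so the index set may vary with x.\<close>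

lemma abs_summable_tail:
  fixes f :: "'a \<Rightarrow> complex"
  assumes W: "(\<lambda>i. norm (f i)) summable_on W" and e: "e > 0"
  obtains F where "finite F" "F \<subseteq> W" "\<And>X. X \<subseteq> W - F \<Longrightarrow> norm (infsum f X) \<le> e"
proof -
  obtain F where F: "finite F" "F \<subseteq> W" "dist (sum (\<lambda>i. norm (f i)) F) (infsum (\<lambda>i. norm (f i)) W) \<le> e"
    using infsum_finite_approximation[OF W e] by blast
  have WF: "(\<lambda>i. norm (f i)) summable_on (W - F)" by (rule summable_on_subset_banach[OF W]) auto
  have "infsum (\<lambda>i. norm (f i)) ((W - F) \<union> F) = infsum (\<lambda>i. norm (f i)) (W - F) + infsum (\<lambda>i. norm (f i)) F"
    by (rule infsum_Un_disjoint[OF WF]) (use F in auto)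
  moreover have "(W - F) \<union> F = W" using F by blast
  ultimately have tail: "infsum (\<lambda>i. norm (f i)) (W - F) \<le> e" using F(1,3) by (simp add: dist_real_def)
  have "norm (infsum f X) \<le> e" if X: "X \<subseteq> W - F" for X
  proof -
    have "(\<lambda>i. norm (f i)) summable_on X" by (rule summable_on_subset_banach[OF WF X])
    then have "norm (infsum f X) \<le> infsum (\<lambda>i. norm (f i)) X" by (rule norm_infsum_bound)
    also have "\<dots> \<le> infsum (\<lambda>i. norm (f i)) (W - F)"
      by (rule infsum_mono2) (use X WF \<open>(\<lambda>i. norm (f i)) summable_on X\<close> in auto)
    finally show ?thesis using tail by simp
  qed
  with F show ?thesis using that by blast
qed

text \<open>The product over p <= x is the exponential of the sum over all (p, k) with p <= x. The
  part with p^(k+1) <= x is the step sum. Beyond it no first powers occur; squares with p <= x < p^2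
  at primes with parameters of modulus at most 1 are displayed, and what is left lies in an
  absolutely convergent family and avoids any given finite subset for large x.\<close>

lemma central_euler_product:
  fixes \<alpha> :: "nat \<Rightarrow> 'n::finite \<Rightarrow> complex"
  assumes lt: "\<And>p j. prime p \<Longrightarrow> norm (\<alpha> p j) < sqrt (real p)"
    and fin: "finite {p. prime p \<and> (\<exists>j. norm (\<alpha> p j) > 1)}"
  defines "a \<equiv> \<lambda>n. euler_coeff_seq \<alpha> n * exp (- (1/2) * of_real (euler_freq_seq n))"
  shows "\<exists>r. (r \<longlongrightarrow> 0) at_top \<and> (\<forall>x\<ge>2.
    (\<Prod>p\<in>{p. prime p \<and> real p \<le> x}. euler_factor (\<alpha> p) p (1/2)) =
    exp (step_sum a euler_freq_seq (ln x) +
      (\<Sum>p | prime p \<and> (\<forall>j. norm (\<alpha> p j) \<le> 1) \<and> real p \<le> x \<and> x < (real p)\<^sup>2. (\<Sum>j\<in>UNIV. (\<alpha> p j)\<^sup>2) / of_real (2 * real p)) + r x))"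
proof -
  define d where "d = (\<lambda>i. euler_coeff \<alpha> i * exp (- (1/2) * of_real (euler_freq i)))"
  \<comment> \<open>Index 2 is the cube. At the exceptional primes the first powers and squares are
    included too; these are finitely many terms, so the family stays summable.\<close>
  define W where "W = ({p. prime p} \<times> {2..}) \<union> ({p. prime p \<and> (\<exists>j. norm (\<alpha> p j) > 1)} \<times> {..<2::nat})"
  have nd: "norm (d i) = norm (euler_coeff \<alpha> i) * exp (- (1/2) * euler_freq i)" for i
  proof -
    have "norm (exp (- (1/2) * complex_of_real (euler_freq i))) = exp (- (1/2) * euler_freq i)"
      unfolding norm_exp_eq_Re by simp
    then show ?thesis by (simp only: d_def norm_mult)
  qed
  have sum2: "(\<lambda>i. norm (d i)) summable_on ({p. prime p} \<times> {2..})"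
    unfolding nd
  proof (rule euler_terms_summable)
    show "norm (\<alpha> p j) < real p powr (1/2)" if "p \<in> {p. prime p}" for p j
      using lt[of p j] that by (simp add: powr_half_sqrt)
  qed (use fin in auto)
  have sumW: "(\<lambda>i. norm (d i)) summable_on W"
    unfolding W_def
    by (rule summable_on_Un_disjoint[OF sum2]) (use fin in auto)
  have sumF: "(\<lambda>i. norm (d i)) summable_on (F \<times> UNIV)" if F: "finite F" "F \<subseteq> {p. prime p}" for F
  proof -
    have "(\<lambda>i. norm (d i)) summable_on (F \<times> {2..} \<union> F \<times> {..<2::nat})"
    proof (rule summable_on_Un_disjoint)
      show "(\<lambda>i. norm (d i)) summable_on (F \<times> {2..})"
        by (rule summable_on_subset_banach[OF sum2]) (use F in auto)
    qed (use F in auto)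
    moreover have "F \<times> {2..} \<union> F \<times> {..<2::nat} = F \<times> UNIV" by auto
    ultimately show ?thesis by simp
  qed
  have "\<exists>lg. ((\<lambda>k. d (p, k)) has_sum lg) UNIV \<and> exp lg = euler_factor (\<alpha> p) p (1/2)" if p: "prime p" for p
    unfolding d_def
  proof (rule euler_factor_eq_exp[OF p])
    fix j
    have p0: "real p > 0" using p prime_gt_0_nat by simp
    have "norm (of_nat p powr (- (1/2)) :: complex) = real p powr (- (1/2))"
      using norm_powr_real_powr[of "of_nat p" "- (1/2)"] p0 by simp
    also have "\<dots> = 1 / sqrt (real p)" by (simp only: powr_minus_divide powr_half_sqrt of_nat_0_le_iff)
    finally have "norm (\<alpha> p j * of_nat p powr (- (1/2))) = norm (\<alpha> p j) / sqrt (real p)"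
      by (simp only: norm_mult times_divide_eq_right mult_1_right)
    then show "norm (\<alpha> p j * of_nat p powr (- (1/2))) < 1" using lt[OF p, of j] p0 by simp
  qed
  then obtain lg where lg: "\<And>p. prime p \<Longrightarrow> ((\<lambda>k. d (p, k)) has_sum lg p) UNIV"
    "\<And>p. prime p \<Longrightarrow> exp (lg p) = euler_factor (\<alpha> p) p (1/2)" by metis
  define P where "P = (\<lambda>x. {p. prime p \<and> real p \<le> x})"
  define Y where "Y = (\<lambda>x. {i \<in> P x \<times> UNIV. euler_freq i \<le> ln x})"
  define G0 where "G0 = (\<lambda>x. {p. prime p \<and> (\<forall>j. norm (\<alpha> p j) \<le> 1) \<and> real p \<le> x \<and> x < (real p)\<^sup>2})"
  define G where "G = (\<lambda>x. (\<lambda>p. (p, 1::nat)) ` G0 x)"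
  define Z where "Z = (\<lambda>x. (P x \<times> UNIV) - Y x - G x)"
  have finP: "finite (P x)" for x
    by (rule finite_subset[of _ "{..nat \<lfloor>x\<rfloor>}"]) (auto simp: P_def le_nat_floor)
  have finG0: "finite (G0 x)" for x
    by (rule finite_subset[OF _ finP[of x]]) (auto simp: P_def G0_def)
  define r where "r = (\<lambda>x. infsum d (Z x))"
  have freq1: "euler_freq (p, 1) = ln ((real p)\<^sup>2)" if "prime p" for p
    using prime_gt_0_nat[OF that] by (simp add: euler_freq_def ln_realpow)
  have main: "(\<Prod>p\<in>P x. euler_factor (\<alpha> p) p (1/2)) =
    exp (step_sum a euler_freq_seq (ln x) + (\<Sum>p\<in>G0 x. (\<Sum>j\<in>UNIV. (\<alpha> p j)\<^sup>2) / of_real (2 * real p)) + r x)" if x: "2 \<le> x" for x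
  proof -
    have Pp: "P x \<subseteq> {p. prime p}" by (auto simp: P_def)
    note sPn = sumF[OF finP Pp]
    have sP: "d summable_on X" if "X \<subseteq> P x \<times> UNIV" for X
      by (rule Infinite_Sum.abs_summable_summable, rule summable_on_subset_banach[OF sPn that])
    have GP: "G x \<subseteq> P x \<times> UNIV" by (auto simp: G_def G0_def P_def)
    have YG: "Y x \<inter> G x = {}"
    proof -
      have "x < (real p)\<^sup>2 \<Longrightarrow> prime p \<Longrightarrow> ln x < euler_freq (p, 1)" for p
        unfolding freq1 using x by (subst ln_less_cancel_iff) auto
      then have "euler_freq i > ln x" if "i \<in> G x" for i using that by (auto simp: G_def G0_def)
      moreover have "euler_freq i \<le> ln x" if "i \<in> Y x" for i using that by (simp add: Y_def)
      ultimately show ?thesis by (meson disjoint_iff not_le)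
    qed
    have "(d has_sum infsum d (P x \<times> UNIV)) (Sigma (P x) (\<lambda>_. UNIV))" using sP[of "P x \<times> UNIV"] by simp
    then have "(lg has_sum infsum d (P x \<times> UNIV)) (P x)"
      by (rule has_sum_Sigma') (use lg(1) Pp in auto)
    from infsumI[OF this] have 1: "infsum d (P x \<times> UNIV) = (\<Sum>p\<in>P x. lg p)"
      using finP by simp
    have "P x \<times> UNIV = (Y x \<union> G x) \<union> Z x" using GP by (auto simp: Z_def Y_def)
    then have "infsum d (P x \<times> UNIV) = infsum d ((Y x \<union> G x) \<union> Z x)" by simp
    also have "\<dots> = infsum d (Y x \<union> G x) + infsum d (Z x)"
      by (rule infsum_Un_disjoint; (rule sP)?) (use GP in \<open>auto simp: Y_def Z_def\<close>)
    also have "infsum d (Y x \<union> G x) = infsum d (Y x) + infsum d (G x)"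
      by (rule infsum_Un_disjoint; (rule sP)?) (use GP YG in \<open>auto simp: Y_def\<close>)
    also have "infsum d (G x) = (\<Sum>p\<in>G0 x. d (p, 1))"
      unfolding G_def using finG0 by (simp add: sum.reindex inj_on_def)
    also have "\<dots> = (\<Sum>p\<in>G0 x. (\<Sum>j\<in>UNIV. (\<alpha> p j)\<^sup>2) / of_real (2 * real p))"
    proof (rule sum.cong[OF refl])
      fix p assume "p \<in> G0 x"
      then have p: "prime p" "p > 0" by (auto simp: G0_def prime_gt_0_nat)
      have "exp (- (1/2) * of_real (euler_freq (p, 1))) = (of_nat p powr (- (1/2)) :: complex) ^ Suc 1"
        by (rule exp_euler_freq(2)[OF p(2)])
      also have "\<dots> = of_nat p powr (- (1/2) + - (1/2))"
        unfolding powr_add by (simp add: power2_eq_square)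
      also have "\<dots> = 1 / of_nat p" using p by (simp add: powr_minus_divide)
      finally show "d (p, 1) = (\<Sum>j\<in>UNIV. (\<alpha> p j)\<^sup>2) / of_real (2 * real p)"
        using p by (simp add: d_def euler_coeff_def numeral_2_eq_2)
    qed
    also have "infsum d (Y x) = step_sum a euler_freq_seq (ln x)"
    proof -
      \<comment> \<open>The step sum ranges over all primes, but p^(k+1) <= x already forces p <= x,
        so nothing outside \<open>Y x\<close> contributes.\<close>
      define h where "h = (\<lambda>i. if euler_freq i \<le> ln x then d i else 0)"
      have out: "h i = 0" if "i \<notin> Y x" for i
      proof (cases i)
        case (Pair p k)
        show ?thesis
        proof (cases "prime p \<and> euler_freq i \<le> ln x")
          case True
          have "1 * ln (real p) \<le> real (Suc k) * ln (real p)"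
            using True prime_ge_1_nat[of p] by (intro mult_right_mono) auto
          then have "ln (real p) \<le> ln x" using True by (simp add: Pair euler_freq_def)
          then have "real p \<le> x" using True x prime_gt_0_nat[of p] by simp
          then show ?thesis using that True by (simp add: Y_def P_def Pair)
        next
          case False
          then show ?thesis by (auto simp: h_def d_def euler_coeff_def Pair)
        qed
      qed
      have eqs: "infsum d (Y x) = infsum h UNIV" "d summable_on (Y x) \<longleftrightarrow> h summable_on UNIV"
        by (rule infsum_cong_neutral summable_on_cong_neutral; use out in \<open>auto simp: h_def Y_def\<close>)+
      have hs: "h summable_on UNIV" using eqs(2) sP[of "Y x"] by (auto simp: Y_def)
      then have "(\<lambda>n. h (prod_decode n)) summable_on UNIV" by (subst summable_on_prod_decode)
      from has_sum_imp_sums[OF has_sum_infsum[OF this]] 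
      have "(\<Sum>n. h (prod_decode n)) = infsum (\<lambda>n. h (prod_decode n)) UNIV"
        by (rule sums_unique[symmetric])
      also have "\<dots> = infsum h UNIV" by (rule infsum_reindex_bij_betw) (rule bij_prod_decode)
      finally have "infsum d (Y x) = (\<Sum>n. h (prod_decode n))" using eqs(1) by simp
      also have "\<dots> = step_sum a euler_freq_seq (ln x)"
        unfolding step_sum_def h_def d_def a_def euler_coeff_seq_def euler_freq_seq_def ..
      finally show ?thesis .
    qed
    finally have "(\<Sum>p\<in>P x. lg p) = step_sum a euler_freq_seq (ln x) + (\<Sum>p\<in>G0 x. (\<Sum>j\<in>UNIV. (\<alpha> p j)\<^sup>2) / of_real (2 * real p)) + r x"
      unfolding 1 r_def by simp
    moreover have "(\<Prod>p\<in>P x. euler_factor (\<alpha> p) p (1/2)) = exp (\<Sum>p\<in>P x. lg p)"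
      unfolding exp_sum[OF finP] by (rule prod.cong[OF refl]) (use lg(2) in \<open>auto simp: P_def\<close>)
    ultimately show ?thesis by simp
  qed
  have "(r \<longlongrightarrow> 0) at_top"
  proof (rule tendstoI)
    fix e :: real assume e: "e > 0"
    obtain F where F: "finite F" "F \<subseteq> W" "\<And>X. X \<subseteq> W - F \<Longrightarrow> norm (infsum d X) \<le> e / 2"
      using abs_summable_tail[OF sumW, of "e/2"] e by auto
    \<comment> \<open>Beyond x0 every frequency in F is at most ln x, whereas the frequencies in
      \<open>Z x\<close> exceed ln x.\<close>
    define x0 where "x0 = max 2 (exp (Max (insert 0 (euler_freq ` F))))"
    show "\<forall>\<^sub>F x in at_top. dist (r x) 0 < e"
    proof (rule eventually_at_top_linorderI[of x0])
      fix x assume x: "x0 \<le> x"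
      then have x2: "2 \<le> x" and "exp (Max (insert 0 (euler_freq ` F))) \<le> x" by (auto simp: x0_def)
      then have "Max (insert 0 (euler_freq ` F)) \<le> ln x" by (simp add: ln_ge_iff)
      then have Fx: "euler_freq i \<le> ln x" if "i \<in> F" for i
        using that F(1) by simp
      have "Z x \<subseteq> W - F"
      proof
        fix i assume i: "i \<in> Z x"
        obtain p k where pk: "i = (p, k)" by force
        have p: "prime p" "real p \<le> x" and fr: "\<not> euler_freq i \<le> ln x" and nG: "i \<notin> G x"
          using i by (auto simp: Z_def Y_def P_def pk)
        have "i \<in> W"
        proof (cases "k \<ge> 2")
          case False
          have "k \<noteq> 0"
          proof
            assume "k = 0"
            then have "euler_freq i = ln (real p)" by (simp add: pk euler_freq_def)
            moreover have "ln (real p) \<le> ln x" using p prime_gt_0_nat[of p] by simp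
            ultimately show False using fr by simp
          qed
          with False have k: "k = 1" by simp
          have "ln x < ln ((real p)\<^sup>2)" using fr freq1[OF p(1)] by (simp add: pk k)
          then have "x < (real p)\<^sup>2" using x2 prime_gt_0_nat[OF p(1)] by simp
          then have "\<not> (\<forall>j. norm (\<alpha> p j) \<le> 1)" using nG p by (auto simp: G_def G0_def pk k)
          then show ?thesis using p by (auto simp: W_def pk k not_le)
        qed (use p in \<open>auto simp: W_def pk\<close>)
        moreover have "i \<notin> F" using fr Fx by blast
        ultimately show "i \<in> W - F" by blast
      qed
      from F(3)[OF this] show "dist (r x) 0 < e" using e by (simp add: r_def)
    qed
  qed
  with main show ?thesis unfolding P_def G0_def by blast
qed

section \<open>Ramified primes and growth of the L-function\<close>

lemma rat_val_ge_uminus: "rat_val_ge q k r \<Longrightarrow> rat_val_ge q k (- r)"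
  unfolding rat_val_ge_def
proof (elim exE conjE)
  fix a b :: int
  assume "b \<noteq> 0" "coprime b (int q)" "r * of_int b = of_int (int q ^ k * a)"
  then show "\<exists>a b::int. b \<noteq> 0 \<and> coprime b (int q) \<and> - r * of_int b = of_int (int q ^ k * a)"
    by (intro exI[of _ "- a"] exI[of _ b]) simp
qed

lemma rat_val_ge_of_int: "rat_val_ge q 0 (of_int c)"
  unfolding rat_val_ge_def by (intro exI[of _ c] exI[of _ 1]) simp

text \<open>Writing N = q^v M with q not dividing M, the factor M is a unit at q and can be moved
  into the denominator.\<close>

lemma rat_val_ge_divide:
  assumes q: "prime q" and N: "N > 0" and r: "rat_val_ge q (multiplicity q N) r"
  shows "rat_val_ge q 0 (1 / of_nat N * r)"
proof -
  obtain M where M: "N = q ^ multiplicity q N * M" "\<not> q dvd M"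
    using multiplicity_decompose'[of N q] q N by (metis less_irrefl not_prime_unit)
  have M0: "M > 0" using N M by (metis gr0I mult_0_right)
  from r obtain a b :: int where ab: "b \<noteq> 0" "coprime b (int q)" 
    "r * of_int b = of_int (int q ^ multiplicity q N * a)"
    unfolding rat_val_ge_def by blast
  have "coprime (int M) (int q)"
    using q M(2) by (metis coprime_commute coprime_int_iff prime_imp_coprime)
  moreover have "1 / of_nat N * r * of_int (b * int M) = (of_int a :: rat)"
  proof -
    have q0: "(of_nat q :: rat) \<noteq> 0" using q prime_gt_0_nat by fastforce
    have "1 / of_nat N * r * of_int (b * int M) = (r * of_int b) * of_nat M / (of_nat N :: rat)" by simp
    also have "\<dots> = of_int a * (of_nat q ^ multiplicity q N * of_nat M) / of_nat N"
      unfolding ab(3) by simp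
    also have "of_nat q ^ multiplicity q N * of_nat M = (of_nat N :: rat)"
      by (subst (2) M(1)) simp
    finally show ?thesis using N by simp
  qed
  ultimately show ?thesis
    using ab M0 unfolding rat_val_ge_def by (intro exI[of _ a] exI[of _ "b * int M"]) auto
qed

lemma val_ge_add: "val_ge q k x \<Longrightarrow> val_ge q k y \<Longrightarrow> val_ge q k (x + y)"
  by transfer (blast intro: eventually_elim2 rat_val_ge_add)

lemma val_ge_uminus: "val_ge q k x \<Longrightarrow> val_ge q k (- x)"
  by transfer (blast intro: eventually_mono rat_val_ge_uminus)

lemma val_ge_0: "q > 0 \<Longrightarrow> val_ge q 0 0"
  by transfer (simp add: rat_val_ge_of_int[of _ 0, simplified])

lemma val_ge_1: "q > 0 \<Longrightarrow> val_ge q 0 1"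
  by transfer (simp add: rat_val_ge_of_int[of _ 1, simplified])

lemma val_ge_divide:
  assumes "prime q" "N > 0" "val_ge q (multiplicity q N) x"
  shows "val_ge q 0 (rat_adele (1 / of_nat N) * x)"
  using assms(3)
proof (transfer fixing: q N)
  fix x assume "0 < q \<and> (\<forall>\<^sub>F i in sequentially. rat_val_ge q (multiplicity q N) (x i))"
  then show "0 < q \<and> (\<forall>\<^sub>F i in sequentially. rat_val_ge q 0 (1 / of_nat N * x i))"
    by (blast intro: eventually_mono rat_val_ge_divide[OF assms(1,2)])
qed

lemma rat_adele_mult: "rat_adele (a * b) = rat_adele a * rat_adele b"
  by transfer (simp add: adelic_rel_def)

lemma rat_adele_of_nat: "rat_adele (of_nat n) = of_nat n"
proof (induction n)
  case 0
  show ?case by simp (transfer, simp add: adelic_rel_def)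
next
  case (Suc n)
  have "rat_adele (1 + of_nat n) = 1 + rat_adele (of_nat n)"
    by transfer (simp add: adelic_rel_def)
  with Suc show ?case by simp
qed

text \<open>Away from p the matrix k is the identity, and at p the integer N is a unit; so k - 1 is
  divisible by N at every prime.\<close>

lemma K_loc_subset_K_cong:
  assumes p: "prime p" "\<not> p dvd N" and N: "N > 0"
  shows "K_loc p \<subseteq> (K_cong N :: (fin_adele^'n::finite^'n) set)"
proof
  fix k :: "fin_adele^'n^'n" assume k: "k \<in> K_loc p"
  then have GL: "k \<in> GL_Zhat" and eq: "\<And>q i j. prime q \<Longrightarrow> q \<noteq> p \<Longrightarrow> eq_at q (k $ i $ j) (mat 1 $ i $ j)"
    unfolding K_loc_def by blast+
  have Z: "k $ i $ j \<in> Zhat" for i j using GL unfolding GL_Zhat_def by blast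
  have "\<exists>y\<in>Zhat. (k - mat 1) $ i $ j = of_nat N * y" for i j
  proof -
    define x where "x = k $ i $ j - mat 1 $ i $ j"
    \<comment> \<open>Division by N is multiplication by the embedded rational 1 / N; the
      integrality of the result is then checked prime by prime.\<close>
    define y where "y = rat_adele (1 / of_nat N) * x"
    have "of_nat N * y = rat_adele (of_nat N * (1 / of_nat N)) * x"
      unfolding y_def rat_adele_mult rat_adele_of_nat by (simp add: mult.assoc)
    also have "\<dots> = rat_adele (of_nat 1) * x" using N by simp
    finally have "x = of_nat N * y" unfolding rat_adele_of_nat by simp
    moreover have "val_ge q 0 y" if q: "prime q" for q
      unfolding y_def
    proof (rule val_ge_divide[OF q N])
      show "val_ge q (multiplicity q N) x"
      proof (cases "q = p")
        case True
        have "multiplicity q N = 0" using p True by (simp add: not_dvd_imp_multiplicity_0)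
        moreover have "val_ge q 0 (k $ i $ j)" using Z[of i j] q unfolding Zhat_def by simp
        moreover have "val_ge q 0 (mat 1 $ i $ j :: fin_adele)"
          using q prime_gt_0_nat by (simp add: mat_def val_ge_0 val_ge_1)
        ultimately show ?thesis
          unfolding x_def using val_ge_add[OF _ val_ge_uminus] by (metis diff_conv_add_uminus)
      next
        case False
        then show ?thesis using eq[OF q False, of i j] unfolding eq_at_def x_def by blast
      qed
    qed
    ultimately show ?thesis by (intro bexI[of _ y]) (auto simp: x_def Zhat_def)
  qed
  with GL show "k \<in> K_cong N" unfolding K_cong_def by blast
qed

text \<open>A nonzero form in \<pi> is fixed by some principal congruence subgroup of level N, hence
  is spherical at every prime not dividing N. The Ramanujan-Petersson conjecture therefore bounds
  the parameters by 1 at all but finitely many primes.\<close>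

lemma finite_ramified:
  fixes \<pi> :: "'n::finite adele_fun set"
  assumes "cuspidal_automorphic_rep \<pi>"
  shows "finite {p. prime p \<and> \<not> unramified \<pi> p}"
proof -
  have inv: "invariant_subspace \<pi>" and cusp: "\<And>\<phi>. \<phi> \<in> \<pi> \<Longrightarrow> cusp_form \<phi>" and ne: "\<pi> \<noteq> {\<lambda>_. 0}"
    using assms unfolding cuspidal_automorphic_rep_def by blast+
  have "(\<lambda>_. 0) \<in> \<pi>" using inv unfolding invariant_subspace_def by blast
  with ne obtain \<phi> where \<phi>: "\<phi> \<in> \<pi>" "\<phi> \<noteq> (\<lambda>_. 0)" by blast
  obtain N where N: "N > 0" "\<And>k. k \<in> K_cong N \<Longrightarrow> rtrans (mat 1, k) \<phi> = \<phi>"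
  proof -
    have "automorphic_form \<phi>" using cusp[OF \<phi>(1)] unfolding cusp_form_def by (elim conjE)
    then have "\<exists>N>0. \<forall>k\<in>K_cong N. rtrans (mat 1, k) \<phi> = \<phi>"
      unfolding automorphic_form_def by (elim conjE)
    then show ?thesis using that by blast
  qed
  have "{p. prime p \<and> \<not> unramified \<pi> p} \<subseteq> {p. p dvd N}"
  proof safe
    fix p assume p: "prime p" "\<not> unramified \<pi> p"
    show "p dvd N"
    proof (rule ccontr)
      assume "\<not> p dvd N"
      then have "spherical \<pi> p \<phi>"
        using K_loc_subset_K_cong[OF p(1) _ N(1)] N(2) \<phi> unfolding spherical_def by blast
      with p(2) show False unfolding unramified_def by blast
    qed
  qed
  then show ?thesis using finite_divisors_nat[OF N(1)] finite_subset by blast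
qed

section \<open>Polynomial growth of the L-function to the right of Re s = -1/2\<close>

text \<open>Multiplying by exp (- e cos z) gives doubly exponential decay, as |Re z| <= 1 < pi / 2
  keeps cos (Re z) >= cos 1 > 0; this beats the exponential of any power of |Im z|. The maximum
  principle on a large box yields M for each e > 0, and then e tends to 0.\<close>

lemma Phragmen_Lindelof_strip:
  fixes f :: "complex \<Rightarrow> complex"
  assumes hol: "f holomorphic_on S" and S: "open S" "{z. \<bar>Re z\<bar> \<le> 1} \<subseteq> S"
    and bd: "\<And>z. \<bar>Re z\<bar> = 1 \<Longrightarrow> norm (f z) \<le> M"
    and growth: "\<And>z. \<bar>Re z\<bar> \<le> 1 \<Longrightarrow> R0 \<le> \<bar>Im z\<bar> \<Longrightarrow> norm (f z) \<le> exp ((2 + \<bar>Im z\<bar>) ^ A)"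
    and z: "\<bar>Re z\<bar> \<le> 1" and M: "M > 0"
  shows "norm (f z) \<le> M"
proof -
  have Recos: "Re (cos w) = cos (Re w) * cosh (Im w)" for w :: complex
    by (simp add: Re_cos cosh_field_def)
  have c1: "cos (1::real) > 0" using cos_gt_zero[of 1] pi_gt3 by simp
  have cos1: "cos 1 \<le> cos x" if "\<bar>x\<bar> \<le> 1" for x :: real
    using cos_monotone_0_pi_le[of "\<bar>x\<bar>" 1] that pi_gt3 by (simp add: abs_if split: if_splits)
  have eps: "norm (f z) * exp (- e * Re (cos z)) \<le> M" if e: "e > 0" for e
  proof -
    define F where "F = (\<lambda>w. f w * exp (- of_real e * cos w))"
    have nF: "norm (F w) = norm (f w) * exp (- e * Re (cos w))" for w
      by (simp add: F_def norm_mult)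
    define c where "c = e * cos 1 / 2"
    have c: "c > 0" using e c1 by (simp add: c_def)
    have "((\<lambda>R::real. (R + 2) ^ A / exp (R + 2)) \<longlongrightarrow> 0) at_top"
      by (rule filterlim_compose[OF tendsto_power_div_exp_0]) real_asymp
    then have "\<forall>\<^sub>F R in at_top. (R + 2) ^ A / exp (R + 2) < c / (2 * exp 2)"
      by (rule order_tendstoD) (use c in simp)
    moreover have "filterlim (\<lambda>R::real. - (c / 2) * exp R) at_bot at_top"
      using c by real_asymp
    then have "\<forall>\<^sub>F R in at_top. - (c / 2) * exp R \<le> ln M"
      by (simp add: filterlim_at_bot)
    ultimately have "\<forall>\<^sub>F R in at_top. (2 + R) ^ A - e * cos 1 * cosh R \<le> ln M"
    proof eventually_elim
      case (elim R)
      have "(2 + R) ^ A \<le> c / 2 * exp R"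
        using elim(1) by (simp add: exp_add field_simps)
      moreover have "c * exp R \<le> c * (exp R + exp (- R))" using c by simp
      then have "c * exp R \<le> e * cos 1 * cosh R" by (simp add: c_def cosh_field_def field_simps)
      ultimately show ?case using elim(2) by linarith
    qed
    moreover have "\<forall>\<^sub>F R in at_top. R \<ge> max (max R0 1) (\<bar>Im z\<bar>)" by (rule eventually_ge_at_top)
    ultimately have "\<forall>\<^sub>F R in at_top. (2 + R) ^ A - e * cos 1 * cosh R \<le> ln M \<and> R \<ge> max (max R0 1) (\<bar>Im z\<bar>)"
      by eventually_elim simp
    from eventually_happens'[OF _ this]
    \<comment> \<open>R is so large that on the horizontal sides the decay beats the growth bound
      and the modulus drops below M.\<close>
    obtain R where R: "(2 + R) ^ A - e * cos 1 * cosh R \<le> ln M" "R \<ge> R0" "R \<ge> 1" "\<bar>Im z\<bar> \<le> R"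
      by auto
    let ?B = "cbox (Complex (-1) (-R)) (Complex 1 R)"
    have B: "?B \<subseteq> S" using S(2) by (force simp: in_cbox_complex_iff)
    have holF: "F holomorphic_on S" unfolding F_def by (intro holomorphic_intros hol)
    have "norm (F z) \<le> M"
    proof (rule maximum_modulus_frontier[where f = F and S = ?B and \<xi> = z])
      have holB: "F holomorphic_on ?B" by (rule holomorphic_on_subset[OF holF B])
      show "F holomorphic_on interior ?B" by (rule holomorphic_on_subset[OF holB interior_subset])
      show "continuous_on (closure ?B) F"
        unfolding closure_closed[OF closed_cbox] by (rule holomorphic_on_imp_continuous_on[OF holB])
      show "bounded ?B" by simp
      show "z \<in> ?B" using z R by (auto simp: in_cbox_complex_iff)
      fix w assume "w \<in> frontier ?B"
      then have w: "\<bar>Re w\<bar> \<le> 1" "\<bar>Im w\<bar> \<le> R" "\<bar>Re w\<bar> = 1 \<or> \<bar>Im w\<bar> = R"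
        by (auto simp: frontier_cbox in_cbox_complex_iff in_box_complex_iff not_less split: if_splits)
      have cw: "cos 1 * cosh (Im w) \<le> Re (cos w)"
        unfolding Recos by (intro mult_right_mono cos1 w) auto
      then have cw0: "0 \<le> Re (cos w)" using c1 by (meson order_trans mult_nonneg_nonneg less_imp_le cosh_real_nonneg)
      show "norm (F w) \<le> M"
      proof (cases "\<bar>Re w\<bar> = 1")
        case True
        have "norm (f w) * exp (- e * Re (cos w)) \<le> M * 1"
          using bd[OF True] cw0 e M by (intro mult_mono) auto
        then show ?thesis by (simp add: nF)
      next
        case False
        then have Im: "\<bar>Im w\<bar> = R" using w by simp
        then have ch: "cosh (Im w) = cosh R" using cosh_real_abs[of "Im w"] by simp
        have "norm (f w) * exp (- e * Re (cos w)) \<le> exp ((2 + R) ^ A) * exp (- e * (cos 1 * cosh R))"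
          using growth[of w] w Im R cw e by (intro mult_mono) (auto simp: ch)
        also have "\<dots> = exp ((2 + R) ^ A - e * cos 1 * cosh R)" by (simp flip: exp_add)
        also have "\<dots> \<le> M" using R(1) M by (metis exp_le_cancel_iff exp_ln)
        finally show ?thesis by (simp add: nF)
      qed
    qed
    then show ?thesis by (simp add: nF)
  qed
  have "((\<lambda>e. norm (f z) * exp (- e * Re (cos z))) \<longlongrightarrow> norm (f z) * exp (- 0 * Re (cos z))) (at_right 0)"
    by (intro tendsto_intros)
  then have "norm (f z) * exp (- 0 * Re (cos z)) \<le> M"
    by (rule tendsto_upperbound) (use eps in \<open>auto simp: eventually_at_right_less eventually_at intro!: exI[of _ 1]\<close>)
  then show ?thesis by simp
qed

lemma Gamma_R_cnj: "Gamma_R (cnj z) = cnj (Gamma_R z)"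
proof -
  have "of_real pi powr (cnj w) = cnj (of_real pi powr w)" for w
    unfolding powr_def by (simp add: exp_cnj Ln_of_real)
  from this[of "- z / 2"] have "of_real pi powr (- cnj z / 2) = cnj (of_real pi powr (- z / 2))" by simp
  moreover have "Gamma (cnj z / 2) = cnj (Gamma (z / 2))" using cnj_Gamma[of "z / 2"] by simp
  ultimately show ?thesis unfolding Gamma_R_def by simp
qed

lemma Gamma_R_plus2:
  assumes "z / 2 \<notin> \<int>\<^sub>\<le>\<^sub>0"
  shows "norm (Gamma_R (z + 2)) = norm z / (2 * pi) * norm (Gamma_R z)"
proof -
  have e: "(z + 2) / 2 = z / 2 + 1" by simp
  have "Gamma (z / 2 + 1) = z / 2 * Gamma (z / 2)" using assms by (intro Gamma_plus1) auto
  moreover have "norm (complex_of_real pi powr (- (z + 2) / 2)) = norm (complex_of_real pi powr (- z / 2)) / pi"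
  proof -
    have "pi powr (- (Re z + 2) / 2) = pi powr (- Re z / 2 - 1)" by (simp add: field_simps)
    also have "\<dots> = pi powr (- Re z / 2) / pi" by (simp add: powr_diff)
    finally show ?thesis by (simp add: norm_powr_real_powr)
  qed
  ultimately have "norm (Gamma_R (z + 2)) = norm (complex_of_real pi powr (- z / 2)) / pi * (norm (z / 2) * norm (Gamma (z / 2)))"
    unfolding Gamma_R_def e norm_mult by (simp only: norm_mult)
  then show ?thesis unfolding Gamma_R_def norm_mult norm_divide by (simp add: mult_ac)
qed

text \<open>On Re s = -1/2 the reflected point 1 - s is the conjugate of s + 2, so the Gamma factors
  of the functional equation differ by an exact shift by 2. Their quotient has modulus |s + \<mu> j|
  / (2 pi), which replaces Stirling's formula. Phragmen-Lindelof then fills the strip up to Re s =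
  3/2, where L is bounded by hypothesis.\<close>

lemma L_function_growth:
  fixes \<pi> :: "'n::finite adele_fun set"
  assumes L: "L_function \<pi> \<alpha> Q \<mu> \<epsilon> L" and hol: "L holomorphic_on UNIV"
    and bd: "\<And>s. Re s \<ge> 3/2 \<Longrightarrow> norm (L s) \<le> K"
  shows "\<exists>C>0. \<forall>s. Re s \<ge> -1/2 \<longrightarrow> norm (L s) \<le> C * norm (s + 2) ^ CARD('n)"
proof -
  have Q: "Q > 0" and eps: "norm \<epsilon> = 1"
    and fe: "\<And>s. (\<forall>j. (s + \<mu> j) / 2 \<notin> \<int>\<^sub>\<le>\<^sub>0 \<and> (1 - s + cnj (\<mu> j)) / 2 \<notin> \<int>\<^sub>\<le>\<^sub>0) \<Longrightarrow> L analytic_on {s, 1 - cnj s} \<Longrightarrow>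
        completed_L Q \<mu> L s = \<epsilon> * completed_L Q (\<lambda>j. cnj (\<mu> j)) (\<lambda>z. cnj (L (cnj z))) (1 - s)"
    and gr: "\<exists>A. \<forall>\<^sub>F s in at_infinity. norm (L s) \<le> exp (norm s ^ A)"
    using L unfolding L_function_def by blast+
  have ana: "L analytic_on X" for X
    using hol by (meson analytic_on_holomorphic open_UNIV subset_UNIV)
  have K0: "K \<ge> 0" using order_trans[OF norm_ge_zero bd[of 2]] by simp
  \<comment> \<open>At height at least T0 no argument of a Gamma factor is real, so poles are
    avoided; the remaining segment of the line is handled by compactness.\<close>
  define T0 where "T0 = Max (range (\<lambda>j. \<bar>Im (\<mu> j)\<bar>)) + 1"
  have T0: "\<bar>Im (\<mu> j)\<bar> < T0" for j unfolding T0_def by (meson Max_ge finite_imageI finite range_eqI less_add_one order_le_less_trans)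
  define C1 where "C1 = (\<Prod>j\<in>UNIV. (2 + norm (\<mu> j)))"
  have left: "norm (L s) \<le> Q * C1 * K * norm (s + 2) ^ CARD('n)" if s: "Re s = -1/2" "\<bar>Im s\<bar> \<ge> T0" for s
  proof -
    have Im0: "Im (s + \<mu> j) \<noteq> 0" for j using T0[of j] s by auto
    have nonpole: "(s + \<mu> j) / 2 \<notin> \<int>\<^sub>\<le>\<^sub>0 \<and> (1 - s + cnj (\<mu> j)) / 2 \<notin> \<int>\<^sub>\<le>\<^sub>0" for j
    proof -
      have "Im ((s + \<mu> j) / 2) \<noteq> 0" "Im ((1 - s + cnj (\<mu> j)) / 2) \<noteq> 0"
        using Im0[of j] by auto
      moreover have "Im x = 0" if "x \<in> \<int>\<^sub>\<le>\<^sub>0" for x :: complex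
        using that by (auto elim!: nonpos_Ints_cases)
      ultimately show ?thesis by blast
    qed
    have s2: "1 - s + cnj (\<mu> j) = cnj (s + 2 + \<mu> j)" for j using s by (simp add: complex_eq_iff)
    have s3: "cnj (1 - s) = s + 2" using s by (simp add: complex_eq_iff)
    have Gnz: "Gamma_R (s + \<mu> j) \<noteq> 0" for j
      using nonpole[of j] by (simp add: Gamma_R_def Gamma_eq_zero_iff)
    have GR: "norm (Gamma_R (1 - s + cnj (\<mu> j))) = norm (s + \<mu> j) / (2 * pi) * norm (Gamma_R (s + \<mu> j))" for j
    proof -
      have "norm (Gamma_R (1 - s + cnj (\<mu> j))) = norm (Gamma_R (s + \<mu> j + 2))"
        unfolding s2 Gamma_R_cnj by (simp add: add_ac)
      then show ?thesis using Gamma_R_plus2[of "s + \<mu> j"] nonpole[of j] by simp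
    qed
    define P where "P = (\<Prod>j\<in>UNIV. norm (Gamma_R (s + \<mu> j)))"
    have P: "P > 0" unfolding P_def by (intro prod_pos) (use Gnz in auto)
    have q1: "norm (of_nat Q powr (s / 2) :: complex) = Q powr (-1/4)"
      using norm_powr_real_powr[of "of_nat Q" "s/2"] Q s by simp
    have q2: "norm (of_nat Q powr ((1 - s) / 2) :: complex) = Q powr (3/4)"
      using norm_powr_real_powr[of "of_nat Q" "(1-s)/2"] Q s by simp
    have "norm (completed_L Q \<mu> L s) = norm (completed_L Q (\<lambda>j. cnj (\<mu> j)) (\<lambda>z. cnj (L (cnj z))) (1 - s))"
      using fe[OF _ ana] nonpole eps by (simp add: norm_mult)
    then have "Q powr (-1/4) * P * norm (L s) =
       Q powr (3/4) * (\<Prod>j\<in>UNIV. norm (s + \<mu> j) / (2 * pi) * norm (Gamma_R (s + \<mu> j))) * norm (L (s + 2))"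
      unfolding completed_L_def norm_mult q1 q2 prod_norm[symmetric] GR s3 by (simp add: P_def)
    also have "\<dots> = Q powr (3/4) * (\<Prod>j\<in>UNIV. norm (s + \<mu> j) / (2 * pi)) * P * norm (L (s + 2))"
      unfolding prod.distrib P_def by simp
    finally have "P * (Q powr (-1/4) * norm (L s)) = P * (Q powr (3/4) * (\<Prod>j\<in>UNIV. norm (s + \<mu> j) / (2 * pi)) * norm (L (s + 2)))"
      by (simp only: mult_ac)
    then have "Q powr (-1/4) * norm (L s) = Q powr (3/4) * (\<Prod>j\<in>UNIV. norm (s + \<mu> j) / (2 * pi)) * norm (L (s + 2))"
      using P by simp
    then have "Q powr (1/4) * (Q powr (-1/4) * norm (L s)) = Q powr (1/4) * (Q powr (3/4) * (\<Prod>j\<in>UNIV. norm (s + \<mu> j) / (2 * pi)) * norm (L (s + 2)))"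
      by simp
    then have "norm (L s) = Q * (\<Prod>j\<in>UNIV. norm (s + \<mu> j) / (2 * pi)) * norm (L (s + 2))"
      using Q by (simp add: mult.assoc[symmetric] flip: powr_add)
    also have "\<dots> \<le> Q * (\<Prod>j\<in>UNIV. (2 + norm (\<mu> j)) * norm (s + 2)) * K"
    proof (intro mult_mono prod_mono conjI)
      fix j
      have n1: "norm (s + 2) \<ge> 1" using complex_Re_le_cmod[of "s + 2"] s by simp
      have "norm (s + \<mu> j) \<le> norm (s + 2) + norm (\<mu> j - 2)"
        using norm_triangle_ineq[of "s + 2" "\<mu> j - 2"] by simp
      also have "norm (\<mu> j - 2) \<le> norm (\<mu> j) + 2" using norm_triangle_ineq4[of "\<mu> j" 2] by simp
      also have "norm (s + 2) + (norm (\<mu> j) + 2) \<le> norm (s + 2) * (3 + norm (\<mu> j))"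
        using mult_left_mono[OF n1, of "2 + norm (\<mu> j)"] by (simp add: algebra_simps)
      finally have "norm (s + \<mu> j) \<le> norm (s + 2) * (3 + norm (\<mu> j))" by simp
      then have "norm (s + \<mu> j) / (2 * pi) \<le> norm (s + 2) * (3 + norm (\<mu> j)) / 2"
        using pi_gt3 by (intro frac_le) auto
      also have "\<dots> \<le> (2 + norm (\<mu> j)) * norm (s + 2)"
        using mult_nonneg_nonneg[of "norm (s + 2)" "norm (\<mu> j)"] by (simp add: algebra_simps)
      finally show "norm (s + \<mu> j) / (2 * pi) \<le> (2 + norm (\<mu> j)) * norm (s + 2)" .
      show "norm (L (s + 2)) \<le> K" using s by (intro bd) simp
    qed (auto intro!: prod_nonneg mult_nonneg_nonneg add_nonneg_nonneg)
    finally show ?thesis by (simp add: prod.distrib C1_def mult_ac)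
  qed
  have "compact (cbox (Complex (-1/2) (-T0)) (Complex (-1/2) T0))" by (rule compact_cbox)
  then have "bounded (L ` cbox (Complex (-1/2) (-T0)) (Complex (-1/2) T0))"
    by (intro compact_imp_bounded compact_continuous_image holomorphic_on_imp_continuous_on holomorphic_on_subset[OF hol]) auto
  then obtain C2 where C2: "\<And>s. Re s = -1/2 \<Longrightarrow> \<bar>Im s\<bar> \<le> T0 \<Longrightarrow> norm (L s) \<le> C2"
    by (force simp: bounded_iff in_cbox_complex_iff)
  define M where "M = max (max (Q * C1 * K) C2) K + 1"
  have M: "M > 0" "K \<le> M" "C2 \<le> M" "Q * C1 * K \<le> M" using K0 by (auto simp: M_def)
  obtain A where A: "\<forall>\<^sub>F s in at_infinity. norm (L s) \<le> exp (norm s ^ A)" using gr by blast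
  then obtain R0 where R0: "\<And>s. norm s \<ge> R0 \<Longrightarrow> norm (L s) \<le> exp (norm s ^ A)"
    by (auto simp: eventually_at_infinity)
  have strip: "norm (L s) \<le> M * norm (s + 2) ^ CARD('n)" if s: "-1/2 \<le> Re s" "Re s \<le> 3/2" for s
  proof -
    \<comment> \<open>With s = z + 1/2, dividing by (s + 2)^n makes the function bounded on both
      edges; s + 2 has no zero in the region.\<close>
    define f where "f = (\<lambda>z. L (z + 1/2) / (z + 5/2) ^ CARD('n))"
    have z2: "norm (z + 5/2) \<ge> 1" if "Re z \<ge> -1" for z
      using complex_Re_le_cmod[of "z + 5/2"] that by simp
    have "norm (f (s - 1/2)) \<le> M"
    proof (rule Phragmen_Lindelof_strip[where f = f and z = "s - 1/2" and S = "{z. Re z > -5/2}" and ?R0.0 = "R0"])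
      show "f holomorphic_on {z. Re z > -5/2}"
        unfolding f_def
      proof (rule holomorphic_on_divide)
        show "(\<lambda>z. L (z + 1/2)) holomorphic_on {z. Re z > -5/2}"
          by (rule holomorphic_on_compose_gen[OF _ hol, unfolded o_def]) (auto intro!: holomorphic_intros)
        show "(\<lambda>z. (z + 5/2) ^ CARD('n)) holomorphic_on {z. Re z > -5/2}" by (intro holomorphic_intros)
        fix z assume "z \<in> {z. Re z > -5/2}"
        then have "z + 5/2 \<noteq> 0" by (auto simp: complex_eq_iff)
        then show "(z + 5/2) ^ CARD('n) \<noteq> 0" by simp
      qed
      show "open {z. Re z > -5/2}" by (rule open_halfspace_Re_gt)
      show "\<bar>Re (s - 1/2)\<bar> \<le> 1" using s by auto
      show "norm (f z) \<le> M" if "\<bar>Re z\<bar> = 1" for z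
      proof -
        have p1: "norm (z + 5/2) ^ CARD('n) \<ge> 1" using z2[of z] that by (intro one_le_power) auto
        have "Re z = 1 \<or> (Re z = -1 \<and> T0 \<le> \<bar>Im z\<bar>) \<or> (Re z = -1 \<and> \<bar>Im z\<bar> \<le> T0)"
          using that by arith
        then consider "Re z = 1" | "Re z = -1" "\<bar>Im z\<bar> \<ge> T0" | "Re z = -1" "\<bar>Im z\<bar> \<le> T0" by blast
        then have "norm (L (z + 1/2)) \<le> M * norm (z + 5/2) ^ CARD('n)"
        proof cases
          case 1
          then have "norm (L (z + 1/2)) \<le> M * 1" using bd[of "z + 1/2"] M by simp
          also have "\<dots> \<le> M * norm (z + 5/2) ^ CARD('n)" using p1 M by (intro mult_left_mono) auto
          finally show ?thesis .
        next
          case 2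
          then have "norm (L (z + 1/2)) \<le> Q * C1 * K * norm (z + 5/2) ^ CARD('n)" using left[of "z + 1/2"] by (simp add: add.assoc)
          also have "\<dots> \<le> M * norm (z + 5/2) ^ CARD('n)" using M by (intro mult_right_mono) auto
          finally show ?thesis .
        next
          case 3
          then have "norm (L (z + 1/2)) \<le> M * 1" using C2[of "z + 1/2"] M by simp
          also have "\<dots> \<le> M * norm (z + 5/2) ^ CARD('n)" using p1 M by (intro mult_left_mono) auto
          finally show ?thesis .
        qed
        moreover have "norm (z + 5/2) ^ CARD('n) > 0" using p1 by linarith
        ultimately show ?thesis unfolding f_def norm_divide norm_power by (simp only: pos_divide_le_eq)
      qed
      show "norm (f z) \<le> exp ((2 + \<bar>Im z\<bar>) ^ A)" if "\<bar>Re z\<bar> \<le> 1" "R0 \<le> \<bar>Im z\<bar>" for z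
      proof -
        have "norm (z + 1/2) \<ge> \<bar>Im z\<bar>" using abs_Im_le_cmod[of "z + 1/2"] by simp
        then have "norm (L (z + 1/2)) \<le> exp (norm (z + 1/2) ^ A)" using that by (intro R0) auto
        also have "norm (z + 1/2) \<le> 2 + \<bar>Im z\<bar>"
          using cmod_le[of "z + 1/2"] that by simp
        then have "exp (norm (z + 1/2) ^ A) \<le> exp ((2 + \<bar>Im z\<bar>) ^ A)" by (simp add: power_mono)
        finally have *: "norm (L (z + 1/2)) \<le> exp ((2 + \<bar>Im z\<bar>) ^ A)" .
        have p1: "norm (z + 5/2) ^ CARD('n) \<ge> 1" using z2[of z] that by (intro one_le_power) auto
        have "norm (f z) \<le> norm (L (z + 1/2)) / 1"
          unfolding f_def norm_divide norm_power using p1 by (intro divide_left_mono) auto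
        then show ?thesis using * by simp
      qed
    qed (use M in auto)
    moreover have "norm (s + 2) \<ge> 1" using complex_Re_le_cmod[of "s + 2"] s by simp
    then have "norm (s + 2) ^ CARD('n) > 0" by (intro zero_less_power) linarith
    moreover have "s - 1/2 + 1/2 = s" "s - 1/2 + 5/2 = s + 2" by simp_all
    ultimately show ?thesis
      unfolding f_def norm_divide norm_power by (simp only: pos_divide_le_eq)
  qed
  show ?thesis
  proof (intro exI[of _ M] conjI allI impI)
    fix s :: complex assume s: "Re s \<ge> -1/2"
    show "norm (L s) \<le> M * norm (s + 2) ^ CARD('n)"
    proof (cases "Re s \<le> 3/2")
      case False
      have "norm (s + 2) ^ CARD('n) \<ge> 1"
        using complex_Re_le_cmod[of "s + 2"] s by (intro one_le_power) simp
      then have "M * 1 \<le> M * norm (s + 2) ^ CARD('n)" using M by (intro mult_left_mono) auto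
      moreover have "norm (L s) \<le> K" using False by (intro bd) simp
      ultimately show ?thesis using M(2) by linarith
    qed (use strip s in simp)
  qed fact
qed

section \<open>Sums over primes\<close>

definition prime_weight :: "nat \<Rightarrow> real" where
  "prime_weight n = (if prime n then ln (real n) / real n else 0)"

lemma prime_weight_nonneg: "0 \<le> prime_weight n"
  using prime_ge_1_nat[of n] by (auto simp: prime_weight_def)

lemma prod_primes_dvd:
  assumes "finite S" "\<And>p. p \<in> S \<Longrightarrow> prime p" "\<And>p. p \<in> S \<Longrightarrow> p dvd (m::nat)"
  shows "\<Prod>S dvd m"
  using assms
proof (induction S rule: finite_induct)
  case (insert p S)
  have "coprime p (\<Prod>S)"
    by (rule prod_coprime_right) (use insert in \<open>auto intro!: primes_coprime\<close>)
  then show ?case using insert by (auto intro!: divides_mult)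
qed simp

text \<open>Chebyshev's argument: the primes in (n, 2n] all divide the central binomial
  coefficient.\<close>

lemma prod_primes_le: "\<Prod>{p::nat. prime p \<and> n < p \<and> p \<le> 2 * n} \<le> 2 ^ (2 * n)"
proof -
  let ?S = "{p::nat. prime p \<and> n < p \<and> p \<le> 2 * n}"
  have "\<Prod>?S dvd (2 * n) choose n"
  proof (rule prod_primes_dvd)
    fix p assume p: "p \<in> ?S"
    have "p dvd fact (2 * n)" using p by (auto simp: prime_dvd_fact_iff)
    also have "fact (2 * n) = fact n * fact (2 * n - n) * ((2 * n) choose n)"
      by (rule binomial_fact_lemma[symmetric]) simp
    finally have "p dvd fact n * fact n * ((2 * n) choose n)" by simp
    moreover have "\<not> p dvd fact n" using p by (auto simp: prime_dvd_fact_iff)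
    ultimately show "p dvd (2 * n) choose n" using p by (auto simp: prime_dvd_mult_iff)
  qed auto
  then have "\<Prod>?S \<le> (2 * n) choose n" by (rule dvd_imp_le) simp
  also have "\<dots> \<le> (\<Sum>k\<le>2 * n. (2 * n) choose k)" by (rule member_le_sum) auto
  also have "\<dots> = 2 ^ (2 * n)" by (rule choose_row_sum)
  finally show ?thesis .
qed

text \<open>By Chebyshev's bound a dyadic block contributes at most 2 ln 2. Summed over blocks this
  is the upper bound in Mertens' first theorem up to a constant.\<close>

lemma prime_weight_block: "(\<Sum>n\<in>{2 ^ k<..2 ^ Suc k}. prime_weight n) \<le> 2"
proof -
  let ?n = "2 ^ k :: nat"
  let ?S = "{p::nat. prime p \<and> ?n < p \<and> p \<le> 2 * ?n}"
  have fin: "finite ?S" by (rule finite_subset[of _ "{..2 * ?n}"]) auto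
  have "(\<Sum>n\<in>{2 ^ k<..2 ^ Suc k}. prime_weight n) = (\<Sum>p\<in>?S. ln (real p) / real p)"
    unfolding prime_weight_def by (rule sum.mono_neutral_cong_right) auto
  also have "\<dots> \<le> (\<Sum>p\<in>?S. ln (real p) / 2 ^ k)"
  proof (intro sum_mono divide_left_mono)
    fix p assume p: "p \<in> ?S"
    show "2 ^ k \<le> real p" using p by (metis (no_types, lifting) less_imp_le mem_Collect_eq of_nat_le_iff of_nat_numeral of_nat_power)
    show "0 \<le> ln (real p)" using p prime_ge_1_nat by auto
    show "0 < real p * 2 ^ k" using p prime_gt_0_nat by auto
  qed
  also have "\<dots> = ln (real (\<Prod>?S)) / 2 ^ k"
    using prime_gt_0_nat by (subst of_nat_prod, subst ln_prod) (auto simp: sum_divide_distrib fin)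
  also have "\<dots> \<le> ln (real (2 ^ (2 * ?n))) / 2 ^ k"
  proof (intro divide_right_mono)
    have "\<Prod>?S > 0" using prime_gt_0_nat by (intro prod_pos) auto
    then show "ln (real (\<Prod>?S)) \<le> ln (real (2 ^ (2 * ?n)))"
      using prod_primes_le[of ?n] by (subst ln_le_cancel_iff) (auto simp del: of_nat_prod of_nat_power)
  qed simp
  also have "\<dots> = 2 * ln 2" by (simp add: ln_realpow)
  also have "\<dots> \<le> 2 * 1" using ln_2_less_1 by simp
  finally show ?thesis by simp
qed

text \<open>Partial summation in dyadic form.\<close>

lemma prime_weight_sum_blocks:
  assumes "\<And>k n. k < K \<Longrightarrow> 2 ^ k < n \<Longrightarrow> n \<le> 2 ^ Suc k \<Longrightarrow> h n \<le> H k" and "\<And>k. 0 \<le> H k"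
  shows "(\<Sum>n\<le>2 ^ K. prime_weight n * h n) \<le> 2 * (\<Sum>k<K. H k)"
  using assms(1)
proof (induction K)
  case 0
  have "prime_weight 0 = 0" "prime_weight (Suc 0) = 0" by (auto simp: prime_weight_def)
  then show ?case by simp
next
  case (Suc K)
  have "{..2 ^ Suc K} = {..2 ^ K} \<union> {2 ^ K<..2 ^ Suc K :: nat}" by auto
  then have "(\<Sum>n\<le>2 ^ Suc K. prime_weight n * h n) = (\<Sum>n\<le>2 ^ K. prime_weight n * h n) + (\<Sum>n\<in>{2 ^ K<..2 ^ Suc K}. prime_weight n * h n)"
    by (simp only:) (rule sum.union_disjoint; auto)
  also have "(\<Sum>n\<in>{2 ^ K<..2 ^ Suc K}. prime_weight n * h n) \<le> (\<Sum>n\<in>{2 ^ K<..2 ^ Suc K}. prime_weight n * H K)"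
    using Suc.prems by (intro sum_mono mult_left_mono prime_weight_nonneg) auto
  also have "\<dots> = (\<Sum>n\<in>{2 ^ K<..2 ^ Suc K}. prime_weight n) * H K" by (rule sum_distrib_right[symmetric])
  also have "\<dots> \<le> 2 * H K" by (rule mult_right_mono[OF prime_weight_block assms(2)])
  also have "(\<Sum>n\<le>2 ^ K. prime_weight n * h n) \<le> 2 * (\<Sum>k<K. H k)"
    by (rule Suc.IH) (use Suc.prems in auto)
  finally show ?case by simp
qed

text \<open>The dyadic blocks give a geometric series of ratio 2^(- \<sigma>), whose sum is of order
  1 / \<sigma>. The factor \<sigma> in front keeps the functionals of Karamata's method bounded as
  \<sigma> tends to 0.\<close>

lemma prime_weight_Dirichlet_bound:
  assumes \<sigma>: "0 < \<sigma>" "\<sigma> \<le> 1"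
  shows "summable (\<lambda>n. prime_weight n * real n powr - \<sigma>)"
    and "\<sigma> * (\<Sum>n. prime_weight n * real n powr - \<sigma>) \<le> 8"
proof -
  define q where "q = (2::real) powr - \<sigma>"
  have q: "0 < q" "q < 1" using \<sigma> by (auto simp: q_def powr_less_one)
  \<comment> \<open>From 2^\<sigma> >= 1 + \<sigma> ln 2 and 1/2 <= ln 2 <= 1.\<close>
  have q8: "\<sigma> / (1 - q) \<le> 4"
  proof -
    have ln2: "1/2 \<le> ln (2::real)"
      using ln_add_one_self_le_self2[of "-1/2"] by (simp add: ln_div)
    have "exp (\<sigma> * ln 2) \<ge> 1 + \<sigma> * ln 2" by (rule exp_ge_add_one_self)
    then have "q \<le> 1 / (1 + \<sigma> * ln 2)"
    proof -
      have "q = 1 / exp (\<sigma> * ln 2)" by (simp add: q_def powr_def exp_minus inverse_eq_divide)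
      also have "\<dots> \<le> 1 / (1 + \<sigma> * ln 2)"
        using \<sigma> ln2 exp_ge_add_one_self[of "\<sigma> * ln 2"] by (intro divide_left_mono mult_pos_pos add_pos_nonneg) auto
      finally show ?thesis .
    qed
    moreover have "1 / (1 + \<sigma> * ln 2) \<le> 1 - \<sigma> / 4"
    proof -
      have l1: "ln 2 \<le> (1::real)" using ln_2_less_1 by simp
      have "(1 - \<sigma> / 4) * (1 + \<sigma> * ln 2) = 1 + \<sigma> * (ln 2 - 1/4 - \<sigma> * ln 2 / 4)" by (simp add: algebra_simps)
      moreover have "\<sigma> * ln 2 \<le> 1 * 1" using \<sigma> ln2 l1 by (intro mult_mono) auto
      then have "0 \<le> \<sigma> * (ln 2 - 1/4 - \<sigma> * ln 2 / 4)" using \<sigma> ln2 by (intro mult_nonneg_nonneg) auto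
      ultimately have "1 \<le> (1 - \<sigma> / 4) * (1 + \<sigma> * ln 2)" by simp
      moreover have "1 + \<sigma> * ln 2 > 0" using \<sigma> ln2 by (intro add_pos_nonneg) auto
      ultimately show ?thesis by (simp add: pos_divide_le_eq)
    qed
    ultimately have "q \<le> 1 - \<sigma> / 4" by (rule order_trans)
    then have "\<sigma> \<le> 4 * (1 - q)" by simp
    then show ?thesis using q by (simp add: pos_divide_le_eq)
  qed
  have part: "(\<Sum>n\<le>N. prime_weight n * real n powr - \<sigma>) \<le> 2 / (1 - q)" for N
  proof -
    obtain K where K: "N \<le> 2 ^ K" using less_exp[of N] less_imp_le by blast
    have "(\<Sum>n\<le>N. prime_weight n * real n powr - \<sigma>) \<le> (\<Sum>n\<le>2 ^ K. prime_weight n * real n powr - \<sigma>)"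
      by (rule sum_mono2) (use K prime_weight_nonneg in auto)
    also have "\<dots> \<le> 2 * (\<Sum>k<K. q ^ k)"
    proof (rule prime_weight_sum_blocks)
      fix k n :: nat assume n: "2 ^ k < n"
      then have "real (2 ^ k) \<le> real n" by simp
      then have "real n powr - \<sigma> \<le> real (2 ^ k) powr - \<sigma>" using \<sigma> by (intro powr_mono2') auto
      also have "\<dots> = q ^ k"
        by (simp add: q_def powr_powr mult.commute flip: powr_realpow)
      finally show "real n powr - \<sigma> \<le> q ^ k" .
    qed (use q in auto)
    also have "(\<Sum>k<K. q ^ k) \<le> (\<Sum>k. q ^ k)"
      using q by (intro sum_le_suminf) auto
    also have "(\<Sum>k. q ^ k) = 1 / (1 - q)" using q by (intro suminf_geometric) auto
    finally show ?thesis by simp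
  qed
  have nn: "0 \<le> prime_weight n * real n powr - \<sigma>" for n using prime_weight_nonneg by simp
  show sm: "summable (\<lambda>n. prime_weight n * real n powr - \<sigma>)"
    by (rule bounded_imp_summable[OF nn part])
  have "(\<Sum>n. prime_weight n * real n powr - \<sigma>) \<le> 2 / (1 - q)"
  proof (rule suminf_le_const[OF sm])
    fix N
    have "(\<Sum>n<N. prime_weight n * real n powr - \<sigma>) \<le> (\<Sum>n\<le>N. prime_weight n * real n powr - \<sigma>)"
      by (rule sum_mono2) (use nn in auto)
    then show "(\<Sum>n<N. prime_weight n * real n powr - \<sigma>) \<le> 2 / (1 - q)" using part[of N] by linarith
  qed
  then have "\<sigma> * (\<Sum>n. prime_weight n * real n powr - \<sigma>) \<le> \<sigma> * (2 / (1 - q))" using \<sigma> by (intro mult_left_mono) auto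
  also have "\<dots> = 2 * (\<sigma> / (1 - q))" by simp
  also have "\<dots> \<le> 2 * 4" using q8 by (intro mult_left_mono) auto
  finally show "\<sigma> * (\<Sum>n. prime_weight n * real n powr - \<sigma>) \<le> 8" by simp
qed

lemma card_nat_interval_le:
  assumes "a \<le> b"
  shows "real (card {k::nat. a < real k \<and> real k < b}) \<le> b - a + 1"
proof -
  have "int ` {k::nat. a < real k \<and> real k < b} \<subseteq> {\<lfloor>a\<rfloor>+1..\<lceil>b\<rceil>-1}"
    by (auto simp: floor_less_iff less_ceiling_iff) linarith+
  then have "card (int ` {k::nat. a < real k \<and> real k < b}) \<le> card {\<lfloor>a\<rfloor>+1..\<lceil>b\<rceil>-1}"
    by (intro card_mono) auto
  also have "card (int ` {k::nat. a < real k \<and> real k < b}) = card {k::nat. a < real k \<and> real k < b}"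
    by (intro card_image) (auto simp: inj_on_def)
  finally have "card {k::nat. a < real k \<and> real k < b} \<le> nat (\<lceil>b\<rceil> - 1 - \<lfloor>a\<rfloor>)" by simp
  moreover have "real (nat (\<lceil>b\<rceil> - 1 - \<lfloor>a\<rfloor>)) \<le> b - a + 1" using assms by linarith
  ultimately show ?thesis by linarith
qed

text \<open>At most (V - U) / ln 2 + 2 dyadic blocks meet the interval, and each contributes at most
  2. In contrast to the Dirichlet bound this is local, and so controls what happens near the ends of
  a sharp cut-off.\<close>

lemma prime_weight_interval:
  assumes UV: "U \<le> V" and S: "finite S" "\<And>n. n \<in> S \<Longrightarrow> U < ln (real n) \<and> ln (real n) < V"
  shows "(\<Sum>n\<in>S. prime_weight n) \<le> 4 * (V - U) + 6"
proof -
  have l2: "1/2 \<le> ln (2::real)" using ln_add_one_self_le_self2[of "-1/2"] by (simp add: ln_div)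
  obtain N where N: "\<And>n. n \<in> S \<Longrightarrow> n \<le> N" using S(1) by (meson Max_ge)
  obtain K where K: "N \<le> 2 ^ K" using less_exp[of N] less_imp_le by blast
  \<comment> \<open>Marks the k for which the block from 2^k to 2^(k+1) can meet the interval; the
    -1 accounts for the upper end of the block.\<close>
  define H where "H = (\<lambda>k::nat. if U / ln 2 - 1 < real k \<and> real k < V / ln 2 then 1 else (0::real))"
  have "(\<Sum>n\<in>S. prime_weight n) = (\<Sum>n\<in>S. prime_weight n * of_bool (n \<in> S))" by simp
  also have "\<dots> \<le> (\<Sum>n\<le>2 ^ K. prime_weight n * of_bool (n \<in> S))"
    by (rule sum_mono2) (use N K prime_weight_nonneg in \<open>auto intro: order_trans\<close>)
  also have "\<dots> \<le> 2 * (\<Sum>k<K. H k)"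
  proof (rule prime_weight_sum_blocks)
    fix k n :: nat assume n: "2 ^ k < n" "n \<le> 2 ^ Suc k"
    show "of_bool (n \<in> S) \<le> H k"
    proof (cases "n \<in> S")
      case True
      have n0: "0 < n" using n(1) by (metis gr0I not_less_zero)
      have "ln (real (2 ^ k)) \<le> ln (real n)" using n n0 by (subst ln_le_cancel_iff) (auto simp del: of_nat_power)
      then have 1: "real k * ln 2 < V" using S(2)[OF True] by (simp add: ln_realpow)
      have "ln (real n) \<le> ln (real (2 ^ Suc k))" using n n0 by (subst ln_le_cancel_iff) (auto simp del: of_nat_power power_Suc)
      also have "\<dots> = real (Suc k) * ln 2" by (simp add: ln_realpow del: power_Suc of_nat_Suc)
      finally have 2: "U < real (Suc k) * ln 2" using S(2)[OF True] by linarith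
      have "H k = 1" using 1 2 l2 unfolding H_def by (auto simp: field_simps)
      then show ?thesis by simp
    qed (simp add: H_def)
  qed (simp add: H_def)
  also have "(\<Sum>k<K. H k) \<le> real (card {k::nat. U / ln 2 - 1 < real k \<and> real k < V / ln 2})"
  proof -
    have fin: "finite {k::nat. U / ln 2 - 1 < real k \<and> real k < V / ln 2}"
      by (rule finite_subset[of _ "{..nat \<lceil>V / ln 2\<rceil>}"]) (auto, linarith)
    have "(\<Sum>k<K. H k) = real (card ({..<K} \<inter> {k::nat. U / ln 2 - 1 < real k \<and> real k < V / ln 2}))"
      unfolding H_def by (simp add: sum.If_cases)
    also have "\<dots> \<le> real (card {k::nat. U / ln 2 - 1 < real k \<and> real k < V / ln 2})"
      using fin by (intro of_nat_mono card_mono) auto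
    finally show ?thesis .
  qed
  also have "\<dots> \<le> V / ln 2 - (U / ln 2 - 1) + 1"
    using UV l2 by (intro card_nat_interval_le) (auto simp: divide_right_mono intro!: order_trans[OF _ divide_right_mono[OF UV]])
  also have "\<dots> = (V - U) / ln 2 + 2" by (simp add: diff_divide_distrib)
  also have "(V - U) / ln 2 \<le> (V - U) / (1/2)" using UV l2 by (intro divide_left_mono) auto
  finally show ?thesis using UV by simp
qed

section \<open>Karamata's method for sums over primes\<close>

lemma integral_power_unit: "((\<lambda>x::real. x ^ i) has_integral 1 / real (Suc i)) {0..1}"
proof -
  have "((\<lambda>x::real. x ^ i) has_integral (1 ^ Suc i / real (Suc i) - 0 ^ Suc i / real (Suc i))) {0..1}"
  proof (rule fundamental_theorem_of_calculus)
    fix x :: real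
    have "((\<lambda>x. x ^ Suc i / real (Suc i)) has_real_derivative (real (Suc i) * x ^ i) / real (Suc i)) (at x within {0..1})"
      by (rule DERIV_cdivide) (rule derivative_eq_intros refl | simp)+
    then show "((\<lambda>x. x ^ Suc i / real (Suc i)) has_vector_derivative x ^ i) (at x within {0..1})"
      by (simp add: has_real_derivative_iff_has_vector_derivative del: power_Suc of_nat_Suc)
  qed simp
  then show ?thesis by simp
qed

text \<open>With y = n^(-1/U), the range [exp (-1), exp (-1/2)] means U / 2 <= ln n <= U, and y
  times 1 / (y (- ln y)) is U / ln n; hence the integral ln 2 of this function is the constant of
  the limit. The sharp cut-off is made continuous by two ramps of width \<delta>, and as f <= 6 they
  change the integral by at most 12 \<delta>.\<close>

lemma Karamata_test_function:
  fixes \<delta> :: real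
  assumes \<delta>: "0 < \<delta>" "\<delta> \<le> 1/12"
  defines "a \<equiv> exp (-1)" and "b \<equiv> exp (-1/2)"
  shows "\<exists>f. continuous_on UNIV f \<and> (\<forall>y. 0 \<le> f y \<and> f y \<le> 6) \<and> (\<forall>y. y \<le> a - \<delta> \<longrightarrow> f y = 0) \<and> (\<forall>y. b + \<delta> \<le> y \<longrightarrow> f y = 0) \<and>
    (\<forall>y. a \<le> y \<longrightarrow> y \<le> b \<longrightarrow> f y = 1 / (y * - ln y)) \<and> \<bar>integral {0..1} f - ln 2\<bar> \<le> 12 * \<delta>"
proof -
  have a3: "1/3 \<le> a"
    using exp_le by (simp add: a_def exp_minus field_simps)
  have ab: "a \<le> b" by (simp add: a_def b_def)
  have b1: "b \<le> 7/8"
  proof -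
    have "3/2 \<le> exp (1/2 :: real)" using exp_ge_add_one_self[of "1/2 :: real"] by simp
    then have "1 / exp (1/2) \<le> 1 / (3/2 :: real)" by (intro divide_left_mono) auto
    then show ?thesis by (simp add: b_def exp_minus inverse_eq_divide)
  qed
  define \<psi> where "\<psi> = (\<lambda>y::real. 1 / (y * - ln y))"
  have psi: "0 \<le> \<psi> y \<and> \<psi> y \<le> 6" if "a \<le> y" "y \<le> b" for y
  proof -
    have y0: "y > 0" using that a3 by linarith
    have "ln y \<le> ln b" using that y0 by simp
    then have l: "1/2 \<le> - ln y" by (simp add: b_def)
    have "1/3 * (1/2) \<le> y * - ln y" using that a3 l by (intro mult_mono) auto
    then have "1/6 \<le> y * - ln y" by simp
    then have "\<psi> y \<le> 1 / (1/6)" unfolding \<psi>_def by (intro divide_left_mono) auto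
    moreover have "0 \<le> \<psi> y" unfolding \<psi>_def using \<open>1/6 \<le> y * - ln y\<close> by (intro divide_nonneg_nonneg) auto
    ultimately show ?thesis by simp
  qed
  \<comment> \<open>Clamping the argument to [a, b] extends \<psi> by constants, and the second
    factor is a trapezoid that vanishes from distance \<delta> of [a, b] on.\<close>
  define f where "f = (\<lambda>y. \<psi> (min b (max a y)) * max 0 (1 - (max 0 (a - y) + max 0 (y - b)) / \<delta>))"
  have clamp: "a \<le> min b (max a y) \<and> min b (max a y) \<le> b" for y using ab by auto
  have cont\<psi>: "continuous_on {a..b} \<psi>"
    unfolding \<psi>_def
  proof (intro continuous_intros ballI)
    fix y assume "y \<in> {a..b}"
    then have "y > 0" "y < 1" using a3 b1 by auto
    then show "y \<noteq> 0" "y * - ln y \<noteq> 0" by auto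
  qed
  have cont: "continuous_on UNIV f"
    unfolding f_def
    by (intro continuous_intros continuous_on_compose2[OF cont\<psi>]) (use clamp \<delta> in auto)
  have contS: "continuous_on S f" for S using cont continuous_on_subset by blast
  have f06: "0 \<le> f y \<and> f y \<le> 6" for y
  proof -
    have m: "0 \<le> max 0 (1 - (max 0 (a - y) + max 0 (y - b)) / \<delta>)" "max 0 (1 - (max 0 (a - y) + max 0 (y - b)) / \<delta>) \<le> 1"
      using \<delta> by auto
    have "f y \<le> 6 * 1" unfolding f_def using psi[of "min b (max a y)"] clamp[of y] m by (intro mult_mono) auto
    moreover have "0 \<le> f y" unfolding f_def using psi[of "min b (max a y)"] clamp[of y] m by (intro mult_nonneg_nonneg) auto
    ultimately show ?thesis by simp
  qed
  have fl: "f y = 0" if "y \<le> a - \<delta>" for y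
  proof -
    have "1 \<le> (max 0 (a - y) + max 0 (y - b)) / \<delta>" using that \<delta> by (simp add: pos_le_divide_eq)
    then show ?thesis by (simp add: f_def)
  qed
  have fr: "f y = 0" if "b + \<delta> \<le> y" for y
  proof -
    have "1 \<le> (max 0 (a - y) + max 0 (y - b)) / \<delta>" using that \<delta> by (simp add: pos_le_divide_eq)
    then show ?thesis by (simp add: f_def)
  qed
  have fm: "f y = \<psi> y" if "a \<le> y" "y \<le> b" for y using that by (simp add: f_def)
  have int: "f integrable_on {u..v}" for u v by (rule integrable_continuous_real[OF contS])
  have mid: "integral {a..b} f = ln 2"
  proof -
    have "(\<psi> has_integral (- ln (- ln b) - - ln (- ln a))) {a..b}"
    proof (rule fundamental_theorem_of_calculus[OF ab])
      fix y assume "y \<in> {a..b}"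
      then have y: "y > 0" "y < 1" using a3 b1 by auto
      then have "((\<lambda>y. - ln (- ln y)) has_real_derivative \<psi> y) (at y within {a..b})"
        unfolding \<psi>_def by (auto intro!: derivative_eq_intros simp: field_simps)
      then show "((\<lambda>y. - ln (- ln y)) has_vector_derivative \<psi> y) (at y within {a..b})"
        by (simp add: has_real_derivative_iff_has_vector_derivative)
    qed
    moreover have "- ln (- ln b) - - ln (- ln a) = ln 2" by (simp add: a_def b_def ln_div)
    ultimately have "integral {a..b} \<psi> = ln 2" by (simp add: integral_unique)
    moreover have "integral {a..b} f = integral {a..b} \<psi>" by (rule integral_cong) (use fm in auto)
    ultimately show ?thesis by simp
  qed
  have ramp: "0 \<le> integral {u..v} f \<and> integral {u..v} f \<le> 6 * (v - u)" if "u \<le> v" for u v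
  proof -
    have "integral {u..v} f \<le> integral {u..v} (\<lambda>_. 6)" by (rule integral_le[OF int]) (use f06 in auto)
    moreover have "0 \<le> integral {u..v} f" by (rule integral_nonneg[OF int]) (use f06 in auto)
    ultimately show ?thesis using that by simp
  qed
  have z1: "integral {0..a-\<delta>} f = 0"
    using integral_cong[of "{0..a-\<delta>}" f "\<lambda>_. 0"] fl by simp
  have z2: "integral {b+\<delta>..1} f = 0"
    using integral_cong[of "{b+\<delta>..1}" f "\<lambda>_. 0"] fr by simp
  have "integral {0..1} f = integral {0..a-\<delta>} f + integral {a-\<delta>..1} f"
    by (rule Henstock_Kurzweil_Integration.integral_combine[symmetric]) (use a3 ab b1 \<delta> int in auto)
  also have "integral {a-\<delta>..1} f = integral {a-\<delta>..a} f + integral {a..1} f"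
    by (rule Henstock_Kurzweil_Integration.integral_combine[symmetric]) (use a3 ab b1 \<delta> int in auto)
  also have "integral {a..1} f = integral {a..b} f + integral {b..1} f"
    by (rule Henstock_Kurzweil_Integration.integral_combine[symmetric]) (use a3 ab b1 \<delta> int in auto)
  also have "integral {b..1} f = integral {b..b+\<delta>} f + integral {b+\<delta>..1} f"
    by (rule Henstock_Kurzweil_Integration.integral_combine[symmetric]) (use a3 ab b1 \<delta> int in auto)
  finally have "\<bar>integral {0..1} f - ln 2\<bar> \<le> 12 * \<delta>"
    using ramp[of "a-\<delta>" a] ramp[of b "b+\<delta>"] \<delta> z1 z2 mid by simp
  then show ?thesis using cont f06 fl fr fm unfolding \<psi>_def by blast
qed

theorem Karamata_primes:
  fixes c :: "nat \<Rightarrow> complex" and \<nu> :: complex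
  assumes c: "\<And>n. norm (c n) \<le> N * prime_weight n" and N: "0 \<le> N"
    and lim: "((\<lambda>\<sigma>. of_real \<sigma> * (\<Sum>n. c n * of_real (real n powr - \<sigma>))) \<longlongrightarrow> \<nu>) (at_right 0)"
  shows "((\<lambda>U. \<Sum>n | U / 2 < ln (real n) \<and> ln (real n) \<le> U. c n / of_real (ln (real n))) \<longlongrightarrow> \<nu> * of_real (ln 2)) at_top"
proof -
  define a where "a = exp (-1 :: real)"
  define b where "b = exp (-1/2 :: real)"
  have a3: "1/3 \<le> a" using exp_le by (simp add: a_def exp_minus field_simps)
  have ab: "a < b" by (simp add: a_def b_def)
  have c0: "c 0 = 0" using c[of 0] by (simp add: prime_weight_def)
  define y where "y = (\<lambda>\<sigma> n. real n powr - \<sigma>)"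
  have y01: "0 \<le> y \<sigma> n \<and> y \<sigma> n \<le> 1" if "0 < \<sigma>" for \<sigma> n
  proof (cases "n = 0")
    case False
    then have "real n powr - \<sigma> \<le> real n powr 0" using that by (intro powr_mono) auto
    then show ?thesis using False by (simp add: y_def)
  qed (simp add: y_def)
  define S where "S = (\<lambda>\<sigma> g. of_real \<sigma> * (\<Sum>n. c n * of_real (y \<sigma> n * g (y \<sigma> n))))"
  have bound: "summable (\<lambda>n. norm (c n * of_real (y \<sigma> n * g (y \<sigma> n)))) \<and> norm (S \<sigma> g) \<le> 8 * N * G"
    if \<sigma>: "0 < \<sigma>" "\<sigma> \<le> 1" and g: "\<And>t. 0 \<le> t \<Longrightarrow> t \<le> 1 \<Longrightarrow> \<bar>g t\<bar> \<le> G" for \<sigma> G and g :: "real \<Rightarrow> real"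
  proof -
    have G0: "0 \<le> G" using g[of 0] by simp
    have le: "norm (c n * of_real (y \<sigma> n * g (y \<sigma> n))) \<le> (N * G) * (prime_weight n * real n powr - \<sigma>)" for n
    proof -
      have "norm (c n * of_real (y \<sigma> n * g (y \<sigma> n))) = norm (c n) * (y \<sigma> n * \<bar>g (y \<sigma> n)\<bar>)"
        using y01[OF \<sigma>(1), of n] by (simp add: norm_mult abs_mult)
      also have "\<dots> \<le> (N * prime_weight n) * (y \<sigma> n * G)"
        using c[of n] y01[OF \<sigma>(1), of n] g[of "y \<sigma> n"] N prime_weight_nonneg[of n] by (intro mult_mono) auto
      finally show ?thesis by (simp add: y_def mult_ac)
    qed
    note sm = summable_mult[OF prime_weight_Dirichlet_bound(1)[OF \<sigma>], of "N * G"]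
    have s: "summable (\<lambda>n. norm (c n * of_real (y \<sigma> n * g (y \<sigma> n))))"
      by (rule summable_comparison_test'[OF sm]) (simp only: real_norm_def abs_norm_cancel le)
    have "norm (S \<sigma> g) = \<sigma> * norm (\<Sum>n. c n * of_real (y \<sigma> n * g (y \<sigma> n)))"
      using \<sigma> by (simp add: S_def norm_mult)
    also have "\<dots> \<le> \<sigma> * (\<Sum>n. norm (c n * of_real (y \<sigma> n * g (y \<sigma> n))))"
      using \<sigma> by (intro mult_left_mono summable_norm s) auto
    also have "\<dots> \<le> \<sigma> * (\<Sum>n. (N * G) * (prime_weight n * real n powr - \<sigma>))"
      using \<sigma> by (intro mult_left_mono suminf_le s sm le) auto
    also have "\<dots> = (N * G) * (\<sigma> * (\<Sum>n. prime_weight n * real n powr - \<sigma>))"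
      unfolding suminf_mult[OF prime_weight_Dirichlet_bound(1)[OF \<sigma>]] by simp
    also have "\<dots> \<le> (N * G) * 8"
      using N G0 by (intro mult_left_mono prime_weight_Dirichlet_bound(2)[OF \<sigma>]) auto
    finally show ?thesis using s by (simp add: mult_ac)
  qed
  have S_diff: "S \<sigma> g - S \<sigma> h = S \<sigma> (\<lambda>t. g t - h t)"
    if \<sigma>: "0 < \<sigma>" "\<sigma> \<le> 1" and g: "\<And>t. 0 \<le> t \<Longrightarrow> t \<le> 1 \<Longrightarrow> \<bar>g t\<bar> \<le> G" "\<And>t. 0 \<le> t \<Longrightarrow> t \<le> 1 \<Longrightarrow> \<bar>h t\<bar> \<le> H" for \<sigma> G H and g h :: "real \<Rightarrow> real"
  proof -
    have s1: "summable (\<lambda>n. c n * of_real (y \<sigma> n * g (y \<sigma> n)))"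
      by (rule summable_norm_cancel[OF conjunct1[OF bound[OF \<sigma> g(1)]]])
    have s2: "summable (\<lambda>n. c n * of_real (y \<sigma> n * h (y \<sigma> n)))"
      by (rule summable_norm_cancel[OF conjunct1[OF bound[OF \<sigma> g(2)]]])
    have "S \<sigma> g - S \<sigma> h = of_real \<sigma> * ((\<Sum>n. c n * of_real (y \<sigma> n * g (y \<sigma> n))) - (\<Sum>n. c n * of_real (y \<sigma> n * h (y \<sigma> n))))"
      unfolding S_def by (rule right_diff_distrib[symmetric])
    also have "\<dots> = S \<sigma> (\<lambda>t. g t - h t)"
      unfolding suminf_diff[OF s1 s2] S_def by (simp add: right_diff_distrib)
    finally show ?thesis .
  qed
  have S_poly: "((\<lambda>U. S (1 / U) (\<lambda>t. \<Sum>i\<le>m. q i * t ^ i)) \<longlongrightarrow> \<nu> * of_real (\<Sum>i\<le>m. q i / real (Suc i))) at_top" for q m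
  proof -
    define D where "D = (\<lambda>\<sigma>. (\<Sum>n. c n * of_real (real n powr - \<sigma>)))"
    have mono: "((\<lambda>U. of_real (1 / U) * D (real (Suc i) / U)) \<longlongrightarrow> \<nu> / of_nat (Suc i)) at_top" for i
    proof -
      have "filterlim (\<lambda>U. real (Suc i) / U) (at_right 0) at_top" by real_asymp
      from filterlim_compose[OF lim this]
      have "((\<lambda>U. of_real (real (Suc i) / U) * D (real (Suc i) / U)) \<longlongrightarrow> \<nu>) at_top"
        unfolding D_def .
      then have "((\<lambda>U. of_real (real (Suc i) / U) * D (real (Suc i) / U) / of_nat (Suc i)) \<longlongrightarrow> \<nu> / of_nat (Suc i)) at_top"
        by (intro tendsto_divide tendsto_const) (simp_all del: of_nat_Suc)
      moreover have "of_real (real (Suc i) / U) * D (real (Suc i) / U) / of_nat (Suc i) = of_real (1 / U) * D (real (Suc i) / U)" for U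
        by (simp del: of_nat_Suc)
      ultimately show ?thesis by simp
    qed
    have "((\<lambda>U. \<Sum>i\<le>m. of_real (q i) * (of_real (1 / U) * D (real (Suc i) / U))) \<longlongrightarrow> (\<Sum>i\<le>m. of_real (q i) * (\<nu> / of_nat (Suc i)))) at_top"
      by (intro tendsto_sum tendsto_mult tendsto_const mono)
    also have "(\<Sum>i\<le>m. of_real (q i) * (\<nu> / of_nat (Suc i))) = \<nu> * of_real (\<Sum>i\<le>m. q i / real (Suc i))"
      by (simp add: sum_distrib_left mult_ac del: of_nat_Suc)
    finally have lim': "((\<lambda>U. \<Sum>i\<le>m. of_real (q i) * (of_real (1 / U) * D (real (Suc i) / U))) \<longlongrightarrow> \<nu> * of_real (\<Sum>i\<le>m. q i / real (Suc i))) at_top" .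
    show ?thesis
    proof (rule Lim_transform_eventually[OF lim'], rule eventually_at_top_linorderI[of 1])
      fix U :: real assume U: "1 \<le> U"
      then have \<sigma>: "0 < 1 / U" "1 / U \<le> 1" by auto
      have yp: "c n * of_real (y (1 / U) n * y (1 / U) n ^ i) = c n * of_real (real n powr - (real (Suc i) / U))" for n i
      proof (cases "n = 0")
        case False
        then have "y (1 / U) n * y (1 / U) n ^ i = (real n powr - (1 / U)) ^ Suc i" by (simp add: y_def)
        also have "\<dots> = real n powr - (real (Suc i) / U)"
          using False by (simp add: powr_powr mult.commute flip: powr_realpow del: power_Suc of_nat_Suc)
        finally show ?thesis by simp
      qed (simp add: c0)
      have "S (1 / U) (\<lambda>t. \<Sum>i\<le>m. q i * t ^ i) = of_real (1 / U) * (\<Sum>n. \<Sum>i\<le>m. of_real (q i) * (c n * of_real (y (1 / U) n * y (1 / U) n ^ i)))"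
        unfolding S_def by (simp add: sum_distrib_left mult_ac)
      also have "(\<Sum>n. \<Sum>i\<le>m. of_real (q i) * (c n * of_real (y (1 / U) n * y (1 / U) n ^ i))) =
          (\<Sum>i\<le>m. \<Sum>n. of_real (q i) * (c n * of_real (y (1 / U) n * y (1 / U) n ^ i)))"
      proof (rule suminf_sum)
        fix i
        have "summable (\<lambda>n. c n * of_real (y (1 / U) n * y (1 / U) n ^ i))"
          by (rule summable_norm_cancel[OF conjunct1[OF bound[OF \<sigma>, of "\<lambda>t. t ^ i" 1]]]) (simp add: power_le_one)
        then show "summable (\<lambda>n. of_real (q i) * (c n * of_real (y (1 / U) n * y (1 / U) n ^ i)))" by (rule summable_mult)
      qed
      also have "\<dots> = (\<Sum>i\<le>m. of_real (q i) * D (real (Suc i) / U))"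
      proof (rule sum.cong[OF refl])
        fix i
        have "summable (\<lambda>n. c n * of_real (y (1 / U) n * y (1 / U) n ^ i))"
          by (rule summable_norm_cancel[OF conjunct1[OF bound[OF \<sigma>, of "\<lambda>t. t ^ i" 1]]]) (simp add: power_le_one)
        from suminf_mult[OF this]
        show "(\<Sum>n. of_real (q i) * (c n * of_real (y (1 / U) n * y (1 / U) n ^ i))) = of_real (q i) * D (real (Suc i) / U)"
          unfolding yp D_def .
      qed
      finally show "(\<Sum>i\<le>m. of_real (q i) * (of_real (1 / U) * D (real (Suc i) / U))) = S (1 / U) (\<lambda>t. \<Sum>i\<le>m. q i * t ^ i)"
        by (simp add: sum_distrib_left mult_ac)
    qed
  qed
  \<comment> \<open>Closed at a and open at b, matching ln n <= U and U / 2 < ln n.\<close>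
  define cut where "cut = (\<lambda>t::real. if a \<le> t \<and> t < b then 1 / (t * - ln t) else 0)"
  have chi6: "\<bar>cut t\<bar> \<le> 6" for t
  proof (cases "a \<le> t \<and> t < b")
    case True
    then have t0: "t > 0" using a3 by linarith
    have "ln t \<le> ln b" using True t0 by simp
    then have l: "1/2 \<le> - ln t" by (simp add: b_def)
    have "1/3 * (1/2) \<le> t * - ln t" using True a3 l by (intro mult_mono) auto
    then have "1/6 \<le> t * - ln t" by simp
    then have "1 / (t * - ln t) \<le> 1 / (1/6)" "0 \<le> 1 / (t * - ln t)" by (intro divide_left_mono divide_nonneg_nonneg; simp)+
    then show ?thesis using True by (simp add: cut_def del: mult_minus_right)
  qed (auto simp: cut_def)
  have lny: "ln (y (1 / U) n) = - ln (real n) / U" "y (1 / U) n > 0" if "n > 0" for U n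
    using that by (simp_all add: y_def)
  have S_chi: "S (1 / U) cut = (\<Sum>n | U / 2 < ln (real n) \<and> ln (real n) \<le> U. c n / of_real (ln (real n)))" if U: "1 \<le> U" for U
  proof -
    let ?I = "{n::nat. U / 2 < ln (real n) \<and> ln (real n) \<le> U}"
    have pos: "n > 0" if "n \<in> ?I" for n using that U by (cases "n = 0") auto
    have fin: "finite ?I"
    proof (rule finite_subset)
      show "?I \<subseteq> {..nat \<lfloor>exp U\<rfloor>}"
      proof
        fix n assume n: "n \<in> ?I"
        then have "exp (ln (real n)) \<le> exp U" by simp
        then have "real n \<le> exp U" using pos[OF n] by simp
        then show "n \<in> {..nat \<lfloor>exp U\<rfloor>}" by (simp add: le_nat_floor)
      qed
    qed simp
    have iff: "a \<le> y (1 / U) n \<and> y (1 / U) n < b \<longleftrightarrow> n \<in> ?I" if n: "n > 0" for n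
    proof -
      have "a \<le> y (1 / U) n \<longleftrightarrow> -1 \<le> ln (y (1 / U) n)" unfolding a_def using lny(2)[OF n, of U] by (metis exp_gt_zero ln_exp ln_le_cancel_iff)
      moreover have "y (1 / U) n < b \<longleftrightarrow> ln (y (1 / U) n) < -1/2" unfolding b_def using lny(2)[OF n, of U] by (metis exp_gt_zero ln_exp ln_less_cancel_iff)
      ultimately show ?thesis using lny(1)[OF n, of U] U by (auto simp: field_simps)
    qed
    have "(\<Sum>n. c n * of_real (y (1 / U) n * cut (y (1 / U) n))) = (\<Sum>n\<in>?I. c n * of_real (y (1 / U) n * cut (y (1 / U) n)))"
    proof (rule suminf_finite[OF fin])
      fix n assume "n \<notin> ?I"
      then show "c n * of_real (y (1 / U) n * cut (y (1 / U) n)) = 0"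
        using iff[of n] c0 by (cases "n = 0") (auto simp: cut_def)
    qed
    also have "of_real (1 / U) * \<dots> = (\<Sum>n\<in>?I. c n / of_real (ln (real n)))"
      unfolding sum_distrib_left
    proof (rule sum.cong[OF refl])
      fix n assume n: "n \<in> ?I"
      then have "ln (real n) > 0" using U by auto
      moreover have "cut (y (1 / U) n) = 1 / (y (1 / U) n * - ln (y (1 / U) n))"
        using iff[OF pos[OF n]] n by (simp add: cut_def)
      ultimately have "1 / U * (y (1 / U) n * cut (y (1 / U) n)) = 1 / ln (real n)"
        using lny[OF pos[OF n], of U] U by (simp add: field_simps)
      then have "complex_of_real (1 / U) * of_real (y (1 / U) n * cut (y (1 / U) n)) = 1 / of_real (ln (real n))"
        by (metis of_real_1 of_real_divide of_real_mult)
      then show "of_real (1 / U) * (c n * of_real (y (1 / U) n * cut (y (1 / U) n))) = c n / of_real (ln (real n))"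
        by (metis mult.left_commute mult.right_neutral times_divide_eq_right)
    qed
    finally show ?thesis unfolding S_def .
  qed
  \<comment> \<open>f and \<open>cut\<close> differ only for ln n / U in two windows of width
    O(\<delta>), one beside 1 and one around 1/2.\<close>
  have close: "norm (S (1 / U) cut - S (1 / U) f) \<le> 6 * N * (32 * \<delta> + 12 / U)"
    if U: "1 \<le> U" and \<delta>: "0 < \<delta>" "\<delta> \<le> 1/12"
    and f: "\<And>t. 0 \<le> f t \<and> f t \<le> 6" "\<And>t. t \<le> a - \<delta> \<Longrightarrow> f t = 0" "\<And>t. b + \<delta> \<le> t \<Longrightarrow> f t = 0"
       "\<And>t. a \<le> t \<Longrightarrow> t \<le> b \<Longrightarrow> f t = 1 / (t * - ln t)" for U \<delta> f
  proof -
    define v1 where "v1 = - ln (a - \<delta>)"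
    define v0 where "v0 = - ln (b + \<delta>)"
    have v1: "1 \<le> v1" "v1 - 1 \<le> 4 * \<delta>"
    proof -
      have p: "0 < a - \<delta>" "1/4 \<le> a - \<delta>" using a3 \<delta> by auto
      then have "ln (a - \<delta>) \<le> ln a" using \<delta> by simp
      then show "1 \<le> v1" by (simp add: v1_def a_def)
      have "v1 - 1 = ln (a / (a - \<delta>))" using p a3 by (subst ln_div) (auto simp: v1_def a_def)
      also have "\<dots> \<le> a / (a - \<delta>) - 1" using p a3 by (intro ln_le_minus_one divide_pos_pos) auto
      also have "\<dots> = \<delta> / (a - \<delta>)" using p by (simp add: field_simps)
      also have "\<dots> \<le> \<delta> / (1/4)" using p \<delta> by (intro divide_left_mono) auto
      finally show "v1 - 1 \<le> 4 * \<delta>" by simp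
    qed
    have v0: "v0 \<le> 1/2" "1/2 - v0 \<le> 3 * \<delta>"
    proof -
      have b0: "1/3 \<le> b" "b > 0" using a3 ab by auto
      then have "ln b \<le> ln (b + \<delta>)" using \<delta> by simp
      then show "v0 \<le> 1/2" by (simp add: v0_def b_def)
      have "1/2 - v0 = ln ((b + \<delta>) / b)" using b0 \<delta> by (subst ln_div) (auto simp: v0_def b_def)
      also have "\<dots> \<le> (b + \<delta>) / b - 1" using b0 \<delta> by (intro ln_le_minus_one divide_pos_pos) auto
      also have "\<dots> = \<delta> / b" using b0 by (simp add: field_simps)
      also have "\<dots> \<le> \<delta> / (1/3)" using b0 \<delta> by (intro divide_left_mono) auto
      finally show "1/2 - v0 \<le> 3 * \<delta>" by simp
    qed
    define R1 where "R1 = {n::nat. n > 0 \<and> U < ln (real n) \<and> ln (real n) < U * v1}"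
    \<comment> \<open>The window reaches beyond U / 2 so as to contain ln n = U / 2, where y = b and
      \<open>cut\<close> is 0 but f is not.\<close>
    define R0 where "R0 = {n::nat. n > 0 \<and> U * v0 < ln (real n) \<and> ln (real n) < U * (1/2 + \<delta>)}"
    have finR: "finite {n::nat. n > 0 \<and> P n \<and> ln (real n) < V}" for P V
    proof (rule finite_subset)
      show "{n::nat. n > 0 \<and> P n \<and> ln (real n) < V} \<subseteq> {..nat \<lfloor>exp V\<rfloor>}"
      proof (rule subsetI)
        fix n assume "n \<in> {n::nat. n > 0 \<and> P n \<and> ln (real n) < V}"
        then have n: "0 < n" "ln (real n) < V" by auto
        then have "exp (ln (real n)) < exp V" by (simp only: exp_less_cancel_iff)
        then have "real n < exp V" using n by simp
        then show "n \<in> {..nat \<lfloor>exp V\<rfloor>}" by (simp add: le_nat_floor)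
      qed
    qed simp
    have fin: "finite R1" "finite R0" unfolding R1_def R0_def by (rule finR)+
    have supp: "y (1 / U) n * (cut (y (1 / U) n) - f (y (1 / U) n)) = 0" if n: "n > 0" "n \<notin> R1 \<union> R0" for n
    proof -
      let ?y = "y (1 / U) n"
      have U0: "U > 0" using U by simp
      have lnn: "ln (real n) = - U * ln ?y" using lny(1)[OF n(1), of U] U0 by simp
      have y0: "?y > 0" by (rule lny(2)[OF n(1)])
      consider "?y \<le> a - \<delta>" | "a - \<delta> < ?y" "?y < a" | "a \<le> ?y" "?y < b" | "b \<le> ?y" "?y < b + \<delta>" | "b + \<delta> \<le> ?y" by linarith
      then have "cut ?y = f ?y"
      proof cases
        case 1 then show ?thesis using f(2)[of ?y] \<delta> by (simp add: cut_def)
      next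
        case 2
        have "ln ?y < ln a" "ln (a - \<delta>) < ln ?y" using 2 y0 a3 \<delta> by (subst ln_less_cancel_iff; simp)+
        then have "1 < - ln ?y" "- ln ?y < v1" by (auto simp: a_def v1_def)
        then have "U * 1 < U * - ln ?y" "U * - ln ?y < U * v1" using U0 by (simp_all only: mult_less_cancel_left_pos)
        then have "n \<in> R1" using n lnn by (simp add: R1_def)
        then show ?thesis using n by simp
      next
        case 3 then show ?thesis using f(4)[of ?y] by (simp add: cut_def)
      next
        case 4
        have b0: "b > 0" using ab a3 by linarith
        have "ln b \<le> ln ?y" "ln ?y < ln (b + \<delta>)" using 4 y0 b0 \<delta> by simp_all
        then have "- ln ?y < 1/2 + \<delta>" "v0 < - ln ?y" using \<delta> by (auto simp: b_def v0_def)
        then have "U * - ln ?y < U * (1/2 + \<delta>)" "U * v0 < U * - ln ?y" using U0 by (simp_all only: mult_less_cancel_left_pos)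
        then have "n \<in> R0" using n lnn by (simp add: R0_def)
        then show ?thesis using n by simp
      next
        case 5 then show ?thesis using f(3)[of ?y] \<delta> by (simp add: cut_def)
      qed
      then show ?thesis by simp
    qed
    have \<sigma>: "0 < 1 / U" "1 / U \<le> 1" using U by auto
    have "S (1 / U) cut - S (1 / U) f = S (1 / U) (\<lambda>t. cut t - f t)"
      by (rule S_diff[OF \<sigma>, where G = 6 and H = 6]) (use chi6 f(1) in auto)
    also have "\<dots> = of_real (1 / U) * (\<Sum>n\<in>R1 \<union> R0. c n * of_real (y (1 / U) n * (cut (y (1 / U) n) - f (y (1 / U) n))))"
      unfolding S_def
    proof (subst suminf_finite)
      show "finite (R1 \<union> R0)" using fin by simp
      fix n assume "n \<notin> R1 \<union> R0"
      then show "c n * of_real (y (1 / U) n * (cut (y (1 / U) n) - f (y (1 / U) n))) = 0"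
        using supp[of n] c0 by (cases "n = 0") auto
    qed simp
    finally have "norm (S (1 / U) cut - S (1 / U) f) = 1 / U * norm (\<Sum>n\<in>R1 \<union> R0. c n * of_real (y (1 / U) n * (cut (y (1 / U) n) - f (y (1 / U) n))))"
      using U by (simp only: norm_mult norm_of_real) simp
    also have "\<dots> \<le> 1 / U * (\<Sum>n\<in>R1 \<union> R0. norm (c n * of_real (y (1 / U) n * (cut (y (1 / U) n) - f (y (1 / U) n)))))"
      by (intro mult_left_mono norm_sum) (use U in simp)
    also have "\<dots> \<le> 1 / U * (\<Sum>n\<in>R1 \<union> R0. 6 * N * prime_weight n)"
    proof (intro mult_left_mono sum_mono)
      fix n
      have "\<bar>cut (y (1 / U) n) - f (y (1 / U) n)\<bar> \<le> 6"
        using chi6[of "y (1 / U) n"] f(1)[of "y (1 / U) n"] f(4)[of "y (1 / U) n"]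
        by (cases "a \<le> y (1 / U) n \<and> y (1 / U) n < b") (auto simp: cut_def)
      then have "\<bar>y (1 / U) n * (cut (y (1 / U) n) - f (y (1 / U) n))\<bar> \<le> 1 * 6"
        unfolding abs_mult using y01[OF \<sigma>(1), of n] by (intro mult_mono) auto
      then have "norm (c n) * \<bar>y (1 / U) n * (cut (y (1 / U) n) - f (y (1 / U) n))\<bar> \<le> (N * prime_weight n) * (1 * 6)"
        using c[of n] N prime_weight_nonneg[of n] by (intro mult_mono) auto
      then show "norm (c n * of_real (y (1 / U) n * (cut (y (1 / U) n) - f (y (1 / U) n)))) \<le> 6 * N * prime_weight n"
        unfolding norm_mult norm_of_real by simp
    qed (use U in auto)
    also have "\<dots> = 1 / U * (6 * N * (\<Sum>n\<in>R1 \<union> R0. prime_weight n))" by (simp add: sum_distrib_left)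
    also have "\<dots> \<le> 1 / U * (6 * N * ((4 * (U * v1 - U) + 6) + (4 * (U * (1/2 + \<delta>) - U * v0) + 6)))"
    proof (intro mult_left_mono)
      have "(\<Sum>n\<in>R1 \<union> R0. prime_weight n) \<le> (\<Sum>n\<in>R1. prime_weight n) + (\<Sum>n\<in>R0. prime_weight n)"
        using sum_nonneg[of "R1 \<inter> R0" prime_weight] prime_weight_nonneg by (simp add: sum_Un[OF fin])
      also have "(\<Sum>n\<in>R1. prime_weight n) \<le> 4 * (U * v1 - U) + 6"
        by (rule prime_weight_interval) (use U v1 fin in \<open>auto simp: R1_def\<close>)
      also have "(\<Sum>n\<in>R0. prime_weight n) \<le> 4 * (U * (1/2 + \<delta>) - U * v0) + 6"
        by (rule prime_weight_interval) (use U v0 \<delta> fin in \<open>auto simp: R0_def\<close>)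
      finally show "(\<Sum>n\<in>R1 \<union> R0. prime_weight n) \<le> (4 * (U * v1 - U) + 6) + (4 * (U * (1/2 + \<delta>) - U * v0) + 6)" by simp
    qed (use U N in auto)
    also have "\<dots> = 6 * N * (4 * (v1 - 1) + 4 * (1/2 + \<delta> - v0) + 12 / U)"
      using U by (simp add: field_simps)
    \<comment> \<open>16 \<delta> comes from the window at 1 and 4 times \<delta> + 3 \<delta> from
      the window at 1/2.\<close>
    also have "\<dots> \<le> 6 * N * (32 * \<delta> + 12 / U)"
      using v1 v0 \<delta> N by (intro mult_left_mono) auto
    finally show ?thesis .
  qed
  have "((\<lambda>U. S (1 / U) cut) \<longlongrightarrow> \<nu> * of_real (ln 2)) at_top"
  proof (rule tendstoI)
    fix e :: real assume e: "e > 0"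
    \<comment> \<open>\<delta> and \<eta> bring the ramp errors and the polynomial approximation
      errors down to e / 8 each; the limit for polynomials and the term 72 N / U take e / 4
      each.\<close>
    define \<delta> where "\<delta> = min (1/12) (e / (8 * (192 * N + 12 * norm \<nu> + 1)))"
    define \<eta> where "\<eta> = e / (8 * (8 * N + norm \<nu> + 1))"
    have dpos: "8 * (192 * N + 12 * norm \<nu> + 1) > 0" "8 * (8 * N + norm \<nu> + 1) > 0" using N by (auto intro!: add_nonneg_pos)
    have cancel: "X * (e / (8 * X)) = e / 8" if "X > 0" for X :: real using that by simp
    have d1: "0 < \<delta>" using e dpos by (simp add: \<delta>_def)
    have d2: "\<delta> \<le> 1/12" "\<delta> \<le> e / (8 * (192 * N + 12 * norm \<nu> + 1))"
      unfolding \<delta>_def by (rule min.cobounded1, rule min.cobounded2)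
    note \<delta> = d1 d2(1)
    have \<eta>: "0 < \<eta>" using e dpos by (auto simp: \<eta>_def)
    have \<delta>': "(192 * N + 12 * norm \<nu>) * \<delta> \<le> e / 8"
    proof -
      have "(192 * N + 12 * norm \<nu>) * \<delta> \<le> (192 * N + 12 * norm \<nu> + 1) * (e / (8 * (192 * N + 12 * norm \<nu> + 1)))"
        using N d1 d2(2) by (intro mult_mono) auto
      also have "\<dots> = e / 8" by (rule cancel) (use N in \<open>auto intro!: add_nonneg_pos\<close>)
      finally show ?thesis .
    qed
    have \<eta>': "(8 * N + norm \<nu>) * \<eta> \<le> e / 8"
    proof -
      have "(8 * N + norm \<nu>) * \<eta> \<le> (8 * N + norm \<nu> + 1) * (e / (8 * (8 * N + norm \<nu> + 1)))"
        using N \<eta> by (intro mult_mono) (auto simp: \<eta>_def)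
      also have "\<dots> = e / 8" by (rule cancel) (use N in \<open>auto intro!: add_nonneg_pos\<close>)
      finally show ?thesis .
    qed
    obtain f where f: "continuous_on UNIV f" "\<And>t. 0 \<le> f t \<and> f t \<le> 6" "\<And>t. t \<le> a - \<delta> \<Longrightarrow> f t = 0" "\<And>t. b + \<delta> \<le> t \<Longrightarrow> f t = 0"
       "\<And>t. a \<le> t \<Longrightarrow> t \<le> b \<Longrightarrow> f t = 1 / (t * - ln t)" and fint: "\<bar>integral {0..1} f - ln 2\<bar> \<le> 12 * \<delta>"
      using Karamata_test_function[OF \<delta>] unfolding a_def b_def by blast
    have contf: "continuous_on {0..1} f" using f(1) continuous_on_subset by blast
    obtain P where P: "real_polynomial_function P" "\<And>t. t \<in> {0..1} \<Longrightarrow> \<bar>f t - P t\<bar> < \<eta>"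
      using Stone_Weierstrass_real_polynomial_function[OF compact_Icc contf \<eta>] by blast
    obtain q m where q: "P = (\<lambda>t. \<Sum>i\<le>m. q i * t ^ i)"
      using P(1) unfolding real_polynomial_function_iff_sum by blast
    define J where "J = (\<Sum>i\<le>m. q i / real (Suc i))"
    have "((\<lambda>t. \<Sum>i\<le>m. q i * t ^ i) has_integral (\<Sum>i\<le>m. q i * (1 / real (Suc i)))) {0..1}"
      by (intro has_integral_sum has_integral_mult_right integral_power_unit) auto
    then have PJ: "(P has_integral J) {0..1}" by (simp add: q J_def)
    have fi: "f integrable_on {0..1}" by (rule integrable_continuous_real[OF contf])
    have "norm (integral {0..1} (\<lambda>t. f t - P t)) \<le> integral {0..1} (\<lambda>t::real. \<eta>)"
      by (rule Henstock_Kurzweil_Integration.integral_norm_bound_integral)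
         (use fi PJ P(2) in \<open>auto intro!: Henstock_Kurzweil_Integration.integrable_diff less_imp_le simp: has_integral_integrable\<close>)
    then have "\<bar>integral {0..1} f - J\<bar> \<le> \<eta>"
      using fi PJ by (simp add: Henstock_Kurzweil_Integration.integral_diff has_integral_integrable integral_unique)
    then have Jln: "\<bar>J - ln 2\<bar> \<le> \<eta> + 12 * \<delta>" using fint by linarith
    have "\<forall>\<^sub>F U in at_top. dist (S (1 / U) P) (\<nu> * of_real J) < e / 4"
      unfolding q J_def by (rule tendstoD[OF S_poly]) (use e in simp)
    moreover have "((\<lambda>U. 72 * N / U) \<longlongrightarrow> 0) at_top" by real_asymp
    from order_tendstoD(2)[OF this, of "e/4"] have "\<forall>\<^sub>F U in at_top. 72 * N / U < e / 4" using e by simp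
    moreover have "\<forall>\<^sub>F U in at_top. (1::real) \<le> U" by (rule eventually_ge_at_top)
    ultimately show "\<forall>\<^sub>F U in at_top. dist (S (1 / U) cut) (\<nu> * of_real (ln 2)) < e"
    proof eventually_elim
      case (elim U)
      have \<sigma>: "0 < 1 / U" "1 / U \<le> 1" using elim by auto
      have 1: "norm (S (1 / U) cut - S (1 / U) f) \<le> 6 * N * (32 * \<delta> + 12 / U)"
        by (rule close[OF elim(3) \<delta> f(2-5)])
      have fP: "\<bar>f t - P t\<bar> \<le> \<eta>" if "0 \<le> t" "t \<le> 1" for t using P(2)[of t] that by simp
      have "S (1 / U) f - S (1 / U) P = S (1 / U) (\<lambda>t. f t - P t)"
      proof (rule S_diff[OF \<sigma>, where G = 6 and H = "6 + \<eta>"])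
        show "\<bar>f t\<bar> \<le> 6" for t using f(2)[of t] by simp
        show "\<bar>P t\<bar> \<le> 6 + \<eta>" if "0 \<le> t" "t \<le> 1" for t using fP[OF that] f(2)[of t] by linarith
      qed
      then have 2: "norm (S (1 / U) f - S (1 / U) P) \<le> 8 * N * \<eta>" using bound[OF \<sigma> fP] by simp
      have 3: "norm (S (1 / U) P - \<nu> * of_real J) < e / 4" using elim(1) by (simp add: dist_norm)
      have "norm (\<nu> * of_real J - \<nu> * of_real (ln 2)) = norm \<nu> * \<bar>J - ln 2\<bar>"
        by (simp only: right_diff_distrib[symmetric] of_real_diff[symmetric] norm_mult norm_of_real)
      also have "\<dots> \<le> norm \<nu> * (\<eta> + 12 * \<delta>)" by (intro mult_left_mono Jln) auto
      finally have 4: "norm (\<nu> * of_real J - \<nu> * of_real (ln 2)) \<le> norm \<nu> * (\<eta> + 12 * \<delta>)" .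
      have "norm (S (1 / U) cut - \<nu> * of_real (ln 2)) \<le> norm (S (1 / U) cut - S (1 / U) f) + norm (S (1 / U) f - S (1 / U) P)
          + norm (S (1 / U) P - \<nu> * of_real J) + norm (\<nu> * of_real J - \<nu> * of_real (ln 2))"
        by norm
      also have "\<dots> < 6 * N * (32 * \<delta> + 12 / U) + 8 * N * \<eta> + e / 4 + norm \<nu> * (\<eta> + 12 * \<delta>)"
        using 1 2 3 4 by linarith
      also have "\<dots> = (192 * N + 12 * norm \<nu>) * \<delta> + (8 * N + norm \<nu>) * \<eta> + 72 * N / U + e / 4" by (simp add: algebra_simps)
      also have "\<dots> < e" using \<delta>' \<eta>' elim(2) e by linarith
      finally show ?case by (simp add: dist_norm)
    qed
  qed
  then show ?thesis
    by (rule Lim_transform_eventually) (rule eventually_at_top_linorderI[of 1], rule S_chi)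
qed

section \<open>Prime sums from the order of an Euler product at 1\<close>

text \<open>g' is the logarithmic derivative of f, which has at most a simple pole at 1, with
  residue the order of f. The point 1 is approached from the half plane where g is a logarithm of
  f.\<close>

lemma log_derivative_tendsto_zorder:
  fixes f g g' :: "complex \<Rightarrow> complex"
  assumes g: "\<And>z. Re z > 1 \<Longrightarrow> (g has_field_derivative g' z) (at z)" and ef: "\<And>z. Re z > 1 \<Longrightarrow> exp (g z) = f z"
    and iso: "isolated_singularity_at f 1" "not_essential f 1"
  shows "((\<lambda>\<sigma>. of_real \<sigma> * g' (1 + of_real \<sigma>)) \<longlongrightarrow> of_int (zorder f 1)) (at_right 0)"
proof -
  have "\<exists>\<^sub>F w in at 1. f w \<noteq> 0"
    unfolding frequently_def
  proof
    assume "\<forall>\<^sub>F w in at 1. \<not> f w \<noteq> 0"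
    then obtain d where d: "d > 0" "\<And>w. w \<noteq> 1 \<Longrightarrow> dist w 1 < d \<Longrightarrow> f w = 0"
      by (auto simp: eventually_at)
    have "f (1 + of_real (d / 2)) = 0" by (rule d(2)) (use d(1) in \<open>auto simp: dist_norm\<close>)
    moreover have "f (1 + of_real (d / 2)) = exp (g (1 + of_real (d / 2)))" by (rule ef[symmetric]) (use d(1) in simp)
    ultimately show False by simp
  qed
  from zorder_exist[OF iso this] obtain r where h0: "zor_poly f 1 1 \<noteq> 0" and r: "r > 0"
    and hol: "zor_poly f 1 holomorphic_on cball 1 r"
    and fh: "\<And>w. w \<in> cball 1 r - {1} \<Longrightarrow> f w = zor_poly f 1 w * (w - 1) powi zorder f 1 \<and> zor_poly f 1 w \<noteq> 0"
    by blast
  define h where "h = zor_poly f 1"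
  define k where "k = zorder f 1"
  have holb: "h holomorphic_on ball 1 r" unfolding h_def by (rule holomorphic_on_subset[OF hol]) auto
  have val: "of_real \<sigma> * g' (1 + of_real \<sigma>) = of_real \<sigma> * (deriv h (1 + of_real \<sigma>) / h (1 + of_real \<sigma>)) + of_int k"
    if \<sigma>: "0 < \<sigma>" "\<sigma> < r" for \<sigma>
  proof -
    define w where "w = 1 + complex_of_real \<sigma>"
    have wb: "w \<in> ball 1 r" "w \<noteq> 1" "Re w > 1" using \<sigma> by (auto simp: w_def dist_norm)
    have hw: "h w \<noteq> 0" "f w = h w * (w - 1) powi k" using fh[of w] wb by (auto simp: h_def k_def)
    have dh: "(h has_field_derivative deriv h w) (at w)" by (rule holomorphic_derivI[OF holb open_ball wb(1)])
    have "((\<lambda>w. h w * (w - 1) powi k) has_field_derivative deriv h w * (w - 1) powi k + of_int k * (w - 1) powi (k - 1) * h w) (at w)"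
      using wb(2) by (auto intro!: derivative_eq_intros dh)
    moreover have "((\<lambda>w. exp (g w)) has_field_derivative exp (g w) * g' w) (at w)"
      by (auto intro!: derivative_eq_intros g[OF wb(3)])
    then have "((\<lambda>w. h w * (w - 1) powi k) has_field_derivative exp (g w) * g' w) (at w)"
    proof (rule has_field_derivative_transform_within_open[where S = "ball 1 r \<inter> {w. Re w > 1}"])
      show "open (ball 1 r \<inter> {w. Re w > 1})" by (intro open_Int open_ball open_halfspace_Re_gt)
      fix x assume x: "x \<in> ball 1 r \<inter> {w. Re w > 1}"
      then have "x \<noteq> 1" by auto
      then show "exp (g x) = h x * (x - 1) powi k" using ef[of x] fh[of x] x by (auto simp: h_def k_def)
    qed (use wb in auto)
    ultimately have "exp (g w) * g' w = deriv h w * (w - 1) powi k + of_int k * (w - 1) powi (k - 1) * h w"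
      by (rule DERIV_unique[symmetric])
    moreover have "exp (g w) = h w * (w - 1) powi k" using ef[OF wb(3)] hw by simp
    moreover have "(w - 1) powi (k - 1) = (w - 1) powi k / (w - 1)"
      using wb(2) by (simp add: power_int_diff)
    moreover have "(w - 1) powi k \<noteq> 0" using wb(2) by simp
    ultimately have "(w - 1) powi k * (h w * g' w) = (w - 1) powi k * (deriv h w + of_int k * h w / (w - 1))"
      by (simp add: algebra_simps)
    then have "h w * g' w = deriv h w + of_int k * h w / (w - 1)" by (simp only: mult_left_cancel[OF \<open>(w - 1) powi k \<noteq> 0\<close>])
    then have "g' w = deriv h w / h w + of_int k / (w - 1)" using hw(1) by (simp add: field_simps)
    moreover have "w - 1 = of_real \<sigma>" by (simp add: w_def)
    ultimately show ?thesis using \<sigma> unfolding w_def[symmetric] by (simp add: distrib_left)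
  qed
  have "isCont (deriv h) 1" "isCont h 1"
    using holomorphic_deriv[OF holb open_ball] holb r
    by (auto simp: continuous_on_eq_continuous_at dest!: holomorphic_on_imp_continuous_on)
  then have "isCont (\<lambda>w. deriv h w / h w) 1" using h0 by (auto intro!: continuous_intros simp: h_def)
  moreover have "((\<lambda>\<sigma>. 1 + complex_of_real \<sigma>) \<longlongrightarrow> 1 + of_real 0) (at_right 0)" by (intro tendsto_intros)
  ultimately have quot: "((\<lambda>\<sigma>. deriv h (1 + of_real \<sigma>) / h (1 + of_real \<sigma>)) \<longlongrightarrow> deriv h 1 / h 1) (at_right 0)"
    by (intro isCont_tendsto_compose[where g = "\<lambda>w. deriv h w / h w"]) simp_all
  have "((\<lambda>\<sigma>. of_real \<sigma> * (deriv h (1 + of_real \<sigma>) / h (1 + of_real \<sigma>)) + of_int k) \<longlongrightarrow> of_real 0 * (deriv h 1 / h 1) + of_int k) (at_right 0)"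
    by (intro tendsto_add tendsto_mult quot tendsto_const tendsto_of_real tendsto_ident_at)
  then have "((\<lambda>\<sigma>. of_real \<sigma> * (deriv h (1 + of_real \<sigma>) / h (1 + of_real \<sigma>)) + of_int k) \<longlongrightarrow> of_int k) (at_right 0)"
    by simp
  then show ?thesis unfolding k_def[symmetric]
  proof (rule Lim_transform_eventually)
    show "\<forall>\<^sub>F \<sigma> in at_right 0. of_real \<sigma> * (deriv h (1 + of_real \<sigma>) / h (1 + of_real \<sigma>)) + of_int k = of_real \<sigma> * g' (1 + of_real \<sigma>)"
      unfolding eventually_at_right_field by (rule exI[of _ r]) (use r val in auto)
  qed
qed

lemma sum_exp_le: "0 \<le> t \<Longrightarrow> t * exp (- t) \<le> (1::real)"
proof -
  have "t \<le> exp t" using exp_ge_add_one_self[of t] by linarith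
  then have "t * exp (- t) \<le> exp t * exp (- t)" by (rule mult_right_mono) simp
  then show ?thesis by (simp flip: exp_add)
qed

text \<open>Differentiating the logarithm of the product weights each prime power by its frequency.
  The first powers at primes with parameters of modulus at most 1 form the series with coefficients
  c. The rest, multiplied by \<sigma>, tends to 0 term by term and is dominated by the unweighted
  series at s = 1, because t exp (- t) <= 1 for t = \<sigma> l n absorbs the frequency.\<close>

lemma prime_series_asymptotics:
  fixes \<beta> :: "nat \<Rightarrow> 'n::finite \<Rightarrow> complex"
  assumes lt: "\<And>p j. prime p \<Longrightarrow> norm (\<beta> p j) < real p"
    and fin: "finite {p. prime p \<and> (\<exists>j. norm (\<beta> p j) > 1)}"
    and prod: "\<And>s. Re s > 1 \<Longrightarrow> (\<lambda>p. if prime p then euler_factor (\<beta> p) p s else 1) has_prod f s"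
    and iso: "isolated_singularity_at f 1" "not_essential f 1"
  defines "c \<equiv> \<lambda>p. if prime p \<and> (\<forall>j. norm (\<beta> p j) \<le> 1) then (\<Sum>j\<in>UNIV. \<beta> p j) * of_real (prime_weight p) else 0"
  shows "((\<lambda>\<sigma>. of_real \<sigma> * (\<Sum>p. c p * of_real (real p powr - \<sigma>))) \<longlongrightarrow> - of_int (zorder f 1)) (at_right 0)"
proof -
  define a where "a = euler_coeff_seq \<beta>"
  define l where "l = euler_freq_seq"
  have l0: "0 \<le> l n" for n unfolding l_def euler_freq_seq_def by (rule euler_freq_nonneg)
  have sm: "summable (\<lambda>n. norm (a n) * exp (- b * l n))" if "1 < b" for b
    unfolding a_def l_def by (rule euler_summable(2)[OF lt fin that])
  define g where "g = (\<lambda>z. \<Sum>n. a n * exp (- z * of_real (l n)))"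
  define g' where "g' = (\<lambda>z. \<Sum>n. - of_real (l n) * a n * exp (- z * of_real (l n)))"
  have ser: "(g has_field_derivative g' z) (at z)" "(\<lambda>n. - of_real (l n) * a n * exp (- z * of_real (l n))) sums g' z" if z: "Re z > 1" for z
  proof -
    define b where "b = (1 + Re z) / 2"
    have b: "1 < b" "b < Re z" using z by (auto simp: b_def)
    then have "0 \<le> b" by simp
    obtain G G' where G: "\<And>z. b < Re z \<Longrightarrow> (\<lambda>n. a n * exp (- z * of_real (l n))) sums G z"
       "\<And>z. b < Re z \<Longrightarrow> (\<lambda>n. - of_real (l n) * a n * exp (- z * of_real (l n))) sums G' z"
       "\<And>z. b < Re z \<Longrightarrow> (G has_field_derivative G' z) (at z)"
      using exp_series_derivative[OF l0 \<open>0 \<le> b\<close> sm[OF b(1)]] by blast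
    have Gg: "G w = g w" "G' w = g' w" if "b < Re w" for w
      using G(1,2)[OF that] sums_unique unfolding g_def g'_def by blast+
    have "(g has_field_derivative G' z) (at z)"
      by (rule has_field_derivative_transform_within_open[OF G(3)[OF b(2)], where S = "{w. b < Re w}"])
         (use b Gg in \<open>auto simp: open_halfspace_Re_gt\<close>)
    then show "(g has_field_derivative g' z) (at z)" using Gg(2)[OF b(2)] by simp
    show "(\<lambda>n. - of_real (l n) * a n * exp (- z * of_real (l n))) sums g' z" using G(2)[OF b(2)] Gg(2)[OF b(2)] by simp
  qed
  have eg: "exp (g z) = f z" if "Re z > 1" for z
    unfolding g_def a_def l_def by (rule euler_product_eq_exp[OF lt fin that prod[OF that]])
  have lim: "((\<lambda>\<sigma>. of_real \<sigma> * g' (1 + of_real \<sigma>)) \<longlongrightarrow> of_int (zorder f 1)) (at_right 0)"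
    by (rule log_derivative_tendsto_zorder[OF ser(1) eg iso])
  define good where "good = (\<lambda>p. prime p \<and> (\<forall>j. norm (\<beta> p j) \<le> 1))"
  \<comment> \<open>Index 1 is the square. Squares and higher powers, together with the first powers
    at exceptional primes, make up the remainder; the other indices carry c.\<close>
  define W where "W = {p. prime p} \<times> {1..} \<union> {p. prime p \<and> (\<exists>j. norm (\<beta> p j) > 1)} \<times> {0::nat}"
  define T where "T = (\<lambda>i. norm (euler_coeff \<beta> i) * exp (- 1 * euler_freq i))"
  have "T summable_on W"
    unfolding W_def
  proof (rule summable_on_Un_disjoint)
    show "T summable_on ({p. prime p} \<times> {1..})"
      unfolding T_def by (rule euler_terms_summable) (use lt fin in auto)
  qed (use fin in auto)
  then have "(\<lambda>i. if i \<in> W then T i else 0) summable_on UNIV"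
    by (rule iffD1[OF summable_on_cong_neutral, rotated -1]) auto
  then have sT: "summable (\<lambda>n. if prod_decode n \<in> W then T (prod_decode n) else 0)"
    by (intro summable_on_imp_summable) (subst summable_on_prod_decode)
  define R where "R = (\<lambda>n \<sigma>. if prod_decode n \<in> W then of_real \<sigma> * (of_real (l n) * a n * exp (- (1 + of_real \<sigma>) * of_real (l n))) else 0 :: complex)"
  have nexp: "norm (exp (- (1 + of_real \<sigma>) * complex_of_real t)) = exp (- 1 * t) * exp (- (\<sigma> * t))" for \<sigma> t
    unfolding norm_exp_eq_Re by (simp add: algebra_simps flip: exp_add)
  have Rb: "norm (R n \<sigma>) \<le> (if prod_decode n \<in> W then T (prod_decode n) else 0)" if "0 < \<sigma>" for n \<sigma>
  proof (cases "prod_decode n \<in> W")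
    case True
    have "norm (R n \<sigma>) = norm (a n) * exp (- 1 * l n) * ((\<sigma> * l n) * exp (- (\<sigma> * l n)))"
      unfolding R_def if_P[OF True] norm_mult nexp norm_of_real using that l0[of n] by simp
    also have "\<dots> \<le> norm (a n) * exp (- 1 * l n) * 1"
      using that l0[of n] by (intro mult_left_mono sum_exp_le) auto
    finally show ?thesis using True by (simp add: T_def a_def l_def euler_coeff_seq_def euler_freq_seq_def)
  qed (simp add: R_def)
  have Rlim: "((\<lambda>\<sigma>. \<Sum>n. R n \<sigma>) \<longlongrightarrow> (\<Sum>n. 0 :: complex)) (at_right 0)"
  proof (rule conjunct2[OF conjunct2[OF tannerys_theorem[OF _ _ sT]]])
    show "((\<lambda>\<sigma>. R n \<sigma>) \<longlongrightarrow> 0) (at_right 0)" for n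
    proof (cases "prod_decode n \<in> W")
      case True
      have "((\<lambda>\<sigma>. of_real \<sigma> * (of_real (l n) * a n * exp (- (1 + of_real \<sigma>) * of_real (l n)))) \<longlongrightarrow>
          of_real 0 * (of_real (l n) * a n * exp (- (1 + of_real 0) * of_real (l n)))) (at_right 0)"
        by (intro tendsto_intros)
      then show ?thesis using True by (simp add: R_def)
    qed (simp add: R_def)
    have "\<forall>\<^sub>F \<sigma> in at_right (0::real). 0 < \<sigma>" by (rule eventually_at_right_less)
    from eventually_prodI[OF always_eventually[OF allI[OF TrueI]] this]
    show "\<forall>\<^sub>F (n, \<sigma>) in sequentially \<times>\<^sub>F at_right 0. norm (R n \<sigma>) \<le> (if prod_decode n \<in> W then T (prod_decode n) else 0)"
      by eventually_elim (use Rb in auto)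
  qed simp
  have main: "of_real \<sigma> * (\<Sum>p. c p * of_real (real p powr - \<sigma>)) = - (of_real \<sigma> * g' (1 + of_real \<sigma>)) - (\<Sum>n. R n \<sigma>)" if \<sigma>: "0 < \<sigma>" for \<sigma>
  proof -
    \<comment> \<open>Places the prime series on the pairs (p, 0), so that both parts are summed
      along the same enumeration.\<close>
    define H where "H = (\<lambda>(p, k::nat). if k = 0 then of_real \<sigma> * (c p * of_real (real p powr - \<sigma>)) else 0)"
    have split: "of_real \<sigma> * (of_real (l n) * a n * exp (- (1 + of_real \<sigma>) * of_real (l n))) = R n \<sigma> + H (prod_decode n)" for n
    proof -
      obtain p k where pk: "prod_decode n = (p, k)" by force
      show ?thesis
      proof (cases "(p, k) \<in> W")
        case True
        have "H (p, k) = 0"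
        proof (cases "k = 0")
          case k0: True
          then have "\<exists>j. norm (\<beta> p j) > 1" using True by (auto simp: W_def)
          then have "\<not> (prime p \<and> (\<forall>j. norm (\<beta> p j) \<le> 1))" by (meson not_le)
          then have "c p = 0" unfolding c_def by (rule if_not_P)
          then show ?thesis by (simp add: H_def)
        qed (simp add: H_def)
        then show ?thesis using True by (simp add: R_def pk)
      next
        case False
        then have R0: "R n \<sigma> = 0" by (simp add: R_def pk)
        show ?thesis
        proof (cases "prime p")
          case True
          with False have k: "k = 0" by (auto simp: W_def)
          then have "\<not> (\<exists>j. norm (\<beta> p j) > 1)" using True False by (auto simp: W_def)
          then have gd: "\<forall>j. norm (\<beta> p j) \<le> 1" by (meson not_le)
          have p0: "p > 0" by (rule prime_gt_0_nat[OF True])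
          have "exp (- (1 + of_real \<sigma>) * of_real (l n)) = (of_nat p powr (- (1 + of_real \<sigma>)) :: complex)"
            using exp_euler_freq(2)[OF p0, of "1 + of_real \<sigma>" 0] by (simp add: l_def euler_freq_seq_def pk k)
          also have "of_nat p powr (- (1 + of_real \<sigma>)) = complex_of_real (real p powr (- (1 + \<sigma>)))"
            using powr_of_real[of "real p" "- (1 + \<sigma>)"] by simp
          also have "- (1 + \<sigma>) = - \<sigma> - 1" by simp
          also have "real p powr (- \<sigma> - 1) = real p powr - \<sigma> / real p"
            unfolding powr_diff using p0 by simp
          finally have e: "exp (- (1 + of_real \<sigma>) * of_real (l n)) = complex_of_real (real p powr - \<sigma> / real p)" .
          have "of_real (l n) * a n = of_real (ln (real p)) * (\<Sum>j\<in>UNIV. \<beta> p j)"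
            using True by (simp add: l_def euler_freq_seq_def euler_freq_def a_def euler_coeff_seq_def euler_coeff_def pk k)
          then show ?thesis unfolding e R0 using True gd by (simp add: H_def pk k c_def prime_weight_def)
        next
          case False
          then show ?thesis using R0 by (simp add: H_def pk c_def a_def euler_coeff_seq_def euler_coeff_def)
        qed
      qed
    qed
    have sR: "summable (\<lambda>n. R n \<sigma>)"
      by (rule summable_comparison_test'[OF sT]) (rule Rb[OF \<sigma>])
    have "(\<lambda>n. of_real \<sigma> * (- of_real (l n) * a n * exp (- (1 + of_real \<sigma>) * of_real (l n)))) sums (of_real \<sigma> * g' (1 + of_real \<sigma>))"
      by (intro sums_mult ser(2)) (use \<sigma> in simp)
    then have "(\<lambda>n. - (of_real \<sigma> * (- of_real (l n) * a n * exp (- (1 + of_real \<sigma>) * of_real (l n))))) sums - (of_real \<sigma> * g' (1 + of_real \<sigma>))"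
      by (rule sums_minus)
    then have "(\<lambda>n. R n \<sigma> + H (prod_decode n)) sums - (of_real \<sigma> * g' (1 + of_real \<sigma>))"
      unfolding split[symmetric] by simp
    from sums_diff[OF this summable_sums[OF sR]]
    have Hs: "(\<lambda>n. H (prod_decode n)) sums (- (of_real \<sigma> * g' (1 + of_real \<sigma>)) - (\<Sum>n. R n \<sigma>))" by simp
    have cle: "norm (c p * of_real (real p powr - \<sigma>')) \<le> real CARD('n) * (prime_weight p * real p powr - \<sigma>')" for p \<sigma>'
    proof (cases "good p")
      case True
      have "norm (\<Sum>j\<in>UNIV. \<beta> p j) \<le> (\<Sum>j\<in>(UNIV :: 'n set). 1)" by (rule sum_norm_le) (use True in \<open>auto simp: good_def\<close>)
      then have "norm (\<Sum>j\<in>UNIV. \<beta> p j) * (prime_weight p * real p powr - \<sigma>') \<le> real CARD('n) * (prime_weight p * real p powr - \<sigma>')"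
        using prime_weight_nonneg[of p] by (intro mult_right_mono) auto
      then show ?thesis using True prime_weight_nonneg[of p] by (simp add: good_def c_def norm_mult mult.assoc)
    qed (use prime_weight_nonneg[of p] in \<open>auto simp: good_def c_def\<close>)
    have spw: "summable (\<lambda>p. prime_weight p * real p powr - \<sigma>)"
    proof (cases "\<sigma> \<le> 1")
      case True
      then show ?thesis using prime_weight_Dirichlet_bound(1)[OF \<sigma>] by simp
    next
      case False
      show ?thesis
      proof (rule summable_comparison_test'[OF prime_weight_Dirichlet_bound(1)[of 1]])
        fix p :: nat
        have le: "real p powr - \<sigma> \<le> real p powr - 1"
        proof (cases "p = 0")
          case p0: False
          show ?thesis by (rule powr_mono) (use False p0 in auto)
        qed simp
        have "norm (prime_weight p * real p powr - \<sigma>) = prime_weight p * real p powr - \<sigma>"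
          using prime_weight_nonneg[of p] by simp
        also have "\<dots> \<le> prime_weight p * real p powr - 1" by (rule mult_left_mono[OF le prime_weight_nonneg])
        finally show "norm (prime_weight p * real p powr - \<sigma>) \<le> prime_weight p * real p powr - 1" .
      qed auto
    qed
    have sumc: "summable (\<lambda>p. norm (of_real \<sigma> * (c p * of_real (real p powr - \<sigma>))))"
      unfolding norm_mult[of "of_real \<sigma>"]
      by (intro summable_mult summable_comparison_test'[OF summable_mult[OF spw, of "real CARD('n)"]])
         (simp only: real_norm_def abs_norm_cancel cle)
    define u where "u = (\<lambda>p. of_real \<sigma> * (c p * of_real (real p powr - \<sigma>)))"
    have hu: "(u has_sum (\<Sum>p. u p)) UNIV"
      using sumc summable_norm_cancel[OF sumc] unfolding u_def
      by (intro norm_summable_imp_has_sum summable_sums)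
    have img: "range (\<lambda>p::nat. (p, 0::nat)) = UNIV \<times> {0}" by auto
    have "(H has_sum (\<Sum>p. u p)) (range (\<lambda>p::nat. (p, 0::nat)))"
      by (subst has_sum_reindex) (use hu in \<open>auto simp: inj_on_def o_def H_def u_def\<close>)
    then have HU: "(H has_sum (\<Sum>p. u p)) UNIV"
      by (rule iffD1[OF has_sum_cong_neutral, rotated -1]) (auto simp: H_def)
    then have "((\<lambda>n. H (prod_decode n)) has_sum (\<Sum>p. u p)) UNIV"
      using has_sum_reindex_bij_betw[OF bij_prod_decode, of H "\<Sum>p. u p"] by simp
    from has_sum_imp_sums[OF this] Hs have "(\<Sum>p. u p) = - (of_real \<sigma> * g' (1 + of_real \<sigma>)) - (\<Sum>n. R n \<sigma>)"
      by (rule sums_unique2)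
    moreover have "(\<Sum>p. u p) = of_real \<sigma> * (\<Sum>p. c p * of_real (real p powr - \<sigma>))"
    proof -
      have "summable (\<lambda>p. c p * of_real (real p powr - \<sigma>))"
        by (rule summable_norm_cancel, rule summable_comparison_test'[OF summable_mult[OF spw, of "real CARD('n)"]])
           (simp only: real_norm_def abs_norm_cancel cle)
      from suminf_mult[OF this] show ?thesis unfolding u_def .
    qed
    ultimately show ?thesis by simp
  qed
  have "((\<lambda>\<sigma>. - (of_real \<sigma> * g' (1 + of_real \<sigma>)) - (\<Sum>n. R n \<sigma>)) \<longlongrightarrow> - of_int (zorder f 1) - (\<Sum>n. 0)) (at_right 0)"
    by (intro tendsto_diff tendsto_minus lim Rlim)
  then have "((\<lambda>\<sigma>. - (of_real \<sigma> * g' (1 + of_real \<sigma>)) - (\<Sum>n. R n \<sigma>)) \<longlongrightarrow> - of_int (zorder f 1)) (at_right 0)" by simp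
  then show ?thesis
    by (rule Lim_transform_eventually) (use main in \<open>auto simp: eventually_at_right_field intro!: exI[of _ 1]\<close>)
qed

section \<open>The remainder in the central Euler product\<close>

lemma ln_le_fourth_root:
  fixes x :: real assumes "1 \<le> x" shows "ln x \<le> 4 * x powr (1/4)"
proof -
  have "ln (x powr (1/4)) \<le> x powr (1/4) - 1" using assms by (intro ln_le_minus_one) auto
  then show ?thesis using assms by (simp add: ln_powr)
qed

text \<open>The first bound is uniform up to the boundary, and its exponent 1/2 is below 1, so that
  it survives division by |z|^2 and summation over unit windows. The second, which may blow up like
  ln \<sigma>, serves to move lines of integration. Packaged together they are stable under sums and
  integer multiples, the operations from which H is built.\<close>

definition moderate_growth :: "(complex \<Rightarrow> complex) \<Rightarrow> bool" where
  "moderate_growth l \<longleftrightarrow> l holomorphic_on {z. Re z > 0} \<and> (\<exists>A>0. (\<forall>T \<sigma>. 0 < \<sigma> \<longrightarrow> \<sigma> \<le> 1 \<longrightarrow>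
        (\<integral>\<^sup>+t. ennreal ((norm (l (Complex \<sigma> t)))\<^sup>2) * indicator {T-1/2..T+1/2} t \<partial>lborel) \<le> ennreal (A * (1 + \<bar>T\<bar>) powr (1/2))) \<and>
      (\<forall>\<sigma> t. 0 < \<sigma> \<longrightarrow> \<sigma> \<le> 1 \<longrightarrow> norm (l (Complex \<sigma> t)) \<le> A * (1 + \<bar>ln \<sigma>\<bar>) * (1 + \<bar>t\<bar>)))"

text \<open>Polynomial growth of f makes the local bound \<open>B\<close> logarithmic in T; it is
  then weakened to a power 1/4, whose square gives the exponent 1/2.\<close>

lemma log_bounds_polynomial_growth:
  fixes f l :: "complex \<Rightarrow> complex"
  assumes hol: "f holomorphic_on UNIV" and l: "l holomorphic_on {z. Re z > 0}"
    and ef: "\<And>z. Re z > 0 \<Longrightarrow> exp (l z) = f z"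
    and growth: "\<And>T z. norm (z - Complex 1 T) \<le> 2 \<Longrightarrow> norm (f z) \<le> C * (10 + \<bar>T\<bar>) ^ n" and C: "1 \<le> C"
    and center: "\<And>T. norm (l (Complex 1 T)) \<le> K"
  shows "moderate_growth l"
proof -
  have K0: "0 \<le> K" using order_trans[OF norm_ge_zero center[of 0]] .
  define B where "B = (\<lambda>T. ln C + real n * ln (10 + \<bar>T\<bar>) + K + 1)"
  \<comment> \<open>The 8 comes from ln (10 + |T|) <= 4 (16 (1 + |T|))^(1/4) = 8 (1 +
    |T|)^(1/4).\<close>
  define A0 where "A0 = ln C + real n * 8 + K + 1"
  have lnC: "0 \<le> ln C" using C by simp
  have A0: "1 \<le> A0" using lnC K0 by (simp add: A0_def)
  have BA: "B T \<le> A0 * (1 + \<bar>T\<bar>) powr (1/4)" for T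
  proof -
    have p1: "1 \<le> (1 + \<bar>T\<bar>) powr (1/4)" by (rule ge_one_powr_ge_zero) auto
    have "ln (10 + \<bar>T\<bar>) \<le> 4 * (10 + \<bar>T\<bar>) powr (1/4)" by (rule ln_le_fourth_root) simp
    also have "(10 + \<bar>T\<bar>) powr (1/4) \<le> (16 * (1 + \<bar>T\<bar>)) powr (1/4)" by (rule powr_mono2) auto
    also have "\<dots> = 16 powr (1/4) * (1 + \<bar>T\<bar>) powr (1/4)" by (rule powr_mult)
    also have "(16::real) powr (1/4) = 2"
    proof -
      have "(16::real) powr (1/4) = (2 powr 4) powr (1/4)" by simp
      also have "\<dots> = 2" unfolding powr_powr by simp
      finally show ?thesis .
    qed
    finally have "ln (10 + \<bar>T\<bar>) \<le> 8 * (1 + \<bar>T\<bar>) powr (1/4)" by simp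
    then have "real n * ln (10 + \<bar>T\<bar>) \<le> real n * (8 * (1 + \<bar>T\<bar>) powr (1/4))" by (rule mult_left_mono) simp
    moreover have "ln C + K + 1 \<le> (ln C + K + 1) * (1 + \<bar>T\<bar>) powr (1/4)"
      using p1 lnC K0 by (simp add: mult_le_cancel_left1)
    ultimately show ?thesis by (simp add: B_def A0_def algebra_simps)
  qed
  have B1: "1 \<le> B T" for T using lnC K0 by (simp add: B_def)
  have fB: "norm (f z) \<le> exp (B T)" if "norm (z - Complex 1 T) \<le> 2" for z T
  proof -
    have "norm (f z) \<le> C * (10 + \<bar>T\<bar>) ^ n" by (rule growth[OF that])
    also have "\<dots> = exp (ln C + real n * ln (10 + \<bar>T\<bar>))"
      using C by (simp add: exp_add exp_of_nat_mult)
    also have "\<dots> \<le> exp (B T)" using K0 by (simp add: B_def)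
    finally show ?thesis .
  qed
  have lB: "norm (l (Complex 1 T)) \<le> B T" for T
  proof -
    have "0 \<le> real n * ln (10 + \<bar>T\<bar>)" by (intro mult_nonneg_nonneg) auto
    then show ?thesis using center[of T] lnC unfolding B_def by linarith
  qed
  define A where "A = max (200000 * A0\<^sup>2) (250 * A0)"
  have A: "A > 0" "200000 * A0\<^sup>2 \<le> A" "250 * A0 \<le> A" using A0 by (auto simp: A_def less_max_iff_disj)
  show ?thesis unfolding moderate_growth_def
  proof (intro exI[of _ A] conjI allI impI l)
    show "A > 0" by fact
    fix T \<sigma> :: real assume \<sigma>: "0 < \<sigma>" "\<sigma> \<le> 1"
    have "(\<integral>\<^sup>+t. ennreal ((norm (l (Complex \<sigma> t)))\<^sup>2) * indicator {T-1/2..T+1/2} t \<partial>lborel) \<le> ennreal (200000 * (B T)\<^sup>2)"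
      by (rule log_mean_square_at_height[OF hol l ef fB lB B1 \<sigma>])
    also have "\<dots> \<le> ennreal (A * (1 + \<bar>T\<bar>) powr (1/2))"
    proof (rule ennreal_leI)
      have "(B T)\<^sup>2 \<le> (A0 * (1 + \<bar>T\<bar>) powr (1/4))\<^sup>2" using BA[of T] B1[of T] by (intro power_mono) auto
      also have "\<dots> = A0\<^sup>2 * (1 + \<bar>T\<bar>) powr (1/2)"
        by (simp add: power_mult_distrib power2_eq_square flip: powr_add)
      finally have "200000 * (B T)\<^sup>2 \<le> (200000 * A0\<^sup>2) * (1 + \<bar>T\<bar>) powr (1/2)" by simp
      also have "\<dots> \<le> A * (1 + \<bar>T\<bar>) powr (1/2)" by (rule mult_right_mono[OF A(2)]) simp
      finally show "200000 * (B T)\<^sup>2 \<le> A * (1 + \<bar>T\<bar>) powr (1/2)" .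
    qed
    finally show "(\<integral>\<^sup>+t. ennreal ((norm (l (Complex \<sigma> t)))\<^sup>2) * indicator {T-1/2..T+1/2} t \<partial>lborel) \<le> ennreal (A * (1 + \<bar>T\<bar>) powr (1/2))" .
  next
    fix \<sigma> t :: real assume \<sigma>: "0 < \<sigma>" "\<sigma> \<le> 1"
    have "norm (l (Complex \<sigma> t)) \<le> (250 + 8 * \<bar>ln \<sigma>\<bar>) * B t"
      by (rule log_bound_at_height[OF hol l ef fB lB B1 \<sigma>, of t]) simp_all
    also have "\<dots> \<le> (250 * (1 + \<bar>ln \<sigma>\<bar>)) * (A0 * (1 + \<bar>t\<bar>))"
    proof (intro mult_mono)
      have "(1 + \<bar>t\<bar>) powr (1/4) \<le> (1 + \<bar>t\<bar>) powr 1" by (rule powr_mono) auto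
      then have "A0 * (1 + \<bar>t\<bar>) powr (1/4) \<le> A0 * (1 + \<bar>t\<bar>)" using A0 by (intro mult_left_mono) auto
      then show "B t \<le> A0 * (1 + \<bar>t\<bar>)" using BA[of t] by linarith
    qed (use B1[of t] in auto)
    also have "\<dots> = (250 * A0) * ((1 + \<bar>ln \<sigma>\<bar>) * (1 + \<bar>t\<bar>))" by (simp only: mult_ac)
    also have "\<dots> \<le> A * ((1 + \<bar>ln \<sigma>\<bar>) * (1 + \<bar>t\<bar>))" by (rule mult_right_mono[OF A(3)]) simp
    finally show "norm (l (Complex \<sigma> t)) \<le> A * (1 + \<bar>ln \<sigma>\<bar>) * (1 + \<bar>t\<bar>)" by (simp only: mult.assoc)
  qed
qed

text \<open>The line is covered by unit windows around the integers. Around n and -n the denominator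
  is at least n / 2, which leaves n^(-3/2); around 0 the bound |h z| <= K |z| cancels the pole of 1
  / z.\<close>

lemma mean_square_quotient_bounded:
  fixes h :: "complex \<Rightarrow> complex"
  assumes hol: "h holomorphic_on {z. Re z > 0}" and A: "A \<ge> 0"
    and ms: "\<And>T \<sigma>. 0 < \<sigma> \<Longrightarrow> \<sigma> \<le> 1 \<Longrightarrow>
        (\<integral>\<^sup>+t. ennreal ((norm (h (Complex \<sigma> t)))\<^sup>2) * indicator {T-1/2..T+1/2} t \<partial>lborel) \<le> ennreal (A * (1 + \<bar>T\<bar>) powr (1/2))"
    and r: "0 < r" and near: "\<And>z. Re z > 0 \<Longrightarrow> norm z < r \<Longrightarrow> norm (h z) \<le> K * norm z"
  shows "\<exists>M. \<forall>\<sigma>. 0 < \<sigma> \<longrightarrow> \<sigma> \<le> 1 \<longrightarrow>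
     (\<integral>\<^sup>+t. ennreal ((norm (h (Complex \<sigma> t) / Complex \<sigma> t))\<^sup>2) \<partial>lborel) \<le> ennreal M"
proof -
  \<comment> \<open>The window around 0 is counted twice, as n and -n coincide there. The other
    summand is 0 at n = 0 because \<open>0 powr (-3/2) = 0\<close>.\<close>
  define a where "a = (\<lambda>n::nat. (if n = 0 then 2 * (K\<^sup>2 + A / r\<^sup>2) else 0) + 16 * A * real n powr (-3/2))"
  have a0: "0 \<le> a n" for n using A by (auto simp: a_def)
  have "summable (\<lambda>n::nat. if n = 0 then 2 * (K\<^sup>2 + A / r\<^sup>2) else 0)" by (rule summable_finite[of "{0}"]) auto
  moreover have "summable (\<lambda>n. 16 * A * real n powr (-3/2))" by (intro summable_mult) (simp add: summable_real_powr_iff)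
  ultimately have suma: "summable a" unfolding a_def by (rule summable_add)
  show ?thesis
  proof (intro exI[of _ "suminf a"] allI impI)
    fix \<sigma> :: real assume \<sigma>: "0 < \<sigma>" "\<sigma> \<le> 1"
    define F where "F = (\<lambda>t. ennreal ((norm (h (Complex \<sigma> t) / Complex \<sigma> t))\<^sup>2))"
    define I where "I = (\<lambda>T::real. {T-1/2..T+1/2})"
    have "continuous_on UNIV (\<lambda>t. h (Complex \<sigma> t))"
      by (rule continuous_on_compose2[OF holomorphic_on_imp_continuous_on[OF hol]])
         (use \<sigma> in \<open>auto intro!: continuous_intros\<close>)
    then have [measurable]: "(\<lambda>t. h (Complex \<sigma> t)) \<in> borel_measurable borel" by (rule borel_measurable_continuous_onI)
    have [measurable]: "(\<lambda>t. Complex \<sigma> t) \<in> borel_measurable borel"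
      by (intro borel_measurable_continuous_onI continuous_intros)
    have [measurable]: "F \<in> borel_measurable borel" unfolding F_def by measurable
    have far: "(\<integral>\<^sup>+t. F t * indicator (I T) t \<partial>lborel) \<le> ennreal (8 * A * real n powr (-3/2))"
      if n: "n > 0" "\<bar>T\<bar> = real n" for T n
    proof -
      have le: "F t * indicator (I T) t \<le> ennreal (4 / (real n)\<^sup>2) * (ennreal ((norm (h (Complex \<sigma> t)))\<^sup>2) * indicator {T-1/2..T+1/2} t)" for t
      proof (cases "t \<in> I T")
        case True
        then have "real n / 2 \<le> \<bar>t\<bar>" using n unfolding I_def atLeastAtMost_iff by linarith
        also have "\<bar>t\<bar> \<le> norm (Complex \<sigma> t)" using abs_Im_le_cmod[of "Complex \<sigma> t"] by simp
        finally have "(real n / 2)\<^sup>2 \<le> (norm (Complex \<sigma> t))\<^sup>2" by (intro power_mono) auto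
        then have "(norm (h (Complex \<sigma> t)))\<^sup>2 / (norm (Complex \<sigma> t))\<^sup>2 \<le> (norm (h (Complex \<sigma> t)))\<^sup>2 / (real n / 2)\<^sup>2"
          using n \<sigma> by (intro divide_left_mono) (auto simp: complex_eq_iff)
        then have "(norm (h (Complex \<sigma> t) / Complex \<sigma> t))\<^sup>2 \<le> 4 / (real n)\<^sup>2 * (norm (h (Complex \<sigma> t)))\<^sup>2"
          by (simp add: norm_divide power_divide mult.commute)
        then show ?thesis using True by (simp add: F_def I_def ennreal_mult'[symmetric] ennreal_leI)
      qed (simp add: I_def)
      have "(\<integral>\<^sup>+t. F t * indicator (I T) t \<partial>lborel) \<le> (\<integral>\<^sup>+t. ennreal (4 / (real n)\<^sup>2) * (ennreal ((norm (h (Complex \<sigma> t)))\<^sup>2) * indicator {T-1/2..T+1/2} t) \<partial>lborel)"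
        by (rule nn_integral_mono) (rule le)
      also have "\<dots> = ennreal (4 / (real n)\<^sup>2) * (\<integral>\<^sup>+t. ennreal ((norm (h (Complex \<sigma> t)))\<^sup>2) * indicator {T-1/2..T+1/2} t \<partial>lborel)"
        by (rule nn_integral_cmult) measurable
      also have "\<dots> \<le> ennreal (4 / (real n)\<^sup>2) * ennreal (A * (1 + \<bar>T\<bar>) powr (1/2))"
        by (intro mult_left_mono ms \<sigma>) auto
      also have "\<dots> = ennreal (4 / (real n)\<^sup>2 * (A * (1 + \<bar>T\<bar>) powr (1/2)))"
        by (rule ennreal_mult[symmetric]) (use A in auto)
      also have "\<dots> \<le> ennreal (8 * A * real n powr (-3/2))"
      proof (rule ennreal_leI)
        have "(1 + \<bar>T\<bar>) powr (1/2) \<le> (4 * real n) powr (1/2)" using n by (intro powr_mono2) auto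
        also have "\<dots> = 2 * real n powr (1/2)" by (simp add: powr_mult powr_half_sqrt)
        finally have "4 / (real n)\<^sup>2 * (A * (1 + \<bar>T\<bar>) powr (1/2)) \<le> 4 / (real n)\<^sup>2 * (A * (2 * real n powr (1/2)))"
          using A by (intro mult_left_mono) auto
        also have "\<dots> = 8 * A * (real n powr (1/2) / real n powr 2)"
          using n by (simp add: powr_numeral)
        also have "real n powr (1/2) / real n powr 2 = real n powr (-3/2)" by (subst powr_diff[symmetric]) simp
        finally show "4 / (real n)\<^sup>2 * (A * (1 + \<bar>T\<bar>) powr (1/2)) \<le> 8 * A * real n powr (-3/2)" .
      qed
      finally show ?thesis .
    qed
    have zero: "(\<integral>\<^sup>+t. F t * indicator (I 0) t \<partial>lborel) \<le> ennreal (K\<^sup>2 + A / r\<^sup>2)"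
    proof -
      have le: "F t * indicator (I 0) t \<le> ennreal (K\<^sup>2) * indicator {-1/2..1/2} t + ennreal (1 / r\<^sup>2) * (ennreal ((norm (h (Complex \<sigma> t)))\<^sup>2) * indicator {0-1/2..0+1/2} t)" for t
      proof (cases "t \<in> I 0")
        case True
        have z0: "Complex \<sigma> t \<noteq> 0" "norm (Complex \<sigma> t) > 0" using \<sigma> by (auto simp: complex_eq_iff)
        have "(norm (h (Complex \<sigma> t) / Complex \<sigma> t))\<^sup>2 \<le> K\<^sup>2 + 1 / r\<^sup>2 * (norm (h (Complex \<sigma> t)))\<^sup>2"
        proof (cases "norm (Complex \<sigma> t) < r")
          case True
          then have "norm (h (Complex \<sigma> t) / Complex \<sigma> t) \<le> K"
            using near[of "Complex \<sigma> t"] \<sigma> z0 by (simp add: norm_divide pos_divide_le_eq)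
          then have "(norm (h (Complex \<sigma> t) / Complex \<sigma> t))\<^sup>2 \<le> K\<^sup>2" by (intro power_mono) auto
          then show ?thesis by (simp add: add_increasing2)
        next
          case False
          then have "r\<^sup>2 \<le> (norm (Complex \<sigma> t))\<^sup>2" using r by (intro power_mono) auto
          then have "(norm (h (Complex \<sigma> t)))\<^sup>2 / (norm (Complex \<sigma> t))\<^sup>2 \<le> (norm (h (Complex \<sigma> t)))\<^sup>2 / r\<^sup>2"
            using z0 r by (intro divide_left_mono) auto
          then show ?thesis by (simp add: norm_divide power_divide add_increasing)
        qed
        then have "F t \<le> ennreal (K\<^sup>2 + 1 / r\<^sup>2 * (norm (h (Complex \<sigma> t)))\<^sup>2)"
          unfolding F_def by (rule ennreal_leI)
        also have "\<dots> = ennreal (K\<^sup>2) + ennreal (1 / r\<^sup>2) * ennreal ((norm (h (Complex \<sigma> t)))\<^sup>2)"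
          by (subst ennreal_plus) (auto simp: ennreal_mult'[symmetric])
        finally show ?thesis using True by (simp add: I_def)
      qed simp
      have "(\<integral>\<^sup>+t. F t * indicator (I 0) t \<partial>lborel) \<le> (\<integral>\<^sup>+t. ennreal (K\<^sup>2) * indicator {-1/2..1/2} t + ennreal (1 / r\<^sup>2) * (ennreal ((norm (h (Complex \<sigma> t)))\<^sup>2) * indicator {0-1/2..0+1/2} t) \<partial>lborel)"
        by (rule nn_integral_mono) (rule le)
      also have "\<dots> = (\<integral>\<^sup>+t. ennreal (K\<^sup>2) * indicator {-1/2..1/2} (t::real) \<partial>lborel) + ennreal (1 / r\<^sup>2) * (\<integral>\<^sup>+t. ennreal ((norm (h (Complex \<sigma> t)))\<^sup>2) * indicator {0-1/2..0+1/2} t \<partial>lborel)"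
        by (subst nn_integral_add, measurable, subst nn_integral_cmult[of "\<lambda>t. ennreal ((norm (h (Complex \<sigma> t)))\<^sup>2) * indicator {0-1/2..0+1/2} t"], measurable)
      also have "\<dots> \<le> ennreal (K\<^sup>2) + ennreal (1 / r\<^sup>2) * ennreal (A * (1 + \<bar>0\<bar>) powr (1/2))"
        by (intro add_mono mult_left_mono ms \<sigma>) (auto simp: nn_integral_cmult)
      also have "\<dots> = ennreal (K\<^sup>2 + A / r\<^sup>2)"
        using A by (simp add: ennreal_mult'[symmetric])
      finally show ?thesis .
    qed
    have piece: "(\<integral>\<^sup>+t. F t * indicator (I (real n)) t \<partial>lborel) + (\<integral>\<^sup>+t. F t * indicator (I (- real n)) t \<partial>lborel) \<le> ennreal (a n)" for n
    proof (cases "n = 0")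
      case True
      have "(\<integral>\<^sup>+t. F t * indicator (I (real n)) t \<partial>lborel) + (\<integral>\<^sup>+t. F t * indicator (I (- real n)) t \<partial>lborel) \<le> ennreal (K\<^sup>2 + A / r\<^sup>2) + ennreal (K\<^sup>2 + A / r\<^sup>2)"
        using zero True by (intro add_mono) auto
      also have "\<dots> = ennreal (a n)" using True A by (simp add: a_def flip: ennreal_plus)
      finally show ?thesis .
    next
      case False
      then have "(\<integral>\<^sup>+t. F t * indicator (I (real n)) t \<partial>lborel) + (\<integral>\<^sup>+t. F t * indicator (I (- real n)) t \<partial>lborel) \<le> ennreal (8 * A * real n powr (-3/2)) + ennreal (8 * A * real n powr (-3/2))"
        by (intro add_mono far) auto
      also have "\<dots> = ennreal (a n)" using False A by (subst ennreal_plus[symmetric]) (auto simp: a_def)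
      finally show ?thesis .
    qed
    have cover: "F t \<le> (\<Sum>n. F t * indicator (I (real n)) t + F t * indicator (I (- real n)) t)" for t
    proof -
      \<comment> \<open>The integer nearest to t is N or -N, so t lies in one of these two
        windows.\<close>
      define N where "N = nat \<bar>round t\<bar>"
      have "\<bar>of_int (round t) - t\<bar> \<le> 1/2" by (rule of_int_round_abs_le)
      moreover have "real_of_int (round t) = real N \<or> real_of_int (round t) = - real N" unfolding N_def by linarith
      ultimately have tI: "t \<in> I (real N) \<or> t \<in> I (- real N)" unfolding I_def atLeastAtMost_iff by linarith
      then have "F t \<le> F t * indicator (I (real N)) t + F t * indicator (I (- real N)) t"
        by (auto simp: add_increasing add_increasing2)
      also have "\<dots> = (\<Sum>n\<in>{N}. F t * indicator (I (real n)) t + F t * indicator (I (- real n)) t)" by simp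
      also have "\<dots> \<le> (\<Sum>n. F t * indicator (I (real n)) t + F t * indicator (I (- real n)) t)"
        by (rule sum_le_suminf) auto
      finally show ?thesis .
    qed
    have [measurable]: "I T \<in> sets borel" for T unfolding I_def by measurable
    have "(\<integral>\<^sup>+t. F t \<partial>lborel) \<le> (\<integral>\<^sup>+t. (\<Sum>n. F t * indicator (I (real n)) t + F t * indicator (I (- real n)) t) \<partial>lborel)"
      by (rule nn_integral_mono) (rule cover)
    also have "\<dots> = (\<Sum>n. \<integral>\<^sup>+t. F t * indicator (I (real n)) t + F t * indicator (I (- real n)) t \<partial>lborel)"
      by (rule nn_integral_suminf) measurable
    also have "\<dots> = (\<Sum>n. (\<integral>\<^sup>+t. F t * indicator (I (real n)) t \<partial>lborel) + (\<integral>\<^sup>+t. F t * indicator (I (- real n)) t \<partial>lborel))"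
      by (intro suminf_cong nn_integral_add) measurable
    also have "\<dots> \<le> (\<Sum>n. ennreal (a n))" by (intro suminf_le piece) auto
    also have "\<dots> = ennreal (suminf a)" by (rule suminf_ennreal2[OF a0 suma])
    finally show "(\<integral>\<^sup>+t. ennreal ((norm (h (Complex \<sigma> t) / Complex \<sigma> t))\<^sup>2) \<partial>lborel) \<le> ennreal (suminf a)"
      unfolding F_def .
  qed
qed

section \<open>From square integrability to an exceptional set\<close>

text \<open>Chebyshev's inequality at level 2^(-k), on a tail with mean square below 8^(-k), gives a
  set of measure at most 4^k 8^(-k) = 2^(-k), and the union over k has measure at most 2. Under x =
  exp u, Lebesgue measure in u becomes dx / x.\<close>

lemma exceptional_set:
  fixes D :: "real \<Rightarrow> complex"
  assumes [measurable]: "D \<in> borel_measurable borel"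
    and fin: "(\<integral>\<^sup>+u. ennreal ((norm (D u))\<^sup>2) * indicator {0..} u \<partial>lborel) < \<infinity>"
  shows "\<exists>S\<subseteq>{2..}. finite_log_measure S \<and> ((\<lambda>x. D (ln x)) \<longlongrightarrow> 0) (inf at_top (principal (- S)))"
proof -
  define F where "F = (\<lambda>u. ennreal ((norm (D u))\<^sup>2) * indicator {0..} u)"
  have [measurable]: "F \<in> borel_measurable borel" unfolding F_def by measurable
  have "(\<lambda>n. \<integral>\<^sup>+u. F u * indicator {real n..} u \<partial>lborel) \<longlonglongrightarrow> (\<integral>\<^sup>+u. 0 \<partial>(lborel::real measure))"
  proof (rule nn_integral_dominated_convergence[where u = "\<lambda>n u. F u * indicator {real n..} u" and u' = "\<lambda>_. 0" and w = F])
    show "AE u in lborel. (\<lambda>n. F u * indicator {real n..} u) \<longlonglongrightarrow> 0"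
    proof (rule AE_I2)
      fix u
      obtain N :: nat where N: "u < real N" using reals_Archimedean2 by blast
      show "(\<lambda>n. F u * indicator {real n..} u) \<longlonglongrightarrow> 0"
        by (rule tendsto_eventually, rule eventually_sequentiallyI[of N]) (use N in auto)
    qed
    show "(\<integral>\<^sup>+u. F u \<partial>lborel) < \<infinity>" using fin unfolding F_def .
    show "AE u in lborel. F u * indicator {real n..} u \<le> F u" for n
      by (intro AE_I2) (auto simp: indicator_def)
  qed measurable
  then have tail: "(\<lambda>n. \<integral>\<^sup>+u. F u * indicator {real n..} u \<partial>lborel) \<longlonglongrightarrow> 0" by simp
  have "\<exists>n. (\<integral>\<^sup>+u. F u * indicator {real n..} u \<partial>lborel) < ennreal ((1/8) ^ k)" for k
  proof -
    have "\<forall>\<^sub>F n in sequentially. (\<integral>\<^sup>+u. F u * indicator {real n..} u \<partial>lborel) < ennreal ((1/8) ^ k)"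
      by (rule order_tendstoD(2)[OF tail]) simp
    then show ?thesis by (rule eventually_happens'[OF sequentially_bot])
  qed
  then obtain U where U: "\<And>k. (\<integral>\<^sup>+u. F u * indicator {real (U k)..} u \<partial>lborel) < ennreal ((1/8) ^ k)" by metis
  define E where "E = (\<lambda>k. {u. real (U k) \<le> u \<and> (1/2) ^ k \<le> norm (D u)})"
  have [measurable]: "E k \<in> sets borel" for k unfolding E_def by measurable
  have mE: "emeasure lborel (E k) \<le> ennreal ((1/2) ^ k)" for k
  proof -
    have "emeasure lborel (E k) = (\<integral>\<^sup>+u. indicator (E k) u \<partial>lborel)" by simp
    also have "\<dots> \<le> (\<integral>\<^sup>+u. ennreal (4 ^ k) * (F u * indicator {real (U k)..} u) \<partial>lborel)"
    proof (rule nn_integral_mono)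
      fix u
      show "indicator (E k) u \<le> ennreal (4 ^ k) * (F u * indicator {real (U k)..} u)"
      proof (cases "u \<in> E k")
        case True
        then have u: "real (U k) \<le> u" "(1/2) ^ k \<le> norm (D u)" by (auto simp: E_def)
        then have "((1/2) ^ k)\<^sup>2 \<le> (norm (D u))\<^sup>2" by (intro power_mono) auto
        then have "4 ^ k * ((1/2) ^ k)\<^sup>2 \<le> 4 ^ k * (norm (D u))\<^sup>2" by (intro mult_left_mono) auto
        moreover have "4 ^ k * ((1/2) ^ k)\<^sup>2 = (1::real)"
          by (simp add: power2_eq_square flip: power_mult_distrib)
        ultimately have "1 \<le> ennreal (4 ^ k * (norm (D u))\<^sup>2)" by simp
        moreover have "0 \<le> u" using u(1) of_nat_0_le_iff order_trans by blast
        ultimately show ?thesis using True u by (simp add: F_def ennreal_mult')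
      qed simp
    qed
    also have "\<dots> = ennreal (4 ^ k) * (\<integral>\<^sup>+u. F u * indicator {real (U k)..} u \<partial>lborel)"
      by (rule nn_integral_cmult) measurable
    also have "\<dots> \<le> ennreal (4 ^ k) * ennreal ((1/8) ^ k)" by (intro mult_left_mono less_imp_le U) auto
    also have "\<dots> = ennreal ((1/2) ^ k)"
      by (subst ennreal_mult[symmetric]) (simp_all flip: power_mult_distrib)
    finally show ?thesis .
  qed
  define Su where "Su = (\<Union>k. E k)"
  have [measurable]: "Su \<in> sets borel" unfolding Su_def by measurable
  have "emeasure lborel Su \<le> (\<Sum>k. emeasure lborel (E k))"
    unfolding Su_def by (rule emeasure_subadditive_countably) auto
  also have "\<dots> \<le> (\<Sum>k. ennreal ((1/2) ^ k))" by (intro suminf_le mE) auto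
  also have "\<dots> = ennreal (\<Sum>k. (1/2) ^ k)" by (rule suminf_ennreal2) auto
  also have "\<dots> = 2" by (simp add: suminf_geometric)
  finally have mSu: "emeasure lborel Su \<le> 2" .
  define S where "S = {x. 2 \<le> x \<and> ln x \<in> Su}"
  have [measurable]: "S \<in> sets borel" unfolding S_def by measurable
  define f where "f = (\<lambda>x::real. ennreal (1 / x) * indicator S x)"
  have [measurable]: "f \<in> borel_measurable borel" unfolding f_def by measurable
  have part: "(\<integral>\<^sup>+x. f x * indicator {2..real (Suc k) + 2} x \<partial>lborel) \<le> 2" for k
  proof -
    define b where "b = ln (real (Suc k) + 2)"
    have b: "ln 2 \<le> b" unfolding b_def by (subst ln_le_cancel_iff) auto
    have b2: "ln 2 < b" unfolding b_def by (subst ln_less_cancel_iff) auto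
    have eb: "exp b = real (Suc k) + 2" unfolding b_def by (rule exp_ln) simp
    have "(\<integral>\<^sup>+x. f x * indicator {exp (ln 2)..exp b} x \<partial>lborel) = (\<integral>\<^sup>+x. f (exp x) * ennreal (exp x) * indicator {ln 2..b} x \<partial>lborel)"
      by (rule nn_integral_substitution_aux[where g = exp and g' = exp])
         (use b b2 in \<open>auto intro!: derivative_eq_intros continuous_intros\<close>)
    also have "\<dots> \<le> (\<integral>\<^sup>+x. indicator Su x \<partial>lborel)"
    proof (rule nn_integral_mono)
      fix x :: real
      have "ennreal (1 / exp x) * ennreal (exp x) = 1" by (subst ennreal_mult[symmetric]) auto
      then show "f (exp x) * ennreal (exp x) * indicator {ln 2..b} x \<le> indicator Su x"
        by (auto simp: f_def S_def indicator_def)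
    qed
    also have "\<dots> \<le> 2" using mSu by simp
    finally show ?thesis by (simp add: eb)
  qed
  have "(\<integral>\<^sup>+x. f x \<partial>lborel) = (\<integral>\<^sup>+x. (SUP k. f x * indicator {2..real (Suc k) + 2} x) \<partial>lborel)"
  proof (rule nn_integral_cong)
    fix x :: real
    show "f x = (SUP k. f x * indicator {2..real (Suc k) + 2} x)"
    proof (rule antisym)
      obtain N :: nat where N: "x \<le> real N" using real_arch_simple by blast
      have "f x = f x * indicator {2..real (Suc N) + 2} x" using N by (auto simp: f_def S_def indicator_def)
      also have "\<dots> \<le> (SUP k. f x * indicator {2..real (Suc k) + 2} x)" by (rule SUP_upper) simp
      finally show "f x \<le> (SUP k. f x * indicator {2..real (Suc k) + 2} x)" .
      show "(SUP k. f x * indicator {2..real (Suc k) + 2} x) \<le> f x"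
        by (rule SUP_least) (auto simp: indicator_def)
    qed
  qed
  also have "\<dots> = (SUP k. \<integral>\<^sup>+x. f x * indicator {2..real (Suc k) + 2} x \<partial>lborel)"
    by (intro nn_integral_monotone_convergence_SUP)
       (auto simp: incseq_def le_fun_def intro!: mult_left_mono split: split_indicator)
  also have "\<dots> \<le> 2" by (intro SUP_least part)
  finally have fin2: "(\<integral>\<^sup>+x. f x \<partial>lborel) \<le> 2" .
  have "(\<integral>\<^sup>+x. f x \<partial>lebesgue) = (\<integral>\<^sup>+x. f x \<partial>lborel)" by (rule nn_integral_completion) measurable
  with fin2 have "(\<integral>\<^sup>+x. f x \<partial>lebesgue) < \<infinity>" by (simp add: order_le_less_trans[of _ 2])
  then have "finite_log_measure S"
    unfolding finite_log_measure_def f_def by (auto intro!: sets_completionI_sets)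
  moreover have "S \<subseteq> {2..}" by (auto simp: S_def)
  moreover have "((\<lambda>x. D (ln x)) \<longlongrightarrow> 0) (inf at_top (principal (- S)))"
  proof (rule tendstoI)
    fix e :: real assume e: "e > 0"
    obtain k where k: "(1/2) ^ k < e" using real_arch_pow_inv[OF e, of "1/2"] by auto
    show "\<forall>\<^sub>F x in inf at_top (principal (- S)). dist (D (ln x)) 0 < e"
      unfolding eventually_inf_principal
    proof (rule eventually_at_top_linorderI[of "max 2 (exp (real (U k)))"], rule impI)
      fix x assume x: "max 2 (exp (real (U k))) \<le> x" and nS: "x \<in> - S"
      then have x2: "2 \<le> x" "exp (real (U k)) \<le> x" by auto
      then have "real (U k) \<le> ln x" by (simp add: ln_ge_iff)
      moreover have "ln x \<notin> E k" using nS x2 by (auto simp: S_def Su_def)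
      ultimately have "norm (D (ln x)) < (1/2) ^ k" by (auto simp: E_def not_le)
      then show "dist (D (ln x)) 0 < e" using k by simp
    qed
  qed
  ultimately show ?thesis by blast
qed

text \<open>In Leibniz' rule only the term in which (w - z)^m is differentiated m times survives at
  z.\<close>

lemma leading_coeff_higher_deriv:
  assumes g: "g holomorphic_on ball z r" and r: "r > 0"
    and f: "\<And>w. w \<in> ball z r \<Longrightarrow> f w = (w - z) ^ m * g w"
  shows "(deriv ^^ m) f z = fact m * g z"
proof -
  have z: "z \<in> ball z r" using r by simp
  have hp: "(\<lambda>w. (w - z) ^ m) holomorphic_on ball z r" by (intro holomorphic_intros)
  have hprod: "(\<lambda>w. (w - z) ^ m * g w) holomorphic_on ball z r" by (intro holomorphic_intros g)
  then have hf: "f holomorphic_on ball z r" by (rule holomorphic_transform) (use f in auto)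
  have "(deriv ^^ m) f z = (deriv ^^ m) (\<lambda>w. (w - z) ^ m * g w) z"
    by (rule higher_deriv_transform_within_open[OF hf hprod open_ball z f])
  also have "\<dots> = (\<Sum>i=0..m. of_nat (m choose i) * (deriv ^^ i) (\<lambda>w. (w - z) ^ m) z * (deriv ^^ (m - i)) g z)"
    by (rule higher_deriv_mult[OF hp g open_ball z])
  also have "\<dots> = (\<Sum>i\<in>{m}. of_nat (m choose i) * (deriv ^^ i) (\<lambda>w. (w - z) ^ m) z * (deriv ^^ (m - i)) g z)"
    by (rule sum.mono_neutral_right) (auto simp: higher_deriv_power)
  also have "\<dots> = fact m * g z"
    by (simp add: higher_deriv_power pochhammer_fact[symmetric])
  finally show ?thesis .
qed

lemma moderate_growth_const: "moderate_growth (\<lambda>z. c)"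
  unfolding moderate_growth_def
proof (intro conjI exI[of _ "(norm c)\<^sup>2 + norm c + 1"] allI impI)
  have "0 \<le> (norm c)\<^sup>2" "0 \<le> norm c" by auto
  then show "0 < (norm c)\<^sup>2 + norm c + 1" by linarith
  fix T \<sigma> :: real
  have p1: "1 \<le> (1 + \<bar>T\<bar>) powr (1/2)" by (rule ge_one_powr_ge_zero) auto
  have "(norm c)\<^sup>2 * 1 \<le> ((norm c)\<^sup>2 + norm c + 1) * (1 + \<bar>T\<bar>) powr (1/2)"
    by (intro mult_mono p1) (auto intro!: add_nonneg_nonneg)
  then show "(\<integral>\<^sup>+t. ennreal ((norm c)\<^sup>2) * indicator {T-1/2..T+1/2} t \<partial>lborel)
      \<le> ennreal (((norm c)\<^sup>2 + norm c + 1) * (1 + \<bar>T\<bar>) powr (1/2))"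
    by (simp add: nn_integral_cmult ennreal_leI)
next
  fix \<sigma> t :: real
  have "norm c * 1 \<le> ((norm c)\<^sup>2 + norm c + 1) * ((1 + \<bar>ln \<sigma>\<bar>) * (1 + \<bar>t\<bar>))"
  proof (intro mult_mono)
    have "1 * 1 \<le> (1 + \<bar>ln \<sigma>\<bar>) * (1 + \<bar>t\<bar>)" by (intro mult_mono) auto
    then show "1 \<le> (1 + \<bar>ln \<sigma>\<bar>) * (1 + \<bar>t\<bar>)" by simp
  qed (auto intro!: add_nonneg_nonneg)
  then show "norm c \<le> ((norm c)\<^sup>2 + norm c + 1) * (1 + \<bar>ln \<sigma>\<bar>) * (1 + \<bar>t\<bar>)" by (simp add: mult.assoc)
qed simp

lemma moderate_growth_add:
  assumes "moderate_growth f" "moderate_growth g"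
  shows "moderate_growth (\<lambda>z. f z + g z)"
proof -
  obtain A where f: "f holomorphic_on {z. Re z > 0}" "A > 0"
      "\<And>T \<sigma>. 0 < \<sigma> \<Longrightarrow> \<sigma> \<le> 1 \<Longrightarrow>
        (\<integral>\<^sup>+t. ennreal ((norm (f (Complex \<sigma> t)))\<^sup>2) * indicator {T-1/2..T+1/2} t \<partial>lborel) \<le> ennreal (A * (1 + \<bar>T\<bar>) powr (1/2))"
      "\<And>\<sigma> t. 0 < \<sigma> \<Longrightarrow> \<sigma> \<le> 1 \<Longrightarrow> norm (f (Complex \<sigma> t)) \<le> A * (1 + \<bar>ln \<sigma>\<bar>) * (1 + \<bar>t\<bar>)"
    using assms(1) unfolding moderate_growth_def by blast
  obtain B where g: "g holomorphic_on {z. Re z > 0}" "B > 0"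
      "\<And>T \<sigma>. 0 < \<sigma> \<Longrightarrow> \<sigma> \<le> 1 \<Longrightarrow>
        (\<integral>\<^sup>+t. ennreal ((norm (g (Complex \<sigma> t)))\<^sup>2) * indicator {T-1/2..T+1/2} t \<partial>lborel) \<le> ennreal (B * (1 + \<bar>T\<bar>) powr (1/2))"
      "\<And>\<sigma> t. 0 < \<sigma> \<Longrightarrow> \<sigma> \<le> 1 \<Longrightarrow> norm (g (Complex \<sigma> t)) \<le> B * (1 + \<bar>ln \<sigma>\<bar>) * (1 + \<bar>t\<bar>)"
    using assms(2) unfolding moderate_growth_def by blast
  show ?thesis unfolding moderate_growth_def
  proof (intro conjI exI[of _ "2 * A + 2 * B"] allI impI)
    show "(\<lambda>z. f z + g z) holomorphic_on {z. Re z > 0}" by (intro holomorphic_intros f g)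
    show "0 < 2 * A + 2 * B" using f(2) g(2) by simp
    fix T \<sigma> :: real assume \<sigma>: "0 < \<sigma>" "\<sigma> \<le> 1"
    have meas: "(\<lambda>t. h (Complex \<sigma> t)) \<in> borel_measurable borel" if "h holomorphic_on {z. Re z > 0}" for h :: "complex \<Rightarrow> complex"
    proof (rule borel_measurable_continuous_onI)
      show "continuous_on UNIV (\<lambda>t. h (Complex \<sigma> t))"
        by (rule continuous_on_compose2[OF holomorphic_on_imp_continuous_on[OF that]])
           (use \<sigma> in \<open>auto intro!: continuous_intros\<close>)
    qed
    note [measurable] = meas[OF f(1)] meas[OF g(1)]
    let ?F = "\<lambda>t. ennreal ((norm (f (Complex \<sigma> t)))\<^sup>2) * indicator {T-1/2..T+1/2} t"
    let ?G = "\<lambda>t. ennreal ((norm (g (Complex \<sigma> t)))\<^sup>2) * indicator {T-1/2..T+1/2} t"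
    have le: "ennreal ((norm (f (Complex \<sigma> t) + g (Complex \<sigma> t)))\<^sup>2) * indicator {T-1/2..T+1/2} t \<le> ennreal 2 * ?F t + ennreal 2 * ?G t" for t
    proof -
      let ?x = "norm (f (Complex \<sigma> t))" and ?y = "norm (g (Complex \<sigma> t))"
      have "(norm (f (Complex \<sigma> t) + g (Complex \<sigma> t)))\<^sup>2 \<le> (?x + ?y)\<^sup>2" by (intro power_mono norm_triangle_ineq) auto
      also have "\<dots> \<le> 2 * ?x\<^sup>2 + 2 * ?y\<^sup>2"
        using zero_le_power2[of "?x - ?y"] by (simp add: power2_eq_square algebra_simps)
      finally have "ennreal ((norm (f (Complex \<sigma> t) + g (Complex \<sigma> t)))\<^sup>2) \<le> ennreal (2 * ?x\<^sup>2 + 2 * ?y\<^sup>2)" by (rule ennreal_leI)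
      also have "\<dots> = ennreal 2 * ennreal (?x\<^sup>2) + ennreal 2 * ennreal (?y\<^sup>2)"
        by (subst ennreal_plus) (auto simp: ennreal_mult)
      finally show ?thesis by (simp add: indicator_def)
    qed
    have "(\<integral>\<^sup>+t. ennreal ((norm (f (Complex \<sigma> t) + g (Complex \<sigma> t)))\<^sup>2) * indicator {T-1/2..T+1/2} t \<partial>lborel)
        \<le> (\<integral>\<^sup>+t. ennreal 2 * ?F t + ennreal 2 * ?G t \<partial>lborel)"
      by (rule nn_integral_mono) (rule le)
    also have "\<dots> = (\<integral>\<^sup>+t. ennreal 2 * ?F t \<partial>lborel) + (\<integral>\<^sup>+t. ennreal 2 * ?G t \<partial>lborel)"
      by (rule nn_integral_add) measurable
    also have "(\<integral>\<^sup>+t. ennreal 2 * ?F t \<partial>lborel) = ennreal 2 * (\<integral>\<^sup>+t. ?F t \<partial>lborel)" by (rule nn_integral_cmult) measurable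
    also have "(\<integral>\<^sup>+t. ennreal 2 * ?G t \<partial>lborel) = ennreal 2 * (\<integral>\<^sup>+t. ?G t \<partial>lborel)" by (rule nn_integral_cmult) measurable
    also have "ennreal 2 * (\<integral>\<^sup>+t. ?F t \<partial>lborel) + ennreal 2 * (\<integral>\<^sup>+t. ?G t \<partial>lborel)
        \<le> ennreal 2 * ennreal (A * (1 + \<bar>T\<bar>) powr (1/2)) + ennreal 2 * ennreal (B * (1 + \<bar>T\<bar>) powr (1/2))"
      by (intro add_mono mult_left_mono f(3) g(3) \<sigma>) auto
    also have "\<dots> = ennreal ((2 * A + 2 * B) * (1 + \<bar>T\<bar>) powr (1/2))"
    proof -
      have "(2 * A + 2 * B) * (1 + \<bar>T\<bar>) powr (1/2) = 2 * (A * (1 + \<bar>T\<bar>) powr (1/2)) + 2 * (B * (1 + \<bar>T\<bar>) powr (1/2))"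
        by (simp only: distrib_right mult.assoc)
      then show ?thesis using f(2) g(2)
        by (simp only:) (subst ennreal_plus, simp, simp, subst (1 2) ennreal_mult, simp_all)
    qed
    finally show "(\<integral>\<^sup>+t. ennreal ((norm (f (Complex \<sigma> t) + g (Complex \<sigma> t)))\<^sup>2) * indicator {T-1/2..T+1/2} t \<partial>lborel)
        \<le> ennreal ((2 * A + 2 * B) * (1 + \<bar>T\<bar>) powr (1/2))" .
  next
    fix \<sigma> t :: real assume \<sigma>: "0 < \<sigma>" "\<sigma> \<le> 1"
    have "norm (f (Complex \<sigma> t) + g (Complex \<sigma> t)) \<le> A * (1 + \<bar>ln \<sigma>\<bar>) * (1 + \<bar>t\<bar>) + B * (1 + \<bar>ln \<sigma>\<bar>) * (1 + \<bar>t\<bar>)"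
      by (rule order_trans[OF norm_triangle_ineq add_mono[OF f(4) g(4)]]) (use \<sigma> in auto)
    also have "\<dots> = (A + B) * ((1 + \<bar>ln \<sigma>\<bar>) * (1 + \<bar>t\<bar>))" by (simp add: algebra_simps)
    also have "\<dots> \<le> (2 * A + 2 * B) * ((1 + \<bar>ln \<sigma>\<bar>) * (1 + \<bar>t\<bar>))"
      using f(2) g(2) by (intro mult_right_mono) auto
    finally show "norm (f (Complex \<sigma> t) + g (Complex \<sigma> t)) \<le> (2 * A + 2 * B) * (1 + \<bar>ln \<sigma>\<bar>) * (1 + \<bar>t\<bar>)" by (simp only: mult.assoc)
  qed
qed

lemma moderate_growth_of_nat_mult:
  assumes "moderate_growth f" shows "moderate_growth (\<lambda>z. of_nat k * f z)"
proof (induction k)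
  case 0
  then show ?case using moderate_growth_const[of 0] by simp
next
  case (Suc k)
  from moderate_growth_add[OF assms this] show ?case by (simp add: algebra_simps)
qed

lemma moderate_growth_minus:
  assumes "moderate_growth f" shows "moderate_growth (\<lambda>z. - f z)"
  unfolding moderate_growth_def norm_minus_cancel
  by (rule conjI[OF holomorphic_on_minus[OF conjunct1[OF assms[unfolded moderate_growth_def]]]
        conjunct2[OF assms[unfolded moderate_growth_def]]])

lemma remainder_tendsto_off_exceptional_set:
  fixes D :: "real \<Rightarrow> complex" and H :: "complex \<Rightarrow> complex"
  assumes meas: "D \<in> borel_measurable borel" and neg: "\<And>v. v < 0 \<Longrightarrow> D v = 0"
    and bound: "\<And>v. 0 \<le> v \<Longrightarrow> norm (D v) \<le> C * exp (a * v)" and a: "0 \<le> a" "a < 1"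
    and cont: "AE v in lborel. isCont D v"
    and transform: "\<And>t. H (Complex 1 t) / Complex 1 t = (LINT v|lborel. D v * exp (- Complex 1 t * of_real v))"
    and H: "moderate_growth H"
    and r: "0 < r" and near: "\<And>z. Re z > 0 \<Longrightarrow> norm z < r \<Longrightarrow> norm (H z) \<le> K * norm z"
  shows "\<exists>S\<subseteq>{2..}. finite_log_measure S \<and> ((\<lambda>x. D (ln x)) \<longlongrightarrow> 0) (inf at_top (principal (- S)))"
proof -
  obtain A where hol: "H holomorphic_on {z. Re z > 0}" and A: "A > 0"
    and ms: "\<And>T \<sigma>. 0 < \<sigma> \<Longrightarrow> \<sigma> \<le> 1 \<Longrightarrow>
        (\<integral>\<^sup>+t. ennreal ((norm (H (Complex \<sigma> t)))\<^sup>2) * indicator {T-1/2..T+1/2} t \<partial>lborel) \<le> ennreal (A * (1 + \<bar>T\<bar>) powr (1/2))"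
    and pw: "\<And>\<sigma> t. 0 < \<sigma> \<Longrightarrow> \<sigma> \<le> 1 \<Longrightarrow> norm (H (Complex \<sigma> t)) \<le> A * (1 + \<bar>ln \<sigma>\<bar>) * (1 + \<bar>t\<bar>)"
    using H unfolding moderate_growth_def by blast
  obtain M where M: "\<And>\<sigma>. 0 < \<sigma> \<Longrightarrow> \<sigma> \<le> 1 \<Longrightarrow>
     (\<integral>\<^sup>+t. ennreal ((norm (H (Complex \<sigma> t) / Complex \<sigma> t))\<^sup>2) \<partial>lborel) \<le> ennreal M"
    using mean_square_quotient_bounded[OF hol less_imp_le[OF A] ms r near] by blast
  have growth: "\<exists>K'. \<forall>z. \<sigma> \<le> Re z \<longrightarrow> Re z \<le> 1 \<longrightarrow> norm (H z / z) \<le> K' * (1 + \<bar>Im z\<bar>)" if \<sigma>: "\<sigma> > 0" for \<sigma>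
  \<comment> \<open>This constant degenerates as \<sigma> tends to 0, but it is used on one line at
    a time, and the mean square bound M does not.\<close>
  proof (intro exI[of _ "A * (1 + \<bar>ln \<sigma>\<bar>) / \<sigma>"] allI impI)
    fix z assume z: "\<sigma> \<le> Re z" "Re z \<le> 1"
    have "norm (H z) \<le> A * (1 + \<bar>ln (Re z)\<bar>) * (1 + \<bar>Im z\<bar>)" using pw[of "Re z" "Im z"] z \<sigma> by simp
    also have "\<dots> \<le> A * (1 + \<bar>ln \<sigma>\<bar>) * (1 + \<bar>Im z\<bar>)"
    proof -
      have "ln \<sigma> \<le> ln (Re z)" "ln (Re z) \<le> 0" using z \<sigma> by auto
      then show ?thesis using A by (intro mult_mono) auto
    qed
    finally have 1: "norm (H z) \<le> A * (1 + \<bar>ln \<sigma>\<bar>) * (1 + \<bar>Im z\<bar>)" .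
    have "\<sigma> \<le> norm z" using z complex_Re_le_cmod[of z] by linarith
    then have "norm (H z) / norm z \<le> A * (1 + \<bar>ln \<sigma>\<bar>) * (1 + \<bar>Im z\<bar>) / \<sigma>"
      using 1 \<sigma> A by (intro frac_le) auto
    then show "norm (H z / z) \<le> A * (1 + \<bar>ln \<sigma>\<bar>) / \<sigma> * (1 + \<bar>Im z\<bar>)" by (simp add: norm_divide)
  qed
  have "(\<integral>\<^sup>+u. ennreal ((norm (D u))\<^sup>2) * indicator {0..} u \<partial>lborel) \<le> ennreal (exp 4) * ennreal M"
  proof (rule Laplace_transform_mean_square[where \<Phi> = "\<lambda>z. H z / z" and D = D])
    show "(\<lambda>z. H z / z) holomorphic_on {z. Re z > 0}" by (intro holomorphic_intros hol) auto
  qed (use assms growth M in auto)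
  also have "\<dots> < \<infinity>" by (simp add: ennreal_mult_less_top)
  finally show ?thesis by (rule exceptional_set[OF meas])
qed

section \<open>The logarithm at the central point and on the boundary line\<close>

text \<open>H is a logarithm of q only on the right half of the disc; q has a holomorphic logarithm
  h on all of it, and H - h is constant on the half disc. Differentiability of h at 0 gives both the
  limit c of H and the linear rate, so that (H z - c) / z stays bounded.\<close>

lemma log_extends_continuously:
  fixes q H :: "complex \<Rightarrow> complex"
  assumes q: "q holomorphic_on ball 0 r" "\<And>z. z \<in> ball 0 r \<Longrightarrow> q z \<noteq> 0" and r: "0 < r"
    and H: "continuous_on {z. Re z > 0} H" and eq: "\<And>z. Re z > 0 \<Longrightarrow> norm z < r \<Longrightarrow> exp (H z) = q z"
  shows "\<exists>c K r'. 0 < r' \<and> exp c = q 0 \<and> (\<forall>z. Re z > 0 \<longrightarrow> norm z < r' \<longrightarrow> norm (H z - c) \<le> K * norm z)"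
proof -
  obtain h where h: "h holomorphic_on ball 0 r" "\<And>z. z \<in> ball 0 r \<Longrightarrow> q z = exp (h z)"
    by (rule contractible_imp_holomorphic_log[OF q(1) convex_imp_contractible[OF convex_ball] q(2)]) blast+
  let ?S = "ball 0 r \<inter> {z. Re z > 0}"
  have "connected ?S" by (intro convex_connected convex_Int convex_ball convex_halfspace_Re_gt)
  moreover have "continuous_on ?S H" by (rule continuous_on_subset[OF H]) auto
  moreover have "continuous_on ?S h"
    by (rule continuous_on_subset[OF holomorphic_on_imp_continuous_on[OF h(1)]]) auto
  ultimately obtain c' where c': "\<And>z. z \<in> ?S \<Longrightarrow> H z = h z + c'"
    using exp_eq_imp_diff_constant[of ?S H h] eq h(2) by (metis IntE mem_Collect_eq mem_ball_0)
  define x where "x = complex_of_real (r/2)"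
  have x: "Re x > 0" "norm x < r" "x \<in> ball 0 r" "x \<in> ?S" using r by (auto simp: x_def)
  have "exp (h x) * exp c' = exp (h x) * 1"
    using c'[OF x(4)] eq[OF x(1,2)] h(2)[OF x(3)] by (simp only: exp_add mult_1_right)
  then have ec: "exp c' = 1" by (metis exp_not_eq_zero mult_cancel_left)
  have "(h has_field_derivative deriv h 0) (at 0)"
    by (rule holomorphic_derivI[OF h(1) open_ball]) (use r in simp)
  then have "(h has_derivative (*) (deriv h 0)) (at 0)" by (simp add: has_field_derivative_def)
  from this[unfolded has_derivative_at_alt, THEN conjunct2, rule_format, OF zero_less_one]
  obtain d where d: "d > 0" "\<And>z. norm z < d \<Longrightarrow> norm (h z - h 0 - deriv h 0 * z) \<le> 1 * norm z"
    unfolding diff_zero by blast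
  show ?thesis
  proof (rule exI[of _ "h 0 + c'"], rule exI[of _ "norm (deriv h 0) + 1"], rule exI[of _ "min d r"], intro conjI allI impI)
    show "0 < min d r" using d r by simp
    have "0 \<in> ball (0::complex) r" using r by simp
    from h(2)[OF this] show "exp (h 0 + c') = q 0" by (simp only: exp_add ec mult_1_right)
    fix z assume z: "Re z > 0" "norm z < min d r"
    then have "H z - (h 0 + c') = (h z - h 0 - deriv h 0 * z) + deriv h 0 * z" using c'[of z] by simp
    also have "norm \<dots> \<le> 1 * norm z + norm (deriv h 0 * z)"
      by (rule order_trans[OF norm_triangle_ineq add_right_mono[OF d(2)]]) (use z in simp)
    finally show "norm (H z - (h 0 + c')) \<le> (norm (deriv h 0) + 1) * norm z" by (simp add: norm_mult algebra_simps)
  qed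
qed

text \<open>The series g fixes the branch for Re z > b. The right half plane is simply connected and
  F has no zeros there, so some logarithm exists, and a constant adjusts it to continue g.\<close>

lemma holomorphic_log_extending:
  fixes F g :: "complex \<Rightarrow> complex"
  assumes F: "F holomorphic_on {z. Re z > 0}" "\<And>z. Re z > 0 \<Longrightarrow> F z \<noteq> 0"
    and g: "continuous_on {z. Re z > b} g" "\<And>z. Re z > b \<Longrightarrow> exp (g z) = F z" and b: "0 \<le> b"
  shows "\<exists>l. l holomorphic_on {z. Re z > 0} \<and> (\<forall>z. Re z > 0 \<longrightarrow> exp (l z) = F z) \<and> (\<forall>z. Re z > b \<longrightarrow> l z = g z)"
proof -
  obtain l where l: "l holomorphic_on {z. Re z > 0}" "\<And>z. Re z > 0 \<Longrightarrow> F z = exp (l z)"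
    by (rule contractible_imp_holomorphic_log[OF F(1) convex_imp_contractible[OF convex_halfspace_Re_gt]]) (use F(2) in blast)+
  have "connected {z. Re z > b}" by (intro convex_connected convex_halfspace_Re_gt)
  moreover have "continuous_on {z. Re z > b} l"
    by (rule continuous_on_subset[OF holomorphic_on_imp_continuous_on[OF l(1)]]) (use b in auto)
  ultimately obtain c where c: "\<And>z. Re z > b \<Longrightarrow> g z = l z + c"
    using exp_eq_imp_diff_constant[of "{z. Re z > b}" g l] g l(2) b by (metis mem_Collect_eq order_le_less_trans)
  have ec: "exp c = 1"
  proof -
    have r: "Re (of_real (b + 1)) > b" "Re (of_real (b + 1)) > 0" using b by auto
    have "exp (l (of_real (b + 1)) + c) = exp (l (of_real (b + 1)))"
      using c[OF r(1)] g(2)[OF r(1)] l(2)[OF r(2)] by simp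
    then show ?thesis by (simp add: exp_add)
  qed
  show ?thesis
    by (rule exI[of _ "\<lambda>z. l z + c"]) (use l c ec in \<open>auto intro!: holomorphic_intros simp: exp_add\<close>)
qed

text \<open>e is (1 - exp (- z)) / z with the singularity removed; e 0 = 1 ensures that using (1 -
  exp (- z))^m in place of z^m leaves the leading coefficient at the central zero unchanged.\<close>

lemma one_minus_exp_factor:
  "\<exists>e r. 0 < r \<and> e holomorphic_on UNIV \<and> e 0 = 1 \<and> (\<forall>z::complex. 1 - exp (- z) = z * e z) \<and> (\<forall>z\<in>ball 0 r. e z \<noteq> 0)"
proof -
  define e where "e = (\<lambda>z::complex. if z = 0 then deriv (\<lambda>z. - exp (- z)) 0 else ((- exp (- z)) - (- exp (- 0))) / (z - 0))"
  have hol: "e holomorphic_on UNIV" unfolding e_def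
    by (rule pole_lemma_open) (auto intro!: holomorphic_intros)
  have "deriv (\<lambda>z. - exp (- z)) (0::complex) = 1"
    by (rule DERIV_imp_deriv) (auto intro!: derivative_eq_intros)
  then have e0: "e 0 = 1" by (simp add: e_def)
  have "isCont e 0"
    using holomorphic_on_imp_continuous_on[OF hol] continuous_on_eq_continuous_at[OF open_UNIV] by blast
  then obtain r where "r > 0" "\<And>z. dist 0 z < r \<Longrightarrow> e z \<noteq> 0"
    using continuous_at_avoid[of 0 e 0] e0 by auto
  moreover have "1 - exp (- z) = z * e z" for z by (simp add: e_def)
  ultimately show ?thesis using hol e0 by (intro exI[of _ e] exI[of _ r]) auto
qed

lemma step_sum_harm:
  assumes "0 \<le> u"
  shows "step_sum (\<lambda>n. 1 / of_nat (Suc n)) (\<lambda>n. real (Suc n)) u = harm (nat \<lfloor>u\<rfloor>)"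
proof -
  have iff: "real (Suc n) \<le> u \<longleftrightarrow> n < nat \<lfloor>u\<rfloor>" for n using assms by linarith
  have "step_sum (\<lambda>n. 1 / of_nat (Suc n)) (\<lambda>n. real (Suc n)) u
      = (\<Sum>n\<in>{..<nat \<lfloor>u\<rfloor>}. if real (Suc n) \<le> u then 1 / of_nat (Suc n) else 0)"
    unfolding step_sum_def by (rule suminf_finite) (auto simp only: iff finite_lessThan lessThan_iff if_False)
  also have "\<dots> = (\<Sum>n<nat \<lfloor>u\<rfloor>. inverse (of_nat (Suc n)))"
    by (rule sum.cong) (auto simp only: iff lessThan_iff if_True inverse_eq_divide)
  also have "\<dots> = harm (nat \<lfloor>u\<rfloor>)"
    unfolding harm_def by (simp add: sum.atLeast1_atMost_eq del: of_nat_Suc)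
  finally show ?thesis .
qed

lemma Ln_one_minus_exp_series:
  assumes z: "0 < Re z"
  shows "(\<lambda>n. 1 / of_nat (Suc n) * exp (- z * of_real (real (Suc n)))) sums (- Ln (1 - exp (- z)))"
proof -
  have "norm (- exp (- z)) < 1" using z by simp
  from Ln_series[OF this] have "(\<lambda>n. (-1) ^ Suc n / of_nat n * (- exp (- z)) ^ n) sums ln (1 + - exp (- z))" .
  then have "(\<lambda>n. (-1) ^ Suc (Suc n) / of_nat (Suc n) * (- exp (- z)) ^ Suc n) sums ln (1 + - exp (- z))"
    by (subst sums_Suc_iff) simp
  then have "(\<lambda>n. - ((-1) ^ Suc (Suc n) / of_nat (Suc n) * (- exp (- z)) ^ Suc n)) sums - ln (1 + - exp (- z))"
    by (rule sums_minus)
  moreover have "- ((-1) ^ Suc (Suc n) / of_nat (Suc n) * (- exp (- z)) ^ Suc n) = 1 / of_nat (Suc n) * exp (- z * of_real (real (Suc n)))" for n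
  proof -
    have "exp (- z * of_real (real (Suc n))) = exp (- z) ^ Suc n"
      by (metis exp_of_nat_mult mult.commute of_real_of_nat_eq)
    moreover have "(- exp (- z)) ^ Suc n = (-1) ^ Suc n * exp (- z) ^ Suc n" by (rule power_minus)
    moreover have "(-1) ^ Suc (Suc n) * (-1) ^ Suc n = (-1 :: complex)"
      by (simp flip: power_mult_distrib)
    ultimately show ?thesis by (simp only: mult.assoc mult_minus_left[symmetric] times_divide_eq_left times_divide_eq_right) (simp add: field_simps)
  qed
  ultimately show ?thesis by (simp only: add_uminus_conv_diff)
qed

lemma norm_exp_minus_less_1: "0 < Re z \<Longrightarrow> norm (exp (- z)) < 1"
  by simp

lemma one_minus_exp_notin_nonpos:
  assumes "0 < Re z" shows "1 - exp (- z) \<notin> \<real>\<^sub>\<le>\<^sub>0"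
proof -
  have "Re (exp (- z)) < 1" using complex_Re_le_cmod[of "exp (- z)"] norm_exp_minus_less_1[OF assms] by linarith
  then show ?thesis by (auto simp: complex_nonpos_Reals_iff)
qed

text \<open>The zeros 2 pi i k of 1 - exp (- z) lie on the boundary and are treated like zeros of L.
  On the disc of radius 2 around 1 + iT one has Re z >= -1, so the function is bounded by 1 + e <= 4
  and n = 0 suffices.\<close>

lemma moderate_growth_Ln_one_minus_exp: "moderate_growth (\<lambda>z. Ln (1 - exp (- z)))"
proof (rule log_bounds_polynomial_growth[where f = "\<lambda>z. 1 - exp (- z)" and C = 4 and n = 0 and K = "1 + pi"])
  show "(\<lambda>z. Ln (1 - exp (- z))) holomorphic_on {z. 0 < Re z}"
    by (intro holomorphic_intros) (auto dest: one_minus_exp_notin_nonpos)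
  show "exp (Ln (1 - exp (- z))) = 1 - exp (- z)" if "0 < Re z" for z
    using one_minus_exp_notin_nonpos[OF that] by (intro exp_Ln) auto
  show "norm (1 - exp (- z)) \<le> 4 * (10 + \<bar>T\<bar>) ^ 0" if "norm (z - Complex 1 T) \<le> 2" for T z
  proof -
    have "\<bar>Re (z - Complex 1 T)\<bar> \<le> 2" using abs_Re_le_cmod that order_trans by blast
    then have "- Re z \<le> 1" by simp
    then have "exp (- Re z) \<le> exp 1" by (subst exp_le_cancel_iff)
    moreover have "norm (exp (- z)) = exp (- Re z)" by simp
    ultimately have "norm (exp (- z)) \<le> 3" using exp_le by linarith
    then have "norm (1 - exp (- z)) \<le> 1 + 3" using norm_triangle_ineq4[of 1 "exp (- z)"] by simp
    then show ?thesis by simp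
  qed
  show "norm (Ln (1 - exp (- Complex 1 T))) \<le> 1 + pi" for T
  proof -
    have e: "norm (exp (- Complex 1 T)) \<le> 1/2"
    proof -
      have "exp (-1::real) = inverse (exp 1)" by (rule exp_minus)
      also have "\<dots> \<le> inverse 2" using exp_ge_add_one_self[of 1] by (intro le_imp_inverse_le) auto
      finally show ?thesis by simp
    qed
    have lo: "1/2 \<le> norm (1 - exp (- Complex 1 T))" using norm_triangle_ineq2[of 1 "exp (- Complex 1 T)"] e by simp
    have hi: "norm (1 - exp (- Complex 1 T)) \<le> 2" using norm_triangle_ineq4[of 1 "exp (- Complex 1 T)"] e by simp
    have "ln (1/2) \<le> ln (norm (1 - exp (- Complex 1 T)))" "ln (norm (1 - exp (- Complex 1 T))) \<le> ln 2"
      by (rule ln_le_cancel_iff[THEN iffD2]; use lo hi in linarith)+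
    moreover have "ln (1/2) = - ln (2::real)" by (simp add: ln_div)
    moreover have "ln 2 \<le> (1::real)" using ln_le_minus_one[of "2::real"] by simp
    ultimately have "\<bar>ln (norm (1 - exp (- Complex 1 T)))\<bar> \<le> 1" by linarith
    moreover have "1 - exp (- Complex 1 T) \<noteq> 0" using lo by auto
    ultimately show ?thesis using norm_Ln_le[of "1 - exp (- Complex 1 T)"] by linarith
  qed
qed (auto intro!: holomorphic_intros)

text \<open>For s = 1/2 + z the disc of radius 2 around z = 1 + iT lies in Re s >= -1/2, which
  explains the line on which the functional equation is used.\<close>

lemma moderate_growth_log_L:
  fixes L l :: "complex \<Rightarrow> complex"
  assumes hol: "L holomorphic_on UNIV" and l: "l holomorphic_on {z. Re z > 0}"
    and el: "\<And>z. Re z > 0 \<Longrightarrow> exp (l z) = L (1/2 + z)"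
    and gr: "\<And>s. - (1/2) \<le> Re s \<Longrightarrow> norm (L s) \<le> C * norm (s + 2) ^ N" and C: "C > 0"
    and center: "\<And>T. norm (l (Complex 1 T)) \<le> K"
  shows "moderate_growth l"
proof (rule log_bounds_polynomial_growth[where f = "\<lambda>z. L (1/2 + z)" and C = "max 1 C" and n = N and K = K])
  have "(L \<circ> (\<lambda>z. 1/2 + z)) holomorphic_on UNIV"
    by (rule holomorphic_on_compose) (auto intro!: holomorphic_intros holomorphic_on_subset[OF hol])
  then show "(\<lambda>z. L (1/2 + z)) holomorphic_on UNIV" by (simp add: o_def)
  show "norm (L (1/2 + z)) \<le> max 1 C * (10 + \<bar>T\<bar>) ^ N" if z: "norm (z - Complex 1 T) \<le> 2" for T z
  proof -
    have "\<bar>Re (z - Complex 1 T)\<bar> \<le> 2" using abs_Re_le_cmod z order_trans by blast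
    then have "- (1/2) \<le> Re (1/2 + z)" by simp
    from gr[OF this] have "norm (L (1/2 + z)) \<le> C * norm (1/2 + z + 2) ^ N" .
    also have "\<dots> \<le> max 1 C * (10 + \<bar>T\<bar>) ^ N"
    proof (intro mult_mono power_mono)
      have "norm (Complex 1 T) \<le> 1 + \<bar>T\<bar>" using cmod_le[of "Complex 1 T"] by simp
      moreover have "1/2 + z + 2 = (z - Complex 1 T) + Complex 1 T + 5/2" by simp
      then have "norm (1/2 + z + 2) \<le> norm (z - Complex 1 T) + norm (Complex 1 T) + norm (5/2 :: complex)"
        by (metis add_right_mono norm_triangle_ineq order_trans)
      ultimately show "norm (1/2 + z + 2) \<le> 10 + \<bar>T\<bar>" using z by simp
    qed (use C in auto)
    finally show ?thesis .
  qed
qed (use l el center in auto)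

lemma norm_shift_half_weight:
  fixes a :: "nat \<Rightarrow> complex" and l :: "nat \<Rightarrow> real"
  shows "norm (a n * exp (- (1/2) * of_real (l n))) * exp (- b * l n) = norm (a n) * exp (- (b + 1/2) * l n)"
  by (simp add: norm_mult algebra_simps flip: exp_add)

section \<open>The remainder as a step function with known transform\<close>

text \<open>L enters through a Dirichlet series whose exponential it is for Re s > 1, the absence of
  zeros for Re s > 1/2, and polynomial growth. The constant c is forced: it is the limit at 0 of ln
  L (1/2 + z) - m ln (1 - exp (- z)), hence a particular logarithm of the leading
  coefficient.\<close>

lemma central_log_remainder:
  fixes L :: "complex \<Rightarrow> complex" and a :: "nat \<Rightarrow> complex" and l :: "nat \<Rightarrow> real"
  assumes l: "\<And>n. 0 \<le> l n" and summ: "\<And>\<sigma>. 1 < \<sigma> \<Longrightarrow> summable (\<lambda>n. norm (a n) * exp (- \<sigma> * l n))"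
    and ex: "\<And>s. 1 < Re s \<Longrightarrow> exp (\<Sum>n. a n * exp (- s * of_real (l n))) = L s"
    and hol: "L holomorphic_on UNIV" and nz: "\<And>s. 1/2 < Re s \<Longrightarrow> L s \<noteq> 0"
    and gr: "\<And>s. - (1/2) \<le> Re s \<Longrightarrow> norm (L s) \<le> C * norm (s + 2) ^ N" and C: "C > 0"
    and ord: "int m = zorder L (1/2)"
  shows "\<exists>S\<subseteq>{2..}. \<exists>c. finite_log_measure S \<and> exp c = (deriv ^^ m) L (1/2) / fact m \<and>
    ((\<lambda>x. step_sum (\<lambda>n. a n * exp (- (1/2) * of_real (l n))) l (ln x) + of_nat m * harm (nat \<lfloor>ln x\<rfloor>) - c) \<longlongrightarrow> 0)
      (inf at_top (principal (- S)))"
proof -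
  define a1 where "a1 = (\<lambda>n. a n * exp (- (1/2) * of_real (l n)))"
  \<comment> \<open>Any value strictly between 1/2 and 1 would do: the shifted series converges
    absolutely for Re z > 1/2, and the inversion line is Re z = 1.\<close>
  define b where "b = (3/4 :: real)"
  have b: "0 \<le> b" "b < 1" by (auto simp: b_def)
  have sum1: "summable (\<lambda>n. norm (a1 n) * exp (- b' * l n))" if "1/2 < b'" for b'
    unfolding a1_def norm_shift_half_weight by (rule summ) (use that in simp)
  have sum1b: "summable (\<lambda>n. norm (a1 n) * exp (- b * l n))" by (rule sum1) (simp add: b_def)
  obtain G G' where G: "\<And>z. b < Re z \<Longrightarrow> (\<lambda>n. a1 n * exp (- z * of_real (l n))) sums G z"
      "\<And>z. b < Re z \<Longrightarrow> (G has_field_derivative G' z) (at z)"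
    using exp_series_derivative[OF l b(1) sum1b] by blast
  have eG: "exp (G z) = L (1/2 + z)" if "b < Re z" for z
  proof -
    have "G z = (\<Sum>n. a1 n * exp (- z * of_real (l n)))" using G(1)[OF that] by (rule sums_unique)
    also have "\<dots> = (\<Sum>n. a n * exp (- (1/2 + z) * of_real (l n)))"
      unfolding a1_def by (intro suminf_cong) (simp add: mult.assoc algebra_simps flip: exp_add)
    finally show ?thesis using ex[of "1/2 + z"] that by (simp add: b_def)
  qed
  have contG: "continuous_on {z. Re z > b} G"
    by (intro continuous_at_imp_continuous_on ballI DERIV_isCont[OF G(2)]) auto
  have holF: "(\<lambda>z. L (1/2 + z)) holomorphic_on {z. Re z > 0}"
  proof -
    have "(L \<circ> (\<lambda>z. 1/2 + z)) holomorphic_on {z. Re z > 0}"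
      by (rule holomorphic_on_compose) (auto intro!: holomorphic_intros holomorphic_on_subset[OF hol])
    then show ?thesis by (simp add: o_def)
  qed
  obtain l1 where l1: "l1 holomorphic_on {z. Re z > 0}" "\<And>z. Re z > 0 \<Longrightarrow> exp (l1 z) = L (1/2 + z)"
      "\<And>z. Re z > b \<Longrightarrow> l1 z = G z"
    using holomorphic_log_extending[OF holF _ contG eG b(1)] nz by auto
  have mg1: "moderate_growth l1"
  proof (rule moderate_growth_log_L[OF hol l1(1,2) gr C])
    fix T
    have T: "b < Re (Complex 1 T)" using b by simp
    have nrm: "norm (a1 n * exp (- Complex 1 T * of_real (l n))) = norm (a1 n) * exp (- 1 * l n)" for n
      by (simp add: norm_mult)
    have s1: "summable (\<lambda>n. norm (a1 n * exp (- Complex 1 T * of_real (l n))))"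
      unfolding nrm by (rule sum1) simp
    have "l1 (Complex 1 T) = (\<Sum>n. a1 n * exp (- Complex 1 T * of_real (l n)))"
      using l1(3)[OF T] sums_unique[OF G(1)[OF T]] by simp
    then show "norm (l1 (Complex 1 T)) \<le> (\<Sum>n. norm (a1 n) * exp (- 1 * l n))"
      using summable_norm[OF s1] unfolding nrm by simp
  qed
  obtain e r2 where e: "0 < r2" "e holomorphic_on UNIV" "e 0 = 1" "\<And>z::complex. 1 - exp (- z) = z * e z" "\<And>z. z \<in> ball 0 r2 \<Longrightarrow> e z \<noteq> 0"
    using one_minus_exp_factor by blast
  have "\<exists>w\<in>UNIV. L w \<noteq> 0" using nz[of 1] by auto
  from zorder_exist_zero[OF hol open_UNIV connected_UNIV UNIV_I this, of "1/2"]
  obtain r1 where r1: "0 < r1" "zor_poly L (1/2) holomorphic_on cball (1/2) r1"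
      "\<And>w. w \<in> cball (1/2) r1 \<Longrightarrow> L w = zor_poly L (1/2) w * (w - 1/2) ^ m \<and> zor_poly L (1/2) w \<noteq> 0"
    using ord[symmetric] by (auto simp del: zorder_eq_0_iff)
  define g where "g = zor_poly L (1/2)"
  have gd: "(deriv ^^ m) L (1/2) = fact m * g (1/2)"
  proof (rule leading_coeff_higher_deriv[where r = r1])
    show "g holomorphic_on ball (1/2) r1" unfolding g_def by (rule holomorphic_on_subset[OF r1(2)]) auto
    show "L w = (w - 1/2) ^ m * g w" if "w \<in> ball (1/2) r1" for w
      using r1(3)[of w] that by (simp add: g_def mult.commute)
  qed (rule r1(1))
  \<comment> \<open>q continues L (1/2 + z) / (1 - exp (- z))^m to 0 without zeros; its value there
    is g (1/2), the leading coefficient of L.\<close>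
  define q where "q = (\<lambda>z. g (1/2 + z) / e z ^ m)"
  define r where "r = min r1 r2"
  have r: "0 < r" using r1 e by (simp add: r_def)
  have shift: "1/2 + z \<in> cball (1/2) r1" "z \<in> ball 0 r2" if "z \<in> ball 0 r" for z :: complex
    using that by (auto simp: r_def dist_norm)
  define l2 where "l2 = (\<lambda>z. Ln (1 - exp (- z)))"
  define H0 where "H0 = (\<lambda>z. l1 z + of_nat m * (- l2 z))"
  have mg0: "moderate_growth H0" unfolding H0_def l2_def
    by (intro moderate_growth_add mg1 moderate_growth_of_nat_mult moderate_growth_minus moderate_growth_Ln_one_minus_exp)
  have "\<exists>c K r'. 0 < r' \<and> exp c = q 0 \<and> (\<forall>z. Re z > 0 \<longrightarrow> norm z < r' \<longrightarrow> norm (H0 z - c) \<le> K * norm z)"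
  proof (rule log_extends_continuously[OF _ _ r])
    have "(g \<circ> (\<lambda>z. 1/2 + z)) holomorphic_on ball 0 r"
      by (rule holomorphic_on_compose, intro holomorphic_intros, unfold g_def,
          rule holomorphic_on_subset[OF r1(2)]) (use shift(1) in blast)
    then show "q holomorphic_on ball 0 r"
      unfolding q_def o_def using e(5) shift(2)
      by (intro holomorphic_intros holomorphic_on_subset[OF e(2)]) auto
    show "q z \<noteq> 0" if "z \<in> ball 0 r" for z
      using r1(3)[OF shift(1)[OF that]] e(5)[OF shift(2)[OF that]] by (simp add: q_def g_def)
    show "continuous_on {z. Re z > 0} H0"
      using mg0 unfolding moderate_growth_def by (blast intro: holomorphic_on_imp_continuous_on)
    show "exp (H0 z) = q z" if z: "Re z > 0" "norm z < r" for z
    proof -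
      have zb: "z \<in> ball 0 r" using z by simp
      have z0: "z \<noteq> 0" using z by auto
      have n0: "1 - exp (- z) \<noteq> 0" using one_minus_exp_notin_nonpos[OF z(1)] by auto
      have "exp (H0 z) = L (1/2 + z) / exp (l2 z) ^ m"
      proof -
        have "H0 z = l1 z - of_nat m * l2 z" by (simp add: H0_def)
        then show ?thesis by (simp only: exp_diff exp_of_nat_mult l1(2)[OF z(1)])
      qed
      also have "exp (l2 z) = z * e z" unfolding l2_def using exp_Ln[OF n0] e(4) by simp
      also have "L (1/2 + z) = g (1/2 + z) * z ^ m" using r1(3)[OF shift(1)[OF zb]] by (simp add: g_def)
      finally show ?thesis using z0 by (simp add: q_def power_mult_distrib)
    qed
  qed
  then obtain c K r' where c: "0 < r'" "exp c = q 0" "\<And>z. Re z > 0 \<Longrightarrow> norm z < r' \<Longrightarrow> norm (H0 z - c) \<le> K * norm z"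
    by blast
  have expc: "exp c = (deriv ^^ m) L (1/2) / fact m"
    unfolding c(2) gd by (simp add: q_def e(3))
  define H where "H = (\<lambda>z. H0 z + - c)"
  have mgH: "moderate_growth H" unfolding H_def by (intro moderate_growth_add mg0 moderate_growth_const)
  define a2 where "a2 = (\<lambda>n. 1 / of_nat (Suc n) :: complex)"
  define l2' where "l2' = (\<lambda>n. real (Suc n))"
  \<comment> \<open>The constant c becomes a step sum with a single jump at 0, so that its transform
    is c / z and D vanishes on negative arguments.\<close>
  define a3 where "a3 = (\<lambda>n::nat. if n = 0 then c else 0)"
  define l3 where "l3 = (\<lambda>n::nat. 0 :: real)"
  have l2: "0 \<le> l2' n" and l3: "0 \<le> l3 n" for n by (auto simp: l2'_def l3_def)
  have sum2: "summable (\<lambda>n. norm (a2 n) * exp (- b * l2' n))"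
  proof (rule summable_comparison_test')
    show "summable (\<lambda>n. exp (- b) ^ Suc n)" using b by (subst summable_Suc_iff) (auto simp: b_def intro!: summable_geometric)
    show "norm (norm (a2 n) * exp (- b * l2' n)) \<le> exp (- b) ^ Suc n" for n
    proof -
      have "exp (- b * l2' n) = exp (- b) ^ Suc n" unfolding l2'_def by (metis exp_of_nat_mult mult.commute)
      moreover have "norm (a2 n) \<le> 1" by (simp add: a2_def norm_divide del: of_nat_Suc)
      ultimately show ?thesis by (simp add: mult_left_le_one_le)
    qed
  qed
  have sum3: "summable (\<lambda>n. norm (a3 n) * exp (- b * l3 n))"
    by (rule summable_finite[of "{0}"]) (auto simp: a3_def)
  define D where "D = (\<lambda>v. step_sum a1 l v + of_nat m * step_sum a2 l2' v - step_sum a3 l3 v)"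
  note [measurable] = step_sum_measurable[OF l b(1) sum1b] step_sum_measurable[OF l2 b(1) sum2] step_sum_measurable[OF l3 b(1) sum3]
  note nb = norm_step_sum_le[OF l b(1) sum1b] norm_step_sum_le[OF l2 b(1) sum2] norm_step_sum_le[OF l3 b(1) sum3]
  have s3: "step_sum a3 l3 v = c" if "0 \<le> v" for v
  proof -
    have "step_sum a3 l3 v = (\<Sum>n\<in>{0}. a3 n)"
      unfolding step_sum_def using that by (subst suminf_finite[of "{0}"]) (auto simp: a3_def l3_def)
    then show ?thesis by (simp add: a3_def)
  qed
  have "\<exists>S\<subseteq>{2..}. finite_log_measure S \<and> ((\<lambda>x. D (ln x)) \<longlongrightarrow> 0) (inf at_top (principal (- S)))"
  proof (rule remainder_tendsto_off_exceptional_set[OF _ _ _ b _ _ mgH c(1)])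
    show "D \<in> borel_measurable borel" unfolding D_def by measurable
    show "D v = 0" if "v < 0" for v
      unfolding D_def step_sum_neg[OF l b(1) sum1b that] step_sum_neg[OF l2 b(1) sum2 that] step_sum_neg[OF l3 b(1) sum3 that] by simp
    define B where "B = (\<Sum>n. norm (a1 n) * exp (- b * l n)) + real m * (\<Sum>n. norm (a2 n) * exp (- b * l2' n)) + (\<Sum>n. norm (a3 n) * exp (- b * l3 n))"
    show "norm (D v) \<le> B * exp (b * v)" for v
    proof -
      have "norm (D v) \<le> norm (step_sum a1 l v) + real m * norm (step_sum a2 l2' v) + norm (step_sum a3 l3 v)"
        unfolding D_def by (rule order_trans[OF norm_triangle_ineq4 add_right_mono[OF order_trans[OF norm_triangle_ineq]]]) (simp add: norm_mult)
      also have "\<dots> \<le> B * exp (b * v)"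
        unfolding B_def distrib_right mult.assoc by (intro add_mono mult_left_mono nb[unfolded mult.assoc]) auto
      finally show ?thesis .
    qed
    \<comment> \<open>D can be discontinuous only at the countably many frequencies.\<close>
    have "countable (range l \<union> range l2' \<union> range l3)" by (intro countable_Un) auto
    then have "range l \<union> range l2' \<union> range l3 \<in> null_sets lborel" by (rule countable_imp_null_set_lborel)
    then have "AE v in lborel. v \<notin> range l \<union> range l2' \<union> range l3" by (rule AE_not_in)
    then show "AE v in lborel. isCont D v"
      unfolding D_def
      by eventually_elim (intro continuous_intros isCont_step_sum[OF l b(1) sum1b] isCont_step_sum[OF l2 b(1) sum2] isCont_step_sum[OF l3 b(1) sum3]; simp)
    show "H (Complex 1 t) / Complex 1 t = (LINT v|lborel. D v * exp (- Complex 1 t * of_real v))" for t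
    proof -
      let ?z = "Complex 1 t"
      have z: "b < Re ?z" "0 < Re ?z" using b by auto
      note T1 = step_sum_transform[OF l b(1) sum1b z(1)] and T2 = step_sum_transform[OF l2 b(1) sum2 z(1)] and T3 = step_sum_transform[OF l3 b(1) sum3 z(1)]
      have "(LINT v|lborel. D v * exp (- ?z * of_real v))
          = (LINT v|lborel. step_sum a1 l v * exp (- ?z * of_real v) + of_nat m * (step_sum a2 l2' v * exp (- ?z * of_real v)) - step_sum a3 l3 v * exp (- ?z * of_real v))"
        unfolding D_def by (intro Bochner_Integration.integral_cong refl) (simp only: ring_distribs mult.assoc)
      also have "\<dots> = (LINT v|lborel. step_sum a1 l v * exp (- ?z * of_real v)) + of_nat m * (LINT v|lborel. step_sum a2 l2' v * exp (- ?z * of_real v)) - (LINT v|lborel. step_sum a3 l3 v * exp (- ?z * of_real v))"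
        by (subst Bochner_Integration.integral_diff, intro Bochner_Integration.integrable_add integrable_mult_right T1 T2, rule T3, subst Bochner_Integration.integral_add, rule T1, intro integrable_mult_right T2, simp only: integral_mult_right_zero)
      also have "\<dots> = (l1 ?z + of_nat m * (- Ln (1 - exp (- ?z))) - c) / ?z"
      proof -
        have 1: "(\<Sum>n. a1 n * exp (- ?z * of_real (l n))) = l1 ?z" using sums_unique[OF G(1)[OF z(1)]] l1(3)[OF z(1)] by simp
        have 2: "(\<Sum>n. a2 n * exp (- ?z * of_real (l2' n))) = - Ln (1 - exp (- ?z))"
          using sums_unique[OF Ln_one_minus_exp_series[OF z(2)]] by (simp only: a2_def l2'_def)
        have "(\<Sum>n. a3 n * exp (- ?z * of_real (l3 n))) = (\<Sum>n\<in>{0}. a3 n * exp (- ?z * of_real (l3 n)))"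
          by (rule suminf_finite) (auto simp: a3_def)
        then have 3: "(\<Sum>n. a3 n * exp (- ?z * of_real (l3 n))) = c" by (simp add: a3_def l3_def)
        show ?thesis unfolding T1(2) T2(2) T3(2) 1 2 3 by (simp only: diff_divide_distrib add_divide_distrib times_divide_eq_right)
      qed
      finally show ?thesis by (simp add: H_def H0_def l2_def)
    qed
    show "norm (H z) \<le> K * norm z" if "Re z > 0" "norm z < r'" for z
      using c(3)[OF that] by (simp add: H_def)
  qed
  then obtain S where S: "S \<subseteq> {2..}" "finite_log_measure S" "((\<lambda>x. D (ln x)) \<longlongrightarrow> 0) (inf at_top (principal (- S)))"
    by blast
  have "\<forall>\<^sub>F x in inf at_top (principal (- S)). D (ln x) = step_sum a1 l (ln x) + of_nat m * harm (nat \<lfloor>ln x\<rfloor>) - c"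
  proof (rule filter_leD[OF inf_le1], rule eventually_at_top_linorderI[of "1::real"])
    fix x :: real assume "1 \<le> x"
    then have "0 \<le> ln x" by simp
    from step_sum_harm[OF this] s3[OF this]
    show "D (ln x) = step_sum a1 l (ln x) + of_nat m * harm (nat \<lfloor>ln x\<rfloor>) - c"
      unfolding D_def a2_def l2'_def by simp
  qed
  with S(3) have "((\<lambda>x. step_sum a1 l (ln x) + of_nat m * harm (nat \<lfloor>ln x\<rfloor>) - c) \<longlongrightarrow> 0) (inf at_top (principal (- S)))"
    by (rule Lim_transform_eventually)
  then show ?thesis using S(1,2) expc unfolding a1_def by blast
qed

section \<open>The constants and the final asymptotics\<close>

lemma harm_floor_minus_ln_tendsto:
  "((\<lambda>u::real. harm (nat \<lfloor>u\<rfloor>) - ln u) \<longlongrightarrow> euler_mascheroni) at_top"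
proof -
  have "filterlim (\<lambda>u::real. nat \<lfloor>u\<rfloor>) sequentially at_top"
    by (rule filterlim_compose[OF filterlim_nat_sequentially filterlim_floor_sequentially])
  from filterlim_compose[OF euler_mascheroni_LIMSEQ this]
  have "((\<lambda>u::real. harm (nat \<lfloor>u\<rfloor>) - ln (of_nat (nat \<lfloor>u\<rfloor>)) :: real) \<longlongrightarrow> euler_mascheroni) at_top" .
  moreover have "((\<lambda>u::real. ln (of_int \<lfloor>u\<rfloor>) - ln u) \<longlongrightarrow> 0) at_top" by real_asymp
  ultimately have "((\<lambda>u::real. (harm (nat \<lfloor>u\<rfloor>) - ln (of_nat (nat \<lfloor>u\<rfloor>))) + (ln (of_int \<lfloor>u\<rfloor>) - ln u)) \<longlongrightarrow> euler_mascheroni + 0) at_top"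
    by (rule tendsto_add)
  moreover have "\<forall>\<^sub>F u::real in at_top. (harm (nat \<lfloor>u\<rfloor>) - ln (of_nat (nat \<lfloor>u\<rfloor>))) + (ln (of_int \<lfloor>u\<rfloor>) - ln u) = harm (nat \<lfloor>u\<rfloor>) - ln u"
  proof (rule eventually_at_top_linorderI[of 1])
    fix u :: real assume "1 \<le> u"
    then have "real (nat \<lfloor>u\<rfloor>) = of_int \<lfloor>u\<rfloor>" by simp
    then show "(harm (nat \<lfloor>u\<rfloor>) - ln (of_nat (nat \<lfloor>u\<rfloor>))) + (ln (of_int \<lfloor>u\<rfloor>) - ln u) = harm (nat \<lfloor>u\<rfloor>) - ln u" by simp
  qed
  ultimately show ?thesis by (auto elim: Lim_transform_eventually)
qed

text \<open>Karamata's theorem is applied to the parameters \<alpha>^2 with U = ln x: the condition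
  U / 2 < ln p <= U is sqrt x < p <= x, and c p / ln p is the sum of \<alpha>^2 divided by p. The
  factor 1/2 is the coefficient of the square in the logarithm. From |\<alpha>| < sqrt p the squared
  parameters inherit the bound p.\<close>

lemma prime_square_sum_tendsto:
  fixes \<alpha> :: "nat \<Rightarrow> 'n::finite \<Rightarrow> complex"
  assumes lt: "\<And>p j. prime p \<Longrightarrow> norm (\<alpha> p j) < sqrt (real p)"
    and fin: "finite {p. prime p \<and> (\<exists>j. norm (\<alpha> p j) > 1)}"
    and L2: "second_moment_L \<alpha> L2"
  shows "((\<lambda>x. \<Sum>p | prime p \<and> (\<forall>j. norm (\<alpha> p j) \<le> 1) \<and> real p \<le> x \<and> x < (real p)\<^sup>2. (\<Sum>j\<in>UNIV. (\<alpha> p j)\<^sup>2) / of_real (2 * real p))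
    \<longlongrightarrow> of_int (nu_index L2) * of_real (ln 2) / 2) at_top"
proof -
  define \<beta> where "\<beta> = (\<lambda>p j. (\<alpha> p j)\<^sup>2)"
  have le1: "norm (\<beta> p j) \<le> 1 \<longleftrightarrow> norm (\<alpha> p j) \<le> 1" for p j
    by (simp add: \<beta>_def norm_power power_le_one_iff)
  have lt\<beta>: "norm (\<beta> p j) < real p" if "prime p" for p j
  proof -
    have "(norm (\<alpha> p j))\<^sup>2 < (sqrt (real p))\<^sup>2" using lt[OF that] by (intro power_strict_mono) auto
    then show ?thesis by (simp add: \<beta>_def norm_power)
  qed
  have fin\<beta>: "finite {p. prime p \<and> (\<exists>j. norm (\<beta> p j) > 1)}" using fin le1 by (simp flip: not_le)
  obtain V where V: "open V" "{s. Re s \<ge> 1} \<subseteq> V" "L2 meromorphic_on V"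
    using L2 unfolding second_moment_L_def by blast
  have mero: "L2 meromorphic_on {1}" by (rule meromorphic_on_subset[OF V(3)]) (use V(2) in auto)
  have prod: "(\<lambda>p. if prime p then euler_factor (\<beta> p) p s else 1) has_prod L2 s" if "Re s > 1" for s
    using L2 that unfolding second_moment_L_def \<beta>_def by blast
  define c where "c = (\<lambda>p. if prime p \<and> (\<forall>j. norm (\<beta> p j) \<le> 1) then (\<Sum>j\<in>UNIV. \<beta> p j) * of_real (prime_weight p) else 0)"
  have "((\<lambda>\<sigma>. of_real \<sigma> * (\<Sum>p. c p * of_real (real p powr - \<sigma>))) \<longlongrightarrow> - of_int (zorder L2 1)) (at_right 0)"
    unfolding c_def
    by (rule prime_series_asymptotics[OF lt\<beta> fin\<beta> prod meromorphic_on_isolated_singularity[OF mero] meromorphic_on_not_essential[OF mero]])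
  then have lim: "((\<lambda>\<sigma>. of_real \<sigma> * (\<Sum>p. c p * of_real (real p powr - \<sigma>))) \<longlongrightarrow> of_int (nu_index L2)) (at_right 0)"
    by (simp add: nu_index_def)
  have bound: "norm (c n) \<le> real CARD('n) * prime_weight n" for n
  proof (cases "prime n \<and> (\<forall>j. norm (\<beta> n j) \<le> 1)")
    case True
    have "norm (\<Sum>j\<in>UNIV. \<beta> n j) \<le> (\<Sum>j\<in>(UNIV::'n set). 1)" by (rule sum_norm_le) (use True in auto)
    then have "norm (\<Sum>j\<in>UNIV. \<beta> n j) * prime_weight n \<le> real CARD('n) * prime_weight n"
      by (intro mult_right_mono prime_weight_nonneg) auto
    then show ?thesis using True prime_weight_nonneg[of n] by (simp add: c_def norm_mult)
  qed (auto simp: c_def prime_weight_nonneg)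
  have "((\<lambda>U. \<Sum>n | U/2 < ln (real n) \<and> ln (real n) \<le> U. c n / of_real (ln (real n))) \<longlongrightarrow> of_int (nu_index L2) * of_real (ln 2)) at_top"
    by (rule Karamata_primes[OF bound _ lim]) simp
  from tendsto_divide[OF filterlim_compose[OF this ln_at_top] tendsto_const[of 2]]
  have "((\<lambda>x. (\<Sum>n | ln x / 2 < ln (real n) \<and> ln (real n) \<le> ln x. c n / of_real (ln (real n))) / 2) \<longlongrightarrow> of_int (nu_index L2) * of_real (ln 2) / 2) at_top"
    by simp
  then show ?thesis
  proof (rule Lim_transform_eventually, intro eventually_at_top_linorderI[of 2])
    fix x :: real assume x: "2 \<le> x"
    let ?A = "{n. ln x / 2 < ln (real n) \<and> ln (real n) \<le> ln x}"
    let ?P = "{p. prime p \<and> (\<forall>j. norm (\<alpha> p j) \<le> 1) \<and> real p \<le> x \<and> x < (real p)\<^sup>2}"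
    have lnx: "ln x > 0" using x by simp
    have pos: "0 < n" if "n \<in> ?A" for n using that lnx by (cases n) auto
    have sub: "?A \<subseteq> {..nat \<lfloor>x\<rfloor>}"
    proof
      fix n assume n: "n \<in> ?A"
      then have "real n \<le> x" using pos[OF n] x by simp
      then show "n \<in> {..nat \<lfloor>x\<rfloor>}" using x by (simp add: le_nat_iff le_floor_iff)
    qed
    have mem: "p \<in> ?A \<longleftrightarrow> real p \<le> x \<and> x < (real p)\<^sup>2" if p: "prime p" for p
    proof -
      have p2: "2 \<le> p" by (rule prime_ge_2_nat[OF p])
      have "ln x / 2 < ln (real p) \<longleftrightarrow> ln x < ln ((real p)\<^sup>2)" using p2 by (simp add: ln_realpow mult.commute)
      also have "\<dots> \<longleftrightarrow> x < (real p)\<^sup>2" using p2 x by (subst ln_less_cancel_iff) auto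
      finally show ?thesis using p2 x by auto
    qed
    have "(\<Sum>n\<in>?A. c n / of_real (ln (real n))) = (\<Sum>p\<in>?P. 2 * ((\<Sum>j\<in>UNIV. (\<alpha> p j)\<^sup>2) / of_real (2 * real p)))"
    proof (rule sum.mono_neutral_cong_right)
      show "finite ?A" by (rule finite_subset[OF sub]) simp
      show "?P \<subseteq> ?A" using mem by blast
      show "\<forall>i\<in>?A - ?P. c i / of_real (ln (real i)) = 0"
      proof
        fix i assume i: "i \<in> ?A - ?P"
        then have "\<not> (prime i \<and> (\<forall>j. norm (\<beta> i j) \<le> 1))" using mem[of i] by (auto simp: le1)
        then show "c i / of_real (ln (real i)) = 0" unfolding c_def by (simp only: if_False div_0)
      qed
      fix p assume p: "p \<in> ?P"
      then have "ln (real p) > 0" using prime_gt_1_nat[of p] by simp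
      then have l0: "of_real (ln (real p)) \<noteq> (0::complex)" by simp
      have "c p = (\<Sum>j\<in>UNIV. \<beta> p j) * of_real (ln (real p) / real p)" using p by (simp add: c_def le1 prime_weight_def)
      then have "c p / of_real (ln (real p)) = (\<Sum>j\<in>UNIV. \<beta> p j) * (of_real (ln (real p)) / of_real (real p)) / of_real (ln (real p))"
        by (simp only: of_real_divide)
      also have "\<dots> = (\<Sum>j\<in>UNIV. \<beta> p j) / of_real (real p)" using l0 by (simp only: times_divide_eq_right times_divide_eq_left divide_divide_eq_left) (simp add: field_simps)
      also have "\<dots> = 2 * ((\<Sum>j\<in>UNIV. (\<alpha> p j)\<^sup>2) / of_real (2 * real p))" by (simp add: \<beta>_def)
      finally show "c p / of_real (ln (real p)) = 2 * ((\<Sum>j\<in>UNIV. (\<alpha> p j)\<^sup>2) / of_real (2 * real p))" .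
    qed
    then show "(\<Sum>n\<in>?A. c n / of_real (ln (real n))) / 2 = (\<Sum>p\<in>?P. (\<Sum>j\<in>UNIV. (\<alpha> p j)\<^sup>2) / of_real (2 * real p))"
      by (simp only: sum_distrib_left[symmetric]) simp
  qed
qed

text \<open>A trivial zero has real part -2 k - Re (\<mu> j), which is below 1/2, so none is met to
  the right of the central line.\<close>

lemma Riemann_Hypothesis_nonzero:
  assumes "Riemann_Hypothesis_L \<mu> L" and "\<And>j. Re (\<mu> j) > - 1/2" and "1/2 < Re s"
  shows "L s \<noteq> 0"
proof
  assume "L s = 0"
  moreover have "s \<noteq> - 2 * of_nat k - \<mu> j" for k j
  proof
    assume "s = - 2 * of_nat k - \<mu> j"
    then have "Re s = - 2 * real k - Re (\<mu> j)" by simp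
    then show False using assms(2)[of j] assms(3) by linarith
  qed
  ultimately show False using assms(1,3) unfolding Riemann_Hypothesis_L_def by (metis less_irrefl)
qed

theorem theorem1:
  fixes \<pi> :: "'n::finite adele_fun set"
    and \<alpha> :: "nat \<Rightarrow> 'n \<Rightarrow> complex" and Q :: nat and \<mu> :: "'n \<Rightarrow> complex" and \<epsilon> :: complex
    and L L2 :: "complex \<Rightarrow> complex" and m :: nat
  assumes "cuspidal_automorphic_rep \<pi>"
    and "L_function \<pi> \<alpha> Q \<mu> \<epsilon> L"
    and "second_moment_L \<alpha> L2"
    and "L holomorphic_on UNIV"
    and "int m = zorder L (1 / 2)"
    and "Ramanujan_Petersson \<pi> \<alpha>"
    and "Riemann_Hypothesis_L \<mu> L"
  shows "\<exists>S \<subseteq> {2..}. finite_log_measure S \<and>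
    (\<lambda>x::real. of_real (ln x) ^ m *
        (\<Prod>p\<in>{p::nat. prime p \<and> real p \<le> x}. \<Prod>j\<in>UNIV.
           inverse (1 - \<alpha> p j * of_nat p powr (- (1 / 2)))))
      \<sim>[inf at_top (principal (- S))]
    (\<lambda>x. of_real (sqrt 2 powi nu_index L2 / (exp (real m * euler_mascheroni) * fact m)) *
        (deriv ^^ m) L (1 / 2))"
proof -
  note LF = assms(2)[unfolded L_function_def]
  have lts: "norm (\<alpha> p j) < sqrt (real p)" if "prime p" for p j using LF that by blast
  have lt: "norm (\<alpha> p j) < real p" if p: "prime p" for p j
  proof -
    have "sqrt (real p) \<le> real p" using prime_ge_1_nat[OF p] by (intro real_le_lsqrt) (auto simp: power2_eq_square)
    then show ?thesis using lts[OF p, of j] by linarith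
  qed
  have \<mu>: "Re (\<mu> j) > - 1/2" for j using LF by simp
  have prod: "(\<lambda>p. if prime p then euler_factor (\<alpha> p) p s else 1) has_prod L s" if "1 < Re s" for s
    using LF that by blast
  \<comment> \<open>The Ramanujan-Petersson conjecture speaks of unramified primes; the others are
    finitely many, and there only the bound sqrt p is available.\<close>
  have fin: "finite {p. prime p \<and> (\<exists>j. norm (\<alpha> p j) > 1)}"
  proof (rule finite_subset[OF _ finite_ramified[OF assms(1)]])
    show "{p. prime p \<and> (\<exists>j. norm (\<alpha> p j) > 1)} \<subseteq> {p. prime p \<and> \<not> unramified \<pi> p}"
      using assms(6) unfolding Ramanujan_Petersson_def by fastforce
  qed
  let ?a = "euler_coeff_seq \<alpha>" and ?l = euler_freq_seq
  have l0: "0 \<le> ?l n" for n unfolding euler_freq_seq_def by (rule euler_freq_nonneg)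
  have summ: "summable (\<lambda>n. norm (?a n) * exp (- \<sigma> * ?l n))" if "1 < \<sigma>" for \<sigma>
    by (rule euler_summable(2)[OF lt fin that])
  have ex: "exp (\<Sum>n. ?a n * exp (- s * of_real (?l n))) = L s" if "1 < Re s" for s
    by (rule euler_product_eq_exp[OF lt fin that prod[OF that]])
  \<comment> \<open>The logarithm series at 3/2 dominates the one at every s with Re s >= 3/2, and
    its exponential bounds L there.\<close>
  define K where "K = (\<Sum>n. norm (?a n) * exp (- (3/2) * ?l n))"
  have K: "norm (L s) \<le> exp K" if s: "3/2 \<le> Re s" for s
  proof -
    have le: "norm (?a n * exp (- s * of_real (?l n))) \<le> norm (?a n) * exp (- (3/2) * ?l n)" for n
    proof -
      have "3/2 * ?l n \<le> Re s * ?l n" by (rule mult_right_mono[OF s l0])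
      then show ?thesis by (simp add: norm_mult mult_left_mono)
    qed
    have s1: "summable (\<lambda>n. norm (?a n) * exp (- (3/2) * ?l n))" by (rule summ) simp
    have s2: "summable (\<lambda>n. norm (?a n * exp (- s * of_real (?l n))))"
      by (rule summable_comparison_test'[OF s1]) (use le in simp)
    have "norm (L s) = norm (exp (\<Sum>n. ?a n * exp (- s * of_real (?l n))))" using ex[of s] s by simp
    also have "\<dots> \<le> exp (norm (\<Sum>n. ?a n * exp (- s * of_real (?l n))))" by (rule norm_exp)
    also have "\<dots> \<le> exp (\<Sum>n. norm (?a n * exp (- s * of_real (?l n))))" using summable_norm[OF s2] by simp
    also have "\<dots> \<le> exp K" unfolding K_def using suminf_le[OF le s2 s1] by simp
    finally show ?thesis .
  qed
  obtain C where C: "C > 0" "\<And>s. Re s \<ge> - (1/2) \<Longrightarrow> norm (L s) \<le> C * norm (s + 2) ^ CARD('n)"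
    using L_function_growth[OF assms(2,4) K] by auto
  obtain S c where S: "S \<subseteq> {2..}" "finite_log_measure S" and c: "exp c = (deriv ^^ m) L (1/2) / fact m"
    and lim: "((\<lambda>x. step_sum (\<lambda>n. ?a n * exp (- (1/2) * of_real (?l n))) ?l (ln x) + of_nat m * harm (nat \<lfloor>ln x\<rfloor>) - c) \<longlongrightarrow> 0)
      (inf at_top (principal (- S)))"
    using central_log_remainder[OF l0 summ ex assms(4) Riemann_Hypothesis_nonzero[OF assms(7) \<mu>] C(2,1) assms(5)] by blast
  let ?F = "inf at_top (principal (- S))"
  let ?Q = "\<lambda>x. \<Sum>p | prime p \<and> (\<forall>j. norm (\<alpha> p j) \<le> 1) \<and> real p \<le> x \<and> x < (real p)\<^sup>2. (\<Sum>j\<in>UNIV. (\<alpha> p j)\<^sup>2) / of_real (2 * real p)"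
  let ?s = "\<lambda>x. step_sum (\<lambda>n. ?a n * exp (- (1/2) * of_real (?l n))) ?l (ln x)"
  obtain r where r: "(r \<longlongrightarrow> 0) at_top"
    "\<And>x. 2 \<le> x \<Longrightarrow> (\<Prod>p\<in>{p. prime p \<and> real p \<le> x}. euler_factor (\<alpha> p) p (1/2)) = exp (?s x + ?Q x + r x)"
    using central_euler_product[OF lts fin] by blast
  let ?\<nu> = "nu_index L2"
  have Fle: "?F \<le> at_top" by (rule inf_le1)
  have Qlim: "(?Q \<longlongrightarrow> of_int ?\<nu> * of_real (ln 2) / 2) ?F"
    by (rule tendsto_mono[OF Fle prime_square_sum_tendsto[OF lts fin assms(3)]])
  have rlim: "(r \<longlongrightarrow> 0) ?F" by (rule tendsto_mono[OF Fle r(1)])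
  have "((\<lambda>x. harm (nat \<lfloor>ln x\<rfloor>) - ln (ln x)) \<longlongrightarrow> (euler_mascheroni::real)) ?F"
    by (rule tendsto_mono[OF Fle filterlim_compose[OF harm_floor_minus_ln_tendsto ln_at_top]])
  then have hlim: "((\<lambda>x. of_real (harm (nat \<lfloor>ln x\<rfloor>) - ln (ln x)) :: complex) \<longlongrightarrow> of_real euler_mascheroni) ?F"
    by (rule tendsto_of_real)
  \<comment> \<open>The exponent is grouped into pieces with known limits; c and m times the
    harmonic sum cancel, leaving \<open>?s x + ?Q x + r x\<close> plus m ln (ln x).\<close>
  have explim: "((\<lambda>x. exp ((?s x + of_nat m * harm (nat \<lfloor>ln x\<rfloor>) - c) + ?Q x + r x - of_nat m * of_real (harm (nat \<lfloor>ln x\<rfloor>) - ln (ln x)) + c))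
      \<longlongrightarrow> exp (0 + of_int ?\<nu> * of_real (ln 2) / 2 + 0 - of_nat m * of_real euler_mascheroni + c)) ?F"
    by (intro tendsto_intros lim Qlim rlim hlim)
  \<comment> \<open>The prime squares give sqrt 2 to the power \<open>?\<nu>\<close>, the harmonic
    sum gives exp (- m \<gamma>), and exp c contributes the derivative divided by m!.\<close>
  have const: "exp (0 + of_int ?\<nu> * of_real (ln 2) / 2 + 0 - of_nat m * of_real euler_mascheroni + c)
      = of_real (sqrt 2 powi ?\<nu> / (exp (real m * euler_mascheroni) * fact m)) * (deriv ^^ m) L (1 / 2)"
  proof -
    have "sqrt 2 powi ?\<nu> = sqrt 2 powr of_int ?\<nu>" by (rule powr_real_of_int'[symmetric]) auto
    also have "\<dots> = exp (of_int ?\<nu> * ln 2 / 2)" by (simp add: powr_def ln_sqrt)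
    finally have 1: "sqrt 2 powi ?\<nu> = exp (of_int ?\<nu> * ln 2 / 2)" .
    have "exp (0 + of_int ?\<nu> * of_real (ln 2) / 2 + 0 - of_nat m * of_real euler_mascheroni + c)
        = of_real (exp (of_int ?\<nu> * ln 2 / 2)) / of_real (exp (real m * euler_mascheroni)) * exp c"
      by (simp add: exp_add exp_diff exp_of_real[symmetric])
    also have "\<dots> = of_real (sqrt 2 powi ?\<nu> / (exp (real m * euler_mascheroni) * fact m)) * (deriv ^^ m) L (1 / 2)"
      unfolding c 1 by simp
    finally show ?thesis .
  qed
  have "\<forall>\<^sub>F x in ?F. exp ((?s x + of_nat m * harm (nat \<lfloor>ln x\<rfloor>) - c) + ?Q x + r x - of_nat m * of_real (harm (nat \<lfloor>ln x\<rfloor>) - ln (ln x)) + c)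
      = of_real (ln x) ^ m * (\<Prod>p\<in>{p::nat. prime p \<and> real p \<le> x}. \<Prod>j\<in>UNIV. inverse (1 - \<alpha> p j * of_nat p powr (- (1 / 2))))"
  proof (rule filter_leD[OF Fle], rule eventually_at_top_linorderI[of 2])
    fix x :: real assume x: "2 \<le> x"
    have "of_real (ln x) ^ m = (exp (of_real (ln (ln x))) :: complex) ^ m" using x by (simp add: exp_of_real)
    also have "\<dots> = exp (of_nat m * of_real (ln (ln x)))" by (rule exp_of_nat_mult[symmetric])
    finally have lm: "of_real (ln x) ^ m = exp (of_nat m * of_real (ln (ln x)) :: complex)" .
    have P: "(\<Prod>p\<in>{p::nat. prime p \<and> real p \<le> x}. \<Prod>j\<in>UNIV. inverse (1 - \<alpha> p j * of_nat p powr (- (1 / 2)))) = exp (?s x + ?Q x + r x)"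
      using r(2)[OF x] by (simp add: euler_factor_def)
    have hr: "harm (nat \<lfloor>ln x\<rfloor>) = (of_real (harm (nat \<lfloor>ln x\<rfloor>)) :: complex)" by (simp add: of_real_harm)
    show "exp ((?s x + of_nat m * harm (nat \<lfloor>ln x\<rfloor>) - c) + ?Q x + r x - of_nat m * of_real (harm (nat \<lfloor>ln x\<rfloor>) - ln (ln x)) + c)
      = of_real (ln x) ^ m * (\<Prod>p\<in>{p::nat. prime p \<and> real p \<le> x}. \<Prod>j\<in>UNIV. inverse (1 - \<alpha> p j * of_nat p powr (- (1 / 2))))"
      unfolding lm P hr exp_add[symmetric] of_real_diff right_diff_distrib
      by (rule arg_cong[where f = exp]) (simp only: algebra_simps)
  qed
  \<comment> \<open>The limit is kept as an exponential here, so that it is visibly nonzero, as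
    asymptotic equivalence to a constant requires.\<close>
  from Lim_transform_eventually[OF explim this]
  have "(\<lambda>x::real. of_real (ln x) ^ m *
        (\<Prod>p\<in>{p::nat. prime p \<and> real p \<le> x}. \<Prod>j\<in>UNIV. inverse (1 - \<alpha> p j * of_nat p powr (- (1 / 2)))))
      \<sim>[?F] (\<lambda>x. exp (0 + of_int ?\<nu> * of_real (ln 2) / 2 + 0 - of_nat m * of_real euler_mascheroni + c))"
    by (rule tendsto_imp_asymp_equiv_const) simp
  then show ?thesis unfolding const using S by blast
qed

end
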